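(* For every integer $d \geq 5$ and every algebraically closed field $\mathbf{k}$ (of arbitrary characteristic), there exists a normal singular affine toric variety $X$ of dimension $d$ over $\mathbf{k}$ such that the normalized Nash blowup $\overline{X^*}$ of $X$ contains an open affine subset isomorphic to $X$.
   Context: Let $\mathbf{k}$ be an algebraically closed field. Nash blowup. Let $X \subseteq \mathbf{k}^n$ be an equidimensional affine algebraic variety of dimension $d$ over $\mathbf{k}$, with singular locus $\operatorname{Sing}(X)$. The Gauss map is the morphism $\Phi\colon X\setminus\operatorname{Sing}(X)\to \operatorname{Grass}(d,n)$, $x\mapsto T_xX$, where $\operatorname{Grass}(d,n)$ is the Grassmannian of $d$-dimensional linear subspaces of $\mathbf{k}^n$ and $T_xX\subseteq \mathbf{k}^n$ is the tangent space. The Nash blowup $X^*$ of $X$ is the Zariski closure in $X\times\operatorname{Grass}(d,n)$ of the graph of $\Phi$, together with the natural projection $\nu\colon X^*\to X$, which is proper and birational. The normalized Nash blowup $\overline{X^*}$ of $X$ is the normalization of $X^*$, together with the composition $\overline{\nu}\colon \overline{X^*}\to X$ of the normalization map with $\nu$. (Up to isomorphism over $X$, these do not depend on the chosen closed embedding of $X$ in affine space.) Affine toric varieties. An affine semigroup $S$ is a finitely generated, cancellative, commutative monoid that embeds into a free abelian group. Its semigroup algebra is $\mathbf{k}[S]=\bigoplus_{u\in S}\mathbf{k}\cdot\chi^u$ with $\chi^0=1$ and $\chi^u\cdot\chi^{u'}=\chi^{u+u'}$. An affine toric variety over $\mathbf{k}$ is a variety of the form $X(S)=\operatorname{Spec}\mathbf{k}[S]$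 for an affine semigroup $S$. Its dimension is the rank of the group generated by $S$. A toric variety is not required to be normal by definition. "Isomorphic" means isomorphic as algebraic varieties over $\mathbf{k}$. *)

theory Defs
  imports
    "HOL-Analysis.Function_Topology"
    "HOL-Library.Poly_Mapping"
    "HOL-Library.Function_Algebras"
    "Jordan_Normal_Form.Determinant"
begin

section \<open>Varieties as spaces with functions\<close>

text \<open>
  A variety over the algebraically closed field \<open>'k\<close> is represented classically, by its closed
  points, its Zariski topology, and for every open set \<open>U\<close> the regular functions on \<open>U\<close>.
  Regular functions are total functions of which only the values on \<open>U\<close> matter.
\<close>

record ('p, 'k) fspace =
  ztop :: "'p topology"
  regular :: "'p set \<Rightarrow> ('p \<Rightarrow> 'k) set"

text \<open>
  The points \<open>P\<close>, with the non-vanishing loci of the denominators of the admissible fractions \<open>Q\<close>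
  generating the topology, and with the functions that are locally admissible fractions as regular
  functions. In the homogeneous case numerator and denominator are values of forms of the same
  degree at a chosen coordinate vector, so that the quotient does not depend on the choice.
\<close>

definition frac_space ::
    "'p set \<Rightarrow> (('p \<Rightarrow> 'k::field) \<times> ('p \<Rightarrow> 'k)) set \<Rightarrow> ('p, 'k) fspace" where
  "frac_space P Q =
    (let T = topology_generated_by {{z \<in> P. b z \<noteq> 0} | a b. (a, b) \<in> Q}
     in \<lparr> ztop = T,
          regular = (\<lambda>U. {f. \<forall>y\<in>U. \<exists>V a b. openin T V \<and> y \<in> V \<and> V \<subseteq> U \<and> (a, b) \<in> Q \<and>
                              (\<forall>z\<in>V. b z \<noteq> 0 \<and> f z = a z / b z)}) \<rparr>)"

definition subspace_on :: "('p, 'k) fspace \<Rightarrow> 'p set \<Rightarrow> ('p, 'k) fspace" where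
  "subspace_on Y Z =
    \<lparr> ztop = subtopology (ztop Y) Z,
      regular = (\<lambda>U. {f. openin (subtopology (ztop Y) Z) U \<and>
                         (\<forall>y\<in>U. \<exists>V g. openin (ztop Y) V \<and> y \<in> V \<and> g \<in> regular Y V \<and>
                                      (\<forall>z\<in>V \<inter> U. f z = g z))}) \<rparr>"

definition morphism :: "('p, 'k) fspace \<Rightarrow> ('q, 'k) fspace \<Rightarrow> ('p \<Rightarrow> 'q) \<Rightarrow> bool" where
  "morphism Y Z h \<longleftrightarrow> continuous_map (ztop Y) (ztop Z) h \<and>
     (\<forall>V f. openin (ztop Z) V \<longrightarrow> f \<in> regular Z V \<longrightarrow>
            f \<circ> h \<in> regular Y {y \<in> topspace (ztop Y). h y \<in> V})"

definition isomorphic :: "('p, 'k) fspace \<Rightarrow> ('q, 'k) fspace \<Rightarrow> bool" where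
  "isomorphic Y Z \<longleftrightarrow> (\<exists>h h'. morphism Y Z h \<and> morphism Z Y h' \<and>
     (\<forall>y\<in>topspace (ztop Y). h' (h y) = y) \<and> (\<forall>z\<in>topspace (ztop Z). h (h' z) = z))"

definition irreducible_variety :: "('p, 'k) fspace \<Rightarrow> bool" where
  "irreducible_variety Y \<longleftrightarrow> topspace (ztop Y) \<noteq> {} \<and>
     (\<forall>U V. openin (ztop Y) U \<and> openin (ztop Y) V \<and> U \<noteq> {} \<and> V \<noteq> {} \<longrightarrow> U \<inter> V \<noteq> {})"


section \<open>Affine varieties\<close>

type_synonym ('i, 'k) poly = "('i \<Rightarrow>\<^sub>0 nat) \<Rightarrow>\<^sub>0 'k"

definition peval :: "('i, 'k::comm_semiring_1) poly \<Rightarrow> ('i \<Rightarrow> 'k) \<Rightarrow> 'k" where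
  "peval F x = (\<Sum>m\<in>Poly_Mapping.keys F. Poly_Mapping.lookup F m *
                  (\<Prod>i\<in>Poly_Mapping.keys m. x i ^ Poly_Mapping.lookup m i))"

definition polys_in :: "'i set \<Rightarrow> ('i, 'k::zero) poly set" where
  "polys_in I = {F. \<forall>m\<in>Poly_Mapping.keys F. Poly_Mapping.keys m \<subseteq> I}"

definition pdiff :: "'i \<Rightarrow> ('i, 'k::comm_semiring_1) poly \<Rightarrow> ('i, 'k) poly" where
  "pdiff i F = (\<Sum>m\<in>Poly_Mapping.keys F. Poly_Mapping.single (m - Poly_Mapping.single i 1)
                  (of_nat (Poly_Mapping.lookup m i) * Poly_Mapping.lookup F m))"

text \<open>The points of \<open>k\<^sup>n\<close> are sequences vanishing from index \<open>n\<close> on.\<close>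

definition kpoints :: "nat \<Rightarrow> (nat \<Rightarrow> 'k::zero) set" where
  "kpoints n = {x. \<forall>i\<ge>n. x i = 0}"

definition affine_space :: "nat \<Rightarrow> (nat \<Rightarrow> 'k::field, 'k) fspace" where
  "affine_space n = frac_space (kpoints n)
     {(peval F, peval G) | F G. F \<in> polys_in {..<n} \<and> G \<in> polys_in {..<n}}"

definition closed_in_affine :: "nat \<Rightarrow> (nat \<Rightarrow> 'k::field) set \<Rightarrow> bool" where
  "closed_in_affine n X \<longleftrightarrow> closedin (ztop (affine_space n)) X"

definition affine_var :: "nat \<Rightarrow> (nat \<Rightarrow> 'k::field) set \<Rightarrow> (nat \<Rightarrow> 'k, 'k) fspace" where
  "affine_var n X = subspace_on (affine_space n) X"

definition is_affine :: "('p, 'k::field) fspace \<Rightarrow> bool" where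
  "is_affine Y \<longleftrightarrow> (\<exists>m Z. closed_in_affine m Z \<and> isomorphic Y (affine_var m Z))"


section \<open>Tangent spaces and the Nash blowup\<close>

definition fscale :: "'k \<Rightarrow> ('i \<Rightarrow> 'k) \<Rightarrow> ('i \<Rightarrow> 'k::field)" where
  "fscale c v = (\<lambda>i. c * v i)"

interpretation fvs: vector_space "fscale :: 'k \<Rightarrow> ('i \<Rightarrow> 'k) \<Rightarrow> ('i \<Rightarrow> 'k::field)"
  by standard (auto simp: fscale_def fun_eq_iff algebra_simps)

definition tangent_space :: "nat \<Rightarrow> (nat \<Rightarrow> 'k::field) set \<Rightarrow> (nat \<Rightarrow> 'k) \<Rightarrow> (nat \<Rightarrow> 'k) set" where
  "tangent_space n X x =
     {v \<in> kpoints n. \<forall>F\<in>polys_in {..<n}. (\<forall>y\<in>X. peval F y = 0) \<longrightarrow>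
                        (\<Sum>i<n. peval (pdiff i F) x * v i) = 0}"

text \<open>For \<open>X\<close> equidimensional of dimension \<open>d\<close>.\<close>

definition singular_locus :: "nat \<Rightarrow> nat \<Rightarrow> (nat \<Rightarrow> 'k::field) set \<Rightarrow> (nat \<Rightarrow> 'k) set" where
  "singular_locus d n X = {x \<in> X. fvs.dim (tangent_space n X x) \<noteq> d}"

definition Grass :: "nat \<Rightarrow> nat \<Rightarrow> (nat \<Rightarrow> 'k::field) set set" where
  "Grass d n = {V. fvs.subspace V \<and> V \<subseteq> kpoints n \<and> fvs.dim V = d}"

definition is_frame :: "nat \<Rightarrow> (nat \<Rightarrow> 'k::field) set \<Rightarrow> (nat \<Rightarrow> nat \<Rightarrow> 'k) \<Rightarrow> bool" where
  "is_frame d V B \<longleftrightarrow> inj_on B {..<d} \<and> fvs.independent (B ` {..<d}) \<and> fvs.span (B ` {..<d}) = V"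

text \<open>
  Homogeneous coordinates: another choice of frame multiplies all of them by the same unit scalar.
\<close>

definition pluecker :: "nat \<Rightarrow> (nat \<Rightarrow> 'k::field) set \<Rightarrow> nat set \<Rightarrow> 'k" where
  "pluecker d V I = (let B = SOME B. is_frame d V B
                     in det (mat d d (\<lambda>(i, j). B i (sorted_list_of_set I ! j))))"

text \<open>
  Polynomials in the affine coordinates \<open>Inl i\<close> and the Pluecker coordinates \<open>Inr I\<close>, homogeneous of
  degree \<open>e\<close> in the latter.
\<close>

definition pluecker_forms :: "nat \<Rightarrow> nat \<Rightarrow> nat \<Rightarrow> (nat + nat set, 'k::zero) poly set" where
  "pluecker_forms d n e =
     {F \<in> polys_in (Inl ` {..<n} \<union> Inr ` {I. I \<subseteq> {..<n} \<and> card I = d}).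
        \<forall>m\<in>Poly_Mapping.keys F.
          (\<Sum>I | I \<subseteq> {..<n} \<and> card I = d. Poly_Mapping.lookup m (Inr I)) = e}"

definition pluecker_eval ::
    "nat \<Rightarrow> (nat + nat set, 'k::field) poly \<Rightarrow> (nat \<Rightarrow> 'k) \<times> (nat \<Rightarrow> 'k) set \<Rightarrow> 'k" where
  "pluecker_eval d F = (\<lambda>(x, V). peval F (case_sum x (pluecker d V)))"

text \<open>
  The variety structure of \<open>k\<^sup>n \<times> Grass(d,n)\<close>, induced by the Pluecker embedding of the Grassmannian
  in projective space.
\<close>

definition affine_times_Grass ::
    "nat \<Rightarrow> nat \<Rightarrow> ((nat \<Rightarrow> 'k::field) \<times> (nat \<Rightarrow> 'k) set, 'k) fspace" where
  "affine_times_Grass d n = frac_space (kpoints n \<times> Grass d n)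
     {(pluecker_eval d F, pluecker_eval d G) | F G.
        \<exists>e. F \<in> pluecker_forms d n e \<and> G \<in> pluecker_forms d n e}"

definition gauss_graph ::
    "nat \<Rightarrow> nat \<Rightarrow> (nat \<Rightarrow> 'k::field) set \<Rightarrow> ((nat \<Rightarrow> 'k) \<times> (nat \<Rightarrow> 'k) set) set" where
  "gauss_graph d n X = {(x, tangent_space n X x) | x. x \<in> X - singular_locus d n X}"

definition nash_blowup ::
    "nat \<Rightarrow> nat \<Rightarrow> (nat \<Rightarrow> 'k::field) set \<Rightarrow> ((nat \<Rightarrow> 'k) \<times> (nat \<Rightarrow> 'k) set, 'k) fspace" where
  "nash_blowup d n X =
     (let XG = subspace_on (affine_times_Grass d n) (X \<times> Grass d n)
      in subspace_on XG (ztop XG closure_of gauss_graph d n X))"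


section \<open>Normality and normalization\<close>

text \<open>
  The function field of an irreducible \<open>Y\<close> consists of the functions regular on some nonempty open
  set, modulo agreement on a nonempty open set. We work with representatives; sums and products of
  rational functions are represented by pointwise sums and products.
\<close>

definition rat_funs :: "('p, 'k) fspace \<Rightarrow> ('p \<Rightarrow> 'k) set" where
  "rat_funs Y = {f. \<exists>U. openin (ztop Y) U \<and> U \<noteq> {} \<and> f \<in> regular Y U}"

definition rat_eq :: "('p, 'k) fspace \<Rightarrow> ('p \<Rightarrow> 'k) \<Rightarrow> ('p \<Rightarrow> 'k) \<Rightarrow> bool" where
  "rat_eq Y f g \<longleftrightarrow> (\<exists>U. openin (ztop Y) U \<and> U \<noteq> {} \<and> (\<forall>z\<in>U. f z = g z))"

text \<open>The integral closure in the function field of the ring of regular functions on \<open>U\<close>.\<close>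

definition int_closure :: "('p, 'k::field) fspace \<Rightarrow> 'p set \<Rightarrow> ('p \<Rightarrow> 'k) set" where
  "int_closure Y U = {f \<in> rat_funs Y. \<exists>(m::nat) a. (\<forall>i<m. a i \<in> regular Y U) \<and>
      (\<exists>W. openin (ztop Y) W \<and> W \<noteq> {} \<and> W \<subseteq> U \<and>
           (\<forall>z\<in>W. f z ^ m + (\<Sum>i<m. a i z * f z ^ i) = 0))}"

text \<open>The integral closure in the function field of the local ring at \<open>y\<close>.\<close>

definition local_int_closure :: "('p, 'k::field) fspace \<Rightarrow> 'p \<Rightarrow> ('p \<Rightarrow> 'k) set" where
  "local_int_closure Y y = (\<Union>U\<in>{U. openin (ztop Y) U \<and> y \<in> U}. int_closure Y U)"

text \<open>All local rings are integrally closed in the function field.\<close>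

definition normal_variety :: "('p, 'k::field) fspace \<Rightarrow> bool" where
  "normal_variety Y \<longleftrightarrow> irreducible_variety Y \<and>
     (\<forall>y\<in>topspace (ztop Y). \<forall>f\<in>local_int_closure Y y.
        \<exists>U g. openin (ztop Y) U \<and> y \<in> U \<and> g \<in> regular Y U \<and> rat_eq Y f g)"

text \<open>
  The \<open>k\<close>-algebra homomorphisms to \<open>k\<close> from the subalgebra \<open>A\<close>, where \<open>\<iota>\<close> embeds the constants.
  They are extended by zero outside \<open>A\<close>.
\<close>

definition alg_homs :: "'r::comm_ring_1 set \<Rightarrow> ('k::field \<Rightarrow> 'r) \<Rightarrow> ('r \<Rightarrow> 'k) set" where
  "alg_homs A \<iota> = {\<phi>. (\<forall>f. f \<notin> A \<longrightarrow> \<phi> f = 0) \<and>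
      (\<forall>f\<in>A. \<forall>g\<in>A. \<phi> (f + g) = \<phi> f + \<phi> g \<and> \<phi> (f * g) = \<phi> f * \<phi> g) \<and>
      (\<forall>c. \<phi> (\<iota> c) = c)}"

text \<open>
  The normalization of an irreducible variety \<open>Y\<close> is the relative spectrum of the integral closure
  of the structure sheaf in the function field. Since \<open>k\<close> is algebraically closed, the points over
  \<open>y\<close>, that is the maximal ideals of the integral closure of the local ring at \<open>y\<close>, are the
  homomorphisms from that integral closure to \<open>k\<close>. The admissible fractions over an open set \<open>U\<close>
  have numerator and denominator in the integral closure of the ring of regular functions on \<open>U\<close>.
  The projection to \<open>Y\<close> is \<open>fst\<close>.
\<close>

definition normalization ::
    "('p, 'k::field) fspace \<Rightarrow> ('p \<times> (('p \<Rightarrow> 'k) \<Rightarrow> 'k), 'k) fspace" where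
  "normalization Y = frac_space
     {(y, \<phi>). y \<in> topspace (ztop Y) \<and> \<phi> \<in> alg_homs (local_int_closure Y y) (\<lambda>c z. c) \<and>
        (\<forall>f\<in>local_int_closure Y y. \<forall>g\<in>local_int_closure Y y. rat_eq Y f g \<longrightarrow> \<phi> f = \<phi> g)}
     {((\<lambda>(y, \<phi>). if y \<in> U then \<phi> f else 0), (\<lambda>(y, \<phi>). if y \<in> U then \<phi> g else 0)) | U f g.
        openin (ztop Y) U \<and> f \<in> int_closure Y U \<and> g \<in> int_closure Y U}"

definition normalized_nash_blowup ::
    "nat \<Rightarrow> nat \<Rightarrow> (nat \<Rightarrow> 'k::field) set \<Rightarrow>
       (((nat \<Rightarrow> 'k) \<times> (nat \<Rightarrow> 'k) set) \<times> (((nat \<Rightarrow> 'k) \<times> (nat \<Rightarrow> 'k) set \<Rightarrow> 'k) \<Rightarrow> 'k), 'k) fspace" where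
  "normalized_nash_blowup d n X = normalization (nash_blowup d n X)"


section \<open>Affine toric varieties\<close>

text \<open>
  Affine semigroups are taken inside the free abelian group \<open>nat \<Rightarrow>\<^sub>0 int\<close> of countable rank, which
  up to isomorphism is no restriction since they are finitely generated.
\<close>

interpretation zmod: Modules.module "frag_cmul :: int \<Rightarrow> (nat \<Rightarrow>\<^sub>0 int) \<Rightarrow> (nat \<Rightarrow>\<^sub>0 int)"
  by standard (auto simp: frag_cmul_distrib frag_cmul_distrib2)

inductive_set generated_monoid :: "'a::comm_monoid_add set \<Rightarrow> 'a set" for G where
  zero: "0 \<in> generated_monoid G"
| add: "g \<in> G \<Longrightarrow> u \<in> generated_monoid G \<Longrightarrow> g + u \<in> generated_monoid G"

definition affine_semigroup :: "(nat \<Rightarrow>\<^sub>0 int) set \<Rightarrow> bool" where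
  "affine_semigroup S \<longleftrightarrow> (\<exists>G. finite G \<and> S = generated_monoid G)"

text \<open>The group generated by \<open>S\<close>, which is free abelian, has a basis consisting of \<open>d\<close> elements.\<close>

definition has_rank :: "(nat \<Rightarrow>\<^sub>0 int) set \<Rightarrow> nat \<Rightarrow> bool" where
  "has_rank S d \<longleftrightarrow>
     (\<exists>B. finite B \<and> card B = d \<and> zmod.independent B \<and> zmod.span B = zmod.span S)"

text \<open>The basis element \<open>\<chi>\<^sup>u\<close> is \<open>Poly_Mapping.single u 1\<close>.\<close>

definition semigroup_algebra :: "(nat \<Rightarrow>\<^sub>0 int) set \<Rightarrow> ((nat \<Rightarrow>\<^sub>0 int) \<Rightarrow>\<^sub>0 'k::zero) set" where
  "semigroup_algebra S = {f. Poly_Mapping.keys f \<subseteq> S}"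

text \<open>
  \<open>Spec k[S]\<close>. The closed points are identified with the \<open>k\<close>-algebra homomorphisms to \<open>k\<close>, of which
  they are the kernels.
\<close>

definition toric_spec ::
    "(nat \<Rightarrow>\<^sub>0 int) set \<Rightarrow> (((nat \<Rightarrow>\<^sub>0 int) \<Rightarrow>\<^sub>0 'k::field) \<Rightarrow> 'k, 'k) fspace" where
  "toric_spec S = frac_space (alg_homs (semigroup_algebra S) (Poly_Mapping.single 0))
     {((\<lambda>\<phi>. \<phi> f), (\<lambda>\<phi>. \<phi> g)) | f g. f \<in> semigroup_algebra S \<and> g \<in> semigroup_algebra S}"

text \<open>A closed embedding in \<open>k\<^sup>n\<close> of an affine toric variety of dimension \<open>d\<close>.\<close>

definition affine_toric_variety :: "nat \<Rightarrow> nat \<Rightarrow> (nat \<Rightarrow> 'k::field) set \<Rightarrow> bool" where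
  "affine_toric_variety d n X \<longleftrightarrow> closed_in_affine n X \<and>
     (\<exists>S. affine_semigroup S \<and> has_rank S d \<and> isomorphic (affine_var n X) (toric_spec S))"

end

(*
  A normal semigroup S of dimension d is embedded by its Hilbert basis, which contains the unit
  vectors e_i. On the torus the tangent spaces are graphs over the span of the first d coordinates,
  with matrix entries c_ji x^(b_j - e_i), where c_ji is the i-th coordinate of the generator b_j. Hence
  the chart of the Nash blowup given by these d coordinates is the spectrum of the algebra of the
  semigroup T generated by S and the differences b_j - e_i with c_ji nonzero in k. If the saturation of
  T is isomorphic to S, then X = Spec k[S] is an open subset of the normalized Nash blowup.

  Outside characteristic two there is such an S of dimension 5 for which T itself is saturated. In
  characteristic two there is one of dimension 4 for which the saturation of T has a single additional
  generator u, and 2u lies in T. So squares of functions on X descend to the chart, and as squaring is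
  additive this determines the normalization of the chart. Higher dimensions are reached by adding free
  generators to S.
*)

theory Submission
  imports Defs "HOL-Computational_Algebra.Computational_Algebra"
begin

section \<open>Spaces of fractions\<close>

text \<open>Only one chart of the blowup is computed; the rest enters through irreducibility. The
  closure defining the blowup is taken over the whole smooth locus, so irreducibility requires that
  tangent spaces vary rationally there. Then every nonempty open set meets the graph over the torus,
  and identities of functions can be tested on torus points. The obstacle is the normalization: its
  points are homomorphisms on integral closures of local rings, about which saturating a semigroup
  says nothing directly. One argument serves both cases, with an exponent \<open>q\<close>, 1 or 2,
  for which \<open>x ^ q\<close> is additive. The monoid map from the chart semigroup to
  \<open>S\<close> induces a morphism from \<open>X\<close> to the chart; \<open>q\<close>-th roots
  in the field give preimages, their uniqueness gives injectivity, and a rational function is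
  integral at a point of the chart exactly when its \<open>q\<close>-th power is regular there. So a
  single point lies over each point of the chart. Characteristic two has its own cone because
  entries 2 vanish there and their differences drop out of the chart. Normality of \<open>X\<close>
  comes from valuations, one for each half-space bounding the cone.\<close>

definition frac_closed :: "(('p \<Rightarrow> 'k::field) \<times> ('p \<Rightarrow> 'k)) set \<Rightarrow> bool" where
  "frac_closed Q \<longleftrightarrow>
     (\<forall>a b a' b'. (a, b) \<in> Q \<longrightarrow> (a', b') \<in> Q \<longrightarrow>
        ((\<lambda>z. a z * a' z), (\<lambda>z. b z * b' z)) \<in> Q \<and>
        ((\<lambda>z. a z * b' z + a' z * b z), (\<lambda>z. b z * b' z)) \<in> Q) \<and>
     (\<forall>a b. (a, b) \<in> Q \<longrightarrow> (b, a) \<in> Q) \<and>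
     (\<forall>c. ((\<lambda>_. c), (\<lambda>_. 1)) \<in> Q)"

text \<open>Regularity at \<open>y\<close>, witnessed by one fraction that is valid on its whole
  non-vanishing locus in \<open>P\<close>. This form mentions no open sets, so it is closed under
  arithmetic simply by combining fractions.\<close>

definition local_frac ::
    "'p set \<Rightarrow> (('p \<Rightarrow> 'k::field) \<times> ('p \<Rightarrow> 'k)) set \<Rightarrow> 'p \<Rightarrow> ('p \<Rightarrow> 'k) \<Rightarrow> bool" where
  "local_frac P Q y f \<longleftrightarrow>
     (\<exists>a b. (a, b) \<in> Q \<and> b y \<noteq> 0 \<and> (\<forall>z\<in>P. b z \<noteq> 0 \<longrightarrow> f z = a z / b z))"

lemma frac_closedD:
  assumes "frac_closed Q"
  shows frac_closed_mult: "(a, b) \<in> Q \<Longrightarrow> (a', b') \<in> Q \<Longrightarrow> ((\<lambda>z. a z * a' z), (\<lambda>z. b z * b' z)) \<in> Q"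
    and frac_closed_add: "(a, b) \<in> Q \<Longrightarrow> (a', b') \<in> Q \<Longrightarrow>
          ((\<lambda>z. a z * b' z + a' z * b z), (\<lambda>z. b z * b' z)) \<in> Q"
    and frac_closed_swap: "(a, b) \<in> Q \<Longrightarrow> (b, a) \<in> Q"
    and frac_closed_const: "((\<lambda>_. c), (\<lambda>_. 1)) \<in> Q"
  using assms unfolding frac_closed_def by blast+

text \<open>The sum of \<open>0 / b\<close> and \<open>1 / 1\<close> is \<open>b / b\<close>.
  Multiplying by this fraction restricts another one to the locus of \<open>b\<close>, which is how
  domains are shrunk below.\<close>

lemma frac_closed_refl:
  assumes Q: "frac_closed Q" and ab: "(a, b) \<in> Q"
  shows "(b, b) \<in> Q"
proof -
  have "((\<lambda>z. 0 * a z), (\<lambda>z. 1 * b z)) \<in> Q"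
    using frac_closed_mult[OF Q frac_closed_const[OF Q, of 0] ab] by simp
  then have "((\<lambda>_. 0), b) \<in> Q" by simp
  from frac_closed_add[OF Q this frac_closed_const[OF Q, of 1]] show ?thesis by simp
qed

text \<open>Multiplying fractions intersects their loci, so the loci generating the topology already
  form a basis.\<close>

lemma openin_frac_space:
  assumes Q: "frac_closed Q"
  shows "openin (ztop (frac_space P Q)) U \<longleftrightarrow>
    U \<subseteq> P \<and> (\<forall>y\<in>U. \<exists>a b. (a, b) \<in> Q \<and> b y \<noteq> 0 \<and> {z \<in> P. b z \<noteq> 0} \<subseteq> U)"
    (is "_ \<longleftrightarrow> ?R U")
proof
  let ?S = "{{z \<in> P. b z \<noteq> 0} | a b. (a, b) \<in> Q}"
  assume "openin (ztop (frac_space P Q)) U"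
  then have "generate_topology_on ?S U"
    by (simp add: frac_space_def Let_def openin_topology_generated_by_iff)
  then show "?R U"
  proof induction
    case (Int A B)
    show ?case
    proof (intro conjI ballI)
      fix y assume y: "y \<in> A \<inter> B"
      obtain a b where ab: "(a, b) \<in> Q" "b y \<noteq> 0" "{z \<in> P. b z \<noteq> 0} \<subseteq> A" using Int y by blast
      obtain a' b' where ab': "(a', b') \<in> Q" "b' y \<noteq> 0" "{z \<in> P. b' z \<noteq> 0} \<subseteq> B"
        using Int y by blast
      have "((\<lambda>z. a z * a' z), (\<lambda>z. b z * b' z)) \<in> Q" using frac_closed_mult[OF Q] ab ab' by blast
      moreover have "b y * b' y \<noteq> 0" "{z \<in> P. b z * b' z \<noteq> 0} \<subseteq> A \<inter> B" using ab ab' by auto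
      ultimately show "\<exists>a b. (a, b) \<in> Q \<and> b y \<noteq> 0 \<and> {z \<in> P. b z \<noteq> 0} \<subseteq> A \<inter> B"
        by (intro exI[of _ "\<lambda>z. a z * a' z"] exI[of _ "\<lambda>z. b z * b' z"]) (rule conjI | assumption)+
    qed (use Int in blast)
  next
    case (UN K)
    show ?case
    proof (intro conjI ballI)
      show "\<Union>K \<subseteq> P" using UN by blast
      fix y assume "y \<in> \<Union>K"
      then obtain A where A: "A \<in> K" "y \<in> A" by blast
      then obtain a b where "(a, b) \<in> Q" "b y \<noteq> 0" "{z \<in> P. b z \<noteq> 0} \<subseteq> A" using UN by blast
      then show "\<exists>a b. (a, b) \<in> Q \<and> b y \<noteq> 0 \<and> {z \<in> P. b z \<noteq> 0} \<subseteq> \<Union>K" using A by blast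
    qed
  next
    case (Basis s) then show ?case by blast
  qed simp
next
  assume R: "?R U"
  let ?S = "{{z \<in> P. b z \<noteq> 0} | a b. (a, b) \<in> Q}"
  let ?K = "{A. A \<subseteq> U \<and> A \<in> ?S}"
  have "U = \<Union>?K"
  proof
    show "U \<subseteq> \<Union>?K"
    proof
      fix y assume y: "y \<in> U"
      then obtain a b where "(a, b) \<in> Q" "b y \<noteq> 0" "{z \<in> P. b z \<noteq> 0} \<subseteq> U" using R by blast
      then show "y \<in> \<Union>?K" using y R by blast
    qed
  qed blast
  moreover have "generate_topology_on ?S (\<Union>?K)"
    by (rule generate_topology_on.UN) (auto intro: generate_topology_on.Basis)
  ultimately show "openin (ztop (frac_space P Q)) U"
    by (simp add: frac_space_def Let_def openin_topology_generated_by_iff)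
qed

lemma openin_frac_spaceD:
  assumes "frac_closed Q" "openin (ztop (frac_space P Q)) U"
  shows openin_frac_space_subset: "U \<subseteq> P"
    and openin_frac_space_basic: "y \<in> U \<Longrightarrow> \<exists>a b. (a, b) \<in> Q \<and> b y \<noteq> 0 \<and> {z \<in> P. b z \<noteq> 0} \<subseteq> U"
  using openin_frac_space[OF assms(1), THEN iffD1, OF assms(2)] by simp_all

lemma openin_frac_basic:
  assumes "frac_closed Q" "(a, b) \<in> Q"
  shows "openin (ztop (frac_space P Q)) {z \<in> P. b z \<noteq> 0}"
  using assms by (auto simp: openin_frac_space)

lemma topspace_frac_space:
  assumes Q: "frac_closed Q"
  shows "topspace (ztop (frac_space P Q)) = P"
proof -
  have "openin (ztop (frac_space P Q)) P"
    unfolding openin_frac_space[OF Q]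
    by (intro conjI ballI exI[of _ "\<lambda>_. 1"] frac_closed_const[OF Q]) auto
  moreover have "topspace (ztop (frac_space P Q)) \<subseteq> P"
    using openin_frac_space_subset[OF Q openin_topspace] .
  ultimately show ?thesis by (meson openin_subset subset_antisym)
qed

lemma local_frac_shrink:
  assumes Q: "frac_closed Q" and f: "local_frac P Q y f" and cd: "(c, d) \<in> Q" "d y \<noteq> 0"
  shows "\<exists>a b. (a, b) \<in> Q \<and> b y \<noteq> 0 \<and> (\<forall>z\<in>P. b z \<noteq> 0 \<longrightarrow> d z \<noteq> 0 \<and> f z = a z / b z)"
proof -
  obtain a b where ab: "(a, b) \<in> Q" "b y \<noteq> 0" "\<forall>z\<in>P. b z \<noteq> 0 \<longrightarrow> f z = a z / b z"
    using f unfolding local_frac_def by blast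
  have "((\<lambda>z. a z * d z), (\<lambda>z. b z * d z)) \<in> Q"
    using frac_closed_mult[OF Q ab(1) frac_closed_refl[OF Q cd(1)]] .
  moreover have "b y * d y \<noteq> 0" using ab cd by simp
  moreover have "\<forall>z\<in>P. b z * d z \<noteq> 0 \<longrightarrow> d z \<noteq> 0 \<and> f z = a z * d z / (b z * d z)" using ab by auto
  ultimately show ?thesis
    by (intro exI[of _ "\<lambda>z. a z * d z"] exI[of _ "\<lambda>z. b z * d z"]) (rule conjI | assumption)+
qed

text \<open>Membership in \<open>regular\<close> yields around each point an open set inside
  \<open>U\<close>, so it forces \<open>U\<close> to be open. Conversely a local fraction is cut
  down to \<open>U\<close> by \<open>local_frac_shrink\<close>.\<close>

lemma regular_frac_space:
  assumes Q: "frac_closed Q"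
  shows "f \<in> regular (frac_space P Q) U \<longleftrightarrow>
    openin (ztop (frac_space P Q)) U \<and> (\<forall>y\<in>U. local_frac P Q y f)"
    (is "?L \<longleftrightarrow> ?R")
proof
  let ?T = "ztop (frac_space P Q)"
  have eq: "f \<in> regular (frac_space P Q) U \<longleftrightarrow> (\<forall>y\<in>U. \<exists>V a b. openin ?T V \<and> y \<in> V \<and> V \<subseteq> U \<and>
     (a, b) \<in> Q \<and> (\<forall>z\<in>V. b z \<noteq> 0 \<and> f z = a z / b z))"
    by (simp add: frac_space_def Let_def)
  { assume ?L
    note L = eq[THEN iffD1, OF this]
    show ?R
    proof
      have "\<exists>V. openin ?T V \<and> y \<in> V \<and> V \<subseteq> U" if "y \<in> U" for y
        using bspec[OF L that] by auto
      then show "openin ?T U" by (intro openin_subopen[THEN iffD2] ballI) auto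
      show "\<forall>y\<in>U. local_frac P Q y f"
      proof
        fix y assume y: "y \<in> U"
        obtain V a b where V: "openin ?T V" "y \<in> V" "V \<subseteq> U" "(a, b) \<in> Q"
          "\<forall>z\<in>V. b z \<noteq> 0 \<and> f z = a z / b z" using bspec[OF L y] by auto
        obtain a' b' where ab': "(a', b') \<in> Q" "b' y \<noteq> 0" "{z \<in> P. b' z \<noteq> 0} \<subseteq> V"
          using openin_frac_space_basic[OF Q V(1,2)] by auto
        have "((\<lambda>z. a z * b' z), (\<lambda>z. b z * b' z)) \<in> Q"
          using frac_closed_mult[OF Q V(4) frac_closed_refl[OF Q ab'(1)]] .
        moreover have "b y * b' y \<noteq> 0" using V ab' by simp
        moreover have "\<forall>z\<in>P. b z * b' z \<noteq> 0 \<longrightarrow> f z = a z * b' z / (b z * b' z)"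
          using V ab' by auto
        ultimately show "local_frac P Q y f" unfolding local_frac_def
          by (intro exI[of _ "\<lambda>z. a z * b' z"] exI[of _ "\<lambda>z. b z * b' z"]) (rule conjI | assumption)+
      qed
    qed }
  { assume R: ?R
    show ?L unfolding eq
    proof
      fix y assume y: "y \<in> U"
      then obtain c d where cd: "(c, d) \<in> Q" "d y \<noteq> 0" "{z \<in> P. d z \<noteq> 0} \<subseteq> U"
        using openin_frac_space_basic[OF Q R[THEN conjunct1] y] by auto
      obtain a b where ab: "(a, b) \<in> Q" "b y \<noteq> 0"
          "\<forall>z\<in>P. b z \<noteq> 0 \<longrightarrow> d z \<noteq> 0 \<and> f z = a z / b z"
        using local_frac_shrink[OF Q R[THEN conjunct2, THEN bspec, OF y] cd(1,2)] by auto
      have "y \<in> P" using openin_frac_space_subset[OF Q R[THEN conjunct1]] y by blast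
      then show "\<exists>V a b. openin ?T V \<and> y \<in> V \<and> V \<subseteq> U \<and>
            (a, b) \<in> Q \<and> (\<forall>z\<in>V. b z \<noteq> 0 \<and> f z = a z / b z)"
        using openin_frac_basic[OF Q ab(1), of P] ab cd
        by (intro exI[of _ "{z \<in> P. b z \<noteq> 0}"] exI[of _ a] exI[of _ b]) auto
    qed }
qed

lemma openin_frac_subspace:
  assumes Q: "frac_closed Q" and Z: "Z \<subseteq> P"
  shows "ztop (frac_space Z Q) = subtopology (ztop (frac_space P Q)) Z"
proof (rule topology_eq[THEN iffD2], rule allI)
  fix U
  show "openin (ztop (frac_space Z Q)) U = openin (subtopology (ztop (frac_space P Q)) Z) U"
  proof
    assume U: "openin (ztop (frac_space Z Q)) U"
    let ?V = "\<Union>{{z \<in> P. b z \<noteq> 0} |a b. (a, b) \<in> Q \<and> {z \<in> Z. b z \<noteq> 0} \<subseteq> U}"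
    have "openin (ztop (frac_space P Q)) ?V" using openin_frac_basic[OF Q] by blast
    moreover have "U = ?V \<inter> Z"
    proof
      show "U \<subseteq> ?V \<inter> Z"
      proof
        fix y assume y: "y \<in> U"
        then obtain a b where "(a, b) \<in> Q" "b y \<noteq> 0" "{z \<in> Z. b z \<noteq> 0} \<subseteq> U" "y \<in> Z"
          using openin_frac_space_basic[OF Q U y] openin_frac_space_subset[OF Q U] by auto
        then show "y \<in> ?V \<inter> Z" using Z by blast
      qed
    qed blast
    ultimately show "openin (subtopology (ztop (frac_space P Q)) Z) U"
      unfolding openin_subtopology by blast
  next
    assume "openin (subtopology (ztop (frac_space P Q)) Z) U"
    then obtain V where V: "openin (ztop (frac_space P Q)) V" "U = V \<inter> Z"
      unfolding openin_subtopology by blast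
    show "openin (ztop (frac_space Z Q)) U"
      unfolding openin_frac_space[OF Q]
    proof (intro conjI ballI)
      fix y assume "y \<in> U"
      then obtain a b where "(a, b) \<in> Q" "b y \<noteq> 0" "{z \<in> P. b z \<noteq> 0} \<subseteq> V"
        using openin_frac_space_basic[OF Q V(1), of y] V(2) by auto
      then show "\<exists>a b. (a, b) \<in> Q \<and> b y \<noteq> 0 \<and> {z \<in> Z. b z \<noteq> 0} \<subseteq> U" using V Z by blast
    qed (use V in blast)
  qed
qed

lemma local_frac_mono: "local_frac P Q y f \<Longrightarrow> Z \<subseteq> P \<Longrightarrow> local_frac Z Q y f"
  unfolding local_frac_def by blast

text \<open>A fraction on \<open>Z\<close> is the restriction of the same fraction on
  \<open>P\<close>, so it extends to a neighbourhood. Nested subspaces, as in the Nash blowup, thus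
  collapse to one space of fractions.\<close>

lemma subspace_on_frac_space:
  assumes Q: "frac_closed Q" and Z: "Z \<subseteq> P"
  shows "subspace_on (frac_space P Q) Z = frac_space Z Q"
proof -
  let ?Y = "frac_space P Q"
  have "regular (subspace_on ?Y Z) U = regular (frac_space Z Q) U" for U
  proof (rule Set.set_eqI)
    fix f
    have 1: "(\<exists>V g. openin (ztop ?Y) V \<and> y \<in> V \<and> g \<in> regular ?Y V \<and> (\<forall>z\<in>V \<inter> U. f z = g z))
           \<longleftrightarrow> local_frac Z Q y f" if U: "openin (ztop (frac_space Z Q)) U" and y: "y \<in> U" for y
    proof
      assume "\<exists>V g. openin (ztop ?Y) V \<and> y \<in> V \<and> g \<in> regular ?Y V \<and> (\<forall>z\<in>V \<inter> U. f z = g z)"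
      then obtain V g where V: "openin (ztop ?Y) V" "y \<in> V" "g \<in> regular ?Y V"
        "\<forall>z\<in>V \<inter> U. f z = g z" by blast
      obtain c d where cd: "(c, d) \<in> Q" "d y \<noteq> 0" "{z \<in> P. d z \<noteq> 0} \<subseteq> V"
        using openin_frac_space_basic[OF Q V(1,2)] by auto
      obtain c' d' where cd': "(c', d') \<in> Q" "d' y \<noteq> 0" "{z \<in> Z. d' z \<noteq> 0} \<subseteq> U"
        using openin_frac_space_basic[OF Q U y] by auto
      have "local_frac P Q y g" using regular_frac_space[OF Q, THEN iffD1, OF V(3)] V(2) by auto
      from local_frac_shrink[OF Q this cd(1,2)] obtain a b where ab: "(a, b) \<in> Q" "b y \<noteq> 0"
        "\<forall>z\<in>P. b z \<noteq> 0 \<longrightarrow> d z \<noteq> 0 \<and> g z = a z / b z" by blast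
      have "local_frac Z Q y g" using ab Z unfolding local_frac_def by blast
      have "((\<lambda>z. a z * d' z), (\<lambda>z. b z * d' z)) \<in> Q"
        using frac_closed_mult[OF Q ab(1) frac_closed_refl[OF Q cd'(1)]] .
      moreover have "\<forall>z\<in>Z. b z * d' z \<noteq> 0 \<longrightarrow> f z = a z * d' z / (b z * d' z)"
      proof (intro ballI impI)
        fix z assume z: "z \<in> Z" "b z * d' z \<noteq> 0"
        then have zz: "z \<in> P" "b z \<noteq> 0" "d' z \<noteq> 0" using Z by auto
        then have dz: "d z \<noteq> 0" "g z = a z / b z" using ab(3) by blast+
        then have "z \<in> V" "z \<in> U" using cd(3) cd'(3) z zz by blast+
        then have "f z = g z" using V(4) by blast
        then show "f z = a z * d' z / (b z * d' z)" using dz zz by simp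
      qed
      ultimately show "local_frac Z Q y f" unfolding local_frac_def using ab cd'
        by (intro exI[of _ "\<lambda>z. a z * d' z"] exI[of _ "\<lambda>z. b z * d' z"]) auto
    next
      assume "local_frac Z Q y f"
      then obtain a b where ab: "(a, b) \<in> Q" "b y \<noteq> 0" "\<forall>z\<in>Z. b z \<noteq> 0 \<longrightarrow> f z = a z / b z"
        unfolding local_frac_def by blast
      have yZ: "y \<in> Z" "U \<subseteq> Z" using openin_frac_space_subset[OF Q U] y by auto
      have "(\<lambda>z. a z / b z) \<in> regular ?Y {z \<in> P. b z \<noteq> 0}"
        unfolding regular_frac_space[OF Q] local_frac_def using openin_frac_basic[OF Q ab(1)] ab(1) by blast
      then show "\<exists>V g. openin (ztop ?Y) V \<and> y \<in> V \<and> g \<in> regular ?Y V \<and> (\<forall>z\<in>V \<inter> U. f z = g z)"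
        using openin_frac_basic[OF Q ab(1), of P] ab yZ Z
        by (intro exI[of _ "{z \<in> P. b z \<noteq> 0}"] exI[of _ "\<lambda>z. a z / b z"]) blast
    qed
    show "f \<in> regular (subspace_on ?Y Z) U \<longleftrightarrow> f \<in> regular (frac_space Z Q) U"
      unfolding regular_frac_space[OF Q] using 1
      by (auto simp: subspace_on_def openin_frac_subspace[OF Q Z])
  qed
  then have "regular (subspace_on ?Y Z) = regular (frac_space Z Q)" by blast
  moreover have "ztop (subspace_on ?Y Z) = ztop (frac_space Z Q)"
    by (simp add: subspace_on_def openin_frac_subspace[OF Q Z])
  ultimately show ?thesis by (metis fspace.equality old.unit.exhaust)
qed

section \<open>Arithmetic of local fractions\<close>

lemma local_frac_const: "frac_closed Q \<Longrightarrow> local_frac P Q y (\<lambda>_. c)"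
  unfolding local_frac_def using frac_closed_const by fastforce

lemma local_frac_mult:
  assumes Q: "frac_closed Q" and f: "local_frac P Q y f" and g: "local_frac P Q y g"
  shows "local_frac P Q y (\<lambda>z. f z * g z)"
proof -
  obtain a b where ab: "(a, b) \<in> Q" "b y \<noteq> 0" "\<forall>z\<in>P. b z \<noteq> 0 \<longrightarrow> f z = a z / b z"
    using f unfolding local_frac_def by blast
  obtain a' b' where ab': "(a', b') \<in> Q" "b' y \<noteq> 0" "\<forall>z\<in>P. b' z \<noteq> 0 \<longrightarrow> g z = a' z / b' z"
    using g unfolding local_frac_def by blast
  show ?thesis unfolding local_frac_def
    using frac_closed_mult[OF Q ab(1) ab'(1)] ab ab'
    by (intro exI[of _ "\<lambda>z. a z * a' z"] exI[of _ "\<lambda>z. b z * b' z"]) auto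
qed

lemma local_frac_add:
  assumes Q: "frac_closed Q" and f: "local_frac P Q y f" and g: "local_frac P Q y g"
  shows "local_frac P Q y (\<lambda>z. f z + g z)"
proof -
  obtain a b where ab: "(a, b) \<in> Q" "b y \<noteq> 0" "\<forall>z\<in>P. b z \<noteq> 0 \<longrightarrow> f z = a z / b z"
    using f unfolding local_frac_def by blast
  obtain a' b' where ab': "(a', b') \<in> Q" "b' y \<noteq> 0" "\<forall>z\<in>P. b' z \<noteq> 0 \<longrightarrow> g z = a' z / b' z"
    using g unfolding local_frac_def by blast
  show ?thesis unfolding local_frac_def
    using frac_closed_add[OF Q ab(1) ab'(1)] ab ab'
    by (intro exI[of _ "\<lambda>z. a z * b' z + a' z * b z"] exI[of _ "\<lambda>z. b z * b' z"])
       (auto simp: add_frac_eq)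
qed

lemma local_frac_inverse:
  assumes Q: "frac_closed Q" and f: "local_frac P Q y f" and y: "f y \<noteq> 0" "y \<in> P"
  shows "\<exists>a b. (a, b) \<in> Q \<and> b y \<noteq> 0 \<and> (\<forall>z\<in>P. b z \<noteq> 0 \<longrightarrow> f z \<noteq> 0 \<and> inverse (f z) = a z / b z)"
proof -
  obtain a b where ab: "(a, b) \<in> Q" "b y \<noteq> 0" "\<forall>z\<in>P. b z \<noteq> 0 \<longrightarrow> f z = a z / b z"
    using f unfolding local_frac_def by blast
  have "a y \<noteq> 0" using ab y by auto
  have bb: "(b, b) \<in> Q" "(b, a) \<in> Q" using frac_closed_refl[OF Q ab(1)] frac_closed_swap[OF Q ab(1)] by auto
  show ?thesis
    \<comment> \<open>The inverse is written as \<open>b * b / (a * b)\<close>: its denominator is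
      nonzero only where both \<open>a\<close> and \<open>b\<close> are, and there \<open>f\<close>
      really equals \<open>a / b\<close>.\<close>
    using frac_closed_mult[OF Q bb(2) bb(1)] ab \<open>a y \<noteq> 0\<close>
    by (intro exI[of _ "\<lambda>z. b z * b z"] exI[of _ "\<lambda>z. a z * b z"]) auto
qed

lemma local_frac_divide:
  assumes Q: "frac_closed Q" and f: "local_frac P Q y f" and g: "local_frac P Q y g"
    and y: "g y \<noteq> 0" "y \<in> P"
  shows "local_frac P Q y (\<lambda>z. f z / g z)"
proof -
  have "local_frac P Q y (\<lambda>z. inverse (g z))"
    using local_frac_inverse[OF Q g y] unfolding local_frac_def by blast
  from local_frac_mult[OF Q f this] show ?thesis by (simp add: divide_inverse)
qed

lemma local_frac_cong:
  assumes Q: "frac_closed Q" and f: "local_frac P Q y f" and U: "openin (ztop (frac_space P Q)) U" "y \<in> U"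
    and eq: "\<And>z. z \<in> U \<Longrightarrow> f z = g z"
  shows "local_frac P Q y g"
proof -
  obtain c d where cd: "(c, d) \<in> Q" "d y \<noteq> 0" "{z \<in> P. d z \<noteq> 0} \<subseteq> U"
    using openin_frac_space_basic[OF Q U] by auto
  obtain a b where ab: "(a, b) \<in> Q" "b y \<noteq> 0"
      "\<forall>z\<in>P. b z \<noteq> 0 \<longrightarrow> d z \<noteq> 0 \<and> f z = a z / b z"
    using local_frac_shrink[OF Q f cd(1,2)] by blast
  have "g z = a z / b z" if "z \<in> P" "b z \<noteq> 0" for z
  proof -
    have "z \<in> U" using ab that cd by blast
    then show ?thesis using ab that eq by metis
  qed
  then show ?thesis unfolding local_frac_def using ab by blast
qed

lemma local_frac_sum:
  assumes Q: "frac_closed Q" and "\<And>i. i \<in> I \<Longrightarrow> local_frac P Q y (f i)"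
  shows "local_frac P Q y (\<lambda>z. \<Sum>i\<in>I. f i z)"
  using assms(2)
  by (induction I rule: infinite_finite_induct)
     (auto intro: local_frac_const[OF Q] local_frac_add[OF Q])

lemma local_frac_prod:
  assumes Q: "frac_closed Q" and "\<And>i. i \<in> I \<Longrightarrow> local_frac P Q y (f i)"
  shows "local_frac P Q y (\<lambda>z. \<Prod>i\<in>I. f i z)"
  using assms(2)
  by (induction I rule: infinite_finite_induct)
     (auto intro: local_frac_const[OF Q] local_frac_mult[OF Q])

lemma local_frac_power:
  assumes Q: "frac_closed Q" and "local_frac P Q y f"
  shows "local_frac P Q y (\<lambda>z. f z ^ n)"
  by (induction n) (auto intro: local_frac_const[OF Q] local_frac_mult[OF Q] assms)

lemma local_frac_peval:
  assumes Q: "frac_closed Q"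
    and "\<And>i m. m \<in> Poly_Mapping.keys F \<Longrightarrow> i \<in> Poly_Mapping.keys m \<Longrightarrow> local_frac P Q y (\<lambda>z. h z i)"
  shows "local_frac P Q y (\<lambda>z. peval F (h z))"
  unfolding peval_def
  by (intro local_frac_sum[OF Q] local_frac_mult[OF Q] local_frac_prod[OF Q] local_frac_power[OF Q]
      local_frac_const[OF Q] assms(2))

lemma openin_local_frac_nonzero:
  assumes Q: "frac_closed Q" and "\<And>y. y \<in> P \<Longrightarrow> local_frac P Q y f"
  shows "openin (ztop (frac_space P Q)) {z \<in> P. f z \<noteq> 0}"
  unfolding openin_frac_space[OF Q]
proof (intro conjI ballI)
  fix y assume "y \<in> {z \<in> P. f z \<noteq> 0}"
  then show "\<exists>a b. (a, b) \<in> Q \<and> b y \<noteq> 0 \<and> {z \<in> P. b z \<noteq> 0} \<subseteq> {z \<in> P. f z \<noteq> 0}"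
    using local_frac_inverse[OF Q assms(2)] by blast
qed blast

text \<open>The factor \<open>u\<close> accounts for the choice of homogeneous coordinates.\<close>

lemma morphism_frac_spaceI:
  assumes Q: "frac_closed Q" and Q': "frac_closed Q'" and hP: "\<And>y. y \<in> P \<Longrightarrow> h y \<in> P'"
    and h: "\<And>a b. (a, b) \<in> Q' \<Longrightarrow> \<exists>A B u. \<forall>y\<in>P. u y \<noteq> 0 \<and> a (h y) = u y * A y \<and> b (h y) = u y * B y \<and>
              local_frac P Q y A \<and> local_frac P Q y B"
  shows "morphism (frac_space P Q) (frac_space P' Q') h"
proof -
  have op: "openin (ztop (frac_space P Q)) {y \<in> P. h y \<in> V}"
    if V: "openin (ztop (frac_space P' Q')) V" for V
  proof (subst openin_subopen, intro ballI)
    fix y assume y: "y \<in> {y \<in> P. h y \<in> V}"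
    then obtain a b where ab: "(a, b) \<in> Q'" "b (h y) \<noteq> 0" "{z \<in> P'. b z \<noteq> 0} \<subseteq> V"
      using openin_frac_space_basic[OF Q' V, of "h y"] by auto
    obtain A B u where AB: "\<forall>y\<in>P. u y \<noteq> 0 \<and> a (h y) = u y * A y \<and> b (h y) = u y * B y \<and>
              local_frac P Q y A \<and> local_frac P Q y B" using h[OF ab(1)] by blast
    have "openin (ztop (frac_space P Q)) {y \<in> P. B y \<noteq> 0}"
      using openin_local_frac_nonzero[OF Q] AB by blast
    moreover have "y \<in> {y \<in> P. B y \<noteq> 0}" using AB ab y by auto
    moreover have "{y \<in> P. B y \<noteq> 0} \<subseteq> {y \<in> P. h y \<in> V}" using ab AB hP by auto
    ultimately show "\<exists>T. openin (ztop (frac_space P Q)) T \<and> y \<in> T \<and> T \<subseteq> {y \<in> P. h y \<in> V}" by blast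
  qed
  have "f \<circ> h \<in> regular (frac_space P Q) {y \<in> P. h y \<in> V}"
    if V: "openin (ztop (frac_space P' Q')) V" and f: "f \<in> regular (frac_space P' Q') V" for V f
    unfolding regular_frac_space[OF Q]
  proof (intro conjI ballI op[OF V])
    fix y assume y: "y \<in> {y \<in> P. h y \<in> V}"
    then obtain a b where ab: "(a, b) \<in> Q'" "b (h y) \<noteq> 0" "\<forall>z\<in>P'. b z \<noteq> 0 \<longrightarrow> f z = a z / b z"
      using regular_frac_space[OF Q', THEN iffD1, OF f] unfolding local_frac_def by auto
    obtain A B u where AB: "\<forall>y\<in>P. u y \<noteq> 0 \<and> a (h y) = u y * A y \<and> b (h y) = u y * B y \<and>
              local_frac P Q y A \<and> local_frac P Q y B" using h[OF ab(1)] by blast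
    have B: "B y \<noteq> 0" "y \<in> P" using AB ab y by auto
    have "local_frac P Q y A" "local_frac P Q y B" using AB B by auto
    then have 1: "local_frac P Q y (\<lambda>z. A z / B z)"
      using B by (intro local_frac_divide[OF Q, where f = A and g = B])
    have 2: "openin (ztop (frac_space P Q)) {y \<in> P. B y \<noteq> 0}"
      using openin_local_frac_nonzero[OF Q] AB by blast
    have 3: "A z / B z = (f \<circ> h) z" if "z \<in> {y \<in> P. B y \<noteq> 0}" for z
      using that ab(3) hP[of z] AB by auto
    show "local_frac P Q y (f \<circ> h)"
      by (rule local_frac_cong[OF Q 1 2 _ 3]) (use B in auto)
  qed
  then show ?thesis
    unfolding morphism_def continuous_map using op hP
    by (auto simp: topspace_frac_space[OF Q] topspace_frac_space[OF Q'] image_subset_iff)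
qed

section \<open>Complete integral closedness of polynomial rings\<close>

definition subring_on :: "'a::comm_ring_1 set \<Rightarrow> bool" where
  "subring_on A \<longleftrightarrow> 1 \<in> A \<and> (\<forall>x\<in>A. \<forall>y\<in>A. x - y \<in> A \<and> x * y \<in> A)"

text \<open>An element \<open>p / q\<close> of the fraction field whose powers have the common
  denominator \<open>c\<close> lies in the ring. Unlike an integral equation, this condition can be
  compared coefficient by coefficient, so it passes to polynomial rings.\<close>

definition completely_closed_on :: "'a::idom set \<Rightarrow> bool" where
  "completely_closed_on A \<longleftrightarrow> (\<forall>p\<in>A. \<forall>q\<in>A. \<forall>c\<in>A. q \<noteq> 0 \<longrightarrow> c \<noteq> 0 \<longrightarrow>
     (\<forall>j::nat. \<exists>e\<in>A. q ^ j * e = c * p ^ j) \<longrightarrow> (\<exists>s\<in>A. q * s = p))"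

definition polys_over :: "'a::comm_ring_1 set \<Rightarrow> 'a Polynomial.poly set" where
  "polys_over A = {f. \<forall>i. coeff f i \<in> A}"

lemma subring_on_closed:
  assumes A: "subring_on A"
  shows subring_on_1: "1 \<in> A" and subring_on_0: "0 \<in> A"
    and subring_on_diff: "x \<in> A \<Longrightarrow> y \<in> A \<Longrightarrow> x - y \<in> A"
    and subring_on_mult: "x \<in> A \<Longrightarrow> y \<in> A \<Longrightarrow> x * y \<in> A"
    and subring_on_uminus: "x \<in> A \<Longrightarrow> - x \<in> A"
    and subring_on_add: "x \<in> A \<Longrightarrow> y \<in> A \<Longrightarrow> x + y \<in> A"
proof -
  show 1: "1 \<in> A" and d: "\<And>x y. x \<in> A \<Longrightarrow> y \<in> A \<Longrightarrow> x - y \<in> A"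
    and "x \<in> A \<Longrightarrow> y \<in> A \<Longrightarrow> x * y \<in> A" using A unfolding subring_on_def by auto
  show 0: "0 \<in> A" using d[OF 1 1] by simp
  show u: "\<And>x. x \<in> A \<Longrightarrow> - x \<in> A" using d[OF 0] by simp
  show "x \<in> A \<Longrightarrow> y \<in> A \<Longrightarrow> x + y \<in> A" using d[of x "- y"] u by simp
qed

lemma subring_on_sum:
  "subring_on A \<Longrightarrow> (\<And>i. i \<in> I \<Longrightarrow> f i \<in> A) \<Longrightarrow> sum f I \<in> A"
  by (induction I rule: infinite_finite_induct) (auto intro: subring_on_0 subring_on_add)

lemma subring_on_power: "subring_on A \<Longrightarrow> x \<in> A \<Longrightarrow> x ^ n \<in> A"
  by (induction n) (auto intro: subring_on_1 subring_on_mult)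

lemma subring_on_of_nat: "subring_on A \<Longrightarrow> of_nat n \<in> A"
  by (induction n) (auto intro: subring_on_0 subring_on_1 subring_on_add)

lemma subring_on_polys_over:
  assumes A: "subring_on A" shows "subring_on (polys_over A)"
  unfolding subring_on_def polys_over_def
  by (auto simp: coeff_mult of_bool_def intro!: subring_on_sum[OF A] subring_on_mult[OF A]
      subring_on_diff[OF A] subring_on_1[OF A] subring_on_0[OF A])

text \<open>An element of least degree in the ideal of \<open>p\<close> and \<open>q\<close> divides
  every element of the ideal, and the two quotients are coprime.\<close>

lemma bezout_field_poly:
  fixes p q :: "'f::field Polynomial.poly"
  assumes q: "q \<noteq> 0"
  obtains g u v p' q' where "p = g * p'" "q = g * q'" "u * p' + v * q' = 1"
proof -
  define S where "S = {u * p + v * q | u v. True}"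
  have "q \<in> S" unfolding S_def by (rule CollectI, rule exI[of _ 0], rule exI[of _ 1]) simp
  with q have "\<exists>g. g \<in> S \<and> g \<noteq> 0" by blast
  from ex_has_least_nat[of "\<lambda>g. g \<in> S \<and> g \<noteq> 0", OF this[THEN someI_ex], of degree]
  obtain g where g: "g \<in> S" "g \<noteq> 0" and min: "\<And>h. h \<in> S \<Longrightarrow> h \<noteq> 0 \<Longrightarrow> degree g \<le> degree h" by blast
  obtain u v where uv: "g = u * p + v * q" using g S_def by blast
  have dvd: "g dvd h" if h: "h \<in> S" for h
  proof -
    obtain a b where ab: "h = a * p + b * q" using h S_def by blast
    have "h mod g = h - (h div g) * g" by (simp add: minus_div_mult_eq_mod)
    also have "\<dots> = (a - (h div g) * u) * p + (b - (h div g) * v) * q"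
      using ab uv by (simp add: algebra_simps)
    finally have "h mod g \<in> S" unfolding S_def by blast
    moreover have "h mod g \<noteq> 0 \<Longrightarrow> degree (h mod g) < degree g" using degree_mod_less[OF g(2)] by blast
    ultimately have "h mod g = 0" using min by fastforce
    then show ?thesis by (simp add: dvd_eq_mod_eq_0)
  qed
  have "p \<in> S" unfolding S_def by (rule CollectI, rule exI[of _ 1], rule exI[of _ 0]) simp
  from dvd[OF this] dvd[OF \<open>q \<in> S\<close>] obtain p' q' where pq: "p = g * p'" "q = g * q'" by (auto elim!: dvdE)
  have "g * (u * p' + v * q') = g * 1" using uv pq by (simp add: algebra_simps)
  then have "u * p' + v * q' = 1" by (rule mult_left_cancel[OF g(2), THEN iffD1])
  with pq show ?thesis by (rule that)
qed

lemma bezout_power: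
  fixes x y :: "'a::comm_ring_1"
  assumes "u * x + v * y = 1"
  shows "\<exists>u' v'. u' * x ^ n + v' * y ^ n = 1"
proof -
  have 1: "\<exists>a b. a * x ^ i + b * y = 1" for i
  proof (induction i)
    case (Suc i)
    then obtain a b where ab: "a * x ^ i + b * y = 1" by blast
    have "1 = (a * x ^ i + b * y) * (u * x + v * y)" using ab assms by simp
    also have "\<dots> = (a * u) * x ^ Suc i + (b * u * x + b * v * y + a * x ^ i * v) * y"
      by (simp add: algebra_simps)
    finally have "(a * u) * x ^ Suc i + (b * u * x + b * v * y + a * x ^ i * v) * y = 1" by (rule sym)
    then show ?case by blast
  qed (rule exI[of _ 1], rule exI[of _ 0], simp)
  have "\<exists>a b. a * x ^ n + b * y ^ i = 1" for i
  proof (induction i)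
    case (Suc i)
    then obtain a b where ab: "a * x ^ n + b * y ^ i = 1" by blast
    obtain c d where cd: "c * x ^ n + d * y = 1" using 1 by blast
    have "1 = (a * x ^ n + b * y ^ i) * (c * x ^ n + d * y)" using ab cd by simp
    also have "\<dots> = (a * c * x ^ n + a * d * y + b * y ^ i * c) * x ^ n + (b * d) * y ^ Suc i"
      by (simp add: algebra_simps)
    finally have "(a * c * x ^ n + a * d * y + b * y ^ i * c) * x ^ n + (b * d) * y ^ Suc i = 1" by (rule sym)
    then show ?case by blast
  qed (rule exI[of _ 0], rule exI[of _ 1], simp)
  then show ?thesis by blast
qed

text \<open>After removal of the greatest common factor, \<open>q' ^ j\<close> is coprime to
  \<open>p' ^ j\<close> and therefore divides \<open>c\<close> for every \<open>j\<close>. The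
  degree of \<open>c\<close> then leaves no room for a nonconstant \<open>q'\<close>.\<close>

lemma field_poly_dvd_if_powers_dvd:
  fixes p q c :: "'f::field Polynomial.poly"
  assumes q: "q \<noteq> 0" and c: "c \<noteq> 0" and dvd: "\<And>j::nat. q ^ j dvd c * p ^ j"
  shows "q dvd p"
proof -
  obtain g u v p' q' where g: "p = g * p'" "q = g * q'" "u * p' + v * q' = 1"
    by (rule bezout_field_poly[OF q])
  have nz: "g \<noteq> 0" "q' \<noteq> 0" using g q by auto
  have "degree q' * j \<le> degree c" for j
  proof -
    have "g ^ j * q' ^ j dvd g ^ j * (c * p' ^ j)"
      using dvd[of j] unfolding g(1,2) by (simp add: power_mult_distrib ac_simps)
    then have "q' ^ j dvd c * p' ^ j" using nz by simp
    moreover obtain a b where "a * p' ^ j + b * q' ^ j = 1" using bezout_power[OF g(3)] by blast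
    then have "c * (a * p' ^ j + b * q' ^ j) = c" by simp
    then have "c = a * (c * p' ^ j) + (c * b) * q' ^ j" by (simp add: algebra_simps)
    moreover have "q' ^ j dvd (c * b) * q' ^ j" by (rule dvd_triv_right)
    ultimately have "q' ^ j dvd c" using dvd_add dvd_mult by metis
    then have "degree (q' ^ j) \<le> degree c" using c by (rule dvd_imp_degree_le)
    then show ?thesis using nz by (simp add: degree_power_eq mult.commute)
  qed
  from this[of "Suc (degree c)"] have "degree q' = 0" by (cases "degree q'") auto
  then have "q' dvd 1" using nz by (metis is_unit_iff_degree)
  then have "q' dvd p'" by (rule dvd_trans) (rule one_dvd)
  then show ?thesis unfolding g(1,2) by (intro mult_dvd_mono dvd_refl)
qed

lemma clear_denominators:
  fixes f :: "'a::idom fract Polynomial.poly"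
  shows "\<exists>a r. a \<noteq> 0 \<and> smult (to_fract a) f = map_poly to_fract r"
proof (induction f)
  case 0 show ?case by (intro exI[of _ 1] exI[of _ 0]) simp
next
  case (pCons x f)
  then obtain a r where ar: "a \<noteq> 0" "smult (to_fract a) f = map_poly to_fract r" by blast
  obtain n d where x: "x = Fract n d" "d \<noteq> 0" by (cases x) auto
  have x': "to_fract d * x = to_fract n" using x by (simp add: to_fract_def eq_fract)
  have "smult (to_fract (d * a)) (pCons x f) =
      pCons (to_fract (a * n)) (smult (to_fract d) (smult (to_fract a) f))"
    using x' by (simp add: ac_simps)
  also have "\<dots> = map_poly to_fract (pCons (a * n) (smult d r))"
    unfolding ar(2) by (intro poly_eqI) (simp add: coeff_map_poly coeff_pCons split: nat.split)
  finally show ?case using ar x by (metis mult_eq_0_iff)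
qed

text \<open>The division is exact over the fraction field of the coefficients; \<open>a\<close>
  collects the denominators of the quotient.\<close>

lemma poly_dvd_up_to_constant:
  fixes p q c :: "'a::idom Polynomial.poly"
  assumes q: "q \<noteq> 0" and c: "c \<noteq> 0" and dvd: "\<And>j::nat. q ^ j dvd c * p ^ j"
  shows "\<exists>a r. a \<noteq> 0 \<and> smult a p = q * r"
proof -
  let ?h = "map_poly to_fract :: 'a Polynomial.poly \<Rightarrow> _"
  have inj: "?h f = 0 \<longleftrightarrow> f = 0" for f by (simp add: map_poly_eq_0_iff)
  have mult: "?h (f * g) = ?h f * ?h g" for f g by (simp add: fract_poly_mult)
  have pow: "?h (f ^ j) = ?h f ^ j" for f j by (induction j) (simp_all add: mult)
  have "?h q ^ j dvd ?h c * ?h p ^ j" for j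
    using dvd[of j] by (metis dvd_def mult pow)
  from field_poly_dvd_if_powers_dvd[OF _ _ this] obtain s where s: "?h p = ?h q * s"
    using q c inj by (auto elim: dvdE)
  obtain a r where ar: "a \<noteq> 0" "smult (to_fract a) s = ?h r" using clear_denominators by blast
  have "?h (smult a p) = smult (to_fract a) (?h p)" by (simp add: fract_poly_smult)
  also have "\<dots> = ?h (q * r)" unfolding s mult ar(2)[symmetric] by simp
  finally have "smult a p = q * r"
    by (metis fract_poly_eq_iff)
  with ar show ?thesis by blast
qed

text \<open>The order of vanishing at the origin is at least \<open>i\<close>. Lowest coefficients
  multiply without interference from other terms, which turns identities between polynomials into
  identities in the coefficient ring.\<close>

definition low_zero :: "'a::comm_ring_1 Polynomial.poly \<Rightarrow> nat \<Rightarrow> bool" where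
  "low_zero f i \<longleftrightarrow> (\<forall>k<i. coeff f k = 0)"

lemma low_zero_mult:
  assumes f: "low_zero f i" and g: "low_zero g j"
  shows "low_zero (f * g) (i + j)" "coeff (f * g) (i + j) = coeff f i * coeff g j"
proof -
  have z: "coeff f k * coeff g (n - k) = 0" if "k \<le> n" "n \<le> i + j" "n = i + j \<longrightarrow> k \<noteq> i" for k n
  proof (cases "k < i")
    case False
    then have "n - k < j" using that by auto
    then show ?thesis using g unfolding low_zero_def by simp
  qed (use f in \<open>simp add: low_zero_def\<close>)
  show "low_zero (f * g) (i + j)" unfolding low_zero_def coeff_mult
    by (intro allI impI sum.neutral ballI z) auto
  have "coeff (f * g) (i + j) = (\<Sum>k\<in>{i}. coeff f k * coeff g (i + j - k))"
    unfolding coeff_mult by (intro sum.mono_neutral_right) (auto intro!: z)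
  then show "coeff (f * g) (i + j) = coeff f i * coeff g j" by simp
qed

lemma low_zero_power:
  assumes f: "low_zero f i"
  shows "low_zero (f ^ n) (n * i)" "coeff (f ^ n) (n * i) = coeff f i ^ n"
proof -
  have "low_zero (f ^ n) (n * i) \<and> coeff (f ^ n) (n * i) = coeff f i ^ n"
  proof (induction n)
    case 0 then show ?case by (simp add: low_zero_def)
  next
    case (Suc n)
    then show ?case using low_zero_mult[OF f, of "f ^ n" "n * i"] by simp
  qed
  then show "low_zero (f ^ n) (n * i)" "coeff (f ^ n) (n * i) = coeff f i ^ n" by auto
qed

lemma low_zero_Least: "f \<noteq> 0 \<Longrightarrow> \<exists>i. low_zero f i \<and> coeff f i \<noteq> 0"
proof -
  assume "f \<noteq> 0"
  then have "coeff f (degree f) \<noteq> 0" by simp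
  then show ?thesis unfolding low_zero_def
    by (intro exI[of _ "LEAST i. coeff f i \<noteq> 0"]) (metis (mono_tags, lifting) LeastI not_less_Least)
qed

lemma low_zero_cancel:
  fixes f g :: "'a::idom Polynomial.poly"
  assumes fg: "low_zero (f * g) (i + j)" and f: "low_zero f i" "coeff f i \<noteq> 0"
  shows "low_zero g j"
proof (cases "g = 0")
  case False
  then obtain k where k: "low_zero g k" "coeff g k \<noteq> 0" using low_zero_Least by blast
  have "coeff (f * g) (i + k) \<noteq> 0" using low_zero_mult(2)[OF f(1) k(1)] f k by simp
  then have "j \<le> k" using fg unfolding low_zero_def by (metis add_less_cancel_left not_le_imp_less)
  then show ?thesis using k unfolding low_zero_def by auto
qed (simp add: low_zero_def)

text \<open>Expanding the power binomially shows that subtracting a ring element \<open>t\<close>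
  from \<open>p / q\<close> keeps the common denominator \<open>c\<close>.\<close>

lemma almost_integral_diff:
  assumes B: "subring_on B" and t: "t \<in> B"
    and e: "\<And>j::nat. \<exists>e\<in>B. q ^ j * e = c * p ^ j"
  shows "\<exists>e\<in>B. q ^ j * e = c * (p - q * t) ^ j"
proof -
  obtain E where E: "\<And>j. E j \<in> B" "\<And>j. q ^ j * E j = c * p ^ j" using e by metis
  let ?e = "\<Sum>i\<le>j. of_nat (j choose i) * E i * (- t) ^ (j - i)"
  have "?e \<in> B"
    by (intro subring_on_sum[OF B] subring_on_mult[OF B] subring_on_of_nat[OF B]
        subring_on_power[OF B] subring_on_uminus[OF B] t E)
  moreover have "q ^ j * ?e = c * (p - q * t) ^ j"
  proof -
    have "c * (p - q * t) ^ j = c * (p + q * (- t)) ^ j" by simp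
    also have "\<dots> = (\<Sum>i\<le>j. of_nat (j choose i) * (c * p ^ i) * (q * (- t)) ^ (j - i))"
      unfolding binomial_ring sum_distrib_left by (intro sum.cong refl) (simp only: ac_simps)
    also have "\<dots> = (\<Sum>i\<le>j. q ^ j * (of_nat (j choose i) * E i * (- t) ^ (j - i)))"
    proof (rule sum.cong[OF refl])
      fix i assume "i \<in> {..j}"
      then have "q ^ j = q ^ i * q ^ (j - i)" by (simp add: power_add[symmetric])
      then show "of_nat (j choose i) * (c * p ^ i) * (q * (- t)) ^ (j - i) =
          q ^ j * (of_nat (j choose i) * E i * (- t) ^ (j - i))"
        unfolding E(2)[symmetric] power_mult_distrib by (simp add: ac_simps)
    qed
    finally show ?thesis by (simp add: sum_distrib_left)
  qed
  ultimately show ?thesis by blast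
qed

text \<open>
  The quotient exists over the fraction field. Its lowest coefficient is almost integral over \<open>A\<close>,
  hence lies in \<open>A\<close>, and can be subtracted.
\<close>

lemma completely_closed_on_polys_over:
  fixes A :: "'a::idom set"
  assumes A: "subring_on A" and cA: "completely_closed_on A"
  shows "completely_closed_on (polys_over A)"
  unfolding completely_closed_on_def
proof (intro ballI impI)
  let ?B = "polys_over A"
  note B = subring_on_polys_over[OF A]
  fix p0 q c assume p0: "p0 \<in> ?B" and q: "q \<in> ?B" "q \<noteq> 0" and c: "c \<in> ?B" "c \<noteq> 0"
    and al: "\<forall>j. \<exists>e\<in>?B. q ^ j * e = c * p0 ^ j"
  have "q ^ j dvd c * p0 ^ j" for j using al by (metis dvd_triv_left)
  then obtain a r0 where a: "a \<noteq> 0" "smult a p0 = q * r0"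
    using poly_dvd_up_to_constant[OF q(2) c(2)] by blast
  obtain w where w: "low_zero q w" "coeff q w \<noteq> 0" using low_zero_Least[OF q(2)] by blast
  obtain x where x: "low_zero c x" "coeff c x \<noteq> 0" using low_zero_Least[OF c(2)] by blast
  let ?N = "Suc (degree r0)"
  \<comment> \<open>The coefficients of \<open>r\<close> are removed from below: at stage
    \<open>k\<close> those under \<open>?N - k\<close> have gone, and from \<open>?N\<close> on
    there are none. At \<open>k = 0\<close> nothing is left. The constant \<open>a\<close> stays
    fixed throughout.\<close>
  have "p \<in> ?B \<Longrightarrow> smult a p = q * r \<Longrightarrow> (\<And>j. \<exists>e\<in>?B. q ^ j * e = c * p ^ j) \<Longrightarrow>
      low_zero r (?N - k) \<Longrightarrow> (\<And>i. i \<ge> ?N \<Longrightarrow> coeff r i = 0) \<Longrightarrow> k \<le> ?N \<Longrightarrow> \<exists>s\<in>?B. q * s = p" for k p r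
  proof (induction k arbitrary: p r)
    case 0
    then have "r = 0" by (intro poly_eqI) (metis coeff_0 diff_zero leI low_zero_def)
    then have "p = 0" using 0 a by simp
    then show ?case using subring_on_0[OF B] by auto
  next
    case (Suc k)
    let ?v = "?N - Suc k"
    let ?\<pi> = "coeff p (w + ?v)"
    have lp: "low_zero p (w + ?v)" and ap: "a * ?\<pi> = coeff q w * coeff r ?v"
    proof -
      have 1: "low_zero (smult a p) (w + ?v)" and 2: "coeff (smult a p) (w + ?v) = coeff q w * coeff r ?v"
        using low_zero_mult[OF w(1) Suc.prems(4)] Suc.prems(2) by auto
      show "low_zero p (w + ?v)" using 1 a unfolding low_zero_def by simp
      show "a * ?\<pi> = coeff q w * coeff r ?v" using 2 by simp
    qed
    \<comment> \<open>Comparing lowest coefficients in \<open>q ^ j * e = c * p ^ j\<close> makes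
      the quotient of \<open>?\<pi>\<close> by \<open>coeff q w\<close> almost integral over
      \<open>A\<close>, with the lowest coefficient of \<open>c\<close> as common
      denominator.\<close>
    have "\<exists>e\<in>A. coeff q w ^ j * e = coeff c x * ?\<pi> ^ j" for j
    proof -
      obtain e where e: "e \<in> ?B" "q ^ j * e = c * p ^ j" using Suc.prems(3) by blast
      have cp: "low_zero (c * p ^ j) (x + j * (w + ?v))"
           "coeff (c * p ^ j) (x + j * (w + ?v)) = coeff c x * ?\<pi> ^ j"
        using low_zero_mult[OF x(1) low_zero_power(1)[OF lp, of j]] low_zero_power(2)[OF lp, of j] by auto
      have eq: "x + j * (w + ?v) = j * w + (x + j * ?v)" by (simp add: algebra_simps)
      note qj = low_zero_power[OF w(1), of j]
      have 1: "low_zero (q ^ j * e) (j * w + (x + j * ?v))"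
        unfolding e(2) eq[symmetric] by (rule cp(1))
      have 2: "coeff (q ^ j) (j * w) \<noteq> 0" unfolding qj(2) using w(2) by (rule power_not_zero)
      have 3: "low_zero e (x + j * ?v)" by (rule low_zero_cancel[OF 1 qj(1) 2])
      have "coeff q w ^ j * coeff e (x + j * ?v) = coeff c x * ?\<pi> ^ j"
        using low_zero_mult(2)[OF qj(1) 3] unfolding qj(2) e(2) eq[symmetric] cp(2) by (rule sym)
      moreover have "coeff e (x + j * ?v) \<in> A" using e(1) unfolding polys_over_def by blast
      ultimately show ?thesis by blast
    qed
    moreover have "?\<pi> \<in> A" "coeff q w \<in> A" "coeff c x \<in> A"
      using Suc.prems(1) q c unfolding polys_over_def by auto
    ultimately obtain \<sigma> where \<sigma>: "\<sigma> \<in> A" "coeff q w * \<sigma> = ?\<pi>"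
      using cA w(2) x(2) unfolding completely_closed_on_def by blast
    have "coeff q w * (a * \<sigma>) = coeff q w * coeff r ?v" 
      unfolding ap[symmetric] \<sigma>(2)[symmetric] by (rule mult.left_commute)
    then have rv: "coeff r ?v = a * \<sigma>" using w(2) by simp
    \<comment> \<open>The lowest term of the quotient, now known to have its coefficient in
      \<open>A\<close>. Subtracting it leads to the next stage.\<close>
    let ?t = "Polynomial.monom \<sigma> ?v"
    let ?p = "p - q * ?t" let ?r = "r - Polynomial.monom (a * \<sigma>) ?v"
    have t: "?t \<in> ?B" unfolding polys_over_def using \<sigma> subring_on_0[OF A] by simp
    have "\<exists>s\<in>?B. q * s = ?p"
    proof (rule Suc.IH)
      show "?p \<in> ?B" using Suc.prems(1) q t by (intro subring_on_diff[OF B] subring_on_mult[OF B])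
      have "smult a (q * ?t) = q * Polynomial.monom (a * \<sigma>) ?v"
        by (metis mult_smult_right smult_monom)
      then show "smult a ?p = q * ?r" using Suc.prems(2) by (simp add: smult_diff_right right_diff_distrib)
      show "\<exists>e\<in>?B. q ^ j * e = c * ?p ^ j" for j
        by (rule almost_integral_diff[OF B t Suc.prems(3)])
      show "low_zero ?r (?N - k)" unfolding low_zero_def
      proof (intro allI impI)
        fix i assume "i < ?N - k"
        then have "i < ?v \<or> i = ?v" using Suc.prems(6) by linarith
        then show "coeff ?r i = 0" using Suc.prems(4) rv unfolding low_zero_def by auto
      qed
      show "coeff ?r i = 0" if "i \<ge> ?N" for i
      proof -
        have "i \<noteq> ?v" using that by linarith
        then show ?thesis using Suc.prems(5)[OF that] by simp
      qed
    qed (use Suc.prems in simp)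
    then obtain s where "s \<in> ?B" "q * s = ?p" by blast
    then have "s + ?t \<in> ?B" "q * (s + ?t) = p" using t subring_on_add[OF B] by (auto simp: distrib_left)
    then show ?case by blast
  qed
  from this[OF p0 a(2), of ?N] al show "\<exists>s\<in>?B. q * s = p0"
    by (simp add: low_zero_def coeff_eq_0)
qed

hide_const (open) Polynomial.order

section \<open>Polynomials and Laurent polynomials\<close>

abbreviation "lk \<equiv> Poly_Mapping.lookup"
abbreviation "ks \<equiv> Poly_Mapping.keys"
abbreviation "sgl \<equiv> Poly_Mapping.single"

definition coeff_hom :: "('k::comm_ring_1 \<Rightarrow> 'r::comm_ring_1) \<Rightarrow> bool" where
  "coeff_hom \<iota> \<longleftrightarrow> \<iota> 1 = 1 \<and> (\<forall>a b. \<iota> (a + b) = \<iota> a + \<iota> b \<and> \<iota> (a * b) = \<iota> a * \<iota> b)"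

text \<open>The linear extension of a map on exponents. Evaluation of polynomials, monomial
  substitution, evaluation at torus points and partial derivatives at a point are all
  instances.\<close>

definition mext :: "('k::comm_ring_1 \<Rightarrow> 'r::comm_ring_1) \<Rightarrow> ('a \<Rightarrow> 'r) \<Rightarrow> ('a \<Rightarrow>\<^sub>0 'k) \<Rightarrow> 'r" where
  "mext \<iota> \<chi> F = (\<Sum>u\<in>ks F. \<iota> (lk F u) * \<chi> u)"

lemma coeff_homD:
  assumes "coeff_hom \<iota>"
  shows coeff_hom_0: "\<iota> 0 = 0" and coeff_hom_1: "\<iota> 1 = 1" and coeff_hom_add: "\<iota> (a + b) = \<iota> a + \<iota> b"
    and coeff_hom_mult: "\<iota> (a * b) = \<iota> a * \<iota> b"
proof -
  show "\<iota> 1 = 1" "\<iota> (a * b) = \<iota> a * \<iota> b" and add: "\<And>a b. \<iota> (a + b) = \<iota> a + \<iota> b"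
    using assms unfolding coeff_hom_def by auto
  show "\<iota> 0 = 0" using add[of 0 0] by simp
qed

lemma coeff_hom_id: "coeff_hom (\<lambda>c. c)" by (simp add: coeff_hom_def)

lemma coeff_hom_single: "coeff_hom (sgl (0::'a::comm_monoid_add))"
  by (simp add: coeff_hom_def single_add mult_single)

lemma poly_mapping_sum_single: "F = (\<Sum>u\<in>ks F. sgl u (lk F u))"
  by (rule poly_mapping_eqI) (auto simp: lookup_sum lookup_single when_def in_keys_iff)

lemma mext_superset:
  "coeff_hom \<iota> \<Longrightarrow> finite A \<Longrightarrow> ks F \<subseteq> A \<Longrightarrow> mext \<iota> \<chi> F = (\<Sum>u\<in>A. \<iota> (lk F u) * \<chi> u)"
  unfolding mext_def by (intro sum.mono_neutral_left) (auto simp: in_keys_iff coeff_hom_0)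

lemma mext_add:
  assumes "coeff_hom \<iota>" shows "mext \<iota> \<chi> (F + G) = mext \<iota> \<chi> F + mext \<iota> \<chi> G"
proof -
  let ?A = "ks F \<union> ks G"
  have "ks (F + G) \<subseteq> ?A" by (rule keys_add)
  then have "mext \<iota> \<chi> (F + G) = (\<Sum>u\<in>?A. \<iota> (lk (F + G) u) * \<chi> u)"
    by (intro mext_superset assms) auto
  also have "\<dots> = mext \<iota> \<chi> F + mext \<iota> \<chi> G"
    using mext_superset[OF assms, of ?A F] mext_superset[OF assms, of ?A G]
    by (simp add: lookup_add coeff_hom_add[OF assms] distrib_right sum.distrib)
  finally show ?thesis .
qed

lemma mext_0 [simp]: "mext \<iota> \<chi> 0 = 0" by (simp add: mext_def)

lemma mext_single: "coeff_hom \<iota> \<Longrightarrow> mext \<iota> \<chi> (sgl u c) = \<iota> c * \<chi> u"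
  using mext_superset[of \<iota> "{u}" "sgl u c" \<chi>] by simp

lemma mext_sum: "coeff_hom \<iota> \<Longrightarrow> mext \<iota> \<chi> (sum f I) = (\<Sum>i\<in>I. mext \<iota> \<chi> (f i))"
  by (induction I rule: infinite_finite_induct) (auto simp: mext_add)

lemma mext_uminus: "coeff_hom \<iota> \<Longrightarrow> mext \<iota> \<chi> (- F) = - mext \<iota> \<chi> F"
  using mext_add[of \<iota> \<chi> F "- F"] by (simp add: add_eq_0_iff)

lemma mext_diff: "coeff_hom \<iota> \<Longrightarrow> mext \<iota> \<chi> (F - G) = mext \<iota> \<chi> F - mext \<iota> \<chi> G"
  using mext_add[of \<iota> \<chi> F "- G"] by (simp add: mext_uminus)

lemma times_eq_sum_single:
  "F * G = (\<Sum>u\<in>ks F. \<Sum>v\<in>ks G. sgl (u + v) (lk F u * lk G v))"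
proof -
  have "F * G = (\<Sum>u\<in>ks F. sgl u (lk F u)) * (\<Sum>v\<in>ks G. sgl v (lk G v))"
    using poly_mapping_sum_single[of F] poly_mapping_sum_single[of G] by simp
  then show ?thesis by (simp add: sum_product mult_single)
qed

text \<open>Multiplicativity is required on the supports only, because a point of a toric variety is
  multiplicative only on the semigroup.\<close>

lemma mext_mult:
  assumes \<iota>: "coeff_hom \<iota>" and \<chi>: "\<And>u v. u \<in> ks F \<Longrightarrow> v \<in> ks G \<Longrightarrow> \<chi> (u + v) = \<chi> u * \<chi> v"
  shows "mext \<iota> \<chi> (F * G) = mext \<iota> \<chi> F * mext \<iota> \<chi> G"
proof -
  have "mext \<iota> \<chi> (F * G) = (\<Sum>u\<in>ks F. \<Sum>v\<in>ks G. (\<iota> (lk F u) * \<chi> u) * (\<iota> (lk G v) * \<chi> v))"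
    unfolding times_eq_sum_single
    by (simp add: mext_sum[OF \<iota>] mext_single[OF \<iota>] coeff_hom_mult[OF \<iota>] \<chi> ac_simps)
  then show ?thesis by (simp add: mext_def sum_product)
qed

section \<open>Evaluation of polynomials in several variables\<close>

definition pmon :: "('i \<Rightarrow> 'k::comm_monoid_mult) \<Rightarrow> ('i \<Rightarrow>\<^sub>0 nat) \<Rightarrow> 'k" where
  "pmon x m = (\<Prod>i\<in>ks m. x i ^ lk m i)"

lemma pmon_superset: "finite A \<Longrightarrow> ks m \<subseteq> A \<Longrightarrow> pmon x m = (\<Prod>i\<in>A. x i ^ lk m i)"
  unfolding pmon_def by (intro prod.mono_neutral_left) (auto simp: in_keys_iff)

lemma pmon_0 [simp]: "pmon x 0 = 1" by (simp add: pmon_def)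

lemma pmon_add: "pmon x (m + m') = pmon x m * pmon x m'"
proof -
  let ?A = "ks m \<union> ks m'"
  have "ks (m + m') \<subseteq> ?A" by (rule keys_add)
  then show ?thesis
    using pmon_superset[of ?A "m + m'" x] pmon_superset[of ?A m x] pmon_superset[of ?A m' x]
    by (simp add: lookup_add power_add prod.distrib)
qed

lemma pmon_single [simp]: "pmon x (sgl i c) = x i ^ c"
  using pmon_superset[of "{i}" "sgl i c" x] by simp

lemma peval_mext: "peval F x = mext (\<lambda>c. c) (pmon x) F"
  by (simp add: peval_def mext_def pmon_def)

lemma peval_add: "peval (F + G) x = peval F x + peval G x"
  and peval_diff: "peval (F - G) x = peval F x - peval G x"
  and peval_uminus: "peval (- F) x = - peval F x"
  and peval_mult: "peval (F * G) x = peval F x * peval G x"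
  and peval_single: "peval (sgl m c) x = c * pmon x m"
  and peval_sum: "peval (sum f I) x = (\<Sum>i\<in>I. peval (f i) x)"
  and peval_0: "peval 0 x = 0"
  for x :: "'i \<Rightarrow> 'k::comm_ring_1"
  unfolding peval_mext
  by (simp_all add: mext_add mext_diff mext_uminus mext_mult mext_single mext_sum coeff_hom_id pmon_add)

lemma peval_1: "peval 1 (x :: 'i \<Rightarrow> 'k::comm_ring_1) = 1"
  using peval_single[of 0 1 x] by simp

lemma peval_power: "peval (F ^ n) (x :: 'i \<Rightarrow> 'k::comm_ring_1) = peval F x ^ n"
  by (induction n) (simp_all add: peval_1 peval_mult)

lemma polys_in_iff: "F \<in> polys_in I \<longleftrightarrow> (\<forall>m\<in>ks F. ks m \<subseteq> I)" by (simp add: polys_in_def)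

lemma polys_in_single: "ks m \<subseteq> I \<Longrightarrow> sgl m c \<in> polys_in I" by (simp add: polys_in_iff)

lemma subring_on_polys_in: "subring_on (polys_in I :: ('i, 'k::comm_ring_1) poly set)"
  unfolding subring_on_def
proof (intro conjI ballI)
  show "1 \<in> polys_in I"  by (simp add: polys_in_iff)
  fix F G :: "('i, 'k) poly" assume FG: "F \<in> polys_in I" "G \<in> polys_in I"
  have "ks (F - G) \<subseteq> ks F \<union> ks G" by (auto simp: in_keys_iff lookup_minus)
  then show "F - G \<in> polys_in I" using FG unfolding polys_in_iff by blast
  have "ks m \<subseteq> I" if m: "m \<in> ks (F * G)" for m
  proof -
    obtain u v where uv: "m = u + v" "u \<in> ks F" "v \<in> ks G" using m keys_mult[of F G] by blast
    then show ?thesis using keys_add[of u v] FG unfolding polys_in_iff by blast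
  qed
  then show "F * G \<in> polys_in I" unfolding polys_in_iff by blast
qed

lemma finite_polys_in:
  assumes "finite \<F>" shows "\<exists>n. \<F> \<subseteq> polys_in {..<n::nat}"
proof -
  let ?V = "\<Union>F\<in>\<F>. \<Union>m\<in>ks F. ks m"
  have "finite ?V" using assms by auto
  then obtain n where "\<forall>i\<in>?V. i < n" using finite_nat_set_iff_bounded by blast
  then show ?thesis unfolding polys_in_def by (intro exI[of _ n]) blast
qed

text \<open>A polynomial seen as a univariate one in variable \<open>n\<close>; its coefficients are
  again polynomials in several variables, but avoid that one. Evaluation at the variable recovers
  it, see \<open>poly_split_var\<close>.\<close>

definition split_var :: "nat \<Rightarrow> (nat, 'k::comm_ring_1) poly \<Rightarrow> (nat, 'k) poly Polynomial.poly" where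
  "split_var n = mext (\<lambda>c. [:sgl 0 c:]) (\<lambda>m. Polynomial.monom (sgl (m - sgl n (lk m n)) 1) (lk m n))"

lemma coeff_hom_split: "coeff_hom (\<lambda>c. [:sgl 0 c:] :: (nat, 'k::comm_ring_1) poly Polynomial.poly)"
  by (simp add: coeff_hom_def single_add mult_single one_pCons mult.commute)

lemma minus_single_add:
  "(u + v) - sgl n (lk (u + v) n) = (u - sgl n (lk u n)) + (v - sgl n (lk v n))"
  for u :: "nat \<Rightarrow>\<^sub>0 nat"
  by (rule poly_mapping_eqI) (auto simp: lookup_add lookup_minus lookup_single when_def)

lemma split_var_mult: "split_var n (F * G) = split_var n F * split_var n G"
  unfolding split_var_def
  by (rule mext_mult[OF coeff_hom_split]) (simp only: minus_single_add mult_monom mult_single, simp add: lookup_add)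

lemma split_var_power: "split_var n (F ^ j) = split_var n F ^ j"
proof (induction j)
  case 0 
  have "split_var n (sgl 0 1) = (1 :: (nat, 'a) poly Polynomial.poly)"
    unfolding split_var_def mext_single[OF coeff_hom_split] by (simp add: one_pCons monom_0)
  then show ?case by simp
qed (simp add: split_var_mult)

lemma single_var_power: "sgl (sgl n (Suc 0)) 1 ^ j = sgl (sgl n j) (1::'k::comm_ring_1)"
  by (induction j) (simp_all add: mult_single single_add[symmetric])

lemma poly_split_var: "poly (split_var n F) (sgl (sgl n 1) 1) = F"
proof -
  have 1: "(m - sgl n (lk m n)) + sgl n (lk m n) = m" for m :: "nat \<Rightarrow>\<^sub>0 nat"
    by (rule poly_mapping_eqI) (simp add: lookup_add lookup_minus lookup_single when_def)
  have "poly (split_var n F) (sgl (sgl n 1) 1) = (\<Sum>m\<in>ks F. sgl m (lk F m))"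
    unfolding split_var_def mext_def poly_sum
    by (simp add: poly_monom single_var_power mult_single 1)
  then show ?thesis using poly_mapping_sum_single[of F] by simp
qed

lemma split_var_polys_over:
  assumes F: "F \<in> polys_in {..<Suc n}"
  shows "split_var n F \<in> polys_over (polys_in {..<n})"
  unfolding split_var_def mext_def
proof (rule subring_on_sum[OF subring_on_polys_over[OF subring_on_polys_in]])
  fix m assume m: "m \<in> ks F"
  have "ks (m - sgl n (lk m n)) \<subseteq> {..<n}"
  proof
    fix i assume i: "i \<in> ks (m - sgl n (lk m n))"
    then have "i \<noteq> n" "i \<in> ks m" by (auto simp: in_keys_iff lookup_minus lookup_single when_def split: if_splits)
    then show "i \<in> {..<n}" using m F unfolding polys_in_iff by fastforce
  qed
  then have "sgl 0 c * sgl (m - sgl n (lk m n)) 1 \<in> polys_in {..<n}" for c :: 'a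
    by (simp add: mult_single polys_in_single)
  then show "[:sgl 0 (lk F m):] * Polynomial.monom (sgl (m - sgl n (lk m n)) 1) (lk m n) \<in> polys_over (polys_in {..<n})"
    unfolding polys_over_def using subring_on_0[OF subring_on_polys_in] by (auto simp: coeff_monom)
qed

lemma poly_polys_over:
  assumes s: "s \<in> polys_over (polys_in {..<n})"
  shows "poly s (sgl (sgl n 1) 1) \<in> polys_in {..<Suc n}"
  unfolding poly_altdef
proof (intro subring_on_sum[OF subring_on_polys_in] subring_on_mult[OF subring_on_polys_in]
    subring_on_power[OF subring_on_polys_in] polys_in_single)
  fix i 
  have "coeff s i \<in> polys_in {..<n}" using s unfolding polys_over_def by blast
  then show "coeff s i \<in> polys_in {..<Suc n}" unfolding polys_in_iff by fastforce
qed simp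

text \<open>Induction on the number of variables: \<open>split_var\<close> moves the problem to
  univariate polynomials over fewer variables, and evaluation at the variable brings the quotient
  back. At the bottom the constants form a field.\<close>

lemma completely_closed_on_polys_in:
  "completely_closed_on (polys_in {..<n::nat} :: (nat, 'k::field) poly set)"
proof (induction n)
  case 0
  have 1: "\<exists>c. F = sgl 0 c" if "F \<in> polys_in {..<0::nat}" for F :: "(nat, 'k) poly"
  proof -
    have "ks F \<subseteq> {0}" using that unfolding polys_in_iff by auto
    then have "F = sgl 0 (lk F 0)" by (intro poly_mapping_eqI) (auto simp: lookup_single when_def in_keys_iff)
    then show ?thesis by blast
  qed
  show ?case unfolding completely_closed_on_def
  proof (intro ballI impI)
    fix p q c :: "(nat, 'k) poly" assume "p \<in> polys_in {..<0}" "q \<in> polys_in {..<0}" "q \<noteq> 0"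
    then obtain a b where ab: "p = sgl 0 a" "q = sgl 0 b" "b \<noteq> 0" using 1 by (metis single_zero)
    then show "\<exists>s\<in>polys_in {..<0}. q * s = p"
      by (intro bexI[of _ "sgl 0 (a / b)"]) (auto simp: mult_single polys_in_single)
  qed
next
  case (Suc n)
  let ?A = "polys_in {..<Suc n} :: (nat, 'k) poly set" and ?x = "sgl (sgl n 1) 1 :: (nat, 'k) poly"
  have cc: "completely_closed_on (polys_over (polys_in {..<n} :: (nat, 'k) poly set))"
    by (rule completely_closed_on_polys_over[OF subring_on_polys_in Suc])
  show ?case unfolding completely_closed_on_def
  proof (intro ballI impI)
    fix p q c :: "(nat, 'k) poly" assume A: "p \<in> ?A" "q \<in> ?A" "c \<in> ?A" and nz: "q \<noteq> 0" "c \<noteq> 0"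
      and e: "\<forall>j. \<exists>e\<in>?A. q ^ j * e = c * p ^ j"
    have nz': "split_var n q \<noteq> 0" "split_var n c \<noteq> 0" using poly_split_var nz by (metis poly_0)+
    have "\<exists>e\<in>polys_over (polys_in {..<n}). split_var n q ^ j * e = split_var n c * split_var n p ^ j" for j
    proof -
      obtain e' where "e' \<in> ?A" "q ^ j * e' = c * p ^ j" using e by blast
      then show ?thesis using split_var_polys_over[of e' n]
        by (intro bexI[of _ "split_var n e'"]) (auto simp flip: split_var_mult split_var_power)
    qed
    then obtain s where s: "s \<in> polys_over (polys_in {..<n})" "split_var n q * s = split_var n p"
      using cc nz' split_var_polys_over A unfolding completely_closed_on_def by blast
    have "q * poly s ?x = p" 
      using arg_cong[OF s(2), of "\<lambda>f. poly f ?x"] by (simp only: poly_mult poly_split_var)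
    then show "\<exists>s\<in>?A. q * s = p" using poly_polys_over[OF s(1)] by blast
  qed
qed

text \<open>\<open>q ^ m\<close> is a common denominator: it clears the powers of
  \<open>p / q\<close> below the \<open>m\<close>-th, and the equation expresses each higher power
  by lower ones.\<close>

lemma integral_imp_almost_integral:
  fixes p q :: "'a::idom"
  assumes A: "subring_on A" and mem: "p \<in> A" "q \<in> A" "\<And>i. i < m \<Longrightarrow> a i \<in> A"
    and eq: "p ^ m + (\<Sum>i<m. a i * p ^ i * q ^ (m - i)) = 0"
  shows "\<exists>e\<in>A. q ^ j * e = q ^ m * p ^ j"
proof (induction j rule: less_induct)
  case (less j)
  show ?case
  proof (cases "j < m")
    case True
    then show ?thesis using mem A
      by (intro bexI[of _ "q ^ (m - j) * p ^ j"])
         (auto simp: power_add[symmetric] mult.assoc[symmetric] intro: subring_on_mult subring_on_power)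
  next
    case False
    have "\<exists>e. i < m \<longrightarrow> e \<in> A \<and> q ^ (j - (m - i)) * e = q ^ m * p ^ (j - (m - i))" for i
    proof (cases "i < m")
      case True
      then have "j - (m - i) < j" using False by linarith
      from less.IH[OF this] show ?thesis by blast
    qed simp
    then have "\<forall>i. \<exists>e. i < m \<longrightarrow> e \<in> A \<and> q ^ (j - (m - i)) * e = q ^ m * p ^ (j - (m - i))" by blast
    from choice[OF this] obtain e where e: "\<And>i. i < m \<Longrightarrow> e i \<in> A"
      "\<And>i. i < m \<Longrightarrow> q ^ (j - (m - i)) * e i = q ^ m * p ^ (j - (m - i))" by blast
    have "p ^ j = p ^ (j - m) * p ^ m" using False by (simp add: power_add[symmetric])
    also have "p ^ m = - (\<Sum>i<m. a i * p ^ i * q ^ (m - i))" using eq by (simp add: eq_neg_iff_add_eq_0)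
    finally have "q ^ m * p ^ j = - (\<Sum>i<m. q ^ m * p ^ (j - m) * (a i * p ^ i * q ^ (m - i)))"
      by (simp add: sum_distrib_left mult.assoc)
    also have "\<dots> = - (\<Sum>i<m. q ^ j * (a i * e i))"
    proof (rule arg_cong[of _ _ uminus], rule sum.cong[OF refl])
      fix i assume i: "i \<in> {..<m}"
      then have 1: "j - (m - i) = (j - m) + i" "j = (m - i) + (j - (m - i))" using False by auto
      have "q ^ m * p ^ (j - m) * (a i * p ^ i * q ^ (m - i)) =
          a i * q ^ (m - i) * (q ^ m * p ^ (j - (m - i)))"
        unfolding 1(1) power_add by (simp only: ac_simps)
      also have "\<dots> = a i * q ^ (m - i) * (q ^ (j - (m - i)) * e i)" using e(2) i by simp
      also have "\<dots> = q ^ ((m - i) + (j - (m - i))) * (a i * e i)"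
        unfolding power_add by (simp only: ac_simps)
      finally show "q ^ m * p ^ (j - m) * (a i * p ^ i * q ^ (m - i)) = q ^ j * (a i * e i)"
        using 1(2) by simp
    qed
    also have "\<dots> = q ^ j * (- (\<Sum>i<m. a i * e i))" by (simp add: sum_distrib_left)
    finally have "q ^ j * (- (\<Sum>i<m. a i * e i)) = q ^ m * p ^ j" by (rule sym)
    moreover have "- (\<Sum>i<m. a i * e i) \<in> A"
      using e(1) mem(3) by (intro subring_on_uminus[OF A] subring_on_sum[OF A] subring_on_mult[OF A]) auto
    ultimately show ?thesis by blast
  qed
qed

lemma polynomial_integral_dvd:
  fixes p q :: "(nat, 'k::field) poly"
  assumes q: "q \<noteq> 0" and eq: "p ^ m + (\<Sum>i<m. a i * p ^ i * q ^ (m - i)) = 0"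
  shows "q dvd p"
proof -
  have "finite ({p, q} \<union> a ` {..<m})" by simp
  then obtain n where n: "{p, q} \<union> a ` {..<m} \<subseteq> polys_in {..<n}" using finite_polys_in by blast
  let ?A = "polys_in {..<n} :: (nat, 'k) poly set"
  note A = subring_on_polys_in[of "{..<n}"]
  have pq: "p \<in> ?A" "q \<in> ?A" "\<And>i. i < m \<Longrightarrow> a i \<in> ?A" using n by auto
  have "q ^ m \<in> ?A" "q ^ m \<noteq> 0" using pq q subring_on_power[OF A] by auto
  moreover have "\<forall>j. \<exists>e\<in>?A. q ^ j * e = q ^ m * p ^ j"
    using integral_imp_almost_integral[OF A pq eq] by blast
  ultimately obtain s where "q * s = p"
    using completely_closed_on_polys_in[of n, where 'k='k] pq q unfolding completely_closed_on_def by blast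
  then show ?thesis by (metis dvd_triv_left)
qed

section \<open>Laurent polynomials and monomial substitution\<close>

type_synonym 'k laurent = "(nat \<Rightarrow>\<^sub>0 int) \<Rightarrow>\<^sub>0 'k"

definition wt :: "('i \<Rightarrow> (nat \<Rightarrow>\<^sub>0 int)) \<Rightarrow> ('i \<Rightarrow>\<^sub>0 nat) \<Rightarrow> (nat \<Rightarrow>\<^sub>0 int)" where
  "wt g m = (\<Sum>i\<in>ks m. frag_cmul (int (lk m i)) (g i))"

lemma wt_superset: "finite A \<Longrightarrow> ks m \<subseteq> A \<Longrightarrow> wt g m = (\<Sum>i\<in>A. frag_cmul (int (lk m i)) (g i))"
  unfolding wt_def by (intro sum.mono_neutral_left) (auto simp: in_keys_iff)

lemma wt_0 [simp]: "wt g 0 = 0" by (simp add: wt_def)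

lemma wt_add: "wt g (m + m') = wt g m + wt g m'"
proof -
  let ?A = "ks m \<union> ks m'"
  have "ks (m + m') \<subseteq> ?A" by (rule keys_add)
  then show ?thesis
    using wt_superset[of ?A "m + m'" g] wt_superset[of ?A m g] wt_superset[of ?A m' g]
    by (simp add: lookup_add frag_cmul_distrib sum.distrib)
qed

lemma wt_single: "wt g (sgl i c) = frag_cmul (int c) (g i)"
  using wt_superset[of "{i}" "sgl i c" g] by simp

text \<open>Sends variable \<open>i\<close> to the Laurent monomial of exponent \<open>g i\<close>.
  Its kernel is the toric ideal of these exponents; for \<open>g = uvec\<close> it embeds
  polynomials into Laurent polynomials.\<close>

definition psub :: "('i \<Rightarrow> (nat \<Rightarrow>\<^sub>0 int)) \<Rightarrow> ('i, 'k::comm_ring_1) poly \<Rightarrow> 'k laurent" where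
  "psub g = mext (sgl 0) (\<lambda>m. sgl (wt g m) 1)"

lemma psub_eq: "psub g F = (\<Sum>m\<in>ks F. sgl (wt g m) (lk F m))"
  by (simp add: psub_def mext_def mult_single)

lemma psub_add: "psub g (F + G) = psub g F + psub g G"
  and psub_diff: "psub g (F - G) = psub g F - psub g G"
  and psub_mult: "psub g (F * G) = psub g F * psub g G"
  and psub_single: "psub g (sgl m c) = sgl (wt g m) c"
  and psub_sum: "psub g (sum f I) = (\<Sum>i\<in>I. psub g (f i))"
  unfolding psub_def
  by (simp_all add: mext_add mext_diff mext_mult mext_single mext_sum coeff_hom_single mult_single wt_add)

lemma psub_0 [simp]: "psub g 0 = 0" by (simp add: psub_def)

lemma psub_1 [simp]: "psub g 1 = 1" using psub_single[of g 0 1] by simp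

lemma psub_power: "psub g (F ^ n) = psub g F ^ n"
  by (induction n) (simp_all add: psub_mult)

lemma keys_psub: "ks (psub g F) \<subseteq> wt g ` ks F"
proof -
  have "ks (psub g F) \<subseteq> (\<Union>m\<in>ks F. ks (sgl (wt g m) (lk F m)))" unfolding psub_eq by (rule keys_sum)
  then show ?thesis by (auto split: if_splits)
qed

definition uvec :: "nat \<Rightarrow> (nat \<Rightarrow>\<^sub>0 int)" where "uvec i = sgl i 1"

lemma lookup_wt_uvec: "lk (wt uvec m) i = int (lk m i)"
proof -
  have "lk (wt uvec m) i = (\<Sum>j\<in>ks m. int (lk m j) * (1 when j = i))"
    by (simp add: wt_def lookup_sum uvec_def lookup_single when_def eq_commute)
  also have "\<dots> = (\<Sum>j\<in>ks m. (int (lk m j) when j = i))" by (intro sum.cong) (auto simp: when_def)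
  also have "\<dots> = int (lk m i)" by (auto simp: when_def in_keys_iff)
  finally show ?thesis .
qed

lemma inj_wt_uvec: "wt uvec m = wt uvec m' \<Longrightarrow> m = m'"
  by (intro poly_mapping_eqI) (metis lookup_wt_uvec of_nat_eq_iff)

lemma psub_uvec_eq_0: "psub uvec F = 0 \<Longrightarrow> F = 0"
proof (rule poly_mapping_eqI)
  fix m assume 0: "psub uvec F = 0"
  have "lk (psub uvec F) (wt uvec m) = (\<Sum>m'\<in>ks F. lk F m' when m' = m)"
    unfolding psub_eq lookup_sum lookup_single
    by (intro sum.cong refl) (auto simp: when_def dest: inj_wt_uvec)
  also have "\<dots> = lk F m" by (auto simp: when_def in_keys_iff)
  finally show "lk F m = lk 0 m" using 0 by simp
qed

text \<open>The positive part of an exponent vector. As \<open>u\<close> is the difference of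
  \<open>npart u\<close> and \<open>npart (- u)\<close>, it turns Laurent exponents into polynomial
  ones.\<close>

definition npart :: "(nat \<Rightarrow>\<^sub>0 int) \<Rightarrow> (nat \<Rightarrow>\<^sub>0 nat)" where
  "npart u = (\<Sum>i\<in>ks u. sgl i (nat (lk u i)))"

lemma lookup_npart: "lk (npart u) i = nat (lk u i)"
  unfolding npart_def lookup_sum lookup_single by (auto simp: when_def in_keys_iff)

lemma npart_diff: "u + wt uvec (npart (- u)) = wt uvec (npart u)"
  by (rule poly_mapping_eqI) (simp add: lookup_add lookup_wt_uvec lookup_npart)

lemma clear_laurent_denominator:
  "\<exists>\<gamma> F. sgl (wt uvec \<gamma>) 1 * f = psub uvec F" for f :: "'k::comm_ring_1 laurent"
proof -
  let ?\<gamma> = "\<Sum>u\<in>ks f. npart (- u)"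
  have "\<exists>m. wt uvec ?\<gamma> + u = wt uvec m" if "u \<in> ks f" for u
  proof -
    have "?\<gamma> = npart (- u) + (\<Sum>v\<in>ks f - {u}. npart (- v))" using that by (simp add: sum.remove)
    then have "wt uvec ?\<gamma> + u = wt uvec (npart u + (\<Sum>v\<in>ks f - {u}. npart (- v)))"
      unfolding wt_add npart_diff[of u, symmetric] by (simp only: wt_add ac_simps)
    then show ?thesis by blast
  qed
  then obtain M where M: "\<And>u. u \<in> ks f \<Longrightarrow> wt uvec ?\<gamma> + u = wt uvec (M u)" by metis
  have "sgl (wt uvec ?\<gamma>) 1 * f = (\<Sum>u\<in>ks f. sgl (wt uvec ?\<gamma>) 1 * sgl u (lk f u))"
    using poly_mapping_sum_single[of f] by (simp add: sum_distrib_left[symmetric])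
  also have "\<dots> = psub uvec (\<Sum>u\<in>ks f. sgl (M u) (lk f u))"
    unfolding psub_sum psub_single mult_single by (intro sum.cong refl) (simp add: M)
  finally show ?thesis by blast
qed

lemma clear_laurent_denominators:
  fixes f :: "'a \<Rightarrow> 'k::comm_ring_1 laurent"
  assumes I: "finite I"
  shows "\<exists>\<gamma>. \<forall>i\<in>I. \<exists>F. sgl (wt uvec \<gamma>) 1 * f i = psub uvec F"
proof -
  have "\<forall>i. \<exists>\<gamma> F. sgl (wt uvec \<gamma>) 1 * f i = psub uvec F" using clear_laurent_denominator by blast
  from choice[OF this] obtain \<gamma> where \<gamma>: "\<And>i. \<exists>F. sgl (wt uvec (\<gamma> i)) 1 * f i = psub uvec F" by blast
  have "\<exists>F. sgl (wt uvec (sum \<gamma> I)) 1 * f i = psub uvec F" if i: "i \<in> I" for i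
  proof -
    obtain F where F: "sgl (wt uvec (\<gamma> i)) 1 * f i = psub uvec F" using \<gamma> by blast
    have "sum \<gamma> I = sum \<gamma> (I - {i}) + \<gamma> i" using sum.remove[OF I i, of \<gamma>] by (simp add: add.commute)
    then have "sgl (wt uvec (sum \<gamma> I)) 1 * f i =
        sgl (wt uvec (sum \<gamma> (I - {i}))) 1 * (sgl (wt uvec (\<gamma> i)) 1 * f i)"
      by (simp add: wt_add mult.assoc[symmetric] mult_single)
    also have "\<dots> = psub uvec (sgl (sum \<gamma> (I - {i})) 1 * F)"
      by (simp only: F psub_mult psub_single)
    finally show ?thesis by blast
  qed
  then show ?thesis by blast
qed

text \<open>Monomials are units, so numerator, denominator and coefficients can be made polynomial,
  where divisibility is already known.\<close>

lemma laurent_integral_dvd: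
  fixes p q :: "'k::field laurent"
  assumes q: "q \<noteq> 0" and eq: "p ^ m + (\<Sum>i<m. a i * p ^ i * q ^ (m - i)) = 0"
  shows "q dvd p"
proof -
  define f where "f i = (if i < m then a i else if i = m then p else q)" for i
  obtain \<gamma> where \<gamma>: "\<forall>i\<in>{..m + 1}. \<exists>F. sgl (wt uvec \<gamma>) 1 * f i = psub uvec F"
    using clear_laurent_denominators[of "{..m + 1}" f] by auto
  define X :: "'k laurent" where "X = sgl (wt uvec \<gamma>) 1"
  define Y :: "'k laurent" where "Y = sgl (- wt uvec \<gamma>) 1"
  have XY: "X * Y = 1" by (simp add: X_def Y_def mult_single)
  obtain P where P: "X * p = psub uvec P"
    using bspec[OF \<gamma>, of m] unfolding f_def X_def by auto
  obtain R where R: "X * q = psub uvec R"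
    using bspec[OF \<gamma>, of "m + 1"] unfolding f_def X_def by auto
  have "\<forall>i. \<exists>F. i < m \<longrightarrow> X * a i = psub uvec F"
  proof
    fix i show "\<exists>F. i < m \<longrightarrow> X * a i = psub uvec F"
      using bspec[OF \<gamma>, of i] unfolding f_def X_def by (cases "i < m") auto
  qed
  from choice[OF this] obtain A where A: "\<And>i. i < m \<Longrightarrow> X * a i = psub uvec (A i)" by blast
  define x :: "(nat, 'k) poly" where "x = sgl \<gamma> 1"
  \<comment> \<open>Over the denominator \<open>R\<close>, whose image is \<open>X * q\<close>, this
    numerator represents \<open>X\<close> times \<open>p / q\<close>. The integral equation of that
    element has coefficients \<open>X ^ (m - i) * a i\<close>; as \<open>i < m\<close>, a factor
    \<open>X\<close> is available to make \<open>a i\<close> polynomial.\<close>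
  define p' where "p' = x * P"
  define c where "c i = x ^ (m - i - 1) * A i" for i
  have X: "psub uvec x = X" by (simp add: X_def x_def psub_single)
  have pp: "psub uvec p' = X * (X * p)" by (simp only: p'_def psub_mult X P)
  have cc: "psub uvec (c i) = X ^ (m - i) * a i" if "i < m" for i
  proof -
    have "m - i = Suc (m - i - 1)" using that by simp
    then have "X ^ (m - i) = X ^ (m - i - 1) * X" by (metis power_Suc2)
    then show ?thesis unfolding c_def psub_mult psub_power X A[OF that, symmetric] by (simp only: mult.assoc)
  qed
  have tm: "psub uvec (c i * p' ^ i * R ^ (m - i)) = (X * X) ^ m * (a i * p ^ i * q ^ (m - i))"
    if "i < m" for i
  proof -
    have "m = (m - i) + i" using that by simp
    then have "(X * X) ^ m = (X * X) ^ (m - i) * (X * X) ^ i" by (metis power_add)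
    then show ?thesis unfolding psub_mult psub_power cc[OF that] pp R[symmetric]
      by (simp only: power_mult_distrib ac_simps)
  qed
  have "psub uvec (p' ^ m + (\<Sum>i<m. c i * p' ^ i * R ^ (m - i))) =
      (X * X) ^ m * p ^ m + (\<Sum>i<m. (X * X) ^ m * (a i * p ^ i * q ^ (m - i)))"
  proof -
    have "(X * (X * p)) ^ m = (X * X) ^ m * p ^ m" by (simp only: mult.assoc[symmetric] power_mult_distrib)
    moreover have "(\<Sum>i<m. psub uvec (c i * p' ^ i * R ^ (m - i))) =
        (\<Sum>i<m. (X * X) ^ m * (a i * p ^ i * q ^ (m - i)))"
      by (rule sum.cong[OF refl], rule tm) simp
    ultimately show ?thesis unfolding psub_add psub_sum psub_power pp by simp
  qed
  also have "\<dots> = (X * X) ^ m * (p ^ m + (\<Sum>i<m. a i * p ^ i * q ^ (m - i)))"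
    by (simp only: distrib_left sum_distrib_left)
  finally have eq': "p' ^ m + (\<Sum>i<m. c i * p' ^ i * R ^ (m - i)) = 0"
    using eq by (intro psub_uvec_eq_0) simp
  have "X \<noteq> 0" using XY by auto
  then have "X * q \<noteq> 0" using q by simp
  then have "R \<noteq> 0" unfolding R by auto
  from polynomial_integral_dvd[OF this eq'] obtain s where s: "p' = R * s" by (rule dvdE)
  have "X * (X * p) = X * (q * psub uvec s)"
    using arg_cong[OF s, of "psub uvec"] unfolding pp psub_mult R[symmetric] by (simp only: mult.assoc)
  then have "X * p = q * psub uvec s" using \<open>X \<noteq> 0\<close> by simp
  then have "(X * Y) * p = q * (Y * psub uvec s)" by (simp add: ac_simps)
  then have "p = q * (Y * psub uvec s)" unfolding XY by simp
  then show ?thesis by (rule dvdI)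
qed

section \<open>Valuations given by linear functionals\<close>

definition additive_on_Z :: "((nat \<Rightarrow>\<^sub>0 int) \<Rightarrow> int) \<Rightarrow> bool" where
  "additive_on_Z l \<longleftrightarrow> (\<forall>u v. l (u + v) = l u + l v)"

text \<open>\<open>f0\<close> is the initial form of \<open>f\<close> for the grading by
  \<open>l\<close>, and \<open>v\<close> is its degree.\<close>

lemma low_part_exists:
  fixes f :: "'k::field laurent" and l :: "(nat \<Rightarrow>\<^sub>0 int) \<Rightarrow> int"
  assumes "f \<noteq> 0"
  shows "\<exists>v f0. f0 \<noteq> 0 \<and> (\<forall>u\<in>ks f. v \<le> l u) \<and> (\<forall>u\<in>ks f0. l u = v \<and> u \<in> ks f) \<and> (\<forall>u\<in>ks (f - f0). v < l u)"
proof -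
  define v where "v = Min (l ` ks f)"
  have ne: "ks f \<noteq> {}" using assms by simp
  define f0 where "f0 = (\<Sum>u\<in>{u\<in>ks f. l u = v}. sgl u (lk f u))"
  have lk0: "lk f0 u = (if l u = v then lk f u else 0)" for u
    unfolding f0_def lookup_sum lookup_single by (auto simp: when_def in_keys_iff)
  have min: "v \<le> l u" if "u \<in> ks f" for u unfolding v_def using that by simp
  have "v \<in> l ` ks f" unfolding v_def using ne by (intro Min_in) auto
  then obtain u where "u \<in> ks f" "l u = v" by blast
  then have "u \<in> ks f0" by (simp add: in_keys_iff lk0)
  then have "f0 \<noteq> 0" by auto
  moreover have "\<forall>u\<in>ks f0. l u = v \<and> u \<in> ks f" by (auto simp: in_keys_iff lk0 split: if_splits)
  moreover have "v < l u" if "u \<in> ks (f - f0)" for u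
  proof -
    have "l u \<noteq> v" "u \<in> ks f" using that by (auto simp: in_keys_iff lookup_minus lk0 split: if_splits)
    then show ?thesis using min[of u] by simp
  qed
  ultimately show ?thesis using min by blast
qed

text \<open>Initial forms have a nonzero product because Laurent polynomials form a domain. Hence
  the least value of \<open>l\<close> on the support is multiplied by exactly
  \<open>n\<close>.\<close>

lemma low_part_power:
  fixes f :: "'k::field laurent"
  assumes l: "additive_on_Z l" and f: "f \<noteq> 0" "\<forall>u\<in>ks f. v \<le> l u" and u: "u \<in> ks f" "l u = v"
  shows "(\<forall>u\<in>ks (f ^ n). int n * v \<le> l u) \<and> (\<exists>u\<in>ks (f ^ n). l u = int n * v)"
proof (induction n)
  case 0
  have "l 0 = 0" using l unfolding additive_on_Z_def by (metis add.right_neutral add_cancel_right_right)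
  then show ?case by simp
next
  case (Suc n)
  have add: "l (x + y) = l x + l y" for x y using l unfolding additive_on_Z_def by blast
  have le: "\<forall>u\<in>ks (f ^ Suc n). int (Suc n) * v \<le> l u"
  proof
    fix w assume "w \<in> ks (f ^ Suc n)"
    then obtain x y where "w = x + y" "x \<in> ks f" "y \<in> ks (f ^ n)" using keys_mult[of f "f ^ n"] by auto
    then show "int (Suc n) * v \<le> l w" using f(2) Suc by (fastforce simp: add algebra_simps)
  qed
  obtain v1 f0 where f0: "f0 \<noteq> 0" "\<forall>u\<in>ks f. v1 \<le> l u" "\<forall>u\<in>ks f0. l u = v1 \<and> u \<in> ks f" "\<forall>u\<in>ks (f - f0). v1 < l u"
    using low_part_exists[OF f(1), of l] by blast
  obtain z where "z \<in> ks f0" using f0(1) by fastforce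
  then have v1: "v1 = v" using f0(2,3) u f(2) by force
  have fn: "f ^ n \<noteq> 0" using f by simp
  obtain v2 g0 where g0: "g0 \<noteq> 0" "\<forall>u\<in>ks (f ^ n). v2 \<le> l u" "\<forall>u\<in>ks g0. l u = v2 \<and> u \<in> ks (f ^ n)" "\<forall>u\<in>ks (f ^ n - g0). v2 < l u"
    using low_part_exists[OF fn, of l] by blast
  obtain z where "z \<in> ks g0" using g0(1) by fastforce
  then have v2: "v2 = int n * v" using g0(2,3) Suc by force
  have "f0 * g0 \<noteq> 0" using f0 g0 by simp
  then obtain w where w: "w \<in> ks (f0 * g0)" by fastforce
  then obtain x y where "w = x + y" "x \<in> ks f0" "y \<in> ks g0" using keys_mult[of f0 g0] by auto
  then have lw: "l w = v + int n * v" using f0 g0 v1 v2 by (simp add: add)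
  \<comment> \<open>The exponent \<open>w\<close> has the least possible value. Products involving a
    remainder \<open>f - f0\<close> or \<open>f ^ n - g0\<close> have larger values and cannot
    cancel it.\<close>
  have "w \<notin> ks ((f - f0) * f ^ n)" 
  proof
    assume "w \<in> ks ((f - f0) * f ^ n)"
    then obtain x y where "w = x + y" "x \<in> ks (f - f0)" "y \<in> ks (f ^ n)" using keys_mult[of "f - f0" "f ^ n"] by auto
    then show False using lw f0(4) g0(2) v1 v2 by (fastforce simp: add)
  qed
  moreover have "w \<notin> ks (f0 * (f ^ n - g0))" 
  proof
    assume "w \<in> ks (f0 * (f ^ n - g0))"
    then obtain x y where "w = x + y" "x \<in> ks f0" "y \<in> ks (f ^ n - g0)" using keys_mult[of f0 "f ^ n - g0"] by auto
    then show False using lw f0(3) g0(4) v1 v2 by (fastforce simp: add)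
  qed
  moreover have "f ^ Suc n = f0 * g0 + ((f - f0) * f ^ n + f0 * (f ^ n - g0))" by (simp add: algebra_simps)
  ultimately have "lk (f ^ Suc n) w = lk (f0 * g0) w" by (simp add: lookup_add in_keys_iff)
  then have "w \<in> ks (f ^ Suc n)" using w by (simp add: in_keys_iff)
  then show ?case using le lw by (auto simp: algebra_simps)
qed

text \<open>
  The minimum of a functional over the support is a valuation on Laurent polynomials, whence the
  integral quotients have support in the same half-spaces.
\<close>

lemma laurent_integral_dvd_cone:
  fixes p q :: "'k::field laurent"
  assumes \<Lambda>: "\<And>l. l \<in> \<Lambda> \<Longrightarrow> additive_on_Z l" and S: "S = {u. \<forall>l\<in>\<Lambda>. 0 \<le> l u}"
    and q: "q \<noteq> 0" and a: "\<And>i. i < m \<Longrightarrow> ks (a i) \<subseteq> S"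
    and eq: "p ^ m + (\<Sum>i<m. a i * p ^ i * q ^ (m - i)) = 0"
  shows "\<exists>r. ks r \<subseteq> S \<and> p = q * r"
proof -
  obtain r where r: "p = q * r" using laurent_integral_dvd[OF q eq] by (rule dvdE)
  have "q ^ m * (r ^ m + (\<Sum>i<m. a i * r ^ i)) = p ^ m + (\<Sum>i<m. a i * p ^ i * q ^ (m - i))"
  proof -
    have "q ^ m * (a i * r ^ i) = a i * p ^ i * q ^ (m - i)" if "i < m" for i
    proof -
      have "q ^ m = q ^ i * q ^ (m - i)" using that by (simp add: power_add[symmetric])
      then show ?thesis unfolding r by (simp only: power_mult_distrib ac_simps)
    qed
    then have "(\<Sum>i<m. q ^ m * (a i * r ^ i)) = (\<Sum>i<m. a i * p ^ i * q ^ (m - i))"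
      by (intro sum.cong) auto
    then show ?thesis unfolding distrib_left sum_distrib_left by (simp add: r power_mult_distrib)
  qed
  then have int: "r ^ m + (\<Sum>i<m. a i * r ^ i) = 0" using eq q by simp
  have "0 \<le> l u" if l: "l \<in> \<Lambda>" and u: "u \<in> ks r" for l u
  proof (rule ccontr)
    assume neg: "\<not> 0 \<le> l u"
    note ll = \<Lambda>[OF l]
    have add: "l (x + y) = l x + l y" for x y using ll unfolding additive_on_Z_def by blast
    have "r \<noteq> 0" using u by auto
    from low_part_exists[OF this, of l] obtain v and r0 :: "'k laurent" where
      r0: "r0 \<noteq> 0" "\<forall>u\<in>ks r. v \<le> l u" "\<forall>u\<in>ks r0. l u = v \<and> u \<in> ks r"
      by blast
    obtain z where "z \<in> ks r0" using r0(1) by fastforce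
    then have z: "z \<in> ks r" "l z = v" using r0(3) by auto
    have v: "v < 0" using neg bspec[OF r0(2) u] by simp
    note pw = low_part_power[OF ll \<open>r \<noteq> 0\<close> r0(2) z]
    obtain w where w: "w \<in> ks (r ^ m)" "l w = int m * v" 
      using pw[of m, THEN conjunct2] by (rule bexE)
    \<comment> \<open>No other term contributes at \<open>w\<close>: on the support of
      \<open>a i * r ^ i\<close> the value is at least \<open>i\<close> times \<open>v\<close>,
      which exceeds \<open>m\<close> times \<open>v\<close> because \<open>v\<close> is
      negative.\<close>
    have "lk (a i * r ^ i) w = 0" if i: "i < m" for i
    proof (rule ccontr)
      assume "lk (a i * r ^ i) w \<noteq> 0"
      then have "w \<in> ks (a i * r ^ i)" by (simp add: in_keys_iff)
      then obtain x y where xy: "w = x + y" "x \<in> ks (a i)" "y \<in> ks (r ^ i)" using keys_mult[of "a i" "r ^ i"] by auto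
      have "x \<in> S" using xy(2) a[OF i] by blast
      then have "0 \<le> l x" unfolding S using l by blast
      moreover have "int i * v \<le> l y" 
        by (rule bspec[OF pw[of i, THEN conjunct1] xy(3)])
      moreover have "l x + l y = int m * v" using add[of x y] xy(1) w(2) by simp
      ultimately have "int i * v \<le> int m * v" by linarith
      then show False using v i by (simp add: mult_le_cancel_right)
    qed
    then have "lk (r ^ m + (\<Sum>i<m. a i * r ^ i)) w = lk (r ^ m) w" by (simp add: lookup_add lookup_sum)
    then show False using int w by (simp add: in_keys_iff)
  qed
  then have "ks r \<subseteq> S" using S by blast
  then show ?thesis using r by blast
qed

section \<open>Torus characters\<close>

definition chi :: "(nat \<Rightarrow> 'k::field) \<Rightarrow> (nat \<Rightarrow>\<^sub>0 int) \<Rightarrow> 'k" where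
  "chi t u = (\<Prod>i\<in>ks u. t i powi lk u i)"

lemma chi_superset: "finite A \<Longrightarrow> ks u \<subseteq> A \<Longrightarrow> chi t u = (\<Prod>i\<in>A. t i powi lk u i)"
  unfolding chi_def by (intro prod.mono_neutral_left) (auto simp: in_keys_iff)

lemma chi_0 [simp]: "chi t 0 = 1" by (simp add: chi_def)

lemma chi_add:
  assumes "\<And>i. t i \<noteq> 0" shows "chi t (u + v) = chi t u * chi t v"
proof -
  let ?A = "ks u \<union> ks v"
  have "ks (u + v) \<subseteq> ?A" by (rule keys_add)
  then show ?thesis
    using chi_superset[of ?A "u + v" t] chi_superset[of ?A u t] chi_superset[of ?A v t]
    by (simp add: lookup_add power_int_add assms prod.distrib)
qed

lemma chi_uvec [simp]: "chi t (uvec i) = t i"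
  using chi_superset[of "{i}" "uvec i" t] by (simp add: uvec_def)

lemma chi_nonzero: "(\<And>i. t i \<noteq> 0) \<Longrightarrow> chi t u \<noteq> 0"
  by (simp add: chi_def power_int_eq_0_iff)

lemma chi_cmul: "(\<And>i. t i \<noteq> 0) \<Longrightarrow> chi t (frag_cmul (int n) u) = chi t u ^ n"
  by (induction n) (simp_all add: frag_cmul_distrib chi_add)

lemma chi_sum:
  assumes t: "\<And>i. t i \<noteq> 0" shows "chi t (\<Sum>i\<in>I. f i) = (\<Prod>i\<in>I. chi t (f i))"
  by (induction I rule: infinite_finite_induct) (simp_all add: chi_add[OF t])

lemma chi_wt:
  assumes t: "\<And>i. t i \<noteq> 0" shows "chi t (wt g m) = pmon (\<lambda>i. chi t (g i)) m"
  by (simp add: wt_def pmon_def chi_cmul[OF t] chi_sum[OF t])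

text \<open>In a finite field the product of all linear factors, increased by 1, would have no
  root.\<close>

lemma infinite_UNIV_alg_closed: "infinite (UNIV :: 'k::alg_closed_field set)"
proof
  assume fin: "finite (UNIV :: 'k set)"
  define p :: "'k Polynomial.poly" where "p = (\<Prod>a\<in>UNIV. [:- a, 1:]) + 1"
  have d: "degree (\<Prod>a\<in>UNIV. [:- a, 1 :: 'k:]) = card (UNIV :: 'k set)"
    by (subst degree_prod_eq_sum_degree) auto
  have c: "card (UNIV :: 'k set) > 0" using fin by (simp add: card_gt_0_iff)
  have "degree p = card (UNIV :: 'k set)" unfolding p_def using c d
    by (subst degree_add_eq_left) auto
  then have "degree p > 0" using c by simp
  then obtain x where "poly p x = 0" using alg_closed_imp_poly_has_root by blast
  moreover have "poly p x = 1" unfolding p_def using fin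
    by (simp add: poly_prod)
  ultimately show False by simp
qed

text \<open>The exponents differ by some \<open>n > 0\<close>, and all but finitely many
  \<open>s\<close> are neither zero nor an \<open>n\<close>-th root of unity.\<close>

lemma exists_powi_neq:
  assumes "a \<noteq> (b::int)"
  shows "\<exists>s::'k::alg_closed_field. s \<noteq> 0 \<and> s powi a \<noteq> s powi b"
proof -
  have main: "\<exists>s::'k. s \<noteq> 0 \<and> s powi a \<noteq> s powi b" if ab: "a < b" for a b
  proof -
    define n where "n = nat (b - a)"
    have n: "n > 0" "b = a + int n" using ab by (auto simp: n_def)
    let ?p = "Polynomial.monom 1 n - 1 :: 'k Polynomial.poly"
    have "coeff ?p n = 1" using n by simp
    then have "?p \<noteq> 0" by (metis coeff_0 zero_neq_one)
    then have "finite {s. poly ?p s = 0}" by (rule poly_roots_finite)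
    then have "finite ({0} \<union> {s. poly ?p s = 0})" by (rule finite_UnI[OF finite.insertI[OF finite.emptyI]])
    then obtain s where s: "s \<notin> {0} \<union> {s. poly ?p s = 0}"
      using infinite_UNIV_alg_closed by (metis ex_new_if_finite)
    then have "s \<noteq> 0" "s ^ n \<noteq> 1" by (auto simp: poly_monom)
    then have "s powi a \<noteq> s powi a * s ^ n" by (simp add: power_int_eq_0_iff)
    moreover have "s powi b = s powi a * s ^ n" unfolding n(2) using \<open>s \<noteq> 0\<close> by (simp add: power_int_add)
    ultimately show ?thesis using \<open>s \<noteq> 0\<close> by auto
  qed
  show ?thesis using main[of a b] main[of b a] assms by (metis linorder_less_linear)
qed

lemma exists_chi_neq:
  assumes "u \<noteq> v"
  shows "\<exists>t::nat \<Rightarrow> 'k::alg_closed_field. (\<forall>i. t i \<noteq> 0) \<and> chi t u \<noteq> chi t v"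
proof -
  obtain i where i: "lk u i \<noteq> lk v i" using assms by (metis poly_mapping_eqI)
  then obtain s :: 'k where s: "s \<noteq> 0" "s powi lk u i \<noteq> s powi lk v i" using exists_powi_neq by blast
  let ?t = "\<lambda>j. if j = i then s else 1"
  have "chi ?t w = s powi lk w i" for w
  proof -
    have "chi ?t w = (\<Prod>j\<in>insert i (ks w). ?t j powi lk w j)" by (rule chi_superset) auto
    also have "\<dots> = s powi lk w i" by (subst prod.insert_remove) (auto intro!: prod.neutral)
    finally show ?thesis .
  qed
  then show ?thesis using s by (intro exI[of _ ?t]) auto
qed

text \<open>The support is reduced by Dedekind's argument for the independence of characters.\<close>

lemma laurent_nonvanishing:
  fixes f :: "'k::alg_closed_field laurent"
  assumes "f \<noteq> 0"
  shows "\<exists>t. (\<forall>i. t i \<noteq> 0) \<and> mext (\<lambda>c. c) (chi t) f \<noteq> 0"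
  using assms
proof (induction "card (ks f)" arbitrary: f rule: less_induct)
  case (less f)
  obtain u where u: "u \<in> ks f" using less.prems by fastforce
  show ?case
  proof (cases "ks f = {u}")
    case True
    have "lk f u \<noteq> 0" using u by (simp add: in_keys_iff)
    then have "mext (\<lambda>c. c) (chi (\<lambda>_. 1)) f \<noteq> 0" using True by (simp add: mext_def chi_def)
    then show ?thesis by (intro exI[of _ "\<lambda>_. 1"]) simp
  next
    case False
    then obtain v where v: "v \<in> ks f" "v \<noteq> u" using u by blast
    obtain t0 :: "nat \<Rightarrow> 'k" where t0: "\<And>i. t0 i \<noteq> 0" "chi t0 v \<noteq> chi t0 u" using exists_chi_neq[OF v(2)] by blast
    \<comment> \<open>This is the translate of \<open>f\<close> by \<open>t0\<close> minus
      \<open>chi t0 u\<close> times \<open>f\<close>. The exponent \<open>u\<close> cancels, while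
      \<open>v\<close> survives because \<open>t0\<close> separates the two characters.\<close>
    define f' where "f' = (\<Sum>w\<in>ks f. sgl w (lk f w * (chi t0 w - chi t0 u)))"
    have lk': "lk f' w = lk f w * (chi t0 w - chi t0 u)" for w
      unfolding f'_def lookup_sum lookup_single by (auto simp: when_def in_keys_iff)
    have "ks f' \<subseteq> ks f - {u}" by (auto simp: in_keys_iff lk')
    then have "card (ks f') < card (ks f)" using u
      by (intro psubset_card_mono) auto
    moreover have "v \<in> ks f'" using v t0 by (auto simp: in_keys_iff lk')
    then have "f' \<noteq> 0" by auto
    ultimately obtain t where t: "\<And>i. t i \<noteq> 0" "mext (\<lambda>c. c) (chi t) f' \<noteq> 0" using less.hyps by blast
    have "mext (\<lambda>c. c) (chi t) f' = (\<Sum>w\<in>ks f. lk f w * (chi t0 w - chi t0 u) * chi t w)"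
      unfolding f'_def by (simp add: mext_sum mext_single coeff_hom_id)
    also have "\<dots> = (\<Sum>w\<in>ks f. lk f w * chi (\<lambda>i. t0 i * t i) w) - chi t0 u * (\<Sum>w\<in>ks f. lk f w * chi t w)"
      by (simp add: sum_subtractf[symmetric] sum_distrib_left chi_def power_int_mult_distrib prod.distrib algebra_simps)
    finally have "mext (\<lambda>c. c) (chi (\<lambda>i. t0 i * t i)) f - chi t0 u * mext (\<lambda>c. c) (chi t) f \<noteq> 0"
      using t(2) by (simp add: mext_def)
    then have "mext (\<lambda>c. c) (chi (\<lambda>i. t0 i * t i)) f \<noteq> 0 \<or> mext (\<lambda>c. c) (chi t) f \<noteq> 0" by auto
    then show ?thesis
    proof
      assume "mext (\<lambda>c. c) (chi (\<lambda>i. t0 i * t i)) f \<noteq> 0"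
      then show ?thesis using t0(1) t(1) by (intro exI[of _ "\<lambda>i. t0 i * t i"]) simp
    qed (use t(1) in blast)
  qed
qed

section \<open>Affine varieties as spaces of fractions\<close>

definition poly_fracs :: "nat \<Rightarrow> ((nat \<Rightarrow> 'k::field) \<Rightarrow> 'k) rel" where
  "poly_fracs n = {(peval F, peval G) | F G. F \<in> polys_in {..<n} \<and> G \<in> polys_in {..<n}}"

lemma poly_fracsI: "F \<in> polys_in {..<n} \<Longrightarrow> G \<in> polys_in {..<n} \<Longrightarrow> (peval F, peval G) \<in> poly_fracs n"
  unfolding poly_fracs_def by blast

lemma poly_fracsE:
  assumes "(a, b) \<in> poly_fracs n"
  obtains F G where "a = peval F" "b = peval G" "F \<in> polys_in {..<n}" "G \<in> polys_in {..<n}"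
  using assms unfolding poly_fracs_def by blast

lemma peval_const: "peval (sgl 0 c) x = c" for x :: "'i \<Rightarrow> 'k::comm_ring_1"
  by (simp add: peval_single)

lemma frac_closed_poly_fracs: "frac_closed (poly_fracs n :: ((nat \<Rightarrow> 'k::field) \<Rightarrow> 'k) rel)"
proof -
  note R = subring_on_polys_in[of "{..<n}", where 'k = 'k]
  show ?thesis unfolding frac_closed_def
  proof (intro conjI allI impI)
    fix a b a' b' :: "(nat \<Rightarrow> 'k) \<Rightarrow> 'k" assume "(a, b) \<in> poly_fracs n" "(a', b') \<in> poly_fracs n"
    then obtain F G F' G' where FG: "a = peval F" "b = peval G" "a' = peval F'" "b' = peval G'"
      "F \<in> polys_in {..<n}" "G \<in> polys_in {..<n}" "F' \<in> polys_in {..<n}" "G' \<in> polys_in {..<n}"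
      by (elim poly_fracsE)
    show "(\<lambda>z. a z * a' z, \<lambda>z. b z * b' z) \<in> poly_fracs n"
      using poly_fracsI[of "F * F'" n "G * G'"] FG subring_on_mult[OF R] by (simp add: peval_mult[abs_def])
    show "(\<lambda>z. a z * b' z + a' z * b z, \<lambda>z. b z * b' z) \<in> poly_fracs n"
      using poly_fracsI[of "F * G' + F' * G" n "G * G'"] FG subring_on_mult[OF R] subring_on_add[OF R]
      by (simp add: peval_mult[abs_def] peval_add[abs_def])
  next
    fix a b :: "(nat \<Rightarrow> 'k) \<Rightarrow> 'k" assume "(a, b) \<in> poly_fracs n"
    then show "(b, a) \<in> poly_fracs n" unfolding poly_fracs_def by blast
  next
    fix c :: 'k
    show "(\<lambda>_. c, \<lambda>_. 1) \<in> poly_fracs n"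
      using poly_fracsI[of "sgl 0 c" n "sgl 0 1"] by (simp add: peval_const[abs_def] polys_in_single del: single_one)
  qed
qed

lemma affine_space_eq: "affine_space n = frac_space (kpoints n) (poly_fracs n)"
  unfolding affine_space_def poly_fracs_def ..

lemma affine_var_eq: "X \<subseteq> kpoints n \<Longrightarrow> affine_var n X = frac_space X (poly_fracs n)"
  unfolding affine_var_def affine_space_eq by (rule subspace_on_frac_space[OF frac_closed_poly_fracs])

lemma local_frac_peval_affine:
  "F \<in> polys_in {..<n} \<Longrightarrow> local_frac P (poly_fracs n) y (peval F)"
  unfolding local_frac_def using poly_fracsI[of F n 1] subring_on_1[OF subring_on_polys_in]
  by (intro exI[of _ "peval F"] exI[of _ "peval 1"]) (auto simp: peval_1)

lemma kpoints_closed_if_polynomial: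
  assumes X: "X \<subseteq> kpoints n"
    and eqs: "\<And>y. y \<in> kpoints n \<Longrightarrow> y \<notin> X \<Longrightarrow> \<exists>F\<in>polys_in {..<n}. peval F y \<noteq> 0 \<and> (\<forall>x\<in>X. peval F x = 0)"
  shows "closed_in_affine n X"
  unfolding closed_in_affine_def closedin_def affine_space_eq topspace_frac_space[OF frac_closed_poly_fracs]
    openin_frac_space[OF frac_closed_poly_fracs]
proof (intro conjI ballI X)
  fix y assume "y \<in> kpoints n - X"
  then obtain F where "F \<in> polys_in {..<n}" "peval F y \<noteq> 0" "\<forall>x\<in>X. peval F x = 0" using eqs by blast
  then show "\<exists>a b. (a, b) \<in> poly_fracs n \<and> b y \<noteq> 0 \<and> {z \<in> kpoints n. b z \<noteq> 0} \<subseteq> kpoints n - X"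
    using poly_fracsI[of F n F] by (intro exI[of _ "peval F"]) auto
qed blast

text \<open>Only the values of the fractions on \<open>P\<close> matter. This allows a set of
  fractions to be replaced by one that satisfies \<open>frac_closed\<close>.\<close>

lemma frac_space_ext:
  assumes 1: "\<And>a b. (a, b) \<in> Q \<Longrightarrow> \<exists>a' b'. (a', b') \<in> Q' \<and> (\<forall>z\<in>P. a z = a' z \<and> b z = b' z)"
    and 2: "\<And>a b. (a, b) \<in> Q' \<Longrightarrow> \<exists>a' b'. (a', b') \<in> Q \<and> (\<forall>z\<in>P. a z = a' z \<and> b z = b' z)"
  shows "frac_space P Q = frac_space P Q'"
proof -
  let ?B = "\<lambda>Q. {{z \<in> P. b z \<noteq> 0} | a b. (a, b) \<in> Q}"
  have sub: "?B Q \<subseteq> ?B Q'" if h: "\<And>a b. (a, b) \<in> Q \<Longrightarrow> \<exists>a' b'. (a', b') \<in> Q' \<and> (\<forall>z\<in>P. a z = a' z \<and> b z = b' z)" for Q Q' :: "('a \<Rightarrow> 'b) rel"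
  proof
    fix U assume "U \<in> ?B Q"
    then obtain a b where ab: "U = {z \<in> P. b z \<noteq> 0}" "(a, b) \<in> Q" by blast
    obtain a' b' where "(a', b') \<in> Q'" "\<forall>z\<in>P. a z = a' z \<and> b z = b' z" using h[OF ab(2)] by blast
    moreover from this have "U = {z \<in> P. b' z \<noteq> 0}" using ab by auto
    ultimately show "U \<in> ?B Q'" by blast
  qed
  have B: "?B Q = ?B Q'" using sub[OF 1] sub[OF 2] by (rule subset_antisym)
  let ?T = "topology_generated_by (?B Q)"
  have VP: "V \<subseteq> P" if "openin ?T V" for V
    using openin_subset[OF that] by (auto simp: topology_generated_by_topspace)
  let ?R = "\<lambda>Q U. {f. \<forall>y\<in>U. \<exists>V a b. openin ?T V \<and> y \<in> V \<and> V \<subseteq> U \<and> (a, b) \<in> Q \<and> (\<forall>z\<in>V. b z \<noteq> 0 \<and> f z = a z / b z)}"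
  have subR: "?R Q U \<subseteq> ?R Q' U" if h: "\<And>a b. (a, b) \<in> Q \<Longrightarrow> \<exists>a' b'. (a', b') \<in> Q' \<and> (\<forall>z\<in>P. a z = a' z \<and> b z = b' z)" for Q Q' :: "('a \<Rightarrow> 'b) rel" and U
  proof (intro subsetI CollectI ballI)
    fix f y assume f: "f \<in> ?R Q U" and y: "y \<in> U"
    obtain V a b where V: "openin ?T V" "y \<in> V" "V \<subseteq> U" "(a, b) \<in> Q" "\<forall>z\<in>V. b z \<noteq> 0 \<and> f z = a z / b z"
      using f y by blast
    obtain a' b' where ab: "(a', b') \<in> Q'" "\<forall>z\<in>P. a z = a' z \<and> b z = b' z" using h[OF V(4)] by blast
    have "\<forall>z\<in>V. b' z \<noteq> 0 \<and> f z = a' z / b' z" using V(5) ab(2) VP[OF V(1)] by force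
    then show "\<exists>V a b. openin ?T V \<and> y \<in> V \<and> V \<subseteq> U \<and> (a, b) \<in> Q' \<and> (\<forall>z\<in>V. b z \<noteq> 0 \<and> f z = a z / b z)"
      using V(1-3) ab(1) by blast
  qed
  have "?R Q = ?R Q'" using subR[OF 1] subR[OF 2] by (intro ext subset_antisym)
  then show ?thesis unfolding frac_space_def Let_def B by simp
qed

section \<open>Normal affine toric varieties\<close>

text \<open>
  The points are the solutions of the binomial equations, that is, the monoid homomorphisms from
  the semigroup generated by \<open>g 0, \<dots>, g (n - 1)\<close> to \<open>k\<close>.
\<close>

definition toric_points :: "nat \<Rightarrow> (nat \<Rightarrow> (nat \<Rightarrow>\<^sub>0 int)) \<Rightarrow> (nat \<Rightarrow> 'k::field) set" where
  "toric_points n g = {x \<in> kpoints n. \<forall>m m'. ks m \<subseteq> {..<n} \<longrightarrow> ks m' \<subseteq> {..<n} \<longrightarrow>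
     wt g m = wt g m' \<longrightarrow> pmon x m = pmon x m'}"

definition torus_point :: "nat \<Rightarrow> (nat \<Rightarrow> (nat \<Rightarrow>\<^sub>0 int)) \<Rightarrow> (nat \<Rightarrow> 'k::field) \<Rightarrow> nat \<Rightarrow> 'k" where
  "torus_point n g t = (\<lambda>i. if i < n then chi t (g i) else 0)"

text \<open>The first \<open>d\<close> generators are the unit vectors, so the torus coordinates are
  among the coordinates of the variety. The assumption \<open>cone\<close> is saturation: the
  generated monoid contains every integer point of the cone cut out by \<open>\<Lambda>\<close>.
  This is the source of normality.\<close>

locale toric =
  fixes d n :: nat and g :: "nat \<Rightarrow> (nat \<Rightarrow>\<^sub>0 int)" and \<Lambda> :: "((nat \<Rightarrow>\<^sub>0 int) \<Rightarrow> int) set"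
  assumes d_le_n: "d \<le> n"
    and g_basis: "\<And>i. i < d \<Longrightarrow> g i = uvec i"
    and g_supp: "\<And>i. i < n \<Longrightarrow> ks (g i) \<subseteq> {..<d}"
    and \<Lambda>_additive: "\<And>l. l \<in> \<Lambda> \<Longrightarrow> additive_on_Z l"
    and cone: "wt g ` {m. ks m \<subseteq> {..<n}} = {u. \<forall>l\<in>\<Lambda>. 0 \<le> l u}"
begin

definition S :: "(nat \<Rightarrow>\<^sub>0 int) set" where "S = wt g ` {m. ks m \<subseteq> {..<n}}"

abbreviation X :: "(nat \<Rightarrow> 'k::field) set" where "X \<equiv> toric_points n g"

lemma X_kpoints: "X \<subseteq> kpoints n" by (auto simp: toric_points_def)

lemma S_cone: "S = {u. \<forall>l\<in>\<Lambda>. 0 \<le> l u}" unfolding S_def by (rule cone)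

lemma S_add: "u \<in> S \<Longrightarrow> v \<in> S \<Longrightarrow> u + v \<in> S"
  unfolding S_cone using \<Lambda>_additive unfolding additive_on_Z_def by fastforce

lemma S_0: "0 \<in> S" unfolding S_def by (rule image_eqI[of _ _ 0]) auto

lemma wt_S: "ks m \<subseteq> {..<n} \<Longrightarrow> wt g m \<in> S" unfolding S_def by blast

lemma g_S: "i < n \<Longrightarrow> g i \<in> S"
  using wt_S[of "sgl i 1"] by (simp add: wt_single)

text \<open>A point read as a monoid homomorphism on \<open>S\<close>. On \<open>X\<close> the
  choice of the exponent is immaterial by the binomial equations; outside \<open>S\<close> the value
  is arbitrary.\<close>

definition pt_eval :: "(nat \<Rightarrow> 'k::field) \<Rightarrow> (nat \<Rightarrow>\<^sub>0 int) \<Rightarrow> 'k" where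
  "pt_eval x u = pmon x (SOME m. ks m \<subseteq> {..<n} \<and> wt g m = u)"

lemma pt_eval_wt:
  assumes x: "x \<in> X" and m: "ks m \<subseteq> {..<n}"
  shows "pt_eval x (wt g m) = pmon x m"
proof -
  let ?P = "\<lambda>m'. ks m' \<subseteq> {..<n} \<and> wt g m' = wt g m"
  have "?P (Eps ?P)" by (rule someI[of ?P m]) (use m in simp)
  then show ?thesis using x m unfolding toric_points_def pt_eval_def by blast
qed

lemma pt_eval_g: "x \<in> X \<Longrightarrow> i < n \<Longrightarrow> pt_eval x (g i) = x i"
  using pt_eval_wt[of x "sgl i 1"] by (simp add: wt_single)

lemma pt_eval_add:
  assumes x: "x \<in> X" and uv: "u \<in> S" "v \<in> S"
  shows "pt_eval x (u + v) = pt_eval x u * pt_eval x v"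
proof -
  obtain m m' where m: "u = wt g m" "ks m \<subseteq> {..<n}" "v = wt g m'" "ks m' \<subseteq> {..<n}" using uv S_def by auto
  then have "ks (m + m') \<subseteq> {..<n}" using keys_add[of m m'] by blast
  then show ?thesis using pt_eval_wt[OF x, of "m + m'"] pt_eval_wt[OF x] m by (simp add: wt_add pmon_add)
qed

lemma pt_eval_0: "x \<in> X \<Longrightarrow> pt_eval x 0 = 1"
  using pt_eval_wt[of x 0] by simp

definition leval :: "(nat \<Rightarrow> 'k::field) \<Rightarrow> 'k laurent \<Rightarrow> 'k" where
  "leval x f = mext (\<lambda>c. c) (pt_eval x) f"

lemma leval_psub:
  assumes x: "x \<in> X" and F: "F \<in> polys_in {..<n}"
  shows "leval x (psub g F) = peval F x"
proof -
  have "leval x (psub g F) = (\<Sum>m\<in>ks F. lk F m * pt_eval x (wt g m))"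
    unfolding leval_def psub_eq by (simp add: mext_sum mext_single coeff_hom_id)
  also have "\<dots> = (\<Sum>m\<in>ks F. lk F m * pmon x m)"
    using F by (intro sum.cong refl) (simp add: pt_eval_wt[OF x] polys_in_iff)
  finally show ?thesis by (simp add: peval_mext mext_def)
qed

lemma peval_eq_0: "x \<in> X \<Longrightarrow> F \<in> polys_in {..<n} \<Longrightarrow> psub g F = 0 \<Longrightarrow> peval F x = 0"
  using leval_psub[of x F] unfolding leval_def by simp

lemma keys_psub_S: "F \<in> polys_in {..<n} \<Longrightarrow> ks (psub g F) \<subseteq> S"
  using keys_psub[of g F] wt_S unfolding polys_in_iff by fast

lemma psub_surj:
  assumes "ks f \<subseteq> S" shows "\<exists>F\<in>polys_in {..<n}. psub g F = f"
proof -
  have "\<forall>u\<in>ks f. \<exists>m. ks m \<subseteq> {..<n} \<and> wt g m = u" using assms unfolding S_def by blast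
  from bchoice[OF this] obtain M where M: "\<And>u. u \<in> ks f \<Longrightarrow> ks (M u) \<subseteq> {..<n}" "\<And>u. u \<in> ks f \<Longrightarrow> wt g (M u) = u"
    by blast
  have "psub g (\<Sum>u\<in>ks f. sgl (M u) (lk f u)) = (\<Sum>u\<in>ks f. sgl u (lk f u))"
    unfolding psub_sum psub_single by (intro sum.cong refl) (simp add: M(2))
  then have "psub g (\<Sum>u\<in>ks f. sgl (M u) (lk f u)) = f"
    unfolding poly_mapping_sum_single[of f, symmetric] .
  moreover have "(\<Sum>u\<in>ks f. sgl (M u) (lk f u)) \<in> polys_in {..<n}"
    by (intro subring_on_sum[OF subring_on_polys_in] polys_in_single M(1))
  ultimately show ?thesis by blast
qed

lemma pmon_torus_point:
  assumes t: "\<And>i. t i \<noteq> 0" and m: "ks m \<subseteq> {..<n}"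
  shows "pmon (torus_point n g t) m = chi t (wt g m)"
  unfolding chi_wt[OF t] pmon_def torus_point_def using m by (intro prod.cong) auto

lemma torus_point_in: "(\<And>i. t i \<noteq> 0) \<Longrightarrow> torus_point n g t \<in> X"
proof -
  assume t: "\<And>i. t i \<noteq> 0"
  have "torus_point n g t \<in> kpoints n" by (simp add: torus_point_def kpoints_def)
  then show ?thesis unfolding toric_points_def by (simp add: pmon_torus_point[OF t])
qed

lemma peval_torus_point:
  assumes t: "\<And>i. t i \<noteq> 0" and F: "F \<in> polys_in {..<n}"
  shows "peval F (torus_point n g t) = mext (\<lambda>c. c) (chi t) (psub g F)"
proof -
  have "mext (\<lambda>c. c) (chi t) (psub g F) = (\<Sum>m\<in>ks F. lk F m * chi t (wt g m))"
    unfolding psub_eq by (simp add: mext_sum mext_single coeff_hom_id)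
  also have "\<dots> = (\<Sum>m\<in>ks F. lk F m * pmon (torus_point n g t) m)"
    using F by (intro sum.cong refl) (simp add: pmon_torus_point[OF t] polys_in_iff)
  finally show ?thesis by (simp add: peval_mext mext_def)
qed

lemma torus_dense:
  fixes F :: "(nat, 'k::alg_closed_field) poly"
  assumes F: "F \<in> polys_in {..<n}" and nz: "psub g F \<noteq> 0"
  shows "\<exists>t. (\<forall>i. t i \<noteq> 0) \<and> peval F (torus_point n g t) \<noteq> 0"
proof -
  obtain t where t: "\<And>i. t i \<noteq> 0" "mext (\<lambda>c. c) (chi t) (psub g F) \<noteq> 0"
    using laurent_nonvanishing[OF nz] by blast
  then show ?thesis using peval_torus_point[OF t(1) F] by (intro exI[of _ t]) simp
qed

text \<open>The vanishing ideal of \<open>X\<close> is the toric ideal, because a nonzero Laurent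
  polynomial does not vanish on the whole torus.\<close>

lemma psub_eq_0_iff:
  fixes F :: "(nat, 'k::alg_closed_field) poly"
  assumes F: "F \<in> polys_in {..<n}"
  shows "psub g F = 0 \<longleftrightarrow> (\<forall>x\<in>X. peval F x = 0)"
proof
  assume 0: "\<forall>x\<in>X. peval F x = 0"
  show "psub g F = 0"
  proof (rule ccontr)
    assume "psub g F \<noteq> 0"
    from torus_dense[OF F this] obtain t where t: "\<And>i. t i \<noteq> 0" "peval F (torus_point n g t) \<noteq> 0" by blast
    then show False using bspec[OF 0 torus_point_in[OF t(1)]] by simp
  qed
qed (intro ballI peval_eq_0[OF _ F])

lemma X_closed: "closed_in_affine n (X :: (nat \<Rightarrow> 'k::field) set)"
proof (rule kpoints_closed_if_polynomial[OF X_kpoints])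
  fix y :: "nat \<Rightarrow> 'k" assume "y \<in> kpoints n" "y \<notin> X"
  then obtain m m' where m: "ks m \<subseteq> {..<n}" "ks m' \<subseteq> {..<n}" "wt g m = wt g m'" "pmon y m \<noteq> pmon y m'"
    unfolding toric_points_def by blast
  let ?F = "sgl m 1 - sgl m' 1 :: (nat, 'k) poly"
  have "?F \<in> polys_in {..<n}" using m by (intro subring_on_diff[OF subring_on_polys_in] polys_in_single)
  moreover have "peval ?F x = pmon x m - pmon x m'" for x by (simp add: peval_diff peval_single)
  moreover have "\<forall>x\<in>X. pmon x m = pmon x m'" using m(1-3) unfolding toric_points_def by blast
  ultimately show "\<exists>F\<in>polys_in {..<n}. peval F y \<noteq> 0 \<and> (\<forall>x\<in>X. peval F x = 0)"
    using m(4) by (intro bexI[of _ ?F]) simp_all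
qed

section \<open>Irreducibility and normality of toric varieties\<close>

abbreviation "Y \<equiv> frac_space X (poly_fracs n)"

lemma nonempty_open:
  assumes U: "openin (ztop Y) U" "U \<noteq> {}"
  shows "\<exists>F\<in>polys_in {..<n}. psub g F \<noteq> 0 \<and> {x \<in> X. peval F x \<noteq> 0} \<subseteq> U"
proof -
  note Q = frac_closed_poly_fracs
  obtain y where y: "y \<in> U" using U by blast
  obtain a b where ab: "(a, b) \<in> poly_fracs n" "b y \<noteq> 0" "{z \<in> X. b z \<noteq> 0} \<subseteq> U"
    using openin_frac_space_basic[OF Q U(1) y] by blast
  obtain F where F: "b = peval F" "F \<in> polys_in {..<n}" using ab(1) by (elim poly_fracsE)
  have "y \<in> X" using openin_frac_space_subset[OF Q U(1)] y by blast
  then have "psub g F \<noteq> 0" using peval_eq_0 F ab(2) by blast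
  then show ?thesis using F ab by blast
qed

lemma irreducible_Y: "irreducible_variety (Y :: (nat \<Rightarrow> 'k::alg_closed_field, 'k) fspace)"
  unfolding irreducible_variety_def topspace_frac_space[OF frac_closed_poly_fracs]
proof (intro conjI allI impI)
  show "X \<noteq> ({} :: (nat \<Rightarrow> 'k) set)" using torus_point_in[of "\<lambda>_. 1"] by auto
  fix U V :: "(nat \<Rightarrow> 'k) set" 
  assume UV: "openin (ztop Y) U \<and> openin (ztop Y) V \<and> U \<noteq> {} \<and> V \<noteq> {}"
  obtain F where F: "F \<in> polys_in {..<n}" "psub g F \<noteq> 0" "{x \<in> X. peval F x \<noteq> 0} \<subseteq> U" using nonempty_open UV by blast
  obtain G where G: "G \<in> polys_in {..<n}" "psub g G \<noteq> 0" "{x \<in> X. peval G x \<noteq> 0} \<subseteq> V" using nonempty_open UV by blast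
  have FG: "F * G \<in> polys_in {..<n}" using F G subring_on_mult[OF subring_on_polys_in] by blast
  moreover have "psub g (F * G) \<noteq> 0" using F G by (simp add: psub_mult)
  ultimately obtain x where "x \<in> X" "peval (F * G) x \<noteq> 0" using psub_eq_0_iff[OF FG] by blast
  then show "U \<inter> V \<noteq> {}" using F G by (auto simp: peval_mult)
qed

lemma local_frac_polyD:
  assumes "local_frac X (poly_fracs n) y f"
  shows "\<exists>P Q. P \<in> polys_in {..<n} \<and> Q \<in> polys_in {..<n} \<and> peval Q y \<noteq> 0 \<and>
    (\<forall>z\<in>X. peval Q z \<noteq> 0 \<longrightarrow> f z = peval P z / peval Q z)"
proof -
  obtain a b where ab: "(a, b) \<in> poly_fracs n" "b y \<noteq> 0" "\<forall>z\<in>X. b z \<noteq> 0 \<longrightarrow> f z = a z / b z"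
    using assms unfolding local_frac_def by blast
  obtain P Q where "a = peval P" "b = peval Q" "P \<in> polys_in {..<n}" "Q \<in> polys_in {..<n}"
    using ab(1) by (elim poly_fracsE)
  then show ?thesis using ab by blast
qed

text \<open>Multiplying an integral equation by \<open>(h * q) ^ m\<close> clears both the
  denominator \<open>h\<close> of its coefficients and the denominator \<open>q\<close> of its
  root.\<close>

lemma integral_equation_clear:
  fixes h q p f :: "'k::field"
  assumes i: "i < m" and p: "p = f * q"
  shows "(a * h * h ^ (m - 1 - i)) * (h * p) ^ i * q ^ (m - i) = (h * q) ^ m * (a * f ^ i)"
proof -
  have "h * h ^ (m - 1 - i) = h ^ (m - i)" using i by (metis Suc_diff_Suc diff_Suc_eq_diff_pred power_Suc)
  moreover have "(h * q) ^ m = (h * q) ^ (m - i) * (h * q) ^ i" using i by (simp add: power_add[symmetric])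
  ultimately show ?thesis unfolding p power_mult_distrib by (simp only: ac_simps)
qed

text \<open>Let \<open>H\<close> be a common denominator of the coefficients that does not vanish at
  \<open>y\<close>. Then \<open>H * f\<close> is integral over the semigroup algebra, hence belongs
  to it by the valuations in \<open>\<Lambda>\<close>, and division by \<open>H\<close> gives a
  function regular at \<open>y\<close>.\<close>

lemma local_normal_Y:
  fixes f :: "(nat \<Rightarrow> 'k::alg_closed_field) \<Rightarrow> 'k"
  assumes y: "y \<in> X" and f: "f \<in> local_int_closure Y y"
  shows "\<exists>U h. openin (ztop Y) U \<and> y \<in> U \<and> h \<in> regular Y U \<and> rat_eq Y f h"
proof -
  note Q = frac_closed_poly_fracs and R = subring_on_polys_in[of "{..<n}", where 'k = 'k]
  let ?A = "polys_in {..<n} :: (nat, 'k) poly set"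
  obtain U where U: "openin (ztop Y) U" "y \<in> U" "f \<in> int_closure Y U" using f unfolding local_int_closure_def by blast
  obtain U1 where U1: "openin (ztop Y) U1" "U1 \<noteq> {}" "f \<in> regular Y U1"
    using U(3) unfolding int_closure_def rat_funs_def by blast
  obtain m a W where a: "\<And>i. i < m \<Longrightarrow> a i \<in> regular Y U" and W: "openin (ztop Y) W" "W \<noteq> {}"
    and eq: "\<And>z. z \<in> W \<Longrightarrow> f z ^ m + (\<Sum>i<m. a i z * f z ^ i) = 0"
    using U(3) unfolding int_closure_def by blast
  have "\<forall>i. \<exists>p q. i < m \<longrightarrow> p \<in> ?A \<and> q \<in> ?A \<and> peval q y \<noteq> 0 \<and> (\<forall>z\<in>X. peval q z \<noteq> 0 \<longrightarrow> a i z = peval p z / peval q z)"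
  proof
    fix i show "\<exists>p q. i < m \<longrightarrow> p \<in> ?A \<and> q \<in> ?A \<and> peval q y \<noteq> 0 \<and> (\<forall>z\<in>X. peval q z \<noteq> 0 \<longrightarrow> a i z = peval p z / peval q z)"
    proof (cases "i < m")
      case True
      have "local_frac X (poly_fracs n) y (a i)" using regular_frac_space[OF Q, THEN iffD1, OF a[OF True]] U(2) by blast
      from local_frac_polyD[OF this] show ?thesis by blast
    qed simp
  qed
  from choice[OF this] obtain P where "\<forall>i. \<exists>q. i < m \<longrightarrow> P i \<in> ?A \<and> q \<in> ?A \<and> peval q y \<noteq> 0 \<and>
      (\<forall>z\<in>X. peval q z \<noteq> 0 \<longrightarrow> a i z = peval (P i) z / peval q z)" by blast
  from choice[OF this] obtain q where P: "\<And>i. i < m \<Longrightarrow> P i \<in> ?A" and q: "\<And>i. i < m \<Longrightarrow> q i \<in> ?A" "\<And>i. i < m \<Longrightarrow> peval (q i) y \<noteq> 0"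
    and aq: "\<And>i z. i < m \<Longrightarrow> z \<in> X \<Longrightarrow> peval (q i) z \<noteq> 0 \<Longrightarrow> a i z = peval (P i) z / peval (q i) z" by blast
  define H where "H = (\<Prod>i<m. q i)"
  define A where "A i = P i * (\<Prod>j\<in>{..<m} - {i}. q j)" for i
  have prodA: "(\<Prod>i\<in>I. q i) \<in> ?A" if "I \<subseteq> {..<m}" for I
    using that by (induction I rule: infinite_finite_induct) (auto intro!: subring_on_1[OF R] subring_on_mult[OF R] q)
  have H: "H \<in> ?A" unfolding H_def by (rule prodA) simp
  have AA: "A i \<in> ?A" if "i < m" for i unfolding A_def using P[OF that] prodA by (intro subring_on_mult[OF R]) auto
  have Hq: "peval H z = peval (q i) z * peval (\<Prod>j\<in>{..<m} - {i}. q j) z" if "i < m" for i z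
    unfolding H_def using that by (subst prod.remove[of _ i]) (auto simp: peval_mult)
  have peval_prod: "peval (\<Prod>i\<in>I. q i) z = (\<Prod>i\<in>I. peval (q i) z)" for I z
    by (induction I rule: infinite_finite_induct) (auto simp: peval_mult peval_1)
  have Hy: "peval H y \<noteq> 0" unfolding H_def peval_prod using q(2) by simp
  have aA: "peval (A i) z = a i z * peval H z" if "i < m" "z \<in> X" "peval H z \<noteq> 0" for i z
  proof -
    have "peval (q i) z \<noteq> 0" using Hq[OF that(1)] that(3) by auto
    then show ?thesis unfolding A_def peval_mult Hq[OF that(1)] aq[OF that(1,2) \<open>peval (q i) z \<noteq> 0\<close>] by simp
  qed
  have psub_nz: "psub g F \<noteq> 0" if "F \<in> ?A" "z \<in> X" "peval F z \<noteq> 0" for F z using peval_eq_0 that by blast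
  obtain z1 where z1: "z1 \<in> U1" using U1 by blast
  have z1X: "z1 \<in> X" using openin_frac_space_subset[OF Q U1(1)] z1 by blast
  have "local_frac X (poly_fracs n) z1 f" using regular_frac_space[OF Q, THEN iffD1, OF U1(3)] z1 by blast
  from local_frac_polyD[OF this] obtain p s where p: "p \<in> ?A" and s: "s \<in> ?A" "peval s z1 \<noteq> 0"
    and fps: "\<And>z. z \<in> X \<Longrightarrow> peval s z \<noteq> 0 \<Longrightarrow> f z = peval p z / peval s z" by blast
  obtain F0 where F0: "F0 \<in> ?A" "psub g F0 \<noteq> 0" "{x \<in> X. peval F0 x \<noteq> 0} \<subseteq> W" using nonempty_open[OF W] by blast
  \<comment> \<open>The monic equation of \<open>H * f\<close>, that is of \<open>H * p\<close> over
    \<open>s\<close>, with the powers of \<open>s\<close> cleared. Its coefficients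
    \<open>A i * H ^ (m - 1 - i)\<close> are polynomials.\<close>
  define E where "E = (H * p) ^ m + (\<Sum>i<m. (A i * H ^ (m - 1 - i)) * (H * p) ^ i * s ^ (m - i))"
  have E: "E \<in> ?A" unfolding E_def using AA
    by (auto intro!: subring_on_add[OF R] subring_on_power[OF R] subring_on_mult[OF R] subring_on_sum[OF R] H p s)
  have E0: "peval E x = 0" if x: "x \<in> X" "peval F0 x \<noteq> 0" "peval H x \<noteq> 0" "peval s x \<noteq> 0" for x
  proof -
    have fp: "peval p x = f x * peval s x" using fps[OF x(1,4)] x(4) by simp
    have "peval E x = (peval H x * peval p x) ^ m + (\<Sum>i<m. (peval (A i) x * peval H x ^ (m - 1 - i)) *
        (peval H x * peval p x) ^ i * peval s x ^ (m - i))"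
      unfolding E_def by (simp add: peval_add peval_sum peval_mult peval_power)
    also have "\<dots> = (peval H x * peval s x) ^ m * f x ^ m + (\<Sum>i<m. (peval H x * peval s x) ^ m * (a i x * f x ^ i))"
    proof (intro arg_cong2[of _ _ _ _ "(+)"] sum.cong refl)
      show "(peval H x * peval p x) ^ m = (peval H x * peval s x) ^ m * f x ^ m"
        unfolding fp by (simp add: power_mult_distrib)
      fix i assume "i \<in> {..<m}"
      then show "(peval (A i) x * peval H x ^ (m - 1 - i)) * (peval H x * peval p x) ^ i * peval s x ^ (m - i) =
         (peval H x * peval s x) ^ m * (a i x * f x ^ i)"
        using integral_equation_clear[OF _ fp] aA x by simp
    qed
    also have "\<dots> = (peval H x * peval s x) ^ m * (f x ^ m + (\<Sum>i<m. a i x * f x ^ i))"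
      by (simp add: distrib_left sum_distrib_left)
    also have "\<dots> = 0" using eq[of x] F0(3) x by auto
    finally show ?thesis .
  qed
  \<comment> \<open>The equation is known only where \<open>F0\<close>, \<open>H\<close> and
    \<open>s\<close> do not vanish. Multiplied by them it holds on all of \<open>X\<close>, and they
    cancel because the Laurent ring is a domain.\<close>
  have "psub g (E * (F0 * (H * s))) = 0"
    using E0 by (subst psub_eq_0_iff) (auto simp: peval_mult intro!: subring_on_mult[OF R] E F0 H s)
  then have "psub g E = 0" using F0(2) psub_nz[OF H y Hy] psub_nz[OF s(1) z1X s(2)] by (simp add: psub_mult)
  then have E': "psub g (H * p) ^ m + (\<Sum>i<m. psub g (A i * H ^ (m - 1 - i)) * psub g (H * p) ^ i * psub g s ^ (m - i)) = 0"
    unfolding E_def psub_add psub_sum by (simp only: psub_mult psub_power)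
  have "ks (psub g (A i * H ^ (m - 1 - i))) \<subseteq> S" if "i < m" for i
    using AA[OF that] H by (intro keys_psub_S subring_on_mult[OF R] subring_on_power[OF R])
  from laurent_integral_dvd_cone[OF \<Lambda>_additive S_cone psub_nz[OF s(1) z1X s(2)] this E']
  obtain r where r: "ks r \<subseteq> S" "psub g (H * p) = psub g s * r" by blast
  obtain r' where r': "r' \<in> ?A" "psub g r' = r" using psub_surj[OF r(1)] by blast
  have "psub g (H * p - s * r') = 0" using r r' by (simp add: psub_diff psub_mult)
  then have Hp: "peval H x * peval p x = peval s x * peval r' x" if "x \<in> X" for x
    using peval_eq_0[OF that, of "H * p - s * r'"] H p s r'
    by (simp add: peval_diff peval_mult subring_on_diff[OF R] subring_on_mult[OF R])
  let ?h = "\<lambda>z. peval r' z / peval H z" and ?U = "{z \<in> X. peval H z \<noteq> 0}"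
  have rH: "(peval r', peval H) \<in> poly_fracs n" "(peval (H * s), peval (H * s)) \<in> poly_fracs n"
    using r' H s by (auto intro!: poly_fracsI subring_on_mult[OF R])
  have "openin (ztop Y) ?U" by (rule openin_frac_basic[OF Q rH(1)])
  moreover have "y \<in> ?U" using y Hy by simp
  moreover have "?h \<in> regular Y ?U" unfolding regular_frac_space[OF Q] local_frac_def
    using openin_frac_basic[OF Q rH(1)] rH(1) by blast
  moreover have "rat_eq Y f ?h" unfolding rat_eq_def
  proof (intro exI[of _ "{z \<in> X. peval (H * s) z \<noteq> 0}"] conjI ballI)
    show "openin (ztop Y) {z \<in> X. peval (H * s) z \<noteq> 0}" by (rule openin_frac_basic[OF Q rH(2)])
    have "psub g (H * s) \<noteq> 0" using psub_nz[OF H y Hy] psub_nz[OF s(1) z1X s(2)] by (simp add: psub_mult)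
    then show "{z \<in> X. peval (H * s) z \<noteq> 0} \<noteq> {}"
      using psub_eq_0_iff[of "H * s"] subring_on_mult[OF R H s(1)] by blast
    fix z assume "z \<in> {z \<in> X. peval (H * s) z \<noteq> 0}"
    then have z: "z \<in> X" "peval H z \<noteq> 0" "peval s z \<noteq> 0" by (auto simp: peval_mult)
    have "peval s z * (f z * peval H z) = peval H z * peval p z" using fps[OF z(1,3)] z(3) by simp
    also have "\<dots> = peval s z * peval r' z" by (rule Hp[OF z(1)])
    finally have "f z * peval H z = peval r' z" using z(3) by simp
    then show "f z = ?h z" using z(2) by (simp add: eq_divide_eq)
  qed
  ultimately show ?thesis by blast
qed

lemma normal_X: "normal_variety (affine_var n (X :: (nat \<Rightarrow> 'k::alg_closed_field) set))"
  unfolding normal_variety_def affine_var_eq[OF X_kpoints] topspace_frac_space[OF frac_closed_poly_fracs]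
  by (intro conjI ballI irreducible_Y local_normal_Y)

end

section \<open>Points of the normalization\<close>

lemma regular_restrict:
  assumes Q: "frac_closed Q" and f: "f \<in> regular (frac_space Z Q) U"
    and V: "openin (ztop (frac_space Z Q)) V" "V \<subseteq> U"
  shows "f \<in> regular (frac_space Z Q) V"
  using regular_frac_space[OF Q, THEN iffD1, OF f] V unfolding regular_frac_space[OF Q] by blast

lemma regular_cong:
  assumes Q: "frac_closed Q" and f: "f \<in> regular (frac_space Z Q) U" and eq: "\<And>z. z \<in> U \<Longrightarrow> f z = g z"
  shows "g \<in> regular (frac_space Z Q) U"
proof -
  note R = regular_frac_space[OF Q, THEN iffD1, OF f]
  show ?thesis unfolding regular_frac_space[OF Q]
  proof (intro conjI ballI)
    fix y assume y: "y \<in> U"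
    show "local_frac Z Q y g" by (rule local_frac_cong[OF Q bspec[OF R[THEN conjunct2] y] R[THEN conjunct1] y eq])
  qed (rule R[THEN conjunct1])
qed

lemma openin_frac_open_subspace:
  assumes Q: "frac_closed Q" and U0: "openin (ztop (frac_space Z Q)) U0"
  shows "openin (ztop (frac_space U0 Q)) V \<longleftrightarrow> openin (ztop (frac_space Z Q)) V \<and> V \<subseteq> U0"
  unfolding openin_frac_subspace[OF Q openin_frac_space_subset[OF Q U0]] by (rule openin_open_subtopology[OF U0])

text \<open>A local fraction on an open subset becomes one on the whole space after multiplication
  by some \<open>e / e\<close> whose locus lies in \<open>U0\<close>.\<close>

lemma regular_frac_open_subspace:
  assumes Q: "frac_closed Q" and U0: "openin (ztop (frac_space Z Q)) U0"
  shows "f \<in> regular (frac_space U0 Q) V \<longleftrightarrow> f \<in> regular (frac_space Z Q) V \<and> V \<subseteq> U0"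
proof -
  have "local_frac U0 Q y f \<longleftrightarrow> local_frac Z Q y f" if y: "y \<in> U0" for y
  proof
    assume f: "local_frac U0 Q y f"
    obtain c e where ce: "(c, e) \<in> Q" "e y \<noteq> 0" "{z \<in> Z. e z \<noteq> 0} \<subseteq> U0"
      using openin_frac_space_basic[OF Q U0 y] by blast
    obtain a b where ab: "(a, b) \<in> Q" "b y \<noteq> 0" "\<forall>z\<in>U0. b z \<noteq> 0 \<longrightarrow> e z \<noteq> 0 \<and> f z = a z / b z"
      using local_frac_shrink[OF Q f ce(1,2)] by blast
    have "((\<lambda>z. a z * e z), (\<lambda>z. b z * e z)) \<in> Q"
      using frac_closed_mult[OF Q ab(1) frac_closed_refl[OF Q ce(1)]] .
    moreover have "b y * e y \<noteq> 0" using ab ce by simp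
    moreover have "\<forall>z\<in>Z. b z * e z \<noteq> 0 \<longrightarrow> f z = a z * e z / (b z * e z)" using ab(3) ce(3) by auto
    ultimately show "local_frac Z Q y f" unfolding local_frac_def
      by (intro exI[of _ "\<lambda>z. a z * e z"] exI[of _ "\<lambda>z. b z * e z"]) (intro conjI)
  qed (rule local_frac_mono[OF _ openin_frac_space_subset[OF Q U0]])
  then show ?thesis unfolding regular_frac_space[OF Q] openin_frac_open_subspace[OF Q U0] by blast
qed

section \<open>Normalization of an irreducible space of fractions\<close>

locale irreducible_frac_space =
  fixes Z :: "'p set" and Q :: "(('p \<Rightarrow> 'k::field) \<times> ('p \<Rightarrow> 'k)) set"
  assumes Q: "frac_closed Q" and irr: "irreducible_variety (frac_space Z Q)"
begin

abbreviation "Y \<equiv> frac_space Z Q"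

lemma meets: "openin (ztop Y) U \<Longrightarrow> openin (ztop Y) V \<Longrightarrow> U \<noteq> {} \<Longrightarrow> V \<noteq> {} \<Longrightarrow> U \<inter> V \<noteq> {}"
  using irr unfolding irreducible_variety_def by blast

lemma regular_local: "f \<in> regular Y U \<Longrightarrow> y \<in> U \<Longrightarrow> local_frac Z Q y f"
  and regular_open: "f \<in> regular Y U \<Longrightarrow> openin (ztop Y) U"
  unfolding regular_frac_space[OF Q] by blast+

lemma regularI: "openin (ztop Y) U \<Longrightarrow> (\<And>y. y \<in> U \<Longrightarrow> local_frac Z Q y f) \<Longrightarrow> f \<in> regular Y U"
  unfolding regular_frac_space[OF Q] by blast

lemma rat_eq_sym: "rat_eq Y f g \<Longrightarrow> rat_eq Y g f"
  unfolding rat_eq_def by metis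

lemma rat_eq_refl: "rat_eq Y f f"
  unfolding rat_eq_def using irr unfolding irreducible_variety_def by (metis openin_topspace)

lemma rat_eq_trans:
  assumes "rat_eq Y f g" "rat_eq Y g h" shows "rat_eq Y f h"
proof -
  obtain U where U: "openin (ztop Y) U" "U \<noteq> {}" "\<forall>z\<in>U. f z = g z" using assms(1) unfolding rat_eq_def by blast
  obtain V where V: "openin (ztop Y) V" "V \<noteq> {}" "\<forall>z\<in>V. g z = h z" using assms(2) unfolding rat_eq_def by blast
  show ?thesis unfolding rat_eq_def using meets[OF U(1) V(1) U(2) V(2)] U V
    by (intro exI[of _ "U \<inter> V"]) auto
qed

lemma rat_eq_binop:
  assumes "rat_eq Y f f'" "rat_eq Y g g'" shows "rat_eq Y (\<lambda>z. b (f z) (g z)) (\<lambda>z. b (f' z) (g' z))"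
proof -
  obtain U where U: "openin (ztop Y) U" "U \<noteq> {}" "\<forall>z\<in>U. f z = f' z" using assms(1) unfolding rat_eq_def by blast
  obtain V where V: "openin (ztop Y) V" "V \<noteq> {}" "\<forall>z\<in>V. g z = g' z" using assms(2) unfolding rat_eq_def by blast
  show ?thesis unfolding rat_eq_def using meets[OF U(1) V(1) U(2) V(2)] U V
    by (intro exI[of _ "U \<inter> V"]) auto
qed

lemma regular_imp_int_closure:
  assumes f: "rat_eq Y f g" and g: "g \<in> regular Y U" and U: "U \<noteq> {}"
  shows "f \<in> int_closure Y U"
proof -
  obtain V where V: "openin (ztop Y) V" "V \<noteq> {}" "\<forall>z\<in>V. f z = g z" using f unfolding rat_eq_def by blast
  have Uo: "openin (ztop Y) U" by (rule regular_open[OF g])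
  let ?W = "U \<inter> V"
  have W: "openin (ztop Y) ?W" "?W \<noteq> {}" using Uo V meets[OF Uo V(1) U V(2)] by auto
  have "g \<in> regular Y ?W" by (rule regular_restrict[OF Q g W(1)]) simp
  then have "f \<in> regular Y ?W" by (rule regular_cong[OF Q]) (use V in simp)
  then have "f \<in> rat_funs Y" unfolding rat_funs_def using W by blast
  moreover have "(\<lambda>z. - g z) \<in> regular Y U"
  proof (rule regularI[OF Uo])
    fix y assume "y \<in> U"
    from local_frac_mult[OF Q local_frac_const[OF Q, of Z y "-1"] regular_local[OF g this]]
    show "local_frac Z Q y (\<lambda>z. - g z)" by simp
  qed
  ultimately show ?thesis unfolding int_closure_def
    using W V(3) by (intro CollectI conjI exI[of _ 1] exI[of _ "\<lambda>_ z. - g z"] exI[of _ ?W]) auto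
qed

lemma regular_imp_local_int_closure:
  assumes f: "rat_eq Y f g" and g: "g \<in> regular Y U" and y: "y \<in> U"
  shows "f \<in> local_int_closure Y y"
  unfolding local_int_closure_def using regular_imp_int_closure[OF f g] regular_open[OF g] y by blast

definition npoints :: "('p \<times> (('p \<Rightarrow> 'k) \<Rightarrow> 'k)) set" where
  "npoints = {(y, \<phi>). y \<in> topspace (ztop Y) \<and> \<phi> \<in> alg_homs (local_int_closure Y y) (\<lambda>c z. c) \<and>
        (\<forall>f\<in>local_int_closure Y y. \<forall>g\<in>local_int_closure Y y. rat_eq Y f g \<longrightarrow> \<phi> f = \<phi> g)}"

definition nfracs where
  "nfracs = {((\<lambda>(y, \<phi>). if y \<in> U then \<phi> f else (0::'k)), (\<lambda>(y, \<phi>). if y \<in> U then \<phi> g else 0)) | U f g.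
        openin (ztop Y) U \<and> f \<in> int_closure Y U \<and> g \<in> int_closure Y U}"

lemma normalization_eq: "normalization Y = frac_space npoints nfracs"
  unfolding normalization_def npoints_def nfracs_def ..

text \<open>The set \<open>nfracs\<close> is handled through these two descriptions and not through
  \<open>frac_closed\<close>, which would require integral closures to be rings.\<close>

lemma ztop_normalization:
    "ztop (normalization Y) = topology_generated_by {{z \<in> npoints. b z \<noteq> 0} | a b. (a, b) \<in> nfracs}"
  and regular_normalization: "F \<in> regular (normalization Y) U \<longleftrightarrow>
     (\<forall>y\<in>U. \<exists>V a b. openin (ztop (normalization Y)) V \<and> y \<in> V \<and> V \<subseteq> U \<and> (a, b) \<in> nfracs \<and>
        (\<forall>z\<in>V. b z \<noteq> 0 \<and> F z = a z / b z))"
  unfolding normalization_eq by (simp_all add: frac_space_def[of npoints nfracs] Let_def)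

lemma nfracsI: "openin (ztop Y) U \<Longrightarrow> f \<in> int_closure Y U \<Longrightarrow> g \<in> int_closure Y U \<Longrightarrow>
    ((\<lambda>(y, \<phi>). if y \<in> U then \<phi> f else 0), (\<lambda>(y, \<phi>). if y \<in> U then \<phi> g else 0)) \<in> nfracs"
  unfolding nfracs_def by blast

text \<open>The function \<open>g - \<phi> g\<close> is killed by the homomorphism
  \<open>\<phi>\<close>, so it is not invertible at \<open>y\<close> and must vanish there.\<close>

lemma npoints_regular:
  assumes p: "(y, \<phi>) \<in> npoints" and g: "g \<in> regular Y U" and y: "y \<in> U"
  shows "\<phi> g = g y"
proof (rule ccontr)
  assume neq: "\<phi> g \<noteq> g y"
  define c where "c = \<phi> g - g y"
  have c: "c \<noteq> 0" using neq c_def by simp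
  let ?L = "local_int_closure Y y"
  have Uo: "openin (ztop Y) U" by (rule regular_open[OF g])
  have yZ: "y \<in> Z" using openin_frac_space_subset[OF Q Uo] y by blast
  have \<phi>: "\<And>f h. f \<in> ?L \<Longrightarrow> h \<in> ?L \<Longrightarrow> \<phi> (f + h) = \<phi> f + \<phi> h" "\<And>f h. f \<in> ?L \<Longrightarrow> h \<in> ?L \<Longrightarrow> \<phi> (f * h) = \<phi> f * \<phi> h"
    "\<And>c. \<phi> (\<lambda>z. c) = c" "\<And>f h. f \<in> ?L \<Longrightarrow> h \<in> ?L \<Longrightarrow> rat_eq Y f h \<Longrightarrow> \<phi> f = \<phi> h"
    using p unfolding npoints_def alg_homs_def by auto
  have const: "(\<lambda>_. b) \<in> regular Y U" for b by (rule regularI[OF Uo local_frac_const[OF Q]])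
  note LI = regular_imp_local_int_closure[OF rat_eq_refl]
  define k where "k = (\<lambda>z. g z + (- g y - c))"
  have k_reg: "k \<in> regular Y U" unfolding k_def
    by (rule regularI[OF Uo]) (rule local_frac_add[OF Q regular_local[OF g] local_frac_const[OF Q]])
  have "k = g + (\<lambda>_. - g y - c)" by (simp add: k_def fun_eq_iff)
  then have "\<phi> k = \<phi> g + (- g y - c)" using \<phi>(1)[OF LI[OF g y] LI[OF const y]] \<phi>(3) by simp
  then have \<phi>k: "\<phi> k = 0" by (simp add: c_def)
  have ky: "k y \<noteq> 0" using c by (simp add: k_def)
  obtain a b where ab: "(a, b) \<in> Q" "b y \<noteq> 0" "\<forall>z\<in>Z. b z \<noteq> 0 \<longrightarrow> k z \<noteq> 0 \<and> inverse (k z) = a z / b z"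
    using local_frac_inverse[OF Q regular_local[OF k_reg y] ky yZ] by blast
  let ?U = "{z \<in> Z. b z \<noteq> 0}" and ?i = "\<lambda>z. inverse (k z)"
  have Uo': "openin (ztop Y) ?U" "y \<in> ?U" using openin_frac_basic[OF Q ab(1)] yZ ab(2) by auto
  have inv: "?i \<in> regular Y ?U"
  proof (rule regularI[OF Uo'(1)])
    fix z assume "z \<in> ?U" then show "local_frac Z Q z ?i" unfolding local_frac_def using ab(1,3) by blast
  qed
  have "(k * ?i) z = 1" if "z \<in> ?U" for z
  proof -
    have "k z \<noteq> 0" using ab(3) that by blast
    then show ?thesis by (simp add: times_fun_def)
  qed
  then have "rat_eq Y (k * ?i) (\<lambda>_. 1)" unfolding rat_eq_def
    using Uo' by (intro exI[of _ ?U]) blast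
  moreover have 1: "(\<lambda>_. 1) \<in> regular Y U" by (rule const)
  moreover have "k * ?i \<in> ?L" by (rule regular_imp_local_int_closure[OF \<open>rat_eq Y (k * ?i) (\<lambda>_. 1)\<close> 1 y])
  ultimately have "\<phi> (k * ?i) = 1" using \<phi>(4)[OF _ LI[OF 1 y]] \<phi>(3) by metis
  moreover have "\<phi> (k * ?i) = \<phi> k * \<phi> ?i" by (rule \<phi>(2)[OF LI[OF k_reg y] LI[OF inv Uo'(2)]])
  ultimately show False using \<phi>k by simp
qed

text \<open>A function in the integral closure is only a representative of a rational function, and
  its own value at \<open>y\<close> means nothing. The value is taken from a representative that is
  regular there.\<close>

definition has_value :: "'p \<Rightarrow> ('p \<Rightarrow> 'k) \<Rightarrow> 'k \<Rightarrow> bool" where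
  "has_value y f c \<longleftrightarrow> (\<exists>U g. y \<in> U \<and> g \<in> regular Y U \<and> rat_eq Y f g \<and> g y = c)"

text \<open>Two regular representatives that differ at \<open>y\<close> differ on a neighbourhood,
  which by irreducibility meets the open set where they agree.\<close>

lemma has_value_unique:
  assumes "has_value y f c" "has_value y f c'" shows "c = c'"
proof (rule ccontr)
  assume neq: "c \<noteq> c'"
  obtain U g where g: "y \<in> U" "g \<in> regular Y U" "rat_eq Y f g" "g y = c" using assms(1) unfolding has_value_def by blast
  obtain U' g' where g': "y \<in> U'" "g' \<in> regular Y U'" "rat_eq Y f g'" "g' y = c'" using assms(2) unfolding has_value_def by blast
  have yZ: "y \<in> Z" using openin_frac_space_subset[OF Q regular_open[OF g(2)]] g(1) by blast
  have "local_frac Z Q y (\<lambda>z. g z + (-1) * g' z)"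
    by (rule local_frac_add[OF Q regular_local[OF g(2,1)] local_frac_mult[OF Q local_frac_const[OF Q] regular_local[OF g'(2,1)]]])
  then obtain a b where ab: "(a, b) \<in> Q" "b y \<noteq> 0" "\<forall>z\<in>Z. b z \<noteq> 0 \<longrightarrow> g z + (-1) * g' z \<noteq> 0"
    using local_frac_inverse[OF Q, of Z y "\<lambda>z. g z + (-1) * g' z"] g g' neq yZ by auto
  obtain W where W: "openin (ztop Y) W" "W \<noteq> {}" "\<forall>z\<in>W. g z = g' z"
    using rat_eq_trans[OF rat_eq_sym[OF g(3)] g'(3)] unfolding rat_eq_def by blast
  have "{z \<in> Z. b z \<noteq> 0} \<inter> W \<noteq> {}" using meets[OF openin_frac_basic[OF Q ab(1)] W(1) _ W(2)] yZ ab(2) by blast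
  then show False using ab(3) W(3) by fastforce
qed

definition value_hom :: "'p \<Rightarrow> ('p \<Rightarrow> 'k) \<Rightarrow> 'k" where
  "value_hom y f = (if f \<in> local_int_closure Y y then THE c. has_value y f c else 0)"

lemma value_homI: 
  assumes "has_value y f c" shows "value_hom y f = c"
proof -
  have "f \<in> local_int_closure Y y"
    using assms regular_imp_local_int_closure unfolding has_value_def by blast
  then show ?thesis unfolding value_hom_def using the_equality[of "has_value y f" c] assms has_value_unique by metis
qed

section \<open>Evaluation homomorphisms over the normal locus\<close>

context
  fixes U0
  assumes U0: "openin (ztop Y) U0"
    and nor: "\<And>y f. y \<in> U0 \<Longrightarrow> f \<in> local_int_closure Y y \<Longrightarrow>
          \<exists>U g. openin (ztop Y) U \<and> y \<in> U \<and> g \<in> regular Y U \<and> rat_eq Y f g"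
begin

lemma has_value_ex: "y \<in> U0 \<Longrightarrow> f \<in> local_int_closure Y y \<Longrightarrow> \<exists>c. has_value y f c"
  using nor unfolding has_value_def by blast

lemma has_value_binop:
  assumes "has_value y f a" "has_value y g b"
    and loc: "\<And>f g z. local_frac Z Q z f \<Longrightarrow> local_frac Z Q z g \<Longrightarrow> local_frac Z Q z (\<lambda>x. b' (f x) (g x))"
  shows "has_value y (\<lambda>x. b' (f x) (g x)) (b' a b)"
proof -
  obtain U f' where f': "y \<in> U" "f' \<in> regular Y U" "rat_eq Y f f'" "f' y = a" using assms(1) unfolding has_value_def by blast
  obtain V g' where g': "y \<in> V" "g' \<in> regular Y V" "rat_eq Y g g'" "g' y = b" using assms(2) unfolding has_value_def by blast
  have o: "openin (ztop Y) (U \<inter> V)" using regular_open f'(2) g'(2) by blast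
  have "(\<lambda>x. b' (f' x) (g' x)) \<in> regular Y (U \<inter> V)"
    by (rule regularI[OF o]) (use loc regular_local f'(2) g'(2) in blast)
  moreover have "rat_eq Y (\<lambda>x. b' (f x) (g x)) (\<lambda>x. b' (f' x) (g' x))" by (rule rat_eq_binop[OF f'(3) g'(3)])
  ultimately show ?thesis unfolding has_value_def using f'(1,4) g'(1,4)
    by (intro exI[of _ "U \<inter> V"] exI[of _ "\<lambda>x. b' (f' x) (g' x)"]) auto
qed

lemma value_hom_npoint:
  assumes y: "y \<in> U0" shows "(y, value_hom y) \<in> npoints"
proof -
  let ?L = "local_int_closure Y y"
  have yZ: "y \<in> Z" using openin_frac_space_subset[OF Q U0] y by blast
  have add: "value_hom y (f + g) = value_hom y f + value_hom y g" "value_hom y (f * g) = value_hom y f * value_hom y g"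
    if fg: "f \<in> ?L" "g \<in> ?L" for f g
  proof -
    obtain a b where ab: "has_value y f a" "has_value y g b" using has_value_ex[OF y] fg by blast
    have "has_value y (\<lambda>x. f x + g x) (a + b)"
      by (rule has_value_binop[where b' = "(+)", OF ab local_frac_add[OF Q]])
    moreover have "has_value y (\<lambda>x. f x * g x) (a * b)"
      by (rule has_value_binop[where b' = "(*)", OF ab local_frac_mult[OF Q]])
    ultimately show "value_hom y (f + g) = value_hom y f + value_hom y g" "value_hom y (f * g) = value_hom y f * value_hom y g"
      using value_homI[OF ab(1)] value_homI[OF ab(2)] by (simp_all add: value_homI plus_fun_def times_fun_def)
  qed
  have const: "value_hom y (\<lambda>_. c) = c" for c
  proof (rule value_homI)
    have "(\<lambda>_. c) \<in> regular Y U0" by (rule regularI[OF U0 local_frac_const[OF Q]])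
    then show "has_value y (\<lambda>_. c) c" unfolding has_value_def using y rat_eq_refl by blast
  qed
  have eq: "value_hom y f = value_hom y g" if fg: "f \<in> ?L" "g \<in> ?L" "rat_eq Y f g" for f g
  proof -
    obtain c where c: "has_value y g c" using has_value_ex[OF y fg(2)] by blast
    then have "has_value y f c" unfolding has_value_def using rat_eq_trans[OF fg(3)] by blast
    then show ?thesis using value_homI c by metis
  qed
  have zero: "value_hom y f = 0" if "f \<notin> ?L" for f using that by (simp add: value_hom_def)
  show ?thesis unfolding npoints_def alg_homs_def topspace_frac_space[OF Q]
    using yZ add const eq zero by simp
qed

text \<open>One regular representative gives the values at all points near \<open>y\<close>, so the
  evaluation of \<open>f\<close> varies regularly with the point.\<close>

lemma value_hom_local:
  assumes y: "y \<in> U0" "y \<in> U" and U: "openin (ztop Y) U" and f: "f \<in> int_closure Y U"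
  shows "\<exists>V g. openin (ztop Y) V \<and> y \<in> V \<and> g \<in> regular Y V \<and> (\<forall>z\<in>V. value_hom z f = g z)"
proof -
  have "f \<in> local_int_closure Y y" unfolding local_int_closure_def using U y f by blast
  then obtain V g where "openin (ztop Y) V" "y \<in> V" "g \<in> regular Y V" "rat_eq Y f g" using nor[OF y(1)] by blast
  moreover from this have "value_hom z f = g z" if "z \<in> V" for z
    using that by (intro value_homI) (auto simp: has_value_def)
  ultimately show ?thesis by blast
qed

end

end

section \<open>Graph subspaces and Pluecker coordinates\<close>

text \<open>\<open>J\<close> holds the dependent coordinates. For \<open>i\<close> outside
  \<open>J\<close> these vectors are the standard basis of the graph of the matrix
  \<open>c\<close>.\<close>

definition gvec :: "nat set \<Rightarrow> (nat \<Rightarrow> nat \<Rightarrow> 'k::field) \<Rightarrow> nat \<Rightarrow> nat \<Rightarrow> 'k" where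
  "gvec J c i = (\<lambda>l. if l = i then 1 else if l \<in> J then c l i else 0)"

definition gspace :: "nat \<Rightarrow> nat set \<Rightarrow> (nat \<Rightarrow> nat \<Rightarrow> 'k::field) \<Rightarrow> (nat \<Rightarrow> 'k) set" where
  "gspace n J c = {v \<in> kpoints n. \<forall>j\<in>J. v j = (\<Sum>i\<in>{..<n} - J. c j i * v i)}"

lemma fscale_apply: "fscale a v l = a * v l" by (simp add: fscale_def)

lemma sum_fun_apply: "(\<Sum>i\<in>I. f i) l = (\<Sum>i\<in>I. f i l)" for f :: "'a \<Rightarrow> 'b \<Rightarrow> 'c::comm_monoid_add"
  by (induction I rule: infinite_finite_induct) auto

lemma gspace_expand:
  assumes J: "J \<subseteq> {..<n}" and v: "v \<in> gspace n J c"
  shows "v = (\<Sum>i\<in>{..<n} - J. fscale (v i) (gvec J c i))"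
proof
  fix l
  have "(\<Sum>i\<in>{..<n} - J. fscale (v i) (gvec J c i)) l = (\<Sum>i\<in>{..<n} - J. v i * gvec J c i l)"
    by (simp add: sum_fun_apply fscale_apply)
  also have "\<dots> = v l"
  proof (cases "l \<in> J")
    case True
    then have "(\<Sum>i\<in>{..<n} - J. v i * gvec J c i l) = (\<Sum>i\<in>{..<n} - J. c l i * v i)"
      by (intro sum.cong) (auto simp: gvec_def)
    then show ?thesis using v True unfolding gspace_def by simp
  next
    case False
    then have "(\<Sum>i\<in>{..<n} - J. v i * gvec J c i l) = (\<Sum>i\<in>{..<n} - J. if i = l then v l else 0)"
      by (intro sum.cong) (auto simp: gvec_def)
    also have "\<dots> = v l" using v False unfolding gspace_def kpoints_def by auto
    finally show ?thesis .
  qed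
  finally show "v l = (\<Sum>i\<in>{..<n} - J. fscale (v i) (gvec J c i)) l" by simp
qed

lemma gvec_in_gspace:
  assumes "J \<subseteq> {..<n}" "i \<in> {..<n} - J" shows "gvec J c i \<in> gspace n J c"
proof -
  have "gvec J c i j = (\<Sum>l\<in>{..<n} - J. c j l * gvec J c i l)" if "j \<in> J" for j
  proof -
    have "(\<Sum>l\<in>{..<n} - J. c j l * gvec J c i l) = (\<Sum>l\<in>{..<n} - J. if l = i then c j i else 0)"
      by (intro sum.cong) (auto simp: gvec_def)
    also have "\<dots> = c j i" using assms by simp
    finally show ?thesis using that assms by (auto simp: gvec_def)
  qed
  moreover have "gvec J c i \<in> kpoints n" using assms by (auto simp: gvec_def kpoints_def)
  ultimately show ?thesis by (simp add: gspace_def)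
qed

lemma subspace_gspace: "fvs.subspace (gspace n J c)"
proof (rule fvs.subspaceI)
  show "0 \<in> gspace n J c" by (simp add: gspace_def kpoints_def)
  show "x + y \<in> gspace n J c" if "x \<in> gspace n J c" "y \<in> gspace n J c" for x y
    using that by (simp add: gspace_def kpoints_def distrib_left sum.distrib)
  show "fscale a x \<in> gspace n J c" if x: "x \<in> gspace n J c" for a x
  proof -
    have "a * x j = (\<Sum>i\<in>{..<n} - J. c j i * (a * x i))" if "j \<in> J" for j
    proof -
      have "a * x j = a * (\<Sum>i\<in>{..<n} - J. c j i * x i)" using x that by (simp add: gspace_def)
      then show ?thesis by (simp only: sum_distrib_left mult.left_commute)
    qed
    then show ?thesis using x by (simp add: gspace_def kpoints_def fscale_apply)
  qed
qed

lemma gspace_frame: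
  assumes J: "J \<subseteq> {..<n}"
  shows "inj_on (gvec J c) ({..<n} - J)" "fvs.independent (gvec J c ` ({..<n} - J))"
    "fvs.span (gvec J c ` ({..<n} - J)) = gspace n J c" "fvs.dim (gspace n J c) = card ({..<n} - J)"
proof -
  let ?I = "{..<n} - J" and ?b = "gvec J c"
  show inj: "inj_on ?b ?I"
  proof (rule inj_onI)
    fix i i' assume i: "i \<in> ?I" "i' \<in> ?I" "?b i = ?b i'"
    have "?b i i = ?b i' i" using i(3) by simp
    then show "i = i'" using i(1) by (auto simp: gvec_def split: if_splits)
  qed
  show ind: "fvs.independent (?b ` ?I)"
    unfolding fvs.dependent_explicit
  proof (intro notI, elim exE conjE)
    fix t u assume t: "finite t" "t \<subseteq> ?b ` ?I" "(\<Sum>v\<in>t. fscale (u v) v) = 0" "\<exists>v\<in>t. u v \<noteq> 0"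
    then obtain I' where I': "I' \<subseteq> ?I" "t = ?b ` I'" by (meson subset_imageE)
    have injI': "inj_on ?b I'" using inj I'(1) by (rule inj_on_subset)
    obtain i where i: "i \<in> I'" "u (?b i) \<noteq> 0" using t(4) I'(2) by blast
    have finI': "finite I'" using I'(1) by (rule finite_subset) simp
    have "0 = (\<Sum>v\<in>t. fscale (u v) v) i" using t(3) by simp
    also have "\<dots> = (\<Sum>l\<in>I'. u (?b l) * ?b l i)"
      unfolding I'(2) sum.reindex[OF injI'] by (simp add: sum_fun_apply fscale_apply)
    also have "\<dots> = (\<Sum>l\<in>I'. if l = i then u (?b i) else 0)"
      using i I'(1) by (intro sum.cong) (auto simp: gvec_def)
    also have "\<dots> = u (?b i)" using i finI' by simp
    finally show False using i(2) by simp
  qed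
  show sp: "fvs.span (?b ` ?I) = gspace n J c"
  proof
    show "fvs.span (?b ` ?I) \<subseteq> gspace n J c"
      using gvec_in_gspace[OF J] by (intro fvs.span_minimal subspace_gspace) auto
    show "gspace n J c \<subseteq> fvs.span (?b ` ?I)"
    proof
      fix v assume "v \<in> gspace n J c"
      have "(\<Sum>i\<in>?I. fscale (v i) (?b i)) \<in> fvs.span (?b ` ?I)"
        by (intro fvs.span_sum fvs.span_scale fvs.span_base) auto
      then show "v \<in> fvs.span (?b ` ?I)" using gspace_expand[OF J \<open>v \<in> gspace n J c\<close>] by simp
    qed
  qed
  show "fvs.dim (gspace n J c) = card ?I"
    using fvs.dim_span_eq_card_independent[OF ind] sp card_image[OF inj] by simp
qed

lemma kpoints_eq_gspace: "kpoints n = gspace n {} c"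
  by (simp add: gspace_def)

lemma dim_kpoints: "fvs.dim (kpoints n :: (nat \<Rightarrow> 'k::field) set) = n"
  unfolding kpoints_eq_gspace[of n "\<lambda>_ _. 0 :: 'k"] gspace_frame(4)[OF empty_subsetI] by simp

section \<open>Minors and change of frame\<close>

definition minor :: "nat \<Rightarrow> (nat \<Rightarrow> nat \<Rightarrow> 'k::field) \<Rightarrow> nat set \<Rightarrow> 'k" where
  "minor d w I = det (mat d d (\<lambda>(i, j). w i (sorted_list_of_set I ! j)))"

lemma span_coefficients:
  fixes w :: "nat \<Rightarrow> nat \<Rightarrow> 'k::field"
  assumes inj: "inj_on w {..<d}" and v: "v \<in> fvs.span (w ` {..<d})"
  shows "\<exists>a. v = (\<Sum>l<d. fscale (a l) (w l))"
proof -
  have "fvs.span (w ` {..<d}) = range (\<lambda>u. \<Sum>v\<in>w ` {..<d}. fscale (u v) v)" by (rule fvs.span_finite) simp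
  then obtain u where "v = (\<Sum>v\<in>w ` {..<d}. fscale (u v) v)" using v by auto
  then have "v = (\<Sum>l<d. fscale (u (w l)) (w l))" by (simp add: sum.reindex[OF inj])
  then show ?thesis by (rule exI[of _ "\<lambda>l. u (w l)"])
qed

lemma frame_coefficients_unique:
  fixes w :: "nat \<Rightarrow> nat \<Rightarrow> 'k::field"
  assumes inj: "inj_on w {..<d}" and ind: "fvs.independent (w ` {..<d})"
    and 0: "(\<Sum>l<d. fscale (a l) (w l)) = 0" and l: "l < d"
  shows "a l = 0"
proof (rule ccontr)
  assume "a l \<noteq> 0"
  let ?u = "\<lambda>v. a (the_inv_into {..<d} w v)"
  have "(\<Sum>v\<in>w ` {..<d}. fscale (?u v) v) = (\<Sum>l<d. fscale (a l) (w l))"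
    by (simp add: sum.reindex[OF inj] the_inv_into_f_f[OF inj])
  then have "(\<Sum>v\<in>w ` {..<d}. fscale (?u v) v) = 0" using 0 by simp
  moreover have "?u (w l) \<noteq> 0" using \<open>a l \<noteq> 0\<close> l by (simp add: the_inv_into_f_f[OF inj])
  ultimately have "fvs.dependent (w ` {..<d})" unfolding fvs.dependent_explicit
    using l by (intro exI[of _ "w ` {..<d}"] exI[of _ ?u]) auto
  then show False using ind by simp
qed

lemma is_frame_mem:
  assumes "is_frame d V f" "i < d" shows "f i \<in> V"
proof -
  have "f i \<in> fvs.span (f ` {..<d})" using assms(2) by (intro fvs.span_base imageI) simp
  then show ?thesis using assms(1) by (simp add: is_frame_def)
qed

text \<open>The transition matrices compose to the identity by uniqueness of coefficients, so all
  maximal minors change by the same nonzero determinant.\<close>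

lemma frame_change:
  fixes w B :: "nat \<Rightarrow> nat \<Rightarrow> 'k::field"
  assumes B: "is_frame d V B" and w: "is_frame d V w"
  shows "\<exists>u. u \<noteq> 0 \<and> (\<forall>I. minor d B I = u * minor d w I)"
proof -

  have ex: "\<exists>P. \<forall>i<d. g i = (\<Sum>l<d. fscale (P i l) (f l))" if f: "is_frame d V f" and g: "is_frame d V g" for f g
  proof -
    have "\<forall>i. \<exists>a. i < d \<longrightarrow> g i = (\<Sum>l<d. fscale (a l) (f l))"
    proof
      fix i
      show "\<exists>a. i < d \<longrightarrow> g i = (\<Sum>l<d. fscale (a l) (f l))"
      proof (cases "i < d")
        case True
        have "inj_on f {..<d}" "g i \<in> fvs.span (f ` {..<d})"
          using f is_frame_mem[OF g True] unfolding is_frame_def by auto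
        from span_coefficients[OF this] show ?thesis by blast
      qed simp
    qed
    from choice[OF this] show ?thesis by blast
  qed
  obtain P where P: "\<And>i. i < d \<Longrightarrow> B i = (\<Sum>l<d. fscale (P i l) (w l))" using ex[OF w B] by blast
  obtain R where R: "\<And>i. i < d \<Longrightarrow> w i = (\<Sum>l<d. fscale (R i l) (B l))" using ex[OF B w] by blast
  let ?P = "mat d d (\<lambda>(i, l). P i l)" and ?R = "mat d d (\<lambda>(i, l). R i l)"
  have "(\<Sum>m<d. R i m * P m l) = (if i = l then 1 else 0)" if i: "i < d" and l: "l < d" for i l
  proof -
    have "(\<Sum>l<d. fscale ((\<Sum>m<d. R i m * P m l) - (if i = l then 1 else 0)) (w l)) = 0"
    proof
      fix z
      have "w i z = (\<Sum>m<d. R i m * (\<Sum>l<d. P m l * w l z))"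
        using R[OF i] P by (simp add: sum_fun_apply fscale_apply)
      also have "\<dots> = (\<Sum>l<d. (\<Sum>m<d. R i m * P m l) * w l z)"
        by (simp add: sum_distrib_left sum_distrib_right mult.assoc) (rule sum.swap)
      finally have "w i z = (\<Sum>l<d. (\<Sum>m<d. R i m * P m l) * w l z)" .
      moreover have "(\<Sum>l<d. (if i = l then 1 else 0) * w l z) = w i z"
      proof -
        have "(\<Sum>l<d. (if i = l then 1 else 0) * w l z) = (\<Sum>l<d. if l = i then w i z else 0)"
          by (intro sum.cong) auto
        then show ?thesis using i by simp
      qed
      ultimately show "(\<Sum>l<d. fscale ((\<Sum>m<d. R i m * P m l) - (if i = l then 1 else 0)) (w l)) z = 0 z"
        by (simp add: sum_fun_apply fscale_apply left_diff_distrib sum_subtractf)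
    qed
    from frame_coefficients_unique[OF _ _ this l] w show ?thesis unfolding is_frame_def by simp
  qed
  then have "?R * ?P = 1\<^sub>m d"
    by (intro eq_matI) (auto simp: scalar_prod_def row_def col_def atLeast0LessThan)
  then have "det ?R * det ?P = 1" using det_mult[of ?R d ?P] by simp
  then have nz: "det ?P \<noteq> 0" by auto
  have "minor d B I = det ?P * minor d w I" for I
  proof -
    have "mat d d (\<lambda>(i, j). B i (sorted_list_of_set I ! j)) = ?P * mat d d (\<lambda>(i, j). w i (sorted_list_of_set I ! j))"
      by (intro eq_matI) (auto simp: scalar_prod_def row_def col_def atLeast0LessThan P sum_fun_apply fscale_apply)
    then show ?thesis unfolding minor_def by (simp add: det_mult[of _ d])
  qed
  then show ?thesis using nz by blast
qed

lemma pluecker_frame: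
  assumes w: "is_frame d V w"
  shows "\<exists>u. u \<noteq> 0 \<and> (\<forall>I. pluecker d V I = u * minor d w I)"
proof -
  have "is_frame d V (SOME B. is_frame d V B)" by (rule someI[of "is_frame d V", OF w])
  from frame_change[OF this w] show ?thesis unfolding pluecker_def minor_def Let_def .
qed

lemma Grass_frame:
  assumes V: "V \<in> Grass d n" and d: "d > 0"
  shows "\<exists>B. is_frame d V B"
proof -
  obtain b where b: "b \<subseteq> V" "fvs.independent b" "V \<subseteq> fvs.span b" "card b = fvs.dim V" by (rule fvs.basis_exists)
  have c: "card b = d" using b V unfolding Grass_def by simp
  \<comment> \<open>Positivity of \<open>d\<close> gives finiteness, because an infinite set has
    cardinality 0.\<close>
  then have "finite b" using d by (metis card.infinite less_numeral_extra(3))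
  then obtain B where B: "bij_betw B {..<d} b" using c by (metis ex_bij_betw_nat_finite atLeast0LessThan)
  have "fvs.span b = V" using b V fvs.span_minimal[of b V] unfolding Grass_def by blast
  then show ?thesis using B b unfolding is_frame_def bij_betw_def by (intro exI[of _ B]) auto
qed

abbreviation base_vec :: "nat \<Rightarrow> nat \<Rightarrow> (nat \<Rightarrow> nat \<Rightarrow> 'k::field) \<Rightarrow> nat \<Rightarrow> nat \<Rightarrow> 'k" where
  "base_vec d n c \<equiv> gvec {d..<n} c"

lemma graph_frame:
  assumes "d \<le> n" shows "is_frame d (gspace n {d..<n} c) (base_vec d n c)"
proof -
  have I: "{..<n} - {d..<n} = {..<d}" and J: "{d..<n} \<subseteq> {..<n}" using assms by auto
  show ?thesis unfolding is_frame_def using gspace_frame(1-3)[OF J, of c, unfolded I] by (intro conjI)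
qed

lemma graph_in_Grass: "d \<le> n \<Longrightarrow> gspace n {d..<n} c \<in> Grass d n"
proof -
  assume dn: "d \<le> n"
  then have I: "{..<n} - {d..<n} = {..<d}" and J: "{d..<n} \<subseteq> {..<n}" by auto
  have "fvs.dim (gspace n {d..<n} c) = d" using gspace_frame(4)[OF J, of c, unfolded I] by simp
  moreover have "gspace n {d..<n} c \<subseteq> kpoints n" unfolding gspace_def by (rule Collect_restrict)
  ultimately show ?thesis unfolding Grass_def by (simp add: subspace_gspace)
qed

lemma sorted_list_lessThan: "sorted_list_of_set {..<d::nat} = [0..<d]"
  using sorted_list_of_set_range[of 0 d] by (simp add: lessThan_atLeast0)

lemma minor_base: "d \<le> n \<Longrightarrow> minor d (base_vec d n c) {..<d} = 1"
proof -
  assume dn: "d \<le> n"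
  have "sorted_list_of_set {..<d} ! j = j" if "j < d" for j
    using that by (simp add: sorted_list_lessThan)
  then have "mat d d (\<lambda>(i, j). base_vec d n c i (sorted_list_of_set {..<d} ! j)) = 1\<^sub>m d"
    by (intro eq_matI) (auto simp: gvec_def)
  then show ?thesis by (simp add: minor_def)
qed

lemma sorted_list_swap:
  assumes i: "i < d" and l: "d \<le> l"
  shows "sorted_list_of_set (insert l ({..<d} - {i})) = [0..<i] @ [Suc i..<d] @ [l]"
proof -
  have "set ([0..<i] @ [Suc i..<d] @ [l]) = insert l ({..<d} - {i})" using i by auto
  moreover have "sorted ([0..<i] @ [Suc i..<d] @ [l])" "distinct ([0..<i] @ [Suc i..<d] @ [l])"
    using i l by (auto simp: sorted_append)
  ultimately show ?thesis by (metis sorted_list_of_set.idem_if_sorted_distinct)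
qed

text \<open>Column \<open>l\<close> comes last because \<open>d \<le> l\<close>. Row
  \<open>i\<close> is zero except there, since column \<open>i\<close> has been removed, and
  deleting that row and the last column leaves the identity. The sign is that of the cofactor at
  position \<open>(i, d - 1)\<close>.\<close>

lemma minor_swap:
  assumes i: "i < d" and l: "d \<le> l" "l < n"
  shows "minor d (base_vec d n c) (insert l ({..<d} - {i})) = (-1) ^ (i + (d - 1)) * c l i"
proof -
  let ?L = "[0..<i] @ [Suc i..<d] @ [l]"
  let ?A = "mat d d (\<lambda>(r, j). base_vec d n c r (?L ! j))"
  have L1: "?L ! j = (if j < i then j else Suc j)" if "j < d - 1" for j
    using that i by (auto simp: nth_append)
  have L2: "?L ! (d - 1) = l" using i by (auto simp: nth_append)
  have A: "?A \<in> carrier_mat d d" by simp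
  have row: "?A $$ (i, j) = (if j = d - 1 then c l i else 0)" if "j < d" for j
  proof (cases "j = d - 1")
    case True
    then show ?thesis using i l L2 by (simp add: gvec_def)
  next
    case False
    then have "j < d - 1" using that by simp
    then show ?thesis using i L1[of j] that False by (auto simp: gvec_def)
  qed
  have del: "mat_delete ?A i (d - 1) = 1\<^sub>m (d - 1)"
  proof (intro eq_matI)
    fix r j assume rj: "r < dim_row (1\<^sub>m (d - 1))" "j < dim_col (1\<^sub>m (d - 1))"
    then have "mat_delete ?A i (d - 1) $$ (r, j) = base_vec d n c (if r < i then r else Suc r) (?L ! j)"
      using i unfolding mat_delete_def by auto
    also have "\<dots> = 1\<^sub>m (d - 1) $$ (r, j)"
      using rj i L1[of j] by (auto simp: gvec_def)
    finally show "mat_delete ?A i (d - 1) $$ (r, j) = 1\<^sub>m (d - 1) $$ (r, j)" .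
  qed (use i in auto)
  have "det ?A = (\<Sum>j<d. ?A $$ (i, j) * cofactor ?A i j)"
    by (rule laplace_expansion_row[OF A i])
  also have "\<dots> = (\<Sum>j<d. if j = d - 1 then c l i * cofactor ?A i (d - 1) else 0)"
    by (intro sum.cong) (auto simp: row)
  also have "\<dots> = c l i * cofactor ?A i (d - 1)" using i by simp
  also have "cofactor ?A i (d - 1) = (-1) ^ (i + (d - 1))" unfolding cofactor_def del by simp
  finally show ?thesis unfolding minor_def sorted_list_swap[OF i l(1)] by (simp add: mult.commute)
qed

text \<open>The inverse of the leading square block, taken from the adjugate matrix, turns a frame
  into one whose first \<open>d\<close> coordinates form the identity. Such a frame spans a
  graph.\<close>

lemma chart_is_graph:
  assumes V: "V \<in> Grass d n" and d: "0 < d" "d \<le> n" and nz: "pluecker d V {..<d} \<noteq> (0::'k::field)"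
  shows "\<exists>c. V = gspace n {d..<n} c"
proof -
  obtain B where B: "is_frame d V B" using Grass_frame[OF V d(1)] by blast
  let ?B = "mat d d (\<lambda>(i, j). B i j)"
  have Bc: "?B \<in> carrier_mat d d" by simp
  have sl: "sorted_list_of_set {..<d} ! j = j" if "j < d" for j
    using that by (simp add: sorted_list_lessThan)
  have "minor d B {..<d} = det ?B" unfolding minor_def by (rule arg_cong[of _ _ det]) (auto intro!: eq_matI simp: sl)
  then have dB: "det ?B \<noteq> 0" using pluecker_frame[OF B] nz by auto
  define C where "C = adj_mat ?B"
  have C: "C \<in> carrier_mat d d" "?B * C = det ?B \<cdot>\<^sub>m 1\<^sub>m d" "C * ?B = det ?B \<cdot>\<^sub>m 1\<^sub>m d"
    unfolding C_def using adj_mat[OF Bc] by auto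
  have CB: "(\<Sum>m<d. C $$ (i, m) * B m j) = (if i = j then det ?B else 0)" if "i < d" "j < d" for i j
    using arg_cong[OF C(3), of "\<lambda>A. A $$ (i, j)"] C(1) that
    by (auto simp: scalar_prod_def row_def col_def atLeast0LessThan)
  have BC: "(\<Sum>m<d. B i m * C $$ (m, j)) = (if i = j then det ?B else 0)" if "i < d" "j < d" for i j
    using arg_cong[OF C(2), of "\<lambda>A. A $$ (i, j)"] C(1) that
    by (auto simp: scalar_prod_def row_def col_def atLeast0LessThan)
  define w where "w i = (\<Sum>m<d. fscale (C $$ (i, m) / det ?B) (B m))" for i
  have subV: "fvs.subspace V" "V \<subseteq> kpoints n" using V unfolding Grass_def by auto
  have BV: "B m \<in> V" if "m < d" for m by (rule is_frame_mem[OF B that])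
  have wV: "w i \<in> V" for i unfolding w_def using BV
    by (intro fvs.subspace_sum[OF subV(1)] fvs.subspace_scale[OF subV(1)]) auto
  have wd: "w i j = (if i = j then 1 else 0)" if "i < d" "j < d" for i j
  proof -
    have "w i j = (\<Sum>m<d. C $$ (i, m) * B m j) / det ?B"
      unfolding w_def by (simp add: sum_fun_apply fscale_apply sum_divide_distrib)
    then show ?thesis using CB[OF that] dB by simp
  qed
  \<comment> \<open>Invertibility of the block means that \<open>V\<close> projects injectively to
    the first \<open>d\<close> coordinates.\<close>
  have inj0: "v = 0" if v: "v \<in> V" and v0: "\<And>l. l < d \<Longrightarrow> v l = 0" for v
  proof -
    obtain a where a: "v = (\<Sum>m<d. fscale (a m) (B m))" using span_coefficients[of B d v] B v unfolding is_frame_def by blast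
    have "a j = 0" if j: "j < d" for j
    proof -
      have "0 = (\<Sum>l<d. v l * C $$ (l, j))" using v0 by simp
      also have "\<dots> = (\<Sum>l<d. \<Sum>m<d. a m * (B m l * C $$ (l, j)))"
        unfolding a by (simp add: sum_fun_apply fscale_apply sum_distrib_right mult.assoc)
      also have "\<dots> = (\<Sum>m<d. a m * (\<Sum>l<d. B m l * C $$ (l, j)))"
        by (subst sum.swap) (simp add: sum_distrib_left)
      also have "\<dots> = (\<Sum>m<d. if m = j then a j * det ?B else 0)" by (intro sum.cong) (auto simp: BC j)
      also have "\<dots> = a j * det ?B" using j by simp
      finally show ?thesis using dB by simp
    qed
    then show ?thesis unfolding a by (auto simp: fscale_def fun_eq_iff sum_fun_apply)
  qed
  have expand: "v = (\<Sum>i<d. fscale (v i) (w i))" if v: "v \<in> V" for v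
  proof -
    have "v - (\<Sum>i<d. fscale (v i) (w i)) = 0"
    proof (rule inj0)
      show "v - (\<Sum>i<d. fscale (v i) (w i)) \<in> V"
        by (intro fvs.subspace_diff[OF subV(1)] v fvs.subspace_sum[OF subV(1)] fvs.subspace_scale[OF subV(1)] wV)
      fix l assume l: "l < d"
      have "(\<Sum>i<d. v i * w i l) = (\<Sum>i<d. if i = l then v l else 0)" by (intro sum.cong) (auto simp: wd l)
      then show "(v - (\<Sum>i<d. fscale (v i) (w i))) l = 0" using l by (simp add: sum_fun_apply fscale_apply)
    qed
    then show ?thesis by simp
  qed
  let ?c = "\<lambda>j i. w i j"
  have I: "{..<n} - {d..<n} = {..<d}" using d by auto
  have "V = gspace n {d..<n} ?c"
  proof
    show "V \<subseteq> gspace n {d..<n} ?c"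
    proof
      fix v assume v: "v \<in> V"
      have "v j = (\<Sum>i<d. w i j * v i)" for j
        using arg_cong[OF expand[OF v], of "\<lambda>f. f j"] by (simp add: sum_fun_apply fscale_apply mult.commute)
      then show "v \<in> gspace n {d..<n} ?c" unfolding gspace_def I using v subV(2) by blast
    qed
    show "gspace n {d..<n} ?c \<subseteq> V"
    proof
      fix v assume v: "v \<in> gspace n {d..<n} ?c"
      have "v = (\<Sum>i<d. fscale (v i) (w i))"
      proof
        fix l
        show "v l = (\<Sum>i<d. fscale (v i) (w i)) l"
        proof (cases "l < d")
          case True
          have "(\<Sum>i<d. v i * w i l) = (\<Sum>i<d. if i = l then v l else 0)" by (intro sum.cong) (auto simp: wd True)
          then show ?thesis using True by (simp add: sum_fun_apply fscale_apply)
        next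
          case False
          show ?thesis
          proof (cases "l < n")
            case True
            then show ?thesis using v False unfolding gspace_def I by (simp add: sum_fun_apply fscale_apply mult.commute)
          next
            case False
            then have "w i l = 0" for i using wV[of i] subV(2) unfolding kpoints_def by auto
            then show ?thesis using v False unfolding gspace_def kpoints_def by (simp add: sum_fun_apply fscale_apply)
          qed
        qed
      qed
      also have "\<dots> \<in> V" by (intro fvs.subspace_sum[OF subV(1)] fvs.subspace_scale[OF subV(1)] wV)
      finally show "v \<in> V" .
    qed
  qed
  then show ?thesis by blast
qed

section \<open>Tangent spaces\<close>

definition dval :: "nat \<Rightarrow> (nat \<Rightarrow> 'k::comm_ring_1) \<Rightarrow> (nat, 'k) poly \<Rightarrow> 'k" where
  "dval l x F = mext (\<lambda>c. c) (\<lambda>m. of_nat (lk m l) * pmon x (m - sgl l 1)) F"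

lemma peval_pdiff: "peval (pdiff l F) x = dval l x F" for x :: "nat \<Rightarrow> 'k::comm_ring_1"
  by (simp add: pdiff_def peval_sum peval_single dval_def mext_def ac_simps)

lemma dval_diff: "dval l x (F - G) = dval l x F - dval l x G"
  and dval_sum: "dval l x (sum f I) = (\<Sum>i\<in>I. dval l x (f i))"
  by (simp_all add: dval_def mext_diff mext_sum coeff_hom_id)

lemma dval_scale: "dval l x (sgl 0 a * F) = a * dval l x F" for x :: "nat \<Rightarrow> 'k::idom"
proof -
  have "sgl 0 a * F = (\<Sum>v\<in>ks F. sgl v (a * lk F v))"
  proof (cases "a = 0")
    case False
    then show ?thesis using times_eq_sum_single[of "sgl 0 a" F] by simp
  qed simp
  then have "dval l x (sgl 0 a * F) = (\<Sum>v\<in>ks F. (a * lk F v) * (of_nat (lk v l) * pmon x (v - sgl l 1)))"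
    by (simp add: dval_def mext_sum mext_single coeff_hom_id)
  then show ?thesis by (simp add: dval_def mext_def sum_distrib_left mult.assoc)
qed

text \<open>The Euler operator of variable \<open>l\<close> multiplies each monomial by its
  exponent, so no truncated subtraction of exponents remains.\<close>

lemma times_dval:
  "x l * dval l x F = mext (\<lambda>c. c) (\<lambda>m. of_nat (lk m l) * pmon x m) F"
proof -
  have "x l * (of_nat (lk m l) * pmon x (m - sgl l 1)) = of_nat (lk m l) * pmon x m" for m
  proof (cases "lk m l = 0")
    case False
    have "m = sgl l 1 + (m - sgl l 1)"
      by (rule poly_mapping_eqI) (use False in \<open>auto simp: lookup_add lookup_minus lookup_single when_def\<close>)
    then have "pmon x m = x l * pmon x (m - sgl l 1)" by (metis pmon_add pmon_single power_one_right)
    then show ?thesis by (simp add: ac_simps)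
  qed simp
  then show ?thesis unfolding dval_def mext_def sum_distrib_left
    by (intro sum.cong refl) (metis mult.left_commute)
qed

lemma pdiff_polys_in:
  fixes F :: "('i, 'k::comm_ring_1) poly"
  assumes F: "F \<in> polys_in I" shows "pdiff l F \<in> polys_in I"
  unfolding pdiff_def
proof (intro subring_on_sum[OF subring_on_polys_in] polys_in_single)
  fix m assume "m \<in> ks F"
  then have "ks m \<subseteq> I" using F by (simp add: polys_in_iff)
  moreover have "ks (m - sgl l 1) \<subseteq> ks m" by (auto simp: in_keys_iff lookup_minus)
  ultimately show "ks (m - sgl l 1) \<subseteq> I" by blast
qed

lemma subspace_eq_if_dim_eq:
  assumes TK: "T \<subseteq> gspace n J c" and J: "J \<subseteq> {..<n}" "card ({..<n} - J) = d"
    and T: "T \<in> Grass d n" and d: "d > 0"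
  shows "T = gspace n J c"
proof (rule ccontr)
  assume "T \<noteq> gspace n J c"
  then obtain w where w: "w \<in> gspace n J c" "w \<notin> T" using TK by blast
  obtain B where B: "is_frame d T B" using Grass_frame[OF T d] by blast
  let ?b = "B ` {..<d}" and ?t = "gvec J c ` ({..<n} - J)"
  have ind: "fvs.independent ?b" "fvs.span ?b = T" and inj: "inj_on B {..<d}" using B unfolding is_frame_def by auto
  have "fvs.independent (insert w ?b)" using w(2) ind by (simp add: fvs.independent_insert)
  moreover have "insert w ?b \<subseteq> fvs.span ?t"
    unfolding gspace_frame(3)[OF J(1)] using w(1) TK is_frame_mem[OF B] by auto
  ultimately have "card (insert w ?b) \<le> card ?t" using fvs.independent_span_bound[of ?t "insert w ?b"] by simp
  moreover have "w \<notin> ?b" using w(2) is_frame_mem[OF B] by auto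
  then have "card (insert w ?b) = Suc d" using card_image[OF inj] by simp
  moreover have "card ?t \<le> d" using card_image_le[of "{..<n} - J" "gvec J c"] J(2) by simp
  ultimately show False by simp
qed

lemma times_eq_imp_scaled:
  fixes x :: "'k::field"
  assumes "x * D = a * P" "x \<noteq> 0" shows "D * v = P * (a * (v / x))"
proof -
  have "D * v = (x * D) * (v / x)" using assms(2) by simp
  then show ?thesis unfolding assms(1) by (simp only: ac_simps)
qed

section \<open>Tangent spaces of toric varieties\<close>

context toric
begin

text \<open>The partial derivative of coordinate \<open>j\<close> of the torus parametrization with
  respect to \<open>t i\<close>. Division by \<open>t i\<close> stands for the exponent
  \<open>g j - uvec i\<close>.\<close>

definition tcoef :: "(nat \<Rightarrow> 'k::field) \<Rightarrow> nat \<Rightarrow> nat \<Rightarrow> 'k" where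
  "tcoef t j i = of_int (lk (g j) i) * chi t (g j) / t i"

abbreviation tan :: "(nat \<Rightarrow> 'k::field) \<Rightarrow> (nat \<Rightarrow> 'k) set" where "tan x \<equiv> tangent_space n X x"

lemma tan_iff: "v \<in> tan x \<longleftrightarrow> v \<in> kpoints n \<and>
    (\<forall>F\<in>polys_in {..<n}. (\<forall>y\<in>X. peval F y = 0) \<longrightarrow> (\<Sum>l<n. dval l x F * v l) = 0)"
  unfolding tangent_space_def peval_pdiff by simp

lemma subspace_tan: "fvs.subspace (tan x)"
proof (rule fvs.subspaceI)
  show "0 \<in> tan x" unfolding tan_iff by (simp add: kpoints_def)
  fix v w and a assume v: "v \<in> tan x"
  show "fscale a v \<in> tan x"
  proof -
    have "(\<Sum>l<n. dval l x F * fscale a v l) = a * (\<Sum>l<n. dval l x F * v l)" for F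
      by (simp add: fscale_apply sum_distrib_left ac_simps)
    then show ?thesis using v unfolding tan_iff by (auto simp: kpoints_def fscale_apply)
  qed
  assume w: "w \<in> tan x"
  have "(\<Sum>l<n. dval l x F * (v + w) l) = (\<Sum>l<n. dval l x F * v l) + (\<Sum>l<n. dval l x F * w l)" for F
    by (simp add: distrib_left sum.distrib)
  then show "v + w \<in> tan x" using v w unfolding tan_iff by (auto simp: kpoints_def)
qed

lemma tan_kpoints: "tan x \<subseteq> kpoints n" by (rule subsetI) (simp add: tan_iff)

lemma smooth_Grass: "x \<in> X - singular_locus d n X \<Longrightarrow> tan x \<in> Grass d n"
  unfolding Grass_def singular_locus_def using subspace_tan tan_kpoints by blast

text \<open>The sum is the derivation that multiplies the character of exponent \<open>u\<close> by
  the \<open>i\<close>-th entry of \<open>u\<close>. It acts through \<open>psub g F\<close>, which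
  is zero, and so annihilates the ideal at every point of \<open>X\<close>.\<close>

lemma log_derivation:
  fixes F :: "(nat, 'k::alg_closed_field) poly"
  assumes x: "x \<in> X" and F: "F \<in> polys_in {..<n}" "\<forall>y\<in>X. peval F y = 0"
  shows "(\<Sum>k<n. of_int (lk (g k) i) * (x k * dval k x F)) = 0"
proof -
  have lw: "lk (wt g m) i = (\<Sum>k<n. int (lk m k) * lk (g k) i)" if "ks m \<subseteq> {..<n}" for m
    unfolding wt_superset[OF finite_lessThan that] by (simp add: lookup_sum)
  have "(\<Sum>k<n. of_int (lk (g k) i) * (x k * dval k x F)) =
      (\<Sum>k<n. \<Sum>m\<in>ks F. of_int (lk (g k) i) * (lk F m * (of_nat (lk m k) * pmon x m)))"
    unfolding times_dval mext_def by (simp add: sum_distrib_left)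
  also have "\<dots> = (\<Sum>m\<in>ks F. \<Sum>k<n. of_int (lk (g k) i) * (lk F m * (of_nat (lk m k) * pmon x m)))"
    by (rule sum.swap)
  also have "\<dots> = (\<Sum>m\<in>ks F. lk F m * (of_int (lk (wt g m) i) * pt_eval x (wt g m)))"
  proof (rule sum.cong[OF refl])
    fix m assume "m \<in> ks F"
    then have m: "ks m \<subseteq> {..<n}" using F(1) by (simp add: polys_in_iff)
    show "(\<Sum>k<n. of_int (lk (g k) i) * (lk F m * (of_nat (lk m k) * pmon x m))) =
        lk F m * (of_int (lk (wt g m) i) * pt_eval x (wt g m))"
      unfolding lw[OF m] pt_eval_wt[OF x m] by (simp add: sum_distrib_left sum_distrib_right ac_simps)
  qed
  also have "\<dots> = mext (\<lambda>c. c) (\<lambda>u. of_int (lk u i) * pt_eval x u) (psub g F)"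
    unfolding psub_eq by (simp add: mext_sum mext_single coeff_hom_id)
  also have "psub g F = 0" using psub_eq_0_iff[OF F(1)] F(2) by blast
  finally show ?thesis by simp
qed

lemma wt_npart:
  assumes "ks u \<subseteq> {..<d}"
  shows "wt g (npart u) = wt uvec (npart u)" "ks (npart u) \<subseteq> {..<d}"
proof -
  have "ks (npart u) \<subseteq> ks u" by (auto simp: in_keys_iff lookup_npart)
  then show k: "ks (npart u) \<subseteq> {..<d}" using assms by (rule subset_trans)
  show "wt g (npart u) = wt uvec (npart u)" unfolding wt_def
    by (intro sum.cong refl) (use k g_basis in auto)
qed

text \<open>The derivations of \<open>log_derivation\<close> supply \<open>d\<close> independent
  tangent vectors. Conversely, for each \<open>j\<close> from \<open>d\<close> on, one binomial
  expresses \<open>v j\<close> by the first \<open>d\<close> coordinates.\<close>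

lemma tan_torus:
  fixes t :: "nat \<Rightarrow> 'k::alg_closed_field"
  assumes t: "\<And>i. t i \<noteq> 0"
  shows "tan (torus_point n g t) = gspace n {d..<n} (tcoef t)"
proof
  let ?x = "torus_point n g t"
  have x: "?x \<in> X" by (rule torus_point_in[OF t])
  have I: "{..<n} - {d..<n} = {..<d}" and J: "{d..<n} \<subseteq> {..<n}" using d_le_n by auto
  have xk: "?x k = chi t (g k)" if "k < n" for k using that by (simp add: torus_point_def)
  have nz: "chi t u \<noteq> 0" for u by (rule chi_nonzero[OF t])
  have xi: "?x i = t i" if "i < d" for i using that d_le_n xk[of i] g_basis[of i] by simp
  show "gspace n {d..<n} (tcoef t) \<subseteq> tan ?x"
    unfolding gspace_frame(3)[OF J, symmetric]
  proof (rule fvs.span_minimal[OF _ subspace_tan], rule image_subsetI)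
    fix i assume "i \<in> {..<n} - {d..<n}"
    then have i: "i < d" using I by simp
    have gv: "gvec {d..<n} (tcoef t) i k = of_int (lk (g k) i) * ?x k / t i" if "k < n" for k
    proof (cases "k < d")
      case True
      then show ?thesis using g_basis[of k] xi[of k] t[of i] by (auto simp: gvec_def uvec_def lookup_single when_def)
    next
      case False
      then show ?thesis using that i xk by (simp add: gvec_def tcoef_def)
    qed
    show "gvec {d..<n} (tcoef t) i \<in> tan ?x" unfolding tan_iff
    proof (intro conjI ballI impI)
      show "gvec {d..<n} (tcoef t) i \<in> kpoints n" using i d_le_n by (auto simp: gvec_def kpoints_def)
      fix F :: "(nat, 'k) poly" assume F: "F \<in> polys_in {..<n}" "\<forall>y\<in>X. peval F y = 0"
      have "(\<Sum>l<n. dval l ?x F * gvec {d..<n} (tcoef t) i l) = (\<Sum>l<n. of_int (lk (g l) i) * (?x l * dval l ?x F)) / t i"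
        unfolding sum_divide_distrib by (intro sum.cong refl) (simp add: gv)
      then show "(\<Sum>l<n. dval l ?x F * gvec {d..<n} (tcoef t) i l) = 0" using log_derivation[OF x F, of i] by simp
    qed
  qed
  show "tan ?x \<subseteq> gspace n {d..<n} (tcoef t)"
  proof
    fix v assume v: "v \<in> tan ?x"
    have "v j = (\<Sum>i<d. tcoef t j i * v i)" if j: "j \<in> {d..<n}" for j
    proof -
      \<comment> \<open>Splitting \<open>g j\<close> into positive and negative part gives a
        binomial that contains, besides the first \<open>d\<close> variables, only variable
        \<open>j\<close>, and that to the first power. Its differential therefore has coefficient 1
        at \<open>v j\<close> in logarithmic coordinates, whatever the characteristic.\<close>
      let ?a = "npart (- g j)" and ?b = "npart (g j)"
      let ?m = "sgl j (Suc 0) + ?a"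
      have gj: "ks (g j) \<subseteq> {..<d}" "ks (- g j) \<subseteq> {..<d}" using g_supp[of j] j by auto
      have ka: "ks ?a \<subseteq> {..<d}" "ks ?b \<subseteq> {..<d}" using wt_npart(2) gj by auto
      have "{..<d} \<subseteq> {..<n}" using d_le_n by auto
      then have km: "ks ?m \<subseteq> {..<n}" "ks ?b \<subseteq> {..<n}" using keys_add[of "sgl j (Suc 0)" ?a] ka j by auto
      have wm: "wt g ?m = wt g ?b"
        using npart_diff[of "g j"] wt_npart(1)[OF gj(1)] wt_npart(1)[OF gj(2)] by (simp add: wt_add wt_single)
      have pm: "pmon ?x ?m = pmon ?x ?b" "pmon ?x ?b \<noteq> 0"
        using pmon_torus_point[OF t] km wm nz by auto
      let ?F = "sgl ?m 1 - sgl ?b 1 :: (nat, 'k) poly"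
      have F: "?F \<in> polys_in {..<n}" by (intro subring_on_diff[OF subring_on_polys_in] polys_in_single km)
      have "psub g ?F = 0" by (simp only: psub_diff psub_single wm diff_self)
      then have "(\<Sum>l<n. dval l ?x ?F * v l) = 0" using v F psub_eq_0_iff[OF F] unfolding tan_iff by blast
      moreover have "dval l ?x ?F * v l = pmon ?x ?b * ((of_nat (lk ?m l) - of_nat (lk ?b l)) * (v l / ?x l))" if "l < n" for l
      proof -
        have "?x l * dval l ?x ?F = (of_nat (lk ?m l) - of_nat (lk ?b l)) * pmon ?x ?b"
          unfolding times_dval by (simp add: mext_diff mext_single coeff_hom_id pm(1) left_diff_distrib)
        moreover have "?x l \<noteq> 0" using xk[OF that] nz by simp
        ultimately show ?thesis by (rule times_eq_imp_scaled)
      qed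
      ultimately have "pmon ?x ?b * (\<Sum>l<n. (of_nat (lk ?m l) - of_nat (lk ?b l)) * (v l / ?x l)) = 0"
        by (simp add: sum_distrib_left)
      then have s0: "(\<Sum>l<n. (of_nat (lk ?m l) - of_nat (lk ?b l)) * (v l / ?x l)) = 0" using pm(2) by simp
      have coef: "of_nat (lk ?m l) - of_nat (lk ?b l) = (if l = j then 1 else if l < d then - of_int (lk (g j) l) else (0::'k))"
        if l: "l < n" for l
      proof (cases "l < d")
        case True
        have "of_nat (nat (- z)) - of_nat (nat z) = (- of_int z :: 'k)" for z :: int
          by (cases "z \<ge> 0") (simp_all add: of_nat_nat)
        then show ?thesis using True j by (simp add: lookup_add lookup_single lookup_npart)
      next
        case False
        then have "l \<notin> ks ?a" "l \<notin> ks ?b" using ka by auto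
        then show ?thesis using False by (auto simp: lookup_add lookup_single in_keys_iff when_def)
      qed
      have "(\<Sum>l<n. (of_nat (lk ?m l) - of_nat (lk ?b l)) * (v l / ?x l)) =
          (\<Sum>l\<in>insert j {..<d}. (if l = j then 1 else - of_int (lk (g j) l)) * (v l / ?x l))"
        using j d_le_n by (intro sum.mono_neutral_cong_right) (auto simp: coef)
      also have "\<dots> = v j / ?x j + (\<Sum>l<d. (- of_int (lk (g j) l)) * (v l / ?x l))"
        using j by (subst sum.insert) (auto intro!: sum.cong)
      finally have "v j / ?x j = (\<Sum>l<d. of_int (lk (g j) l) * (v l / ?x l))"
        using s0 by (simp add: sum_negf)
      then have "v j = ?x j * (\<Sum>l<d. of_int (lk (g j) l) * (v l / ?x l))" using xk[of j] nz j by (simp add: field_simps)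
      also have "\<dots> = (\<Sum>i<d. tcoef t j i * v i)"
        unfolding sum_distrib_left by (intro sum.cong refl) (use xi xk[of j] j in \<open>simp add: tcoef_def\<close>)
      finally show ?thesis .
    qed
    then show "v \<in> gspace n {d..<n} (tcoef t)" unfolding gspace_def I using v tan_kpoints by blast
  qed
qed

lemma torus_smooth:
  fixes t :: "nat \<Rightarrow> 'k::alg_closed_field"
  assumes t: "\<And>i. t i \<noteq> 0"
  shows "torus_point n g t \<in> X - singular_locus d n X"
proof -
  have "fvs.dim (gspace n {d..<n} (tcoef t)) = d" using graph_in_Grass[OF d_le_n, of "tcoef t"] unfolding Grass_def by simp
  then show ?thesis using torus_point_in[OF t] unfolding singular_locus_def tan_torus[OF t, symmetric] by simp
qed

text \<open>Pointedness puts the origin on \<open>X\<close>. Irreducibility of the generators leaves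
  no linear term in a polynomial vanishing on \<open>X\<close>: the coefficient of variable
  \<open>l\<close> equals that of \<open>psub g F\<close> at \<open>g l\<close>. So the tangent
  space at the origin is all of \<open>kpoints n\<close>, of dimension greater than
  \<open>d\<close>.\<close>

lemma origin_singular:
  assumes gens: "\<And>m i. ks m \<subseteq> {..<n} \<Longrightarrow> i < n \<Longrightarrow> wt g m = g i \<Longrightarrow> m = sgl i 1"
    and pointed: "\<And>m. ks m \<subseteq> {..<n} \<Longrightarrow> wt g m = 0 \<Longrightarrow> m = 0" and dn: "d < n"
  shows "singular_locus d n (X :: (nat \<Rightarrow> 'k::alg_closed_field) set) \<noteq> {}"
proof -
  let ?z = "0 :: nat \<Rightarrow> 'k"
  have pz: "pmon ?z m = (if m = 0 then 1 else 0)" for m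
  proof (cases "m = 0")
    case False
    then obtain i where "i \<in> ks m" by fastforce
    then have "pmon ?z m = 0" unfolding pmon_def by (intro prod_zero) (auto simp: in_keys_iff)
    then show ?thesis using False by simp
  qed simp
  have zX: "?z \<in> X" unfolding toric_points_def
  proof (intro CollectI conjI allI impI)
    show "?z \<in> kpoints n" by (simp add: kpoints_def)
    fix m m' assume m: "ks m \<subseteq> {..<n}" "ks m' \<subseteq> {..<n}" "wt g m = wt g m'"
    then have "m = 0 \<longleftrightarrow> m' = 0" using pointed[of m] pointed[of m'] by auto
    then show "pmon ?z m = pmon ?z m'" unfolding pz by simp
  qed
  have "tan ?z = kpoints n"
  proof
    show "kpoints n \<subseteq> tan ?z"
    proof
      fix v :: "nat \<Rightarrow> 'k" assume v: "v \<in> kpoints n"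
      have "dval l ?z F = 0" if F: "F \<in> polys_in {..<n}" "\<forall>y\<in>X. peval F y = 0" and l: "l < n" for F :: "(nat, 'k) poly" and l
      proof -
        have "dval l ?z F = (\<Sum>m\<in>ks F. if m = sgl l 1 then lk F m else 0)"
          unfolding dval_def mext_def
        proof (rule sum.cong[OF refl])
          fix m
          show "lk F m * (of_nat (lk m l) * pmon ?z (m - sgl l 1)) = (if m = sgl l 1 then lk F m else 0)"
          proof (cases "m - sgl l 1 = 0 \<and> lk m l \<noteq> 0")
            case True
            have "m = sgl l 1"
            proof (rule poly_mapping_eqI)
              fix i
              have "lk (m - sgl l 1) i = 0" using True by simp
              then show "lk m i = lk (sgl l 1) i" using True
                by (cases "i = l") (auto simp: lookup_minus lookup_single)
            qed
            then show ?thesis by (simp add: pz)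
          next
            case False
            then show ?thesis by (auto simp: pz)
          qed
        qed
        also have "\<dots> = lk F (sgl l 1)" by (auto simp: in_keys_iff)
        also have "\<dots> = lk (psub g F) (g l)"
        proof -
          have "lk (psub g F) (g l) = (\<Sum>m\<in>ks F. if m = sgl l 1 then lk F m else 0)"
            unfolding psub_eq lookup_sum
          proof (rule sum.cong[OF refl])
            fix m assume "m \<in> ks F"
            then have m: "ks m \<subseteq> {..<n}" using F(1) by (simp add: polys_in_iff)
            show "lk (sgl (wt g m) (lk F m)) (g l) = (if m = sgl l 1 then lk F m else 0)"
            proof (cases "m = sgl l 1")
              case True
              have "wt g m = g l" unfolding True wt_single by simp
              then show ?thesis using True by simp
            next
              case False
              then have "wt g m \<noteq> g l" using gens[OF m l] by blast
              then show ?thesis using False by (simp add: lookup_single_not_eq)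
            qed
          qed
          then show ?thesis by (auto simp: in_keys_iff)
        qed
        also have "\<dots> = 0" using psub_eq_0_iff[OF F(1)] F(2) by simp
        finally show ?thesis .
      qed
      then show "v \<in> tan ?z" unfolding tan_iff using v by simp
    qed
  qed (rule tan_kpoints)
  then have "fvs.dim (tan ?z) \<noteq> d" using dim_kpoints[of n, where 'k = 'k] dn by simp
  then show ?thesis using zX unfolding singular_locus_def by blast
qed

end

section \<open>The Nash blowup of a toric variety\<close>

lemma comm_ring_hom_peval: "comm_ring_hom (\<lambda>F :: (nat, 'k::comm_ring_1) poly. peval F x)"
  by unfold_locales (simp_all add: peval_0 peval_1 peval_add peval_mult)

lemma permutes_lt: "p permutes {0..<d} \<Longrightarrow> i < d \<Longrightarrow> p i < d" for d :: nat
  using permutes_in_image[of p "{0..<d}" i] by simp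

text \<open>By the Leibniz formula a minor is a polynomial in its entries.\<close>

lemma local_frac_minor:
  assumes Q: "frac_closed Q" and w: "\<And>i l. i < d \<Longrightarrow> local_frac P Q y (\<lambda>z. w z i l)"
  shows "local_frac P Q y (\<lambda>z. minor d (w z) I)"
proof -
  have eq: "minor d (w z) I = (\<Sum>p | p permutes {0..<d}. signof p * (\<Prod>i = 0..<d. w z i (sorted_list_of_set I ! p i)))" for z
  proof -
    have "minor d (w z) I = (\<Sum>p | p permutes {0..<d}. signof p *
        (\<Prod>i = 0..<d. mat d d (\<lambda>(i, j). w z i (sorted_list_of_set I ! j)) $$ (i, p i)))"
      unfolding minor_def by (rule det_def') simp
    also have "\<dots> = (\<Sum>p | p permutes {0..<d}. signof p * (\<Prod>i = 0..<d. w z i (sorted_list_of_set I ! p i)))"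
      by (intro sum.cong arg_cong2[of _ _ _ _ "(*)"] prod.cong refl) (auto simp: permutes_lt)
    finally show ?thesis .
  qed
  show ?thesis unfolding eq
    by (intro local_frac_sum[OF Q] local_frac_mult[OF Q] local_frac_const[OF Q] local_frac_prod[OF Q] w) simp
qed

section \<open>Homogeneous fractions in Pluecker coordinates\<close>

definition plu_fracs :: "nat \<Rightarrow> nat \<Rightarrow> ((nat \<Rightarrow> 'k::field) \<times> (nat \<Rightarrow> 'k) set \<Rightarrow> 'k) rel" where
  "plu_fracs d n = {(pluecker_eval d F, pluecker_eval d G) | F G.
        \<exists>e. F \<in> pluecker_forms d n e \<and> G \<in> pluecker_forms d n e}"

lemma affine_times_Grass_eq: "affine_times_Grass d n = frac_space (kpoints n \<times> Grass d n) (plu_fracs d n)"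
  unfolding affine_times_Grass_def plu_fracs_def ..

lemma pluecker_forms_closed:
  fixes F G :: "(nat + nat set, 'k::field) poly"
  shows "F \<in> pluecker_forms d n e \<Longrightarrow> G \<in> pluecker_forms d n e \<Longrightarrow> F + G \<in> pluecker_forms d n e"
    and "F \<in> pluecker_forms d n e \<Longrightarrow> G \<in> pluecker_forms d n e' \<Longrightarrow> F * G \<in> pluecker_forms d n (e + e')"
    and "sgl 0 c \<in> pluecker_forms d n 0"
proof -
  note R = subring_on_polys_in[of "Inl ` {..<n} \<union> Inr ` {I. I \<subseteq> {..<n} \<and> card I = d}" , where 'k = 'k]
  assume F: "F \<in> pluecker_forms d n e"
  { assume G: "G \<in> pluecker_forms d n e"
    have "F + G \<in> polys_in (Inl ` {..<n} \<union> Inr ` {I. I \<subseteq> {..<n} \<and> card I = d})"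
      using subring_on_add[OF R] F G unfolding pluecker_forms_def by blast
    then show "F + G \<in> pluecker_forms d n e"
      using F G keys_add[of F G] unfolding pluecker_forms_def by blast }
  { assume G: "G \<in> pluecker_forms d n e'"
    have "F * G \<in> polys_in (Inl ` {..<n} \<union> Inr ` {I. I \<subseteq> {..<n} \<and> card I = d})"
      using subring_on_mult[OF R] F G unfolding pluecker_forms_def by blast
    moreover have "(\<Sum>I | I \<subseteq> {..<n} \<and> card I = d. lk m (Inr I)) = e + e'" if "m \<in> ks (F * G)" for m
    proof -
      obtain u v where "m = u + v" "u \<in> ks F" "v \<in> ks G" using keys_mult[of F G] \<open>m \<in> ks (F * G)\<close> by blast
      then show ?thesis using F G unfolding pluecker_forms_def by (simp add: lookup_add sum.distrib)
    qed
    ultimately show "F * G \<in> pluecker_forms d n (e + e')" unfolding pluecker_forms_def by blast }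
next
  show "sgl 0 c \<in> pluecker_forms d n 0" unfolding pluecker_forms_def by (auto simp: polys_in_iff)
qed

lemma pluecker_eval_hom:
  "pluecker_eval d (F * G) z = pluecker_eval d F z * pluecker_eval d G z"
  "pluecker_eval d (F + G) z = pluecker_eval d F z + pluecker_eval d G z"
  "pluecker_eval d (sgl 0 c) z = c"
  by (simp_all add: pluecker_eval_def peval_mult peval_add peval_const split: prod.split)

lemma plu_fracsI: "F \<in> pluecker_forms d n e \<Longrightarrow> G \<in> pluecker_forms d n e \<Longrightarrow>
    (pluecker_eval d F, pluecker_eval d G) \<in> plu_fracs d n"
  unfolding plu_fracs_def by blast

lemma plu_fracsE:
  assumes "(a, b) \<in> plu_fracs d n"
  obtains e F G where "a = pluecker_eval d F" "b = pluecker_eval d G" "F \<in> pluecker_forms d n e" "G \<in> pluecker_forms d n e"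
  using assms unfolding plu_fracs_def by blast

lemma frac_closed_plu_fracs: "frac_closed (plu_fracs d n :: ((nat \<Rightarrow> 'k::field) \<times> (nat \<Rightarrow> 'k) set \<Rightarrow> 'k) rel)"
  unfolding frac_closed_def
proof (intro conjI allI impI)
  fix a b a' b' :: "(nat \<Rightarrow> 'k) \<times> (nat \<Rightarrow> 'k) set \<Rightarrow> 'k"
  assume "(a, b) \<in> plu_fracs d n" "(a', b') \<in> plu_fracs d n"
  then obtain e F G e' F' G' where FG: "a = pluecker_eval d F" "b = pluecker_eval d G" "F \<in> pluecker_forms d n e" "G \<in> pluecker_forms d n e"
    "a' = pluecker_eval d F'" "b' = pluecker_eval d G'" "F' \<in> pluecker_forms d n e'" "G' \<in> pluecker_forms d n e'"
    by (elim plu_fracsE)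
  show "(\<lambda>z. a z * a' z, \<lambda>z. b z * b' z) \<in> plu_fracs d n"
    using plu_fracsI[OF pluecker_forms_closed(2)[OF FG(3,7)] pluecker_forms_closed(2)[OF FG(4,8)]] FG
    by (simp add: pluecker_eval_hom[abs_def])
  have "F' * G \<in> pluecker_forms d n (e + e')" using pluecker_forms_closed(2)[OF FG(7,4)] by (simp add: add.commute)
  from plu_fracsI[OF pluecker_forms_closed(1)[OF pluecker_forms_closed(2)[OF FG(3,8)] this] pluecker_forms_closed(2)[OF FG(4,8)]]
  show "(\<lambda>z. a z * b' z + a' z * b z, \<lambda>z. b z * b' z) \<in> plu_fracs d n"
    using FG by (simp add: pluecker_eval_hom[abs_def])
next
  fix a b :: "(nat \<Rightarrow> 'k) \<times> (nat \<Rightarrow> 'k) set \<Rightarrow> 'k" assume "(a, b) \<in> plu_fracs d n"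
  then show "(b, a) \<in> plu_fracs d n" unfolding plu_fracs_def by blast
next
  fix c :: 'k
  show "(\<lambda>_. c, \<lambda>_. 1) \<in> plu_fracs d n"
    using plu_fracsI[OF pluecker_forms_closed(3)[of c] pluecker_forms_closed(3)[of 1]] by (simp add: pluecker_eval_hom[abs_def] del: single_one)
qed

lemma pluecker_form_scale:
  fixes F :: "(nat + nat set, 'k::field) poly"
  assumes F: "F \<in> pluecker_forms d n e"
  shows "peval F (case_sum x (\<lambda>I. u * p I)) = u ^ e * peval F (case_sum x p)"
proof -
  let ?D = "{I. I \<subseteq> {..<n} \<and> card I = d}" and ?x = "case_sum x (\<lambda>I. u * p I)" and ?y = "case_sum x p"
  have fin: "finite ?D" by (rule finite_subset[of _ "Pow {..<n}"]) auto
  let ?A = "Inl ` {..<n} \<union> Inr ` ?D :: (nat + nat set) set"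
  have finA: "finite ?A" using fin by simp
  have split: "(\<Prod>i\<in>?A. f i) = (\<Prod>i<n. f (Inl i)) * (\<Prod>I\<in>?D. f (Inr I))" for f :: "nat + nat set \<Rightarrow> 'k"
    using fin by (subst prod.union_disjoint) (auto simp: prod.reindex)
  have "pmon ?x m = u ^ e * pmon ?y m" if m: "m \<in> ks F" for m
  proof -
    have km: "ks m \<subseteq> ?A" and deg: "(\<Sum>I\<in>?D. lk m (Inr I)) = e" using F m unfolding pluecker_forms_def polys_in_iff by auto
    have "pmon ?x m = (\<Prod>i<n. x i ^ lk m (Inl i)) * (\<Prod>I\<in>?D. (u * p I) ^ lk m (Inr I))"
      unfolding pmon_superset[OF finA km] split by simp
    also have "(\<Prod>I\<in>?D. (u * p I) ^ lk m (Inr I)) = u ^ e * (\<Prod>I\<in>?D. p I ^ lk m (Inr I))"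
      unfolding deg[symmetric] by (simp add: power_mult_distrib prod.distrib power_sum)
    finally have "pmon ?x m = u ^ e * ((\<Prod>i<n. x i ^ lk m (Inl i)) * (\<Prod>I\<in>?D. p I ^ lk m (Inr I)))"
      by (simp add: ac_simps)
    also have "(\<Prod>i<n. x i ^ lk m (Inl i)) * (\<Prod>I\<in>?D. p I ^ lk m (Inr I)) = pmon ?y m"
      unfolding pmon_superset[OF finA km] split by simp
    finally show ?thesis .
  qed
  then show ?thesis unfolding peval_mext mext_def sum_distrib_left by (intro sum.cong refl) (simp add: ac_simps)
qed

text \<open>Replacing the chosen frame by \<open>w\<close> multiplies every form of degree
  \<open>e\<close> by \<open>u ^ e\<close>, with the same \<open>u\<close> for all forms. This
  factor is common to numerator and denominator of an admissible fraction.\<close>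

lemma pluecker_eval_frame:
  assumes w: "is_frame d V w"
  shows "\<exists>u. u \<noteq> 0 \<and> (\<forall>e. \<forall>F\<in>pluecker_forms d n e.
     pluecker_eval d F (x, V) = u ^ e * peval F (case_sum x (minor d w)))"
proof -
  obtain u where u: "u \<noteq> 0" "\<forall>I. pluecker d V I = u * minor d w I" using pluecker_frame[OF w] by blast
  have "pluecker d V = (\<lambda>I. u * minor d w I)" using u by auto
  then show ?thesis using u(1) pluecker_form_scale by (intro exI[of _ u]) (auto simp: pluecker_eval_def)
qed

context toric
begin

text \<open>Near a smooth point the tangent space is the graph of a matrix of rational functions.
  Take a maximal set \<open>J\<close> of coordinates on which some equations of \<open>X\<close>
  have identity Jacobian at \<open>x0\<close>; Cramer's rule for the Jacobian on \<open>J\<close>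
  then solves for these coordinates wherever \<open>\<Delta>\<close> is nonzero.\<close>

lemma tangent_fields:
  fixes x0 :: "nat \<Rightarrow> 'k::alg_closed_field"
  assumes x0: "x0 \<in> X - singular_locus d n X" and d: "0 < d"
  shows "\<exists>J P \<Delta>. J \<subseteq> {..<n} \<and> card ({..<n} - J) = d \<and> \<Delta> \<in> polys_in {..<n} \<and> peval \<Delta> x0 \<noteq> 0 \<and>
    (\<forall>l i. P l i \<in> polys_in {..<n}) \<and>
    (\<forall>x\<in>X - singular_locus d n X. peval \<Delta> x \<noteq> 0 \<longrightarrow> tan x = gspace n J (\<lambda>l i. peval (P l i) x / peval \<Delta> x))"
proof -
  define IX where "IX = {F \<in> polys_in {..<n} :: (nat, 'k) poly set. \<forall>y\<in>X. peval F y = 0}"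
  note R = subring_on_polys_in[of "{..<n}", where 'k = 'k]
  have IX_diff: "F - G \<in> IX" if "F \<in> IX" "G \<in> IX" for F G
    using that subring_on_diff[OF R] by (auto simp: IX_def peval_diff)
  have IX_scale: "sgl 0 a * F \<in> IX" if "F \<in> IX" for F a
    using that subring_on_mult[OF R polys_in_single[of 0]] by (auto simp: IX_def peval_mult)
  have IX_sum: "(\<Sum>i\<in>I. f i) \<in> IX" if "\<And>i. i \<in> I \<Longrightarrow> f i \<in> IX" for I :: "nat set" and f
    using that subring_on_sum[OF R, of I f] by (auto simp: IX_def peval_sum)
  define good where "good J \<longleftrightarrow> J \<subseteq> {..<n} \<and> (\<exists>F. \<forall>j\<in>J. F j \<in> IX \<and> (\<forall>l\<in>J. dval l x0 (F j) = (if l = j then 1 else 0)))" for J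
  have "good {}" by (simp add: good_def)
  then have "\<exists>J. good J \<and> (\<forall>J'. good J' \<longrightarrow> n - card J \<le> n - card J')" by (rule ex_has_least_nat)
  then obtain J where J0: "good J" "\<forall>J'. good J' \<longrightarrow> n - card J \<le> n - card J'" by (elim exE conjE)
  have le: "card J' \<le> n" if "good J'" for J'
    using card_mono[OF finite_lessThan, of J' n] that by (simp add: good_def)
  have J: "good J" "\<And>J'. good J' \<Longrightarrow> card J' \<le> card J"
  proof -
    fix J' assume J': "good J'"
    then show "card J' \<le> card J" using J0(2)[rule_format, OF J'] le[OF J'] le[OF J0(1)] by linarith
  qed (rule J0(1))
  obtain F where F: "\<And>j. j \<in> J \<Longrightarrow> F j \<in> IX" "\<And>j l. j \<in> J \<Longrightarrow> l \<in> J \<Longrightarrow> dval l x0 (F j) = (if l = j then 1 else 0)"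
    and Jn: "J \<subseteq> {..<n}" using J(1) unfolding good_def by blast
  have finJ: "finite J" using Jn by (rule finite_subset) simp
  \<comment> \<open>By maximality the differentials of the chosen equations span: subtracting them
    from \<open>G\<close> leaves a differential vanishing on \<open>J\<close>, and a nonzero entry
    at \<open>l\<close> would allow \<open>J\<close> to be enlarged by \<open>l\<close>.\<close>
  have span: "dval l x0 G = (\<Sum>j\<in>J. dval j x0 G * dval l x0 (F j))" if G: "G \<in> IX" and l: "l < n" for G l
  proof -
    define G' where "G' = G - (\<Sum>j\<in>J. sgl 0 (dval j x0 G) * F j)"
    have G': "G' \<in> IX" unfolding G'_def by (intro IX_diff IX_sum IX_scale G F)
    have dG': "dval l x0 G' = dval l x0 G - (\<Sum>j\<in>J. dval j x0 G * dval l x0 (F j))" for l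
      unfolding G'_def by (simp add: dval_diff dval_sum dval_scale)
    have zero: "dval l x0 G' = 0" if "l \<in> J" for l
    proof -
      have "(\<Sum>j\<in>J. dval j x0 G * dval l x0 (F j)) = (\<Sum>j\<in>J. if j = l then dval l x0 G else 0)"
        using that by (intro sum.cong) (auto simp: F(2))
      then show ?thesis using dG' that finJ by simp
    qed
    have "dval l x0 G' = 0"
    proof (rule ccontr)
      assume nz: "dval l x0 G' \<noteq> 0"
      then have lJ: "l \<notin> J" using zero by blast
      define H where "H = sgl 0 (1 / dval l x0 G') * G'"
      have H: "H \<in> IX" "dval l x0 H = 1" "\<And>j. j \<in> J \<Longrightarrow> dval j x0 H = 0"
        unfolding H_def using IX_scale[OF G'] nz zero by (auto simp: dval_scale)
      \<comment> \<open>Column \<open>l\<close> is cleared from the old equations by means of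
        \<open>H\<close>, which restores the identity Jacobian on \<open>insert l J\<close>.\<close>
      let ?F = "\<lambda>j. if j = l then H else F j - sgl 0 (dval l x0 (F j)) * H"
      have "?F j \<in> IX \<and> (\<forall>i\<in>insert l J. dval i x0 (?F j) = (if i = j then 1 else 0))" if "j \<in> insert l J" for j
        using that lJ H F by (auto simp: dval_diff dval_scale intro!: IX_diff IX_scale)
      then have "good (insert l J)" unfolding good_def using Jn l by (intro conjI exI[of _ ?F]) auto
      then show False using J(2)[of "insert l J"] lJ finJ by simp
    qed
    then show ?thesis using dG' by simp
  qed
  let ?I = "{..<n} - J"
  have split: "(\<Sum>l<n. f l) = (\<Sum>j\<in>J. f j) + (\<Sum>i\<in>?I. f i)" for f :: "nat \<Rightarrow> 'k"
    using sum.subset_diff[OF Jn, of f] by (simp add: add.commute)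
  have "tan x0 = gspace n J (\<lambda>j i. - dval i x0 (F j))"
  proof
    show "tan x0 \<subseteq> gspace n J (\<lambda>j i. - dval i x0 (F j))"
    proof
      fix v assume v: "v \<in> tan x0"
      have "v j = (\<Sum>i\<in>?I. - dval i x0 (F j) * v i)" if j: "j \<in> J" for j
      proof -
        have "0 = (\<Sum>l<n. dval l x0 (F j) * v l)" using v F(1)[OF j] unfolding tan_iff IX_def by simp
        also have "\<dots> = (\<Sum>l\<in>J. if l = j then v j else 0) + (\<Sum>i\<in>?I. dval i x0 (F j) * v i)"
          unfolding split using j by (intro arg_cong2[of _ _ _ _ "(+)"] sum.cong) (auto simp: F(2))
        finally show ?thesis using j finJ by (simp add: sum_negf eq_neg_iff_add_eq_0)
      qed
      then show "v \<in> gspace n J (\<lambda>j i. - dval i x0 (F j))" unfolding gspace_def using v tan_kpoints by blast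
    qed
    show "gspace n J (\<lambda>j i. - dval i x0 (F j)) \<subseteq> tan x0"
    proof
      fix v assume v: "v \<in> gspace n J (\<lambda>j i. - dval i x0 (F j))"
      have z: "(\<Sum>l<n. dval l x0 (F j) * v l) = 0" if j: "j \<in> J" for j
      proof -
        have "(\<Sum>l\<in>J. dval l x0 (F j) * v l) = (\<Sum>l\<in>J. if l = j then v j else 0)"
          using j by (intro sum.cong) (auto simp: F(2))
        also have "\<dots> = - (\<Sum>i\<in>?I. dval i x0 (F j) * v i)" using v j finJ unfolding gspace_def by (simp add: sum_negf)
        finally show ?thesis unfolding split by simp
      qed
      show "v \<in> tan x0" unfolding tan_iff
      proof (intro conjI ballI impI)
        show "v \<in> kpoints n" using v by (simp add: gspace_def)
        fix G :: "(nat, 'k) poly" assume "G \<in> polys_in {..<n}" "\<forall>y\<in>X. peval G y = 0"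
        then have G: "G \<in> IX" by (simp add: IX_def)
        have "(\<Sum>l<n. dval l x0 G * v l) = (\<Sum>l<n. \<Sum>j\<in>J. dval j x0 G * (dval l x0 (F j) * v l))"
          by (intro sum.cong refl) (simp add: span[OF G] sum_distrib_right mult.assoc)
        also have "\<dots> = (\<Sum>j\<in>J. dval j x0 G * (\<Sum>l<n. dval l x0 (F j) * v l))"
          by (subst sum.swap) (simp add: sum_distrib_left)
        finally show "(\<Sum>l<n. dval l x0 G * v l) = 0" by (simp add: z)
      qed
    qed
  qed
  \<comment> \<open>Smoothness of \<open>x0\<close> enters here and fixes the number of free
    coordinates.\<close>
  then have cI: "card ?I = d" using x0 gspace_frame(4)[OF Jn, of "\<lambda>j i. - dval i x0 (F j)"] unfolding singular_locus_def by simp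
  define r where "r = card J"
  obtain e where e: "bij_betw e {..<r} J" unfolding r_def using finJ by (metis ex_bij_betw_nat_finite atLeast0LessThan)
  have eJ: "e a \<in> J" if "a < r" for a using e that unfolding bij_betw_def by auto
  \<comment> \<open>The Jacobian matrix as a matrix of polynomials. Its adjugate has polynomial
    entries as well, and its determinant takes the value 1 at \<open>x0\<close>.\<close>
  let ?A = "mat r r (\<lambda>(a, b). pdiff (e b) (F (e a)))"
  have Ac: "?A \<in> carrier_mat r r" by simp
  define C where "C = adj_mat ?A"
  define \<Delta> where "\<Delta> = det ?A"
  have C: "C \<in> carrier_mat r r" "C * ?A = \<Delta> \<cdot>\<^sub>m 1\<^sub>m r" unfolding C_def \<Delta>_def using adj_mat[OF Ac] by auto
  have CA: "(\<Sum>a<r. C $$ (c, a) * pdiff (e b) (F (e a))) = (if c = b then \<Delta> else 0)" if "c < r" "b < r" for c b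
    using arg_cong[OF C(2), of "\<lambda>A. A $$ (c, b)"] C(1) that
    by (auto simp: scalar_prod_def row_def col_def atLeast0LessThan)
  have pd: "pdiff l (F (e a)) \<in> polys_in {..<n}" if "a < r" for l a
    using F(1)[OF eJ[OF that]] by (intro pdiff_polys_in) (simp add: IX_def)
  have det_in: "det M \<in> polys_in {..<n}" if M: "M \<in> carrier_mat k k" "\<And>i j. i < k \<Longrightarrow> j < k \<Longrightarrow> M $$ (i, j) \<in> polys_in {..<n}"
    for M :: "(nat, 'k) poly mat" and k
  proof -
    have "signof p \<in> (polys_in {..<n} :: (nat, 'k) poly set)" for p :: "nat \<Rightarrow> nat"
      by (simp add: sign_def subring_on_1[OF R] subring_on_uminus[OF R])
    moreover have "(\<Prod>i\<in>K. M $$ (i, p i)) \<in> polys_in {..<n}" if "K \<subseteq> {0..<k}" "p permutes {0..<k}" for K p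
      using that by (induction K rule: infinite_finite_induct)
        (auto intro!: subring_on_1[OF R] subring_on_mult[OF R] M(2) simp: permutes_lt)
    ultimately show ?thesis unfolding det_def'[OF M(1)]
      by (intro subring_on_sum[OF R] subring_on_mult[OF R]) auto
  qed
  have \<Delta>: "\<Delta> \<in> polys_in {..<n}" unfolding \<Delta>_def by (rule det_in[OF Ac]) (simp add: pd)
  have Cin: "C $$ (c, a) \<in> polys_in {..<n}" if "c < r" "a < r" for c a
  proof -
    have "mat_delete ?A a c \<in> carrier_mat (r - 1) (r - 1)" by (rule mat_delete_carrier[OF Ac])
    moreover have "mat_delete ?A a c $$ (i, j) \<in> polys_in {..<n}" if "i < r - 1" "j < r - 1" for i j
      using that \<open>c < r\<close> \<open>a < r\<close> by (auto simp: mat_delete_def pd)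
    ultimately have "det (mat_delete ?A a c) \<in> polys_in {..<n}" by (rule det_in)
    then have "cofactor ?A a c \<in> polys_in {..<n}" unfolding cofactor_def
      by (intro subring_on_mult[OF R] subring_on_power[OF R] subring_on_uminus[OF R] subring_on_1[OF R])
    then show ?thesis using that by (simp add: C_def adj_mat_def)
  qed
  define ei where "ei = the_inv_into {..<r} e"
  have ei: "ei (e b) = b" if "b < r" for b unfolding ei_def using e that unfolding bij_betw_def by (simp add: the_inv_into_f_f)
  have ei2: "\<exists>b<r. l = e b" if "l \<in> J" for l using e that unfolding bij_betw_def by auto
  define P where "P l i = (if l \<in> J then - (\<Sum>a<r. C $$ (ei l, a) * pdiff i (F (e a))) else 0)" for l i
  have P: "P l i \<in> polys_in {..<n}" for l i
  proof (cases "l \<in> J")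
    case True
    then obtain b where "b < r" "l = e b" using ei2 by blast
    then show ?thesis unfolding P_def using True ei Cin pd
      by (auto intro!: subring_on_uminus[OF R] subring_on_sum[OF R] subring_on_mult[OF R])
  qed (simp add: P_def subring_on_0[OF R])
  have "peval \<Delta> x0 = 1"
  proof -
    interpret h: comm_ring_hom "\<lambda>F. peval F x0" by (rule comm_ring_hom_peval)
    have "map_mat (\<lambda>F. peval F x0) ?A = 1\<^sub>m r"
    proof (rule eq_matI)
      fix i j assume ij: "i < dim_row (1\<^sub>m r)" "j < dim_col (1\<^sub>m r)"
      have "e j = e i \<longleftrightarrow> i = j" using e ij unfolding bij_betw_def by (auto dest: inj_onD)
      then show "map_mat (\<lambda>F. peval F x0) ?A $$ (i, j) = 1\<^sub>m r $$ (i, j)"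
        using ij F(2)[OF eJ eJ, of i j] by (auto simp: peval_pdiff)
    qed auto
    then show ?thesis unfolding \<Delta>_def using h.hom_det[of ?A] by simp
  qed
  moreover have "tan x = gspace n J (\<lambda>l i. peval (P l i) x / peval \<Delta> x)"
    if x: "x \<in> X - singular_locus d n X" and dx: "peval \<Delta> x \<noteq> 0" for x
  \<comment> \<open>The equations only give an inclusion of \<open>tan x\<close> in the graph.
    Smoothness of \<open>x\<close> makes both spaces \<open>d\<close>-dimensional, hence
    equal.\<close>
  proof (rule subspace_eq_if_dim_eq[OF _ Jn cI smooth_Grass[OF x] d], rule subsetI)
    fix v assume v: "v \<in> tan x"
    have "v j = (\<Sum>i\<in>?I. peval (P j i) x / peval \<Delta> x * v i)" if jJ: "j \<in> J" for j
    proof -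
      obtain b where b: "b < r" "j = e b" using ei2[OF jJ] by blast
      have ebJ: "e b \<in> J" using jJ b(2) by simp
      have eq: "(\<Sum>l\<in>J. dval l x (F (e a)) * v l) = - (\<Sum>i\<in>?I. dval i x (F (e a)) * v i)" if "a < r" for a
      proof -
        have "(\<Sum>l<n. dval l x (F (e a)) * v l) = 0" using v F(1)[OF eJ[OF that]] unfolding tan_iff IX_def by simp
        then show ?thesis unfolding split by (simp add: eq_neg_iff_add_eq_0)
      qed
      have CAx: "(\<Sum>a<r. peval (C $$ (b, a)) x * dval (e c) x (F (e a))) = (if b = c then peval \<Delta> x else 0)" if "c < r" for c
        using arg_cong[OF CA[OF b(1) that], of "\<lambda>F. peval F x"]
        by (simp add: peval_sum peval_mult peval_pdiff peval_0 split: if_splits)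
      have reJ: "(\<Sum>l\<in>J. f l) = (\<Sum>c<r. f (e c))" for f :: "nat \<Rightarrow> 'k"
        using e unfolding bij_betw_def by (metis sum.reindex_cong)
      have "peval \<Delta> x * v j = (\<Sum>c<r. (if b = c then peval \<Delta> x else 0) * v (e c))"
      proof -
        have "(\<Sum>c<r. (if b = c then peval \<Delta> x else 0) * v (e c)) = (\<Sum>c<r. if c = b then peval \<Delta> x * v j else 0)"
          by (intro sum.cong) (auto simp: b(2))
        then show ?thesis using b(1) by simp
      qed
      also have "\<dots> = (\<Sum>c<r. \<Sum>a<r. peval (C $$ (b, a)) x * (dval (e c) x (F (e a)) * v (e c)))"
        by (intro sum.cong refl) (simp add: CAx[symmetric] sum_distrib_right mult.assoc)
      also have "\<dots> = (\<Sum>a<r. peval (C $$ (b, a)) x * (\<Sum>l\<in>J. dval l x (F (e a)) * v l))"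
        by (subst sum.swap) (simp add: sum_distrib_left reJ)
      also have "\<dots> = (\<Sum>a<r. \<Sum>i\<in>?I. - (peval (C $$ (b, a)) x * dval i x (F (e a)) * v i))"
        by (intro sum.cong refl) (simp add: eq sum_distrib_left sum_negf mult.assoc)
      also have "\<dots> = (\<Sum>i\<in>?I. peval (P j i) x * v i)"
        by (subst sum.swap) (intro sum.cong refl, simp add: P_def ebJ b ei peval_uminus peval_sum peval_mult peval_pdiff sum_distrib_right sum_negf)
      finally have "v j = (\<Sum>i\<in>?I. peval (P j i) x * v i) / peval \<Delta> x" using dx by (simp add: eq_divide_eq mult.commute)
      then show ?thesis by (simp add: sum_divide_distrib)
    qed
    then show "v \<in> gspace n J (\<lambda>l i. peval (P l i) x / peval \<Delta> x)" unfolding gspace_def using v tan_kpoints by blast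
  qed
  ultimately show ?thesis using Jn cI \<Delta> P by (intro exI[of _ J] exI[of _ P] exI[of _ \<Delta>]) auto
qed

end

section \<open>Graph coordinates on the Grassmannian\<close>

lemma is_frame_reindex:
  assumes J: "J \<subseteq> {..<n}" and e: "bij_betw e {..<d} ({..<n} - J)"
  shows "is_frame d (gspace n J c) (\<lambda>i. gvec J c (e i))"
proof -
  have im: "(\<lambda>i. gvec J c (e i)) ` {..<d} = gvec J c ` ({..<n} - J)"
    using e unfolding bij_betw_def by (metis image_image)
  have "inj_on (\<lambda>i. gvec J c (e i)) {..<d}"
    using comp_inj_on[of e "{..<d}" "gvec J c"] e gspace_frame(1)[OF J, of c] unfolding bij_betw_def comp_def by simp
  then show ?thesis unfolding is_frame_def im using gspace_frame(2,3)[OF J, of c] by (intro conjI)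
qed

lemma gspace_cong:
  assumes "\<And>j i. j \<in> J \<Longrightarrow> i \<in> {..<n} - J \<Longrightarrow> c j i = c' j i" shows "gspace n J c = gspace n J c'"
proof -
  have "(\<Sum>i\<in>{..<n} - J. c j i * v i) = (\<Sum>i\<in>{..<n} - J. c' j i * v i)" if "j \<in> J" for j v
    using assms that by (intro sum.cong) auto
  then show ?thesis unfolding gspace_def by auto
qed

text \<open>The entries of the matrix whose graph is \<open>V\<close>, as ratios of Pluecker coordinates.\<close>

definition graph_coord :: "nat \<Rightarrow> (nat \<Rightarrow> 'k::field) set \<Rightarrow> nat \<Rightarrow> nat \<Rightarrow> 'k" where
  "graph_coord d V j i = (-1) ^ (i + (d - 1)) * (pluecker d V (insert j ({..<d} - {i})) / pluecker d V {..<d})"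

lemma pluecker_graph:
  assumes dn: "d \<le> n"
  shows "pluecker d (gspace n {d..<n} c) {..<d} \<noteq> 0"
    and "i < d \<Longrightarrow> j \<in> {d..<n} \<Longrightarrow> graph_coord d (gspace n {d..<n} c) j i = c j i"
proof -
  obtain u where u: "u \<noteq> 0" "\<And>I. pluecker d (gspace n {d..<n} c) I = u * minor d (base_vec d n c) I"
    using pluecker_frame[OF graph_frame[OF dn, of c]] by blast
  show "pluecker d (gspace n {d..<n} c) {..<d} \<noteq> 0" using u minor_base[OF dn, of c] by simp
  assume "i < d" "j \<in> {d..<n}"
  moreover have "(-1) ^ k * ((-1) ^ k * y) = y" for k and y :: 'a
    by (simp add: mult.assoc[symmetric] power_mult_distrib[symmetric])
  ultimately show "graph_coord d (gspace n {d..<n} c) j i = c j i"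
    unfolding graph_coord_def u(2) minor_base[OF dn] using u(1) minor_swap[of i d j n c] by simp
qed

lemma gspace_graph_coord:
  assumes V: "V \<in> Grass d n" and d: "0 < d" "d \<le> n" and nz: "pluecker d V {..<d} \<noteq> 0"
  shows "V = gspace n {d..<n} (graph_coord d V)"
proof -
  obtain c where c: "V = gspace n {d..<n} c" using chart_is_graph[OF assms] by blast
  have "gspace n {d..<n} c = gspace n {d..<n} (graph_coord d V)"
  proof (rule gspace_cong)
    fix j i assume "j \<in> {d..<n}" "i \<in> {..<n} - {d..<n}"
    then show "c j i = graph_coord d V j i" unfolding c by (subst pluecker_graph(2)[OF d(2)]) auto
  qed
  then show ?thesis using c by simp
qed

lemma local_frac_poly_var: "i < n \<Longrightarrow> local_frac P (poly_fracs n) y (\<lambda>z. z i)"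
proof -
  assume "i < n"
  then have "sgl (sgl i 1) 1 \<in> polys_in {..<n}" by (intro polys_in_single) simp
  from local_frac_peval_affine[OF this] show ?thesis by (simp add: peval_single[abs_def])
qed

lemma pluecker_var_form:
  assumes I: "I \<subseteq> {..<n}" "card I = d"
  shows "sgl (sgl (Inr I) 1) (1::'k::field) \<in> pluecker_forms d n 1"
proof -
  have "finite {I. I \<subseteq> {..<n} \<and> card I = d}" by (rule finite_subset[of _ "Pow {..<n}"]) auto
  then have "(\<Sum>I' | I' \<subseteq> {..<n} \<and> card I' = d. lk (sgl (Inr I :: nat + nat set) (1::nat)) (Inr I')) = 1"
    using I by (simp add: lookup_single when_def)
  moreover have "sgl (sgl (Inr I) 1) (1::'k) \<in> polys_in (Inl ` {..<n} \<union> Inr ` {I. I \<subseteq> {..<n} \<and> card I = d})"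
    using I by (intro polys_in_single) simp
  ultimately show ?thesis unfolding pluecker_forms_def
    by (intro CollectI conjI ballI) (simp_all del: One_nat_def)
qed

lemma local_frac_plu_var: "i < n \<Longrightarrow> local_frac P (plu_fracs d n) y (\<lambda>z. fst z i)"
proof -
  assume i: "i < n"
  have "sgl (sgl (Inl i) 1) 1 \<in> pluecker_forms d n 0"
    using i unfolding pluecker_forms_def by (auto simp: polys_in_iff lookup_single)
  from plu_fracsI[OF this pluecker_forms_closed(3)[of 1]] show ?thesis
    unfolding local_frac_def
    by (intro exI conjI, assumption) (auto simp: pluecker_eval_hom peval_single pluecker_eval_def split: prod.split simp del: single_one)
qed

lemma local_frac_graph_coord:
  assumes dn: "d \<le> n" and P: "\<And>z. z \<in> P \<Longrightarrow> pluecker d (snd z) {..<d} \<noteq> 0" and y: "y \<in> P" and ij: "i < d" "j \<in> {d..<n}"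
  shows "local_frac P (plu_fracs d n) y (\<lambda>z. graph_coord d (snd z) j i :: 'k::field)"
proof -
  let ?I = "insert j ({..<d} - {i})"
  have "card ?I = d" "?I \<subseteq> {..<n}" using ij dn by (auto simp: card_insert_if)
  then have 1: "sgl (sgl (Inr ?I) 1) (1::'k) \<in> pluecker_forms d n 1" by (intro pluecker_var_form)
  have 2: "sgl (sgl (Inr {..<d}) 1) (1::'k) \<in> pluecker_forms d n 1" using dn by (intro pluecker_var_form) auto
  have ev: "pluecker_eval d (sgl (sgl (Inr I) 1) 1) z = pluecker d (snd z) I" for I z
    by (simp add: pluecker_eval_def peval_single split: prod.split)
  have "local_frac P (plu_fracs d n) y (\<lambda>z. pluecker d (snd z) ?I / pluecker d (snd z) {..<d})"
    unfolding local_frac_def using plu_fracsI[OF 1 2] P[OF y]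
    by (intro exI[of _ "pluecker_eval d (sgl (sgl (Inr ?I) 1) 1)"] exI[of _ "pluecker_eval d (sgl (sgl (Inr {..<d}) 1) 1)"])
       (simp add: ev del: One_nat_def)
  then show ?thesis unfolding graph_coord_def
    by (rule local_frac_mult[OF frac_closed_plu_fracs local_frac_const[OF frac_closed_plu_fracs]])
qed

section \<open>The Nash blowup and its part over the torus\<close>

context toric
begin

definition ZC :: "((nat \<Rightarrow> 'k::field) \<times> (nat \<Rightarrow> 'k) set) set" where
  "ZC = ztop (frac_space (X \<times> Grass d n) (plu_fracs d n)) closure_of gauss_graph d n X"

lemma ZC_sub: "ZC \<subseteq> X \<times> Grass d n"
  unfolding ZC_def using closure_of_subset_topspace topspace_frac_space[OF frac_closed_plu_fracs] by metis

lemma nash_eq: "nash_blowup d n X = frac_space ZC (plu_fracs d n)"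
proof -
  have "X \<times> Grass d n \<subseteq> kpoints n \<times> Grass d n" using X_kpoints by auto
  from subspace_on_frac_space[OF frac_closed_plu_fracs this]
  have 1: "subspace_on (affine_times_Grass d n) (X \<times> Grass d n) = frac_space (X \<times> Grass d n) (plu_fracs d n)"
    unfolding affine_times_Grass_eq .
  show ?thesis unfolding nash_blowup_def Let_def 1 ZC_def[symmetric]
    by (rule subspace_on_frac_space[OF frac_closed_plu_fracs ZC_sub])
qed

lemma gauss_in_ZC:
  assumes x: "x \<in> X - singular_locus d n X" shows "(x, tan x) \<in> ZC"
proof -
  have "gauss_graph d n X \<subseteq> X \<times> Grass d n" unfolding gauss_graph_def using smooth_Grass by auto
  then have "gauss_graph d n X \<subseteq> ZC" unfolding ZC_def
    by (intro closure_of_subset) (simp add: topspace_frac_space[OF frac_closed_plu_fracs])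
  then show ?thesis using x unfolding gauss_graph_def by blast
qed

abbreviation NY where "NY \<equiv> frac_space ZC (plu_fracs d n)"

text \<open>The closure \<open>ZC\<close> is taken over the whole smooth locus, which may exceed the
  torus. Near any smooth point the Pluecker coordinates of the tangent space are rational by
  \<open>tangent_fields\<close>, so an open condition on the graph becomes the non-vanishing of a
  polynomial, which can be met on the torus.\<close>

lemma torus_graph_dense:
  fixes U :: "((nat \<Rightarrow> 'k::alg_closed_field) \<times> (nat \<Rightarrow> 'k) set) set"
  assumes U: "openin (ztop NY) U" "U \<noteq> {}" and d: "0 < d"
  shows "\<exists>F\<in>polys_in {..<n}. psub g F \<noteq> 0 \<and> (\<forall>t. (\<forall>i. t i \<noteq> 0) \<longrightarrow> peval F (torus_point n g t) \<noteq> 0 \<longrightarrow>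
     (torus_point n g t, tan (torus_point n g t)) \<in> U)"
proof -
  note PQ = frac_closed_plu_fracs and Q = frac_closed_poly_fracs
  obtain z where z: "z \<in> U" using U(2) by blast
  obtain a b where ab: "(a, b) \<in> plu_fracs d n" "b z \<noteq> 0" "{p \<in> ZC. b p \<noteq> 0} \<subseteq> U"
    using openin_frac_space_basic[OF PQ U(1) z] by blast
  have zZ: "z \<in> ZC" using openin_frac_space_subset[OF PQ U(1)] z by blast
  obtain e F0 G where G: "b = pluecker_eval d G" "G \<in> pluecker_forms d n e" using ab(1) by (elim plu_fracsE)
  let ?O = "{p \<in> X \<times> Grass d n. b p \<noteq> 0}"
  have O: "openin (ztop (frac_space (X \<times> Grass d n) (plu_fracs d n))) ?O" by (rule openin_frac_basic[OF PQ ab(1)])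
  have zO: "z \<in> ?O" using zZ ZC_sub ab(2) by blast
  have "\<forall>T. z \<in> T \<and> openin (ztop (frac_space (X \<times> Grass d n) (plu_fracs d n))) T \<longrightarrow> (\<exists>y. y \<in> gauss_graph d n X \<and> y \<in> T)"
    using zZ unfolding ZC_def in_closure_of by (rule conjunct2)
  from mp[OF spec[OF this] conjI[OF zO O]] obtain q where q: "q \<in> gauss_graph d n X" "q \<in> ?O"
    by (elim exE conjE)
  from q(1) obtain x0 where x0q: "q = (x0, tan x0)" "x0 \<in> X - singular_locus d n X"
    unfolding gauss_graph_def by auto
  have x0: "x0 \<in> X - singular_locus d n X" "b (x0, tan x0) \<noteq> 0" using x0q q(2) by simp_all
  from tangent_fields[OF x0(1) d] obtain J P \<Delta> where J: "J \<subseteq> {..<n}" "card ({..<n} - J) = d" and \<Delta>: "\<Delta> \<in> polys_in {..<n}" "peval \<Delta> x0 \<noteq> 0"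
    and P': "\<forall>l i. P l i \<in> polys_in {..<n}"
    and tan_all: "\<forall>x\<in>X - singular_locus d n X. peval \<Delta> x \<noteq> 0 \<longrightarrow>
        tan x = gspace n J (\<lambda>l i. peval (P l i) x / peval \<Delta> x)"
    by (elim exE conjE) (rule that, assumption+)
  have P: "P l i \<in> polys_in {..<n}" for l i using P' by blast
  have tan_eq: "tan x = gspace n J (\<lambda>l i. peval (P l i) x / peval \<Delta> x)"
    if "x \<in> X - singular_locus d n X" "peval \<Delta> x \<noteq> 0" for x
    using bspec[OF tan_all that(1)] that(2) by (rule mp)
  obtain s where s: "bij_betw s {..<d} ({..<n} - J)"
    using J(2) ex_bij_betw_nat_finite[of "{..<n} - J"] by (auto simp: atLeast0LessThan)
  define w where "w x i = gvec J (\<lambda>l i. peval (P l i) x / peval \<Delta> x) (s i)" for x i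
  \<comment> \<open>Up to a nonzero factor, the denominator \<open>b\<close> along the Gauss graph,
    computed in a frame with rational entries.\<close>
  define \<Phi> where "\<Phi> x = peval G (case_sum x (minor d (w x)))" for x
  have b\<Phi>: "b (x, tan x) \<noteq> 0 \<longleftrightarrow> \<Phi> x \<noteq> 0" if x: "x \<in> X - singular_locus d n X" "peval \<Delta> x \<noteq> 0" for x
  proof -
    have "is_frame d (tan x) (w x)" unfolding tan_eq[OF x] w_def by (rule is_frame_reindex[OF J(1) s])
    from pluecker_eval_frame[OF this] obtain u where "u \<noteq> 0" "\<forall>e. \<forall>F\<in>pluecker_forms d n e.
        pluecker_eval d F (x, tan x) = u ^ e * peval F (case_sum x (minor d (w x)))" by blast
    then show ?thesis using G unfolding \<Phi>_def by simp
  qed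
  have x0X: "x0 \<in> X" using x0(1) by blast
  have "local_frac X (poly_fracs n) x0 \<Phi>" unfolding \<Phi>_def
  proof (rule local_frac_peval[OF Q])
    fix i m assume im: "m \<in> ks G" "i \<in> ks m"
    have "i \<in> Inl ` {..<n} \<union> Inr ` {I. I \<subseteq> {..<n} \<and> card I = d}"
      using G(2) im unfolding pluecker_forms_def polys_in_iff by blast
    then show "local_frac X (poly_fracs n) x0 (\<lambda>z. case_sum z (minor d (w z)) i)"
    proof
      assume "i \<in> Inl ` {..<n}"
      then show ?thesis using local_frac_poly_var by auto
    next
      assume "i \<in> Inr ` {I. I \<subseteq> {..<n} \<and> card I = d}"
      then obtain I where I: "i = Inr I" by blast
      have "local_frac X (poly_fracs n) x0 (\<lambda>z. w z i l)" for i l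
      proof -
        have 1: "local_frac X (poly_fracs n) x0 (\<lambda>z. peval (P l (s i)) z / peval \<Delta> z)"
          by (rule local_frac_divide[OF Q local_frac_peval_affine[OF P] local_frac_peval_affine[OF \<Delta>(1)] \<Delta>(2) x0X])
        show ?thesis unfolding w_def gvec_def using 1 local_frac_const[OF Q] by (cases "l = s i"; cases "l \<in> J") simp_all
      qed
      then show ?thesis unfolding I by (simp add: local_frac_minor[OF Q])
    qed
  qed
  from local_frac_polyD[OF this] obtain A B where AB: "A \<in> polys_in {..<n}" "B \<in> polys_in {..<n}" "peval B x0 \<noteq> 0"
    "\<forall>z\<in>X. peval B z \<noteq> 0 \<longrightarrow> \<Phi> z = peval A z / peval B z" by blast
  have "\<Phi> x0 \<noteq> 0" using b\<Phi>[OF x0(1) \<Delta>(2)] x0(2) by simp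
  then have "peval A x0 \<noteq> 0" using AB(3,4) x0X by auto
  then have nz: "peval (A * (B * \<Delta>)) x0 \<noteq> 0" using AB(3) \<Delta>(2) by (simp add: peval_mult)
  have in_A: "A * (B * \<Delta>) \<in> polys_in {..<n}" using AB(1,2) \<Delta>(1) by (intro subring_on_mult[OF subring_on_polys_in])
  have "psub g (A * (B * \<Delta>)) \<noteq> 0" using nz peval_eq_0[OF x0X in_A] by blast
  moreover have "(torus_point n g t, tan (torus_point n g t)) \<in> U"
    if t: "\<And>i. t i \<noteq> 0" and tp: "peval (A * (B * \<Delta>)) (torus_point n g t) \<noteq> 0" for t
  proof -
    let ?x = "torus_point n g t"
    have x: "?x \<in> X - singular_locus d n X" by (rule torus_smooth[OF t])
    have "peval A ?x \<noteq> 0" "peval B ?x \<noteq> 0" "peval \<Delta> ?x \<noteq> 0" using tp by (auto simp: peval_mult)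
    then have "\<Phi> ?x \<noteq> 0" using AB(4) x by auto
    then have "b (?x, tan ?x) \<noteq> 0" using b\<Phi>[OF x \<open>peval \<Delta> ?x \<noteq> 0\<close>] by simp
    then show ?thesis using ab(3) gauss_in_ZC[OF x] by blast
  qed
  ultimately show ?thesis using in_A by blast
qed

lemma irreducible_nash:
  assumes d: "0 < d"
  shows "irreducible_variety (NY :: (_, 'k::alg_closed_field) fspace)"
  unfolding irreducible_variety_def topspace_frac_space[OF frac_closed_plu_fracs]
proof (intro conjI allI impI)
  show "ZC \<noteq> ({} :: ((nat \<Rightarrow> 'k) \<times> (nat \<Rightarrow> 'k) set) set)"
    using gauss_in_ZC[OF torus_smooth[of "\<lambda>_. 1"]] by auto
  fix U V :: "((nat \<Rightarrow> 'k) \<times> (nat \<Rightarrow> 'k) set) set"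
  assume UV: "openin (ztop NY) U \<and> openin (ztop NY) V \<and> U \<noteq> {} \<and> V \<noteq> {}"
  obtain F where F: "F \<in> polys_in {..<n}" "psub g F \<noteq> 0" "\<forall>t. (\<forall>i. t i \<noteq> 0) \<longrightarrow> peval F (torus_point n g t) \<noteq> 0 \<longrightarrow>
     (torus_point n g t, tan (torus_point n g t)) \<in> U" using torus_graph_dense[of U] UV d by blast
  obtain G where G: "G \<in> polys_in {..<n}" "psub g G \<noteq> 0" "\<forall>t. (\<forall>i. t i \<noteq> 0) \<longrightarrow> peval G (torus_point n g t) \<noteq> 0 \<longrightarrow>
     (torus_point n g t, tan (torus_point n g t)) \<in> V" using torus_graph_dense[of V] UV d by blast
  have "F * G \<in> polys_in {..<n}" "psub g (F * G) \<noteq> 0"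
    using F G subring_on_mult[OF subring_on_polys_in] by (auto simp: psub_mult)
  from torus_dense[OF this] obtain t where "\<forall>i. t i \<noteq> 0" "peval (F * G) (torus_point n g t) \<noteq> 0" by blast
  then have "(torus_point n g t, tan (torus_point n g t)) \<in> U \<inter> V" using F(3) G(3) by (auto simp: peval_mult)
  then show "U \<inter> V \<noteq> {}" by blast
qed

text \<open>The pairs whose subspace projects isomorphically onto the first \<open>d\<close>
  coordinates.\<close>

definition chart :: "((nat \<Rightarrow> 'k::field) \<times> (nat \<Rightarrow> 'k) set) set" where
  "chart = {z \<in> ZC. pluecker d (snd z) {..<d} \<noteq> 0}"

lemma chart_open: "openin (ztop NY) (chart :: ((nat \<Rightarrow> 'k::field) \<times> (nat \<Rightarrow> 'k) set) set)"
proof -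
  have "sgl (sgl (Inr {..<d}) 1) (1::'k) \<in> pluecker_forms d n 1" using d_le_n by (intro pluecker_var_form) auto
  from openin_frac_basic[OF frac_closed_plu_fracs plu_fracsI[OF this this], of ZC]
  show ?thesis unfolding chart_def by (simp add: pluecker_eval_def peval_single case_prod_unfold)
qed

text \<open>A nonzero value persists on a nonempty open set, which meets the graph over the torus.
  Identities between functions on the chart may thus be checked at torus points.\<close>

lemma chart_vanish:
  fixes f :: "(nat \<Rightarrow> 'k::alg_closed_field) \<times> (nat \<Rightarrow> 'k) set \<Rightarrow> 'k"
  assumes d: "0 < d" and f: "\<And>z. z \<in> chart \<Longrightarrow> local_frac chart (plu_fracs d n) z f"
    and 0: "\<And>t. (\<And>i. t i \<noteq> 0) \<Longrightarrow> f (torus_point n g t, gspace n {d..<n} (tcoef t)) = 0"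
    and z: "z \<in> chart"
  shows "f z = 0"
proof (rule ccontr)
  assume nz: "f z \<noteq> 0"
  let ?W = "{z \<in> chart. f z \<noteq> 0}"
  have "openin (ztop (frac_space chart (plu_fracs d n))) ?W"
    by (rule openin_local_frac_nonzero[OF frac_closed_plu_fracs f])
  then have "openin (ztop NY) ?W" using openin_frac_open_subspace[OF frac_closed_plu_fracs chart_open] by blast
  moreover have "?W \<noteq> {}" using z nz by blast
  ultimately obtain F where F: "F \<in> polys_in {..<n}" "psub g F \<noteq> 0" "\<forall>t. (\<forall>i. t i \<noteq> 0) \<longrightarrow> peval F (torus_point n g t) \<noteq> 0 \<longrightarrow>
     (torus_point n g t, tan (torus_point n g t)) \<in> ?W" using torus_graph_dense[of ?W] d by blast
  obtain t where t: "\<And>i. t i \<noteq> 0" "peval F (torus_point n g t) \<noteq> 0" using torus_dense[OF F(1,2)] by blast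
  then have "(torus_point n g t, tan (torus_point n g t)) \<in> ?W" using F(3) by blast
  then show False using 0[OF t(1)] unfolding tan_torus[OF t(1)] by simp
qed

end

section \<open>Normalization over a radicial image of a normal variety\<close>

text \<open>By additivity the \<open>q\<close>-th power of \<open>x - y\<close> is zero.\<close>

lemma root_unique:
  fixes x y :: "'k::idom"
  assumes frob: "\<And>x y::'k. (x + y) ^ q = x ^ q + y ^ q" and eq: "x ^ q = y ^ q"
  shows "x = y"
  using frob[of "x - y" y] eq by simp

section \<open>Rational functions with regular powers\<close>

context irreducible_frac_space
begin

lemma rat_funsI: "g \<in> regular Y U \<Longrightarrow> U \<noteq> {} \<Longrightarrow> g \<in> rat_funs Y"
  unfolding rat_funs_def using regular_open by blast

lemma rat_funs_binop:
  assumes f: "f \<in> rat_funs Y" and g: "g \<in> rat_funs Y"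
    and loc: "\<And>f g z. local_frac Z Q z f \<Longrightarrow> local_frac Z Q z g \<Longrightarrow> local_frac Z Q z (\<lambda>x. b (f x) (g x))"
  shows "(\<lambda>x. b (f x) (g x)) \<in> rat_funs Y"
proof -
  obtain U where U: "openin (ztop Y) U" "U \<noteq> {}" "f \<in> regular Y U" using f unfolding rat_funs_def by blast
  obtain V where V: "openin (ztop Y) V" "V \<noteq> {}" "g \<in> regular Y V" using g unfolding rat_funs_def by blast
  have "(\<lambda>x. b (f x) (g x)) \<in> regular Y (U \<inter> V)"
    by (rule regularI[OF openin_Int[OF U(1) V(1)] loc]) (use regular_local[OF U(3)] regular_local[OF V(3)] in auto)
  then show ?thesis by (rule rat_funsI[OF _ meets[OF U(1) V(1) U(2) V(2)]])
qed

lemma rat_funs_add: "f \<in> rat_funs Y \<Longrightarrow> g \<in> rat_funs Y \<Longrightarrow> (\<lambda>z. f z + g z) \<in> rat_funs Y"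
  by (rule rat_funs_binop[where b = "(+)", OF _ _ local_frac_add[OF Q]])

lemma rat_funs_mult: "f \<in> rat_funs Y \<Longrightarrow> g \<in> rat_funs Y \<Longrightarrow> (\<lambda>z. f z * g z) \<in> rat_funs Y"
  by (rule rat_funs_binop[where b = "(*)", OF _ _ local_frac_mult[OF Q]])

lemma rat_funs_const: "(\<lambda>_. c) \<in> rat_funs Y"
  by (rule rat_funsI[OF regularI[OF openin_topspace local_frac_const[OF Q]]]) (use irr in \<open>simp add: irreducible_variety_def\<close>)

lemma rat_funs_power: "f \<in> rat_funs Y \<Longrightarrow> (\<lambda>z. f z ^ n) \<in> rat_funs Y"
  by (induction n) (simp_all add: rat_funs_const rat_funs_mult)

text \<open>The integral equation is \<open>f ^ q - g = 0\<close>, with all intermediate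
  coefficients zero.\<close>

lemma int_closure_root:
  assumes f: "f \<in> rat_funs Y" and g: "g \<in> regular Y U" "U \<noteq> {}" and eq: "rat_eq Y (\<lambda>z. f z ^ q) g" and q: "0 < q"
  shows "f \<in> int_closure Y U"
proof -
  obtain V where V: "openin (ztop Y) V" "V \<noteq> {}" "\<forall>z\<in>V. f z ^ q = g z" using eq unfolding rat_eq_def by blast
  have Uo: "openin (ztop Y) U" by (rule regular_open[OF g(1)])
  have W: "openin (ztop Y) (U \<inter> V)" "U \<inter> V \<noteq> {}" using Uo V(1) meets[OF Uo V(1) g(2) V(2)] by auto
  define a where "a i z = (if i = 0 then - g z else 0)" for i :: nat and z
  have a: "a i \<in> regular Y U" for i
  proof (rule regularI[OF Uo])
    fix y assume "y \<in> U"
    from local_frac_mult[OF Q local_frac_const[OF Q, of Z y "-1"] regular_local[OF g(1) this]]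
    show "local_frac Z Q y (a i)" using local_frac_const[OF Q, of Z y 0] by (cases "i = 0") (simp_all add: a_def[abs_def])
  qed
  have "(\<Sum>i<q. a i z * f z ^ i) = - g z" for z
    using q by (subst sum.remove[of _ 0]) (auto simp: a_def intro!: sum.neutral)
  then show ?thesis unfolding int_closure_def using f W a V(3)
    by (intro CollectI conjI exI[of _ q] exI[of _ a] exI[of _ "U \<inter> V"]) auto
qed

lemma openin_npoints:
  assumes V: "openin (ztop Y) V"
  shows "openin (ztop (normalization Y)) {p \<in> npoints. fst p \<in> V}"
proof (cases "V = {}")
  case False
  \<comment> \<open>Since homomorphisms fix constants, the constant 1 as numerator and denominator
    cuts out precisely the fibres over \<open>V\<close>.\<close>
  let ?b = "\<lambda>(y, \<phi>). if y \<in> V then \<phi> (\<lambda>_. 1) else (0::'k)"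
  have "(\<lambda>_. 1) \<in> regular Y V" by (rule regularI[OF V local_frac_const[OF Q]])
  then have "(\<lambda>_. 1) \<in> int_closure Y V" by (rule regular_imp_int_closure[OF rat_eq_refl _ False])
  then have "(?b, ?b) \<in> nfracs" by (intro nfracsI V)
  moreover have "{p \<in> npoints. fst p \<in> V} = {p \<in> npoints. ?b p \<noteq> 0}"
    by (auto simp: npoints_def alg_homs_def split: if_splits)
  ultimately show ?thesis unfolding ztop_normalization
    by (intro topology_generated_by_Basis) blast
qed simp

end

text \<open>
  The bijective birational morphism \<open>h\<close> identifies \<open>q\<close>-th powers of functions on \<open>X\<close> with functions
  on \<open>U0\<close>. Here \<open>q\<close> is \<open>1\<close> or a power of the characteristic.
\<close>

locale radicial_cover = irreducible_frac_space Z Q + cov: irreducible_frac_space X QX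
  for Z :: "'p set" and Q :: "(('p \<Rightarrow> 'k::field) \<times> ('p \<Rightarrow> 'k)) set"
    and X :: "'x set" and QX :: "(('x \<Rightarrow> 'k) \<times> ('x \<Rightarrow> 'k)) set" +
  fixes U0 :: "'p set" and h :: "'x \<Rightarrow> 'p" and q :: nat
  assumes U0: "openin (ztop Y) U0"
    and X_normal: "\<And>y f. y \<in> X \<Longrightarrow> f \<in> local_int_closure cov.Y y \<Longrightarrow>
          \<exists>U g. openin (ztop cov.Y) U \<and> y \<in> U \<and> g \<in> regular cov.Y U \<and> rat_eq cov.Y f g"
    and h: "morphism cov.Y (frac_space U0 Q) h"
    and h_bij: "bij_betw h X U0"
    and dominant: "\<And>V. openin (ztop Y) V \<Longrightarrow> V \<noteq> {} \<Longrightarrow> \<exists>x\<in>X. h x \<in> V"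
    and q: "0 < q" and frob: "\<And>x y::'k. (x + y) ^ q = x ^ q + y ^ q"
    and numerator_regular: "\<And>a b. (a, b) \<in> QX \<Longrightarrow> a \<in> regular (frac_space X QX) X"
    and descend: "\<And>a b. (a, b) \<in> QX \<Longrightarrow> \<exists>F G. F \<in> rat_funs Y \<and> G \<in> regular Y U0 \<and>
          rat_eq cov.Y (\<lambda>x. F (h x)) a \<and> (\<forall>x\<in>X. G (h x) = a x ^ q)"
begin

lemma tops: "topspace (ztop cov.Y) = X" "topspace (ztop (frac_space U0 Q)) = U0"
  by (rule topspace_frac_space[OF cov.Q], rule topspace_frac_space[OF Q])

lemma X_open: "openin (ztop cov.Y) X" using openin_topspace[of "ztop cov.Y"] unfolding tops .

lemma hU0: "x \<in> X \<Longrightarrow> h x \<in> U0" using h_bij by (auto simp: bij_betw_def)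

lemma pull_open: 
  assumes V: "openin (ztop Y) V" shows "openin (ztop cov.Y) {x \<in> X. h x \<in> V}"
proof -
  have "openin (ztop (frac_space U0 Q)) (V \<inter> U0)"
    unfolding openin_frac_open_subspace[OF Q U0] using V U0 by auto
  then have "openin (ztop cov.Y) {x \<in> X. h x \<in> V \<inter> U0}" using h unfolding morphism_def continuous_map tops by blast
  moreover have "{x \<in> X. h x \<in> V \<inter> U0} = {x \<in> X. h x \<in> V}" using hU0 by auto
  ultimately show ?thesis by simp
qed

lemma pull_regular:
  assumes a: "a \<in> regular Y V" shows "(\<lambda>x. a (h x)) \<in> regular cov.Y {x \<in> X. h x \<in> V}"
proof -
  have o: "openin (ztop Y) (V \<inter> U0)" using regular_open[OF a] U0 by auto
  have o': "openin (ztop (frac_space U0 Q)) (V \<inter> U0)"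
    unfolding openin_frac_open_subspace[OF Q U0] using o by auto
  have "a \<in> regular Y (V \<inter> U0)" by (rule regular_restrict[OF Q a o]) simp
  then have "a \<in> regular (frac_space U0 Q) (V \<inter> U0)" unfolding regular_frac_open_subspace[OF Q U0] by simp
  then have "a \<circ> h \<in> regular cov.Y {x \<in> X. h x \<in> V \<inter> U0}" using h o' unfolding morphism_def tops by blast
  moreover have "{x \<in> X. h x \<in> V \<inter> U0} = {x \<in> X. h x \<in> V}" using hU0 by auto
  ultimately show ?thesis by (simp add: comp_def)
qed

lemma pull_rat_eq: "rat_eq Y f g \<Longrightarrow> rat_eq cov.Y (\<lambda>x. f (h x)) (\<lambda>x. g (h x))"
proof -
  assume "rat_eq Y f g"
  then obtain V where V: "openin (ztop Y) V" "V \<noteq> {}" "\<forall>z\<in>V. f z = g z" unfolding rat_eq_def by blast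
  show ?thesis unfolding rat_eq_def using pull_open[OF V(1)] dominant[OF V(1,2)] V(3)
    by (intro exI[of _ "{x \<in> X. h x \<in> V}"]) auto
qed

text \<open>Where both functions are regular, disagreement is an open condition. By dominance its
  preimage is nonempty, and it would meet the open set where the pullbacks agree.\<close>

lemma push_rat_eq:
  assumes f: "f \<in> rat_funs Y" and g: "g \<in> rat_funs Y" and eq: "rat_eq cov.Y (\<lambda>x. f (h x)) (\<lambda>x. g (h x))"
  shows "rat_eq Y f g"
proof -
  obtain U where U: "openin (ztop Y) U" "U \<noteq> {}" "f \<in> regular Y U" using f unfolding rat_funs_def by blast
  obtain V where V: "openin (ztop Y) V" "V \<noteq> {}" "g \<in> regular Y V" using g unfolding rat_funs_def by blast
  obtain W where W: "openin (ztop cov.Y) W" "W \<noteq> {}" "\<forall>x\<in>W. f (h x) = g (h x)" using eq unfolding rat_eq_def by blast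
  have "f z = g z" if z: "z \<in> U \<inter> V" for z
  proof (rule ccontr)
    assume neq: "f z \<noteq> g z"
    have zZ: "z \<in> Z" using openin_frac_space_subset[OF Q U(1)] z by blast
    have fl: "local_frac Z Q z f" and gl: "local_frac Z Q z g"
      using regular_local[OF U(3)] regular_local[OF V(3)] z by auto
    have "local_frac Z Q z (\<lambda>z. f z + (-1) * g z)"
      by (rule local_frac_add[OF Q fl local_frac_mult[OF Q local_frac_const[OF Q] gl]])
    from local_frac_inverse[OF Q this _ zZ] obtain a b where ab: "(a, b) \<in> Q" "b z \<noteq> 0"
      "\<forall>z\<in>Z. b z \<noteq> 0 \<longrightarrow> f z + (-1) * g z \<noteq> 0" using neq by auto
    let ?D = "{z \<in> Z. b z \<noteq> 0}"
    have D: "openin (ztop Y) ?D" "?D \<noteq> {}" using openin_frac_basic[OF Q ab(1)] zZ ab(2) by auto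
    have "{x \<in> X. h x \<in> ?D} \<noteq> {}" using dominant[OF D] by blast
    then obtain x where x: "x \<in> W" "h x \<in> ?D" using cov.meets[OF W(1) pull_open[OF D(1)] W(2)] by blast
    have "f (h x) + (-1) * g (h x) \<noteq> 0" using ab(3) x(2) by blast
    moreover have "f (h x) = g (h x)" using W(3) x(1) by blast
    ultimately show False by simp
  qed
  then show ?thesis unfolding rat_eq_def using meets[OF U(1) V(1) U(2) V(2)] U(1) V(1)
    by (intro exI[of _ "U \<inter> V"]) auto
qed

lemma pull_int_closure:
  assumes f: "f \<in> int_closure Y U" 
  shows "(\<lambda>x. f (h x)) \<in> int_closure cov.Y {x \<in> X. h x \<in> U}"
proof -
  obtain U1 where U1: "openin (ztop Y) U1" "U1 \<noteq> {}" "f \<in> regular Y U1"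
    using f unfolding int_closure_def rat_funs_def by blast
  obtain m a W where a: "\<And>i. i < m \<Longrightarrow> a i \<in> regular Y U" and W: "openin (ztop Y) W" "W \<noteq> {}" "W \<subseteq> U"
    and eq: "\<And>z. z \<in> W \<Longrightarrow> f z ^ m + (\<Sum>i<m. a i z * f z ^ i) = 0"
    using f unfolding int_closure_def by blast
  have "(\<lambda>x. f (h x)) \<in> rat_funs cov.Y" using dominant[OF U1(1,2)]
    by (intro cov.rat_funsI[OF pull_regular[OF U1(3)]]) auto
  moreover have "{x \<in> X. h x \<in> W} \<noteq> {}" using dominant[OF W(1,2)] by blast
  ultimately show ?thesis unfolding int_closure_def using pull_regular[OF a] pull_open[OF W(1)] W(3) eq
    by (intro CollectI conjI exI[of _ m] exI[of _ "\<lambda>i x. a i (h x)"] exI[of _ "{x \<in> X. h x \<in> W}"]) auto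
qed

lemma pull_local_int_closure:
  "x \<in> X \<Longrightarrow> f \<in> local_int_closure Y (h x) \<Longrightarrow> (\<lambda>x. f (h x)) \<in> local_int_closure cov.Y x"
  unfolding local_int_closure_def using pull_int_closure pull_open by blast

text \<open>The \<open>q\<close>-th powers of numerator and denominator descend, so the
  \<open>q\<close>-th power of a local fraction on \<open>X\<close> is regular near
  \<open>h x\<close>.\<close>

lemma root_local:
  assumes x: "x \<in> X" and f: "local_frac X QX x f"
  shows "\<exists>U g. h x \<in> U \<and> g \<in> regular Y U \<and> (\<forall>x'\<in>X. h x' \<in> U \<longrightarrow> f x' ^ q = g (h x'))"
proof -
  obtain a b where ab: "(a, b) \<in> QX" "b x \<noteq> 0" "\<forall>z\<in>X. b z \<noteq> 0 \<longrightarrow> f z = a z / b z"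
    using f unfolding local_frac_def by blast
  obtain G where G: "G \<in> regular Y U0" "\<forall>x\<in>X. G (h x) = a x ^ q" using descend[OF ab(1)] by blast
  obtain H where H: "H \<in> regular Y U0" "\<forall>x\<in>X. H (h x) = b x ^ q"
    using descend[OF frac_closed_swap[OF cov.Q ab(1)]] by blast
  let ?U = "{z \<in> U0. H z \<noteq> 0}"
  have loc: "local_frac U0 Q z H" if "z \<in> U0" for z
    by (rule local_frac_mono[OF regular_local[OF H(1) that] openin_frac_space_subset[OF Q U0]])
  have "openin (ztop Y) ?U"
    using openin_local_frac_nonzero[OF Q loc] unfolding openin_frac_open_subspace[OF Q U0] by blast
  moreover have "local_frac Z Q z (\<lambda>z. G z / H z)" if "z \<in> ?U" for z
    using that openin_frac_space_subset[OF Q U0]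
    by (intro local_frac_divide[OF Q] regular_local[OF G(1)] regular_local[OF H(1)]) auto
  ultimately have "(\<lambda>z. G z / H z) \<in> regular Y ?U" by (rule regularI)
  moreover have "f x' ^ q = G (h x') / H (h x')" if x': "x' \<in> X" "h x' \<in> ?U" for x'
  proof -
    have "b x' \<noteq> 0" using x' H(2) q by (auto simp: zero_power)
    then show ?thesis using ab(3) G(2) H(2) x'(1) by (simp add: power_divide)
  qed
  moreover have "h x \<in> ?U" using hU0[OF x] H(2) x ab(2) by simp
  ultimately show ?thesis by (intro exI[of _ ?U] exI[of _ "\<lambda>z. G z / H z"]) blast
qed

text \<open>An integral \<open>f\<close> pulls back to an integral function on \<open>X\<close>,
  which is regular at \<open>x\<close> by normality, and its \<open>q\<close>-th power descends.
  Conversely \<open>f ^ q = g\<close> is an integral equation. In this form the integral closure at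
  \<open>h x\<close> is visibly closed under sums and products.\<close>

lemma local_int_closure_iff:
  assumes x: "x \<in> X"
  shows "f \<in> local_int_closure Y (h x) \<longleftrightarrow>
    f \<in> rat_funs Y \<and> (\<exists>U g. h x \<in> U \<and> g \<in> regular Y U \<and> rat_eq Y (\<lambda>z. f z ^ q) g)"
proof
  assume f: "f \<in> local_int_closure Y (h x)"
  then have fr: "f \<in> rat_funs Y" unfolding local_int_closure_def int_closure_def by blast
  obtain V g0 where g0: "x \<in> V" "g0 \<in> regular cov.Y V" "rat_eq cov.Y (\<lambda>x. f (h x)) g0"
    using X_normal[OF x pull_local_int_closure[OF x f]] by blast
  obtain U g where g: "h x \<in> U" "g \<in> regular Y U" "\<forall>x'\<in>X. h x' \<in> U \<longrightarrow> g0 x' ^ q = g (h x')"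
    using root_local[OF x cov.regular_local[OF g0(2,1)]] by blast
  have "rat_eq cov.Y (\<lambda>x. g0 x ^ q) (\<lambda>x. g (h x))" unfolding rat_eq_def
    using pull_open[OF regular_open[OF g(2)]] g(1,3) x by (intro exI[of _ "{x \<in> X. h x \<in> U}"]) auto
  then have "rat_eq cov.Y (\<lambda>x. f (h x) ^ q) (\<lambda>x. g (h x))"
    by (rule cov.rat_eq_trans[OF cov.rat_eq_binop[where b = "\<lambda>u _. u ^ q", OF g0(3) g0(3)]])
  moreover have "U \<noteq> {}" using g(1) by blast
  ultimately have "rat_eq Y (\<lambda>z. f z ^ q) g"
    by (intro push_rat_eq[OF rat_funs_power[OF fr] rat_funsI[OF g(2)]])
  then show "f \<in> rat_funs Y \<and> (\<exists>U g. h x \<in> U \<and> g \<in> regular Y U \<and> rat_eq Y (\<lambda>z. f z ^ q) g)"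
    using fr g by blast
next
  assume "f \<in> rat_funs Y \<and> (\<exists>U g. h x \<in> U \<and> g \<in> regular Y U \<and> rat_eq Y (\<lambda>z. f z ^ q) g)"
  then obtain U g where g: "f \<in> rat_funs Y" "h x \<in> U" "g \<in> regular Y U" "rat_eq Y (\<lambda>z. f z ^ q) g" by blast
  have "f \<in> int_closure Y U" by (rule int_closure_root[OF g(1,3) _ g(4) q]) (use g(2) in blast)
  then show "f \<in> local_int_closure Y (h x)"
    unfolding local_int_closure_def using regular_open[OF g(3)] g(2) by blast
qed

lemma local_int_closure_add:
  assumes x: "x \<in> X" and f: "f \<in> local_int_closure Y (h x)" and f': "f' \<in> local_int_closure Y (h x)"
  shows "(\<lambda>z. f z + f' z) \<in> local_int_closure Y (h x)" "(\<lambda>z. f z * f' z) \<in> local_int_closure Y (h x)"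
proof -
  obtain U g where g: "f \<in> rat_funs Y" "h x \<in> U" "g \<in> regular Y U" "rat_eq Y (\<lambda>z. f z ^ q) g"
    using f unfolding local_int_closure_iff[OF x] by blast
  obtain U' g' where g': "f' \<in> rat_funs Y" "h x \<in> U'" "g' \<in> regular Y U'" "rat_eq Y (\<lambda>z. f' z ^ q) g'"
    using f' unfolding local_int_closure_iff[OF x] by blast
  have o: "openin (ztop Y) (U \<inter> U')" "h x \<in> U \<inter> U'" using regular_open[OF g(3)] regular_open[OF g'(3)] g(2) g'(2) by auto
  have l: "local_frac Z Q z g" "local_frac Z Q z g'" if "z \<in> U \<inter> U'" for z
    using that regular_local[OF g(3)] regular_local[OF g'(3)] by auto
  have "(\<lambda>z. g z + g' z) \<in> regular Y (U \<inter> U')" by (rule regularI[OF o(1) local_frac_add[OF Q l]])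
  moreover have "rat_eq Y (\<lambda>z. (f z + f' z) ^ q) (\<lambda>z. g z + g' z)"
    unfolding frob by (rule rat_eq_binop[OF g(4) g'(4)])
  ultimately show "(\<lambda>z. f z + f' z) \<in> local_int_closure Y (h x)"
    unfolding local_int_closure_iff[OF x] using rat_funs_add[OF g(1) g'(1)] o(2) by blast
  have "(\<lambda>z. g z * g' z) \<in> regular Y (U \<inter> U')" by (rule regularI[OF o(1) local_frac_mult[OF Q l]])
  moreover have "rat_eq Y (\<lambda>z. (f z * f' z) ^ q) (\<lambda>z. g z * g' z)"
    unfolding power_mult_distrib by (rule rat_eq_binop[OF g(4) g'(4)])
  ultimately show "(\<lambda>z. f z * f' z) \<in> local_int_closure Y (h x)"
    unfolding local_int_closure_iff[OF x] using rat_funs_mult[OF g(1) g'(1)] o(2) by blast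
qed

lemma local_int_closure_const: "x \<in> X \<Longrightarrow> (\<lambda>_. c) \<in> local_int_closure Y (h x)"
  by (rule regular_imp_local_int_closure[OF rat_eq_refl regularI[OF U0 local_frac_const[OF Q]] hU0])

text \<open>Evaluation of the pullback at \<open>x\<close>; it turns out to be the only point of the
  normalization over \<open>h x\<close>.\<close>

definition point_hom :: "'x \<Rightarrow> ('p \<Rightarrow> 'k) \<Rightarrow> 'k" where
  "point_hom x f = (if f \<in> local_int_closure Y (h x) then cov.value_hom x (\<lambda>x. f (h x)) else 0)"

lemma point_hom_npoint:
  assumes x: "x \<in> X" shows "(h x, point_hom x) \<in> npoints"
proof -
  have "(x, cov.value_hom x) \<in> cov.npoints" by (rule cov.value_hom_npoint[OF X_open X_normal x])
  then have v: "cov.value_hom x (f + g) = cov.value_hom x f + cov.value_hom x g"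
    "cov.value_hom x (f * g) = cov.value_hom x f * cov.value_hom x g" "rat_eq cov.Y f g \<Longrightarrow> cov.value_hom x f = cov.value_hom x g"
    "cov.value_hom x (\<lambda>_. c) = c"
    if "f \<in> local_int_closure cov.Y x" "g \<in> local_int_closure cov.Y x" for f g c
    using that unfolding cov.npoints_def alg_homs_def by auto
  note pl = pull_local_int_closure[OF x]
  have "h x \<in> Z" using openin_frac_space_subset[OF Q U0] hU0[OF x] by blast
  moreover have "point_hom x (f + g) = point_hom x f + point_hom x g \<and> point_hom x (f * g) = point_hom x f * point_hom x g"
    if "f \<in> local_int_closure Y (h x)" "g \<in> local_int_closure Y (h x)" for f g
    using local_int_closure_add[OF x that] that v(1,2)[OF pl[OF that(1)] pl[OF that(2)]]
    by (simp add: point_hom_def plus_fun_def times_fun_def)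
  moreover have "point_hom x f = point_hom x g"
    if "f \<in> local_int_closure Y (h x)" "g \<in> local_int_closure Y (h x)" "rat_eq Y f g" for f g
    using that v(3)[OF pl[OF that(1)] pl[OF that(2)] pull_rat_eq[OF that(3)]] by (simp add: point_hom_def)
  moreover have "point_hom x (\<lambda>_. c) = c" for c
    using v(4)[OF pl pl, OF local_int_closure_const[OF x] local_int_closure_const[OF x]] local_int_closure_const[OF x]
    by (simp add: point_hom_def)
  moreover have "point_hom x f = 0" if "f \<notin> local_int_closure Y (h x)" for f using that by (simp add: point_hom_def)
  ultimately show ?thesis unfolding npoints_def alg_homs_def topspace_frac_space[OF Q] by simp
qed

lemma npoint_power:
  assumes x: "x \<in> X" and p: "(h x, \<phi>) \<in> npoints" and f: "f \<in> local_int_closure Y (h x)"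
    and g: "h x \<in> U" "g \<in> regular Y U" "rat_eq Y (\<lambda>z. f z ^ q) g"
  shows "\<phi> f ^ q = g (h x)"
proof -
  have \<phi>: "\<And>u v. u \<in> local_int_closure Y (h x) \<Longrightarrow> v \<in> local_int_closure Y (h x) \<Longrightarrow> \<phi> (u * v) = \<phi> u * \<phi> v"
    "\<And>c. \<phi> (\<lambda>_. c) = c"
    "\<And>u v. u \<in> local_int_closure Y (h x) \<Longrightarrow> v \<in> local_int_closure Y (h x) \<Longrightarrow> rat_eq Y u v \<Longrightarrow> \<phi> u = \<phi> v"
    using p unfolding npoints_def alg_homs_def by auto
  have "(\<lambda>z. f z ^ i) \<in> local_int_closure Y (h x) \<and> \<phi> (\<lambda>z. f z ^ i) = \<phi> f ^ i" for i
  proof (induction i)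
    case (Suc i)
    then show ?case using local_int_closure_add(2)[OF x f, of "\<lambda>z. f z ^ i"] \<phi>(1)[OF f, of "\<lambda>z. f z ^ i"]
      by (simp add: times_fun_def)
  qed (simp add: local_int_closure_const[OF x] \<phi>(2))
  then have "\<phi> f ^ q = \<phi> g" using \<phi>(3)[OF _ regular_imp_local_int_closure[OF rat_eq_refl g(2,1)] g(3)] by metis
  then show ?thesis using npoints_regular[OF p g(2,1)] by simp
qed

text \<open>Under any homomorphism the value of \<open>f\<close> is a \<open>q\<close>-th root of
  the value of the regular function representing \<open>f ^ q\<close>, and such roots are
  unique.\<close>

lemma npoint_eq_point_hom:
  assumes x: "x \<in> X" and p: "(h x, \<phi>) \<in> npoints" shows "\<phi> = point_hom x"
proof
  fix f
  show "\<phi> f = point_hom x f"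
  proof (cases "f \<in> local_int_closure Y (h x)")
    case True
    then obtain U g where g: "h x \<in> U" "g \<in> regular Y U" "rat_eq Y (\<lambda>z. f z ^ q) g"
      unfolding local_int_closure_iff[OF x] by blast
    have "\<phi> f ^ q = point_hom x f ^ q"
      using npoint_power[OF x p True g] npoint_power[OF x point_hom_npoint[OF x] True g] by simp
    then show ?thesis by (rule root_unique[OF frob])
  qed (use p in \<open>auto simp: npoints_def alg_homs_def point_hom_def\<close>)
qed

lemma point_hom_local:
  assumes x: "x \<in> X" "h x \<in> U" and U: "openin (ztop Y) U" and f: "f \<in> int_closure Y U"
  shows "\<exists>V g. openin (ztop cov.Y) V \<and> x \<in> V \<and> g \<in> regular cov.Y V \<and> (\<forall>z\<in>V. h z \<in> U \<and> point_hom z f = g z)"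
proof -
  have "x \<in> {x \<in> X. h x \<in> U}" using x by simp
  from cov.value_hom_local[OF X_open X_normal x(1) this pull_open[OF U] pull_int_closure[OF f]]
  obtain V g where V: "openin (ztop cov.Y) V" "x \<in> V" "g \<in> regular cov.Y V"
    "\<forall>z\<in>V. cov.value_hom z (\<lambda>x. f (h x)) = g z" by blast
  let ?V = "V \<inter> {x \<in> X. h x \<in> U}"
  have o: "openin (ztop cov.Y) ?V" by (rule openin_Int[OF V(1) pull_open[OF U]])
  have "g \<in> regular cov.Y ?V" by (rule regular_restrict[OF cov.Q V(3) o]) simp
  moreover have "point_hom z f = g z" if "z \<in> ?V" for z
  proof -
    have "f \<in> local_int_closure Y (h z)" unfolding local_int_closure_def using U f that by blast
    then show ?thesis using V(4) that by (simp add: point_hom_def)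
  qed
  ultimately show ?thesis using o V(2) x by (intro exI[of _ ?V] exI[of _ g]) auto
qed

text \<open>The rational function \<open>F\<close> that pulls back to \<open>a\<close> is integral
  over \<open>U0\<close> because its \<open>q\<close>-th power is the regular function
  \<open>G\<close>. In this way functions on \<open>X\<close> become functions on the
  normalization.\<close>

lemma descend_int_closure:
  assumes ab: "(a, b) \<in> QX"
  shows "\<exists>F\<in>int_closure Y U0. \<forall>x\<in>X. point_hom x F = a x"
proof -
  obtain F G where F: "F \<in> rat_funs Y" "G \<in> regular Y U0" "rat_eq cov.Y (\<lambda>x. F (h x)) a" "\<forall>x\<in>X. G (h x) = a x ^ q"
    using descend[OF ab] by blast
  have ne: "U0 \<noteq> {}"
  proof -
    have "X \<noteq> {}" using cov.irr unfolding irreducible_variety_def tops by blast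
    then show ?thesis using hU0 by blast
  qed
  have "rat_eq cov.Y (\<lambda>x. a x ^ q) (\<lambda>x. G (h x))" unfolding rat_eq_def
    using F(4) X_open cov.irr unfolding irreducible_variety_def tops by (intro exI[of _ X]) auto
  then have "rat_eq cov.Y (\<lambda>x. F (h x) ^ q) (\<lambda>x. G (h x))"
    by (rule cov.rat_eq_trans[OF cov.rat_eq_binop[where b = "\<lambda>u _. u ^ q", OF F(3) F(3)]])
  then have "rat_eq Y (\<lambda>z. F z ^ q) G"
    by (rule push_rat_eq[OF rat_funs_power[OF F(1)] rat_funsI[OF F(2) ne]])
  then have int: "F \<in> int_closure Y U0" by (rule int_closure_root[OF F(1,2) ne _ q])
  note areg = numerator_regular[OF ab]
  have "point_hom x F = a x" if x: "x \<in> X" for x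
  proof -
    have "F \<in> local_int_closure Y (h x)" unfolding local_int_closure_def using int U0 hU0[OF x] by blast
    moreover have "cov.has_value x (\<lambda>x. F (h x)) (a x)" unfolding cov.has_value_def using x areg F(3) by blast
    ultimately show ?thesis unfolding point_hom_def by (simp add: cov.value_homI)
  qed
  then show ?thesis using int by blast
qed

text \<open>The fibres over \<open>U0\<close> are single points, so \<open>x\<close> corresponds to
  \<open>point_hom x\<close>. One direction is regular because fractions on \<open>X\<close> lift to
  \<open>nfracs\<close> by \<open>descend_int_closure\<close>, the other because evaluation of an
  integral function is locally a regular function of \<open>x\<close>.\<close>

theorem normalization_radicial:
  "\<exists>U. openin (ztop (normalization Y)) U \<and> isomorphic (subspace_on (normalization Y) U) cov.Y"
proof -
  let ?N = "normalization Y" and ?k = "\<lambda>x. (h x, point_hom x)"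
  let ?U = "{p \<in> npoints. fst p \<in> U0}"
  define k' where "k' p = inv_into X h (fst p)" for p :: "'p \<times> (('p \<Rightarrow> 'k) \<Rightarrow> 'k)"
  have k'k: "k' (h x, \<phi>) = x" if "x \<in> X" for x \<phi>
    using that h_bij unfolding k'_def bij_betw_def by (simp add: inv_into_f_f)
  have kU: "?k x \<in> ?U" if "x \<in> X" for x using point_hom_npoint[OF that] hU0[OF that] by simp
  have U_ex: "\<exists>x\<in>X. p = ?k x" if p: "p \<in> ?U" for p
  proof -
    obtain x where x: "x \<in> X" "h x = fst p" using h_bij p unfolding bij_betw_def by auto
    then show ?thesis using npoint_eq_point_hom[OF x(1), of "snd p"] p by (intro bexI[of _ x]) (auto simp: prod_eq_iff)
  qed
  have U: "openin (ztop ?N) ?U" by (rule openin_npoints[OF U0])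
  have UN: "topspace (ztop (subspace_on ?N ?U)) = ?U"
    using openin_subset[OF U] by (auto simp: subspace_on_def)
  have subU: "openin (ztop (subspace_on ?N ?U)) V \<longleftrightarrow> openin (ztop ?N) V \<and> V \<subseteq> ?U" for V
    unfolding subspace_on_def fspace.simps by (rule openin_open_subtopology[OF U])
  have regU: "F \<in> regular (subspace_on ?N ?U) V" if "openin (ztop ?N) V" "V \<subseteq> ?U" "F \<in> regular ?N V" for F V
    using that subU unfolding subspace_on_def fspace.simps by blast
  have frac: "\<exists>A B. (A, B) \<in> nfracs \<and> (\<forall>x\<in>X. A (?k x) = a x \<and> B (?k x) = b x) \<and>
      openin (ztop ?N) {p \<in> ?U. b (k' p) \<noteq> 0}" if ab: "(a, b) \<in> QX" for a b
  proof -
    obtain F where F: "F \<in> int_closure Y U0" "\<forall>x\<in>X. point_hom x F = a x" using descend_int_closure[OF ab] by blast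
    obtain G where G: "G \<in> int_closure Y U0" "\<forall>x\<in>X. point_hom x G = b x"
      using descend_int_closure[OF frac_closed_swap[OF cov.Q ab]] by blast
    let ?A = "\<lambda>(y, \<phi>). if y \<in> U0 then \<phi> F else (0::'k)" and ?B = "\<lambda>(y, \<phi>). if y \<in> U0 then \<phi> G else (0::'k)"
    have AB: "(?A, ?B) \<in> nfracs" by (rule nfracsI[OF U0 F(1) G(1)])
    have "{p \<in> ?U. b (k' p) \<noteq> 0} = {p \<in> npoints. ?B p \<noteq> 0}"
    proof (rule Set.set_eqI)
      fix p
      show "p \<in> {p \<in> ?U. b (k' p) \<noteq> 0} \<longleftrightarrow> p \<in> {p \<in> npoints. ?B p \<noteq> 0}"
      proof (cases "p \<in> ?U")
        case True
        then obtain x where x: "x \<in> X" "p = ?k x" using U_ex by blast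
        show ?thesis unfolding x(2) using G(2) x(1) hU0[OF x(1)] k'k[OF x(1)] point_hom_npoint[OF x(1)] by simp
      qed (cases p, auto)
    qed
    moreover have "openin (ztop ?N) {p \<in> npoints. ?B p \<noteq> 0}"
      unfolding ztop_normalization by (rule topology_generated_by_Basis) (use AB in blast)
    ultimately show ?thesis using AB F(2) G(2) hU0 by (intro exI[of _ ?A] exI[of _ ?B]) simp
  qed
  have m1: "morphism (subspace_on ?N ?U) cov.Y k'"
    unfolding morphism_def continuous_map UN tops
  proof (intro conjI allI impI)
    show "k' ` ?U \<subseteq> X" using U_ex k'k by fastforce
    fix V assume V: "openin (ztop cov.Y) V"
    have VX: "V \<subseteq> X" by (rule openin_frac_space_subset[OF cov.Q V])
    have op: "openin (ztop ?N) {p \<in> ?U. k' p \<in> V}"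
    proof (subst openin_subopen, intro ballI)
      fix p assume p: "p \<in> {p \<in> ?U. k' p \<in> V}"
      then have "k' p \<in> V" by simp
      from openin_frac_space_basic[OF cov.Q V this] obtain a b where ab: "(a, b) \<in> QX" "b (k' p) \<noteq> 0" "{z \<in> X. b z \<noteq> 0} \<subseteq> V" by blast
      have "{p \<in> ?U. b (k' p) \<noteq> 0} \<subseteq> {p \<in> ?U. k' p \<in> V}"
      proof (rule subsetI)
        fix p' assume p': "p' \<in> {p \<in> ?U. b (k' p) \<noteq> 0}"
        then obtain x where x: "x \<in> X" "p' = ?k x" using U_ex[of p'] by blast
        then show "p' \<in> {p \<in> ?U. k' p \<in> V}" using p' ab(3) k'k[OF x(1)] by auto
      qed
      then show "\<exists>T. openin (ztop ?N) T \<and> p \<in> T \<and> T \<subseteq> {p \<in> ?U. k' p \<in> V}" using frac[OF ab(1)] p ab(2) by blast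
    qed
    then show op': "openin (ztop (subspace_on ?N ?U)) {p \<in> ?U. k' p \<in> V}" unfolding subU by blast
    fix f assume f: "f \<in> regular cov.Y V"
    have "f \<circ> k' \<in> regular ?N {p \<in> ?U. k' p \<in> V}" unfolding regular_normalization
    proof (intro ballI)
      fix p assume p: "p \<in> {p \<in> ?U. k' p \<in> V}"
      then have "k' p \<in> V" by simp
      from cov.regular_local[OF f this] obtain a b where ab: "(a, b) \<in> QX" "b (k' p) \<noteq> 0" "\<forall>z\<in>X. b z \<noteq> 0 \<longrightarrow> f z = a z / b z"
        unfolding local_frac_def by blast
      obtain A B where AB: "(A, B) \<in> nfracs" "\<forall>x\<in>X. A (?k x) = a x \<and> B (?k x) = b x"
        "openin (ztop ?N) {p \<in> ?U. b (k' p) \<noteq> 0}" using frac[OF ab(1)] by blast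
      let ?T = "{p \<in> ?U. k' p \<in> V} \<inter> {p \<in> ?U. b (k' p) \<noteq> 0}"
      have val: "B z \<noteq> 0 \<and> (f \<circ> k') z = A z / B z" if z: "z \<in> ?T" for z
      proof -
        obtain x where x: "x \<in> X" "z = ?k x" using U_ex[of z] z by blast
        have "b x \<noteq> 0" using z k'k[OF x(1)] unfolding x(2) by simp
        then show ?thesis unfolding x(2) using k'k[OF x(1)] AB(2) ab(3) x(1) by simp
      qed
      have oT: "openin (ztop ?N) ?T" by (rule openin_Int[OF op AB(3)])
      have pT: "p \<in> ?T" using p ab(2) by simp
      show "\<exists>W a b. openin (ztop ?N) W \<and> p \<in> W \<and> W \<subseteq> {p \<in> ?U. k' p \<in> V} \<and> (a, b) \<in> nfracs \<and>
        (\<forall>z\<in>W. b z \<noteq> 0 \<and> (f \<circ> k') z = a z / b z)"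
        by (intro exI[of _ ?T] exI[of _ A] exI[of _ B] conjI[OF oT] conjI[OF pT] conjI[OF Int_lower1] conjI[OF AB(1)] ballI)
           (rule val)
    qed
    then show "f \<circ> k' \<in> regular (subspace_on ?N ?U) {p \<in> ?U. k' p \<in> V}" by (intro regU op) auto
  qed
  have cont: "continuous_map (ztop cov.Y) (ztop ?N) ?k" unfolding ztop_normalization
  proof (rule continuous_on_generated_topo)
    fix G assume "G \<in> {{z \<in> npoints. b z \<noteq> 0} |a b. (a, b) \<in> nfracs}"
    then obtain U f g where G: "G = {z \<in> npoints. (\<lambda>(y, \<phi>). if y \<in> U then \<phi> g else 0) z \<noteq> 0}"
      and gU: "openin (ztop Y) U" "g \<in> int_closure Y U" unfolding nfracs_def by blast
    have "?k -` G \<inter> X = {x \<in> X. h x \<in> U \<and> point_hom x g \<noteq> 0}" (is "_ = ?W")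
      unfolding G using point_hom_npoint by auto
    moreover have "openin (ztop cov.Y) ?W"
    proof (subst openin_subopen, intro ballI)
      fix x assume x: "x \<in> ?W"
      then obtain V e where V: "openin (ztop cov.Y) V" "x \<in> V" "e \<in> regular cov.Y V" "\<forall>z\<in>V. h z \<in> U \<and> point_hom z g = e z"
        using point_hom_local[OF _ _ gU] by blast
      have VX: "V \<subseteq> X" by (rule openin_frac_space_subset[OF cov.Q V(1)])
      have ex: "e x \<noteq> 0" "x \<in> X" using V x by auto
      obtain a b where ab: "(a, b) \<in> QX" "b x \<noteq> 0" "\<forall>z\<in>X. b z \<noteq> 0 \<longrightarrow> e z \<noteq> 0 \<and> inverse (e z) = a z / b z"
        using local_frac_inverse[OF cov.Q cov.regular_local[OF V(3,2)] ex] by blast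
      let ?T = "{z \<in> X. b z \<noteq> 0} \<inter> V"
      have "openin (ztop cov.Y) ?T" by (rule openin_Int[OF openin_frac_basic[OF cov.Q ab(1)] V(1)])
      moreover have "x \<in> ?T" using ab(2) ex V(2) by auto
      moreover have "?T \<subseteq> ?W" using ab(3) V(4) VX by auto
      ultimately show "\<exists>T. openin (ztop cov.Y) T \<and> x \<in> T \<and> T \<subseteq> ?W" by blast
    qed
    ultimately show "openin (ztop cov.Y) (?k -` G \<inter> topspace (ztop cov.Y))" unfolding tops by simp
  next
    have "npoints = topspace (ztop ?N)"
    proof
      have "openin (ztop ?N) {p \<in> npoints. fst p \<in> topspace (ztop Y)}" by (rule openin_npoints[OF openin_topspace])
      moreover have "{p \<in> npoints. fst p \<in> topspace (ztop Y)} = npoints" by (auto simp: npoints_def)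
      ultimately show "npoints \<subseteq> topspace (ztop ?N)" using openin_subset by fastforce
      show "topspace (ztop ?N) \<subseteq> npoints" unfolding ztop_normalization topology_generated_by_topspace by blast
    qed
    then show "?k ` topspace (ztop cov.Y) \<subseteq> \<Union>{{z \<in> npoints. b z \<noteq> 0} |a b. (a, b) \<in> nfracs}"
      unfolding tops topology_generated_by_topspace[symmetric] ztop_normalization[symmetric] using point_hom_npoint by auto
  qed
  have op: "openin (ztop cov.Y) {x \<in> X. ?k x \<in> V}" if "openin (ztop ?N) V" for V
    using openin_continuous_map_preimage[OF cont that] unfolding tops .
  have m2: "morphism cov.Y (subspace_on ?N ?U) ?k"
    unfolding morphism_def continuous_map UN tops
  proof (intro conjI allI impI)
    show "?k ` X \<subseteq> ?U" using kU by blast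
    fix V assume "openin (ztop (subspace_on ?N ?U)) V"
    then have V: "openin (ztop ?N) V" "V \<subseteq> ?U" using subU by auto
    show opV: "openin (ztop cov.Y) {x \<in> X. ?k x \<in> V}" by (rule op[OF V(1)])
    fix F assume F: "F \<in> regular (subspace_on ?N ?U) V"
    show "F \<circ> ?k \<in> regular cov.Y {x \<in> X. ?k x \<in> V}"
    proof (rule cov.regularI[OF opV])
      fix x assume x: "x \<in> {x \<in> X. ?k x \<in> V}"
      have "\<forall>p\<in>V. \<exists>V1 G. openin (ztop ?N) V1 \<and> p \<in> V1 \<and> G \<in> regular ?N V1 \<and> (\<forall>z\<in>V1 \<inter> V. F z = G z)"
        using F by (simp add: subspace_on_def)
      moreover have "?k x \<in> V" using x by simp
      ultimately have "\<exists>V1 G. openin (ztop ?N) V1 \<and> ?k x \<in> V1 \<and> G \<in> regular ?N V1 \<and> (\<forall>z\<in>V1 \<inter> V. F z = G z)"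
        by (rule bspec)
      then obtain V1 G where V1: "openin (ztop ?N) V1" "?k x \<in> V1" "G \<in> regular ?N V1" "\<forall>z\<in>V1 \<inter> V. F z = G z"
        by (elim exE conjE)
      from bspec[OF regular_normalization[THEN iffD1, OF V1(3)] V1(2)] obtain V2 a b where V2: "openin (ztop ?N) V2" "?k x \<in> V2" "V2 \<subseteq> V1" "(a, b) \<in> nfracs"
        "\<forall>z\<in>V2. b z \<noteq> 0 \<and> G z = a z / b z"
        by (elim exE conjE)
      obtain U f g where ab: "a = (\<lambda>(y, \<phi>). if y \<in> U then \<phi> f else 0)" "b = (\<lambda>(y, \<phi>). if y \<in> U then \<phi> g else 0)"
        and fg: "openin (ztop Y) U" "f \<in> int_closure Y U" "g \<in> int_closure Y U"
        using V2(4) unfolding nfracs_def by blast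
      have "b (?k x) \<noteq> 0" using V2(2,5) by blast
      then have xU: "h x \<in> U" "point_hom x g \<noteq> 0" "x \<in> X" using ab x by (auto split: if_splits)
      obtain W f' where f': "openin (ztop cov.Y) W" "x \<in> W" "f' \<in> regular cov.Y W" "\<forall>z\<in>W. h z \<in> U \<and> point_hom z f = f' z"
        using point_hom_local[OF xU(3,1) fg(1,2)] by blast
      obtain W' g' where g': "openin (ztop cov.Y) W'" "x \<in> W'" "g' \<in> regular cov.Y W'" "\<forall>z\<in>W'. h z \<in> U \<and> point_hom z g = g' z"
        using point_hom_local[OF xU(3,1) fg(1,3)] by blast
      have "g' x \<noteq> 0" using g'(2,4) xU(2) by auto
      then have 1: "local_frac X QX x (\<lambda>z. f' z / g' z)"
        by (intro local_frac_divide[OF cov.Q] cov.regular_local[OF f'(3,2)] cov.regular_local[OF g'(3,2)] xU(3))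
      let ?T = "{x \<in> X. ?k x \<in> V2 \<inter> V} \<inter> (W \<inter> W')"
      have 2: "openin (ztop cov.Y) ?T" using op[of "V2 \<inter> V"] V2(1) V(1) f'(1) g'(1) by (intro openin_Int) auto
      show "local_frac X QX x (F \<circ> ?k)"
      proof (rule local_frac_cong[OF cov.Q 1 2])
        show "x \<in> ?T" using x V2(2) f'(2) g'(2) by auto
        fix z assume z: "z \<in> ?T"
        then have "?k z \<in> V1 \<inter> V" "?k z \<in> V2" using V2(3) by auto
        then have "F (?k z) = a (?k z) / b (?k z)" using V1(4) V2(5) by auto
        also have "\<dots> = f' z / g' z" using z f'(4) g'(4) unfolding ab by auto
        finally show "f' z / g' z = (F \<circ> ?k) z" by simp
      qed
    qed
  qed
  have "\<forall>p\<in>?U. ?k (k' p) = p"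
  proof
    fix p assume "p \<in> ?U"
    then obtain x where "x \<in> X" "p = ?k x" using U_ex by blast
    then show "?k (k' p) = p" using k'k by simp
  qed
  then have "isomorphic (subspace_on ?N ?U) cov.Y"
    unfolding isomorphic_def UN tops using m1 m2 k'k by (intro exI[of _ k'] exI[of _ ?k]) auto
  then show ?thesis using U by blast
qed

end

section \<open>Points of the spectrum of the semigroup algebra\<close>

lemma generated_monoid_gen: "u \<in> G \<Longrightarrow> u \<in> generated_monoid G"
  using generated_monoid.add[OF _ generated_monoid.zero] by fastforce

lemma generated_monoid_add: "u \<in> generated_monoid G \<Longrightarrow> v \<in> generated_monoid G \<Longrightarrow> u + v \<in> generated_monoid G"
  by (induction rule: generated_monoid.induct) (auto simp: add.assoc intro: generated_monoid.add)

lemma generated_monoid_cmul: "u \<in> generated_monoid G \<Longrightarrow> frag_cmul (int c) u \<in> generated_monoid G"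
  by (induction c) (auto simp: frag_cmul_distrib intro: generated_monoid.zero generated_monoid_add)

context toric
begin

lemma S_generated: "S = generated_monoid (g ` {..<n})"
proof (intro subset_antisym subsetI)
  fix u assume "u \<in> S"
  then obtain m where m: "u = wt g m" "ks m \<subseteq> {..<n}" unfolding S_def by blast
  have "(\<Sum>k\<in>K. frag_cmul (int (lk m k)) (g k)) \<in> generated_monoid (g ` {..<n})" if "K \<subseteq> {..<n}" for K
    using that by (induction K rule: infinite_finite_induct)
      (auto intro: generated_monoid.zero generated_monoid_add generated_monoid_cmul generated_monoid_gen)
  then show "u \<in> generated_monoid (g ` {..<n})" unfolding m(1) wt_def using m(2) by blast
next
  fix u assume "u \<in> generated_monoid (g ` {..<n})"
  then show "u \<in> S" by induction (auto simp: S_0 intro: S_add g_S)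
qed

lemma affine_semigroup_S: "affine_semigroup S"
  unfolding affine_semigroup_def using S_generated by blast

lemma keys_S: 
  assumes "u \<in> S" shows "ks u \<subseteq> {..<d}"
proof -
  have "u \<in> generated_monoid (g ` {..<n})" using assms S_generated by simp
  then show ?thesis
  proof induction
    case (add v u)
    then show ?case using g_supp keys_add[of v u] by blast
  qed simp
qed

text \<open>The unit vectors with index below \<open>d\<close> are themselves in \<open>S\<close>,
  and all exponents in \<open>S\<close> are supported there.\<close>

lemma has_rank_S: "has_rank S d"
proof -
  let ?B = "uvec ` {..<d}"
  have inj: "inj_on uvec {..<d}" unfolding uvec_def by (rule inj_onI) (metis lookup_single_eq lookup_single_not_eq zero_neq_one)
  have lk_uvec: "lk (uvec i) j = (if i = j then 1 else 0)" for i j by (simp add: uvec_def lookup_single when_def)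
  have "zmod.independent ?B"
    unfolding zmod.dependent_explicit
  proof (intro notI, elim exE conjE bexE)
    fix t c v assume t: "finite t" "t \<subseteq> ?B" "(\<Sum>v\<in>t. frag_cmul (c v) v) = 0" "v \<in> t" "c v \<noteq> 0"
    obtain i where i: "v = uvec i" "i < d" using t(2,4) by auto
    have "lk (\<Sum>v\<in>t. frag_cmul (c v) v) i = (\<Sum>w\<in>t. c w * lk w i)"
      using t(1) by (induction t rule: finite_induct) (simp_all add: lookup_add)
    also have "\<dots> = (\<Sum>w\<in>{v}. c w * lk w i)"
    proof (rule sum.mono_neutral_right)
      show "\<forall>w\<in>t - {v}. c w * lk w i = 0"
      proof
        fix w assume "w \<in> t - {v}"
        then obtain j where "w = uvec j" "w \<noteq> v" using t(2) by blast
        then show "c w * lk w i = 0" using i(1) by (cases "i = j") (auto simp: lk_uvec)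
      qed
    qed (use t in auto)
    also have "\<dots> = c v" by (simp add: i(1) lk_uvec)
    finally show False using t(3,5) by simp
  qed
  moreover have "zmod.span ?B = zmod.span S"
  proof (rule zmod.span_eq[THEN iffD2], intro conjI subsetI)
    fix v assume "v \<in> ?B"
    then obtain i where "i < d" "v = uvec i" by blast
    then have "v \<in> S" using g_S[of i] g_basis d_le_n by simp
    then show "v \<in> zmod.span S" by (rule zmod.span_base)
  next
    fix u assume u: "u \<in> S"
    have "sgl i c = frag_cmul c (uvec i)" for i c
      by (rule poly_mapping_eqI) (simp add: uvec_def lookup_single when_def)
    then have "u = (\<Sum>i\<in>ks u. frag_cmul (lk u i) (uvec i))" using poly_mapping_sum_single[of u] by simp
    moreover have "(\<Sum>i\<in>ks u. frag_cmul (lk u i) (uvec i)) \<in> zmod.span ?B"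
      using keys_S[OF u] by (intro zmod.span_sum zmod.span_scale zmod.span_base) auto
    ultimately show "u \<in> zmod.span ?B" by simp
  qed
  ultimately show ?thesis unfolding has_rank_def
    by (intro exI[of _ ?B]) (simp add: card_image[OF inj])
qed

abbreviation spec_points :: "('k::field laurent \<Rightarrow> 'k) set" where
  "spec_points \<equiv> alg_homs (semigroup_algebra S) (sgl 0)"

definition hom_point :: "('k::field laurent \<Rightarrow> 'k) \<Rightarrow> nat \<Rightarrow> 'k" where
  "hom_point \<phi> i = (if i < n then \<phi> (sgl (g i) 1) else 0)"

lemma semigroup_algebra_iff: "f \<in> semigroup_algebra S \<longleftrightarrow> ks f \<subseteq> S" by (simp add: semigroup_algebra_def)

lemma semigroup_algebra_closed:
  "f \<in> semigroup_algebra S \<Longrightarrow> f' \<in> semigroup_algebra S \<Longrightarrow> f + f' \<in> semigroup_algebra S"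
  "f \<in> semigroup_algebra S \<Longrightarrow> f' \<in> semigroup_algebra S \<Longrightarrow> f * f' \<in> semigroup_algebra S"
  "u \<in> S \<Longrightarrow> sgl u c \<in> semigroup_algebra S"
  for f f' :: "'k::field laurent"
proof -
  show "f + f' \<in> semigroup_algebra S" if "f \<in> semigroup_algebra S" "f' \<in> semigroup_algebra S"
    using that keys_add[of f f'] unfolding semigroup_algebra_iff by blast
  show "f * f' \<in> semigroup_algebra S" if ff: "f \<in> semigroup_algebra S" "f' \<in> semigroup_algebra S"
    unfolding semigroup_algebra_iff
  proof
    fix w assume "w \<in> ks (f * f')"
    then obtain u v where "w = u + v" "u \<in> ks f" "v \<in> ks f'" using keys_mult[of f f'] by blast
    then show "w \<in> S" using ff S_add unfolding semigroup_algebra_iff by blast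
  qed
  show "sgl u c \<in> semigroup_algebra S" if "u \<in> S" using that by (simp add: semigroup_algebra_iff)
qed

context
  fixes \<phi> :: "'k::field laurent \<Rightarrow> 'k"
  assumes \<phi>: "\<phi> \<in> spec_points"
begin

lemma hom_add: "ks f \<subseteq> S \<Longrightarrow> ks f' \<subseteq> S \<Longrightarrow> \<phi> (f + f') = \<phi> f + \<phi> f'"
  and hom_mult: "ks f \<subseteq> S \<Longrightarrow> ks f' \<subseteq> S \<Longrightarrow> \<phi> (f * f') = \<phi> f * \<phi> f'"
  and hom_const: "\<phi> (sgl 0 c) = c"
  and hom_outside: "\<not> ks f \<subseteq> S \<Longrightarrow> \<phi> f = 0"
  using \<phi> unfolding alg_homs_def by (auto simp: semigroup_algebra_iff)

lemma hom_sgl_add: "u \<in> S \<Longrightarrow> v \<in> S \<Longrightarrow> \<phi> (sgl (u + v) 1) = \<phi> (sgl u 1) * \<phi> (sgl v 1)"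
  using hom_mult[of "sgl u 1" "sgl v 1"] by (simp add: mult_single)

lemma hom_sgl_0: "\<phi> (sgl 0 1) = 1" by (rule hom_const)

lemma hom_wt:
  assumes "ks m \<subseteq> {..<n}" shows "\<phi> (sgl (wt g m) 1) = pmon (hom_point \<phi>) m"
proof -
  have pow: "frag_cmul (int c) u \<in> S \<and> \<phi> (sgl (frag_cmul (int c) u) 1) = \<phi> (sgl u 1) ^ c" if "u \<in> S" for u c
    using that by (induction c) (auto simp: S_0 hom_sgl_0 frag_cmul_distrib S_add hom_sgl_add simp del: single_one)
  have "(\<Sum>k\<in>K. frag_cmul (int (lk m k)) (g k)) \<in> S \<and>
     \<phi> (sgl (\<Sum>k\<in>K. frag_cmul (int (lk m k)) (g k)) 1) = (\<Prod>k\<in>K. hom_point \<phi> k ^ lk m k)" if "K \<subseteq> {..<n}" for K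
    using that by (induction K rule: infinite_finite_induct)
      (auto simp: S_0 hom_sgl_0 S_add hom_sgl_add pow g_S hom_point_def simp del: single_one)
  from this[OF assms] show ?thesis unfolding wt_def pmon_def by simp
qed

lemma hom_point_in: "hom_point \<phi> \<in> X"
  unfolding toric_points_def by (auto simp: kpoints_def hom_point_def[abs_def] hom_wt[symmetric, unfolded hom_point_def[abs_def]])

lemma hom_eq_leval:
  assumes f: "ks f \<subseteq> S" shows "\<phi> f = leval (hom_point \<phi>) f"
proof -
  have 1: "\<phi> (sgl u c) = c * pt_eval (hom_point \<phi>) u" if u: "u \<in> S" for u c
  proof -
    obtain m where m: "u = wt g m" "ks m \<subseteq> {..<n}" using u unfolding S_def by blast
    have "\<phi> (sgl 0 c * sgl u 1) = c * \<phi> (sgl u 1)" using u S_0 by (subst hom_mult) (auto simp: hom_const)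
    then show ?thesis unfolding m(1) by (simp add: mult_single hom_wt[OF m(2)] pt_eval_wt[OF hom_point_in m(2)])
  qed
  have "ks (\<Sum>u\<in>K. sgl u (lk f u)) \<subseteq> S \<and> \<phi> (\<Sum>u\<in>K. sgl u (lk f u)) = (\<Sum>u\<in>K. lk f u * pt_eval (hom_point \<phi>) u)" if "finite K" "K \<subseteq> S" for K
    using that
  proof (induction K rule: finite_induct)
    case empty
    then show ?case using hom_const[of 0] by simp
  next
    case (insert u K)
    have "ks (sgl u (lk f u)) \<subseteq> S" using insert(4) by simp
    then show ?case using insert 1[of u] hom_add[of "sgl u (lk f u)"] keys_add[of "sgl u (lk f u)" "\<Sum>u\<in>K. sgl u (lk f u)"]
      by auto
  qed
  from this[OF finite_keys f] show ?thesis
    unfolding poly_mapping_sum_single[of f, symmetric] leval_def mext_def by simp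
qed

end

definition point_alg_hom :: "(nat \<Rightarrow> 'k::field) \<Rightarrow> 'k laurent \<Rightarrow> 'k" where
  "point_alg_hom x f = (if ks f \<subseteq> S then leval x f else 0)"

lemma point_alg_hom_in:
  fixes x :: "nat \<Rightarrow> 'k::field"
  assumes x: "x \<in> X" shows "point_alg_hom x \<in> spec_points"
proof -
  have "leval x (f + f') = leval x f + leval x f'" for f f' unfolding leval_def by (rule mext_add[OF coeff_hom_id])
  moreover have "leval x (f * f') = leval x f * leval x f'" if "ks f \<subseteq> S" "ks f' \<subseteq> S" for f f'
    unfolding leval_def by (rule mext_mult[OF coeff_hom_id]) (use that pt_eval_add[OF x] in blast)
  moreover have "leval x (sgl 0 c) = c" "ks (sgl 0 c) \<subseteq> S" for c :: 'k
    unfolding leval_def by (simp_all add: mext_single[OF coeff_hom_id] pt_eval_0[OF x] S_0)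
  ultimately show ?thesis
    using semigroup_algebra_closed(1,2)[where ?'k = 'k] unfolding alg_homs_def semigroup_algebra_iff
    by (auto simp: semigroup_algebra_iff point_alg_hom_def S_0)
qed

lemma hom_point_point_alg_hom:
  assumes x: "x \<in> X" shows "hom_point (point_alg_hom x) = x"
proof
  fix i
  have "leval x (sgl (g i) 1) = x i" if "i < n"
    unfolding leval_def using pt_eval_g[OF x that] by (simp add: mext_single[OF coeff_hom_id])
  then show "hom_point (point_alg_hom x) i = x i"
    using x X_kpoints g_S[of i] unfolding hom_point_def point_alg_hom_def kpoints_def by (auto simp del: single_one)
qed

lemma point_alg_hom_hom_point:
  assumes \<phi>: "\<phi> \<in> spec_points" shows "point_alg_hom (hom_point \<phi>) = \<phi>"
  by (rule ext) (simp add: point_alg_hom_def hom_eq_leval[OF \<phi>] hom_outside[OF \<phi>])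

lemma isomorphic_toric_spec: "isomorphic (affine_var n (X :: (nat \<Rightarrow> 'k::field) set)) (toric_spec S)"
proof -
  let ?P = "spec_points :: ('k laurent \<Rightarrow> 'k) set"
  let ?SA = "semigroup_algebra S :: 'k laurent set"
  \<comment> \<open>The product of two evaluations is an evaluation only at homomorphisms, not as a
    total function. Identifying fractions by their values on the spectrum gives a set that satisfies
    \<open>frac_closed\<close>.\<close>
  define QS where "QS = {(a, b). \<exists>f\<in>?SA. \<exists>f'\<in>?SA. \<forall>\<phi>\<in>?P. a \<phi> = \<phi> f \<and> b \<phi> = \<phi> f'}"
  have QSI: "(a, b) \<in> QS" if "f \<in> ?SA" "f' \<in> ?SA" "\<And>\<phi>. \<phi> \<in> ?P \<Longrightarrow> a \<phi> = \<phi> f" "\<And>\<phi>. \<phi> \<in> ?P \<Longrightarrow> b \<phi> = \<phi> f'" for a b f f'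
    using that unfolding QS_def by blast
  have QSE: "\<exists>f f'. f \<in> ?SA \<and> f' \<in> ?SA \<and> (\<forall>\<phi>\<in>?P. a \<phi> = \<phi> f \<and> b \<phi> = \<phi> f')" if "(a, b) \<in> QS" for a b
    using that unfolding QS_def by blast
  have spec: "toric_spec S = frac_space ?P QS"
    unfolding toric_spec_def
  proof (rule frac_space_ext)
    fix a b :: "('k laurent \<Rightarrow> 'k) \<Rightarrow> 'k" assume "(a, b) \<in> {(\<lambda>\<phi>. \<phi> f, \<lambda>\<phi>. \<phi> f') | f f'. f \<in> ?SA \<and> f' \<in> ?SA}"
    then have "(a, b) \<in> QS" unfolding QS_def by blast
    then show "\<exists>a' b'. (a', b') \<in> QS \<and> (\<forall>\<phi>\<in>?P. a \<phi> = a' \<phi> \<and> b \<phi> = b' \<phi>)" by (intro exI[of _ a] exI[of _ b]) simp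
  next
    fix a b :: "('k laurent \<Rightarrow> 'k) \<Rightarrow> 'k" assume "(a, b) \<in> QS"
    from QSE[OF this] obtain f f' where f: "f \<in> ?SA" "f' \<in> ?SA" "\<forall>\<phi>\<in>?P. a \<phi> = \<phi> f \<and> b \<phi> = \<phi> f'"
      by (elim exE conjE) (rule that, assumption+)
    then show "\<exists>a' b'. (a', b') \<in> {(\<lambda>\<phi>. \<phi> f, \<lambda>\<phi>. \<phi> f') | f f'. f \<in> ?SA \<and> f' \<in> ?SA} \<and>
        (\<forall>\<phi>\<in>?P. a \<phi> = a' \<phi> \<and> b \<phi> = b' \<phi>)"
      by (intro exI[of _ "\<lambda>\<phi>. \<phi> f"] exI[of _ "\<lambda>\<phi>. \<phi> f'"]) blast
  qed
  note cl = semigroup_algebra_closed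
  have hadd: "\<phi> (f + f') = \<phi> f + \<phi> f'" and hmult: "\<phi> (f * f') = \<phi> f * \<phi> f'" if "\<phi> \<in> ?P" "f \<in> ?SA" "f' \<in> ?SA" for \<phi> f f'
    using that hom_add hom_mult unfolding semigroup_algebra_iff by blast+
  have QS: "frac_closed QS" unfolding frac_closed_def
  proof (intro conjI allI impI)
    fix a b a' b' assume ab: "(a, b) \<in> QS" and ab': "(a', b') \<in> QS"
    from QSE[OF ab] obtain f e where f: "f \<in> ?SA" "e \<in> ?SA" "\<forall>\<phi>\<in>?P. a \<phi> = \<phi> f \<and> b \<phi> = \<phi> e"
      by (elim exE conjE) (rule that, assumption+)
    from QSE[OF ab'] obtain f' e' where f': "f' \<in> ?SA" "e' \<in> ?SA" "\<forall>\<phi>\<in>?P. a' \<phi> = \<phi> f' \<and> b' \<phi> = \<phi> e'"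
      by (elim exE conjE) (rule that, assumption+)
    have m: "f * f' \<in> ?SA" "e * e' \<in> ?SA" "f * e' \<in> ?SA" "f' * e \<in> ?SA" "f * e' + f' * e \<in> ?SA"
      by (intro cl(1,2) f(1,2) f'(1,2))+
    show "(\<lambda>z. a z * a' z, \<lambda>z. b z * b' z) \<in> QS"
      by (rule QSI[OF m(1,2)]) (use f f' in \<open>simp_all add: hmult\<close>)
    show "(\<lambda>z. a z * b' z + a' z * b z, \<lambda>z. b z * b' z) \<in> QS"
      by (rule QSI[OF m(5,2)]) (use f f' m in \<open>simp_all add: hmult hadd\<close>)
  next
    fix a b assume "(a, b) \<in> QS"
    then show "(b, a) \<in> QS" unfolding QS_def by blast
  next
    fix c :: 'k
    show "(\<lambda>_. c, \<lambda>_. 1) \<in> QS"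
      by (rule QSI[OF cl(3)[OF S_0] cl(3)[OF S_0]]) (simp_all only: hom_const)
  qed
  note Q = frac_closed_poly_fracs
  have m1: "morphism Y (frac_space ?P QS) point_alg_hom"
  proof (rule morphism_frac_spaceI[OF Q QS point_alg_hom_in])
    fix a b assume "(a, b) \<in> QS"
    from QSE[OF this] obtain f e where f: "f \<in> ?SA" "e \<in> ?SA" "\<forall>\<phi>\<in>?P. a \<phi> = \<phi> f \<and> b \<phi> = \<phi> e"
      by (elim exE conjE) (rule that, assumption+)
    obtain F where F: "F \<in> polys_in {..<n}" "psub g F = f" using psub_surj f(1) unfolding semigroup_algebra_iff by blast
    obtain E where E: "E \<in> polys_in {..<n}" "psub g E = e" using psub_surj f(2) unfolding semigroup_algebra_iff by blast
    have "a (point_alg_hom y) = peval F y \<and> b (point_alg_hom y) = peval E y" if y: "y \<in> X" for y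
      using f point_alg_hom_in[OF y] leval_psub[OF y F(1)] leval_psub[OF y E(1)]
      unfolding F(2) E(2) semigroup_algebra_iff by (simp add: point_alg_hom_def)
    then show "\<exists>A B u. \<forall>y\<in>X. u y \<noteq> 0 \<and> a (point_alg_hom y) = u y * A y \<and> b (point_alg_hom y) = u y * B y \<and>
        local_frac X (poly_fracs n) y A \<and> local_frac X (poly_fracs n) y B"
      using local_frac_peval_affine[OF F(1)] local_frac_peval_affine[OF E(1)]
      by (intro exI[of _ "peval F"] exI[of _ "peval E"] exI[of _ "\<lambda>_. 1"]) simp
  qed
  have m2: "morphism (frac_space ?P QS) Y hom_point"
  proof (rule morphism_frac_spaceI[OF QS Q hom_point_in])
    fix a b :: "(nat \<Rightarrow> 'k) \<Rightarrow> 'k" assume "(a, b) \<in> poly_fracs n"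
    then obtain F E where FE: "a = peval F" "b = peval E" "F \<in> polys_in {..<n}" "E \<in> polys_in {..<n}" by (elim poly_fracsE)
    have eq: "peval G (hom_point \<phi>) = \<phi> (psub g G)" if "\<phi> \<in> ?P" "G \<in> polys_in {..<n}" for \<phi> G
      using hom_eq_leval[OF that(1) keys_psub_S[OF that(2)]] leval_psub[OF hom_point_in[OF that(1)] that(2)] by simp
    have loc: "local_frac ?P QS \<phi> (\<lambda>\<phi>. peval G (hom_point \<phi>))" if "G \<in> polys_in {..<n}" for G \<phi>
    proof -
      have "(\<lambda>\<phi>. peval G (hom_point \<phi>), \<lambda>_. 1) \<in> QS"
        by (rule QSI[of "psub g G" "sgl 0 1", OF _ cl(3)[OF S_0]])
           (use keys_psub_S[OF that] in \<open>simp_all only: semigroup_algebra_iff eq[OF _ that] hom_const\<close>)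
      then show ?thesis unfolding local_frac_def by (intro exI[of _ "\<lambda>\<phi>. peval G (hom_point \<phi>)"] exI[of _ "\<lambda>_. 1"]) simp
    qed
    show "\<exists>A B u. \<forall>y\<in>?P. u y \<noteq> 0 \<and> a (hom_point y) = u y * A y \<and> b (hom_point y) = u y * B y \<and>
        local_frac ?P QS y A \<and> local_frac ?P QS y B"
      using loc[OF FE(3)] loc[OF FE(4)] unfolding FE(1,2)
      by (intro exI[of _ "\<lambda>\<phi>. peval F (hom_point \<phi>)"] exI[of _ "\<lambda>\<phi>. peval E (hom_point \<phi>)"] exI[of _ "\<lambda>_. 1"]) simp
  qed
  show ?thesis unfolding affine_var_eq[OF X_kpoints] spec isomorphic_def topspace_frac_space[OF QS] topspace_frac_space[OF Q]
    by (intro exI[of _ point_alg_hom] exI[of _ hom_point] conjI ballI m1 m2 hom_point_point_alg_hom point_alg_hom_hom_point)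
qed

lemma affine_toric_variety_X: "affine_toric_variety d n (X :: (nat \<Rightarrow> 'k::field) set)"
  unfolding affine_toric_variety_def using X_closed affine_semigroup_S has_rank_S isomorphic_toric_spec by blast

end

section \<open>The graph chart and its normalization\<close>

context toric
begin

lemma local_frac_pt_eval:
  assumes u: "u \<in> S"
  shows "local_frac X (poly_fracs n) y (\<lambda>y. pt_eval y u)"
proof -
  obtain m where m: "u = wt g m" "ks m \<subseteq> {..<n}" using u unfolding S_def by blast
  have "sgl m 1 \<in> polys_in {..<n}" by (rule polys_in_single[OF m(2)])
  from local_frac_peval_affine[OF this, of X y] obtain a b where
    ab: "(a, b) \<in> poly_fracs n" "b y \<noteq> 0" "\<forall>z\<in>X. b z \<noteq> 0 \<longrightarrow> peval (sgl m 1) z = a z / b z"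
    unfolding local_frac_def by blast
  have "\<forall>z\<in>X. b z \<noteq> 0 \<longrightarrow> pt_eval z u = a z / b z"
    using ab(3) unfolding m(1) by (simp add: pt_eval_wt[OF _ m(2)] peval_single)
  then show ?thesis unfolding local_frac_def using ab(1,2) by blast
qed

lemma pt_eval_torus: "(\<And>i. t i \<noteq> 0) \<Longrightarrow> u \<in> S \<Longrightarrow> pt_eval (torus_point n g t) u = chi t u"
proof -
  assume t: "\<And>i. t i \<noteq> 0" and "u \<in> S"
  then obtain m where m: "u = wt g m" "ks m \<subseteq> {..<n}" unfolding S_def by blast
  show ?thesis unfolding m(1) pt_eval_wt[OF torus_point_in[OF t] m(2)] by (rule pmon_torus_point[OF t m(2)])
qed

lemma pt_eval_cmul:
  assumes y: "y \<in> X" and u: "u \<in> S"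
  shows "frag_cmul (int c) u \<in> S" "pt_eval y (frag_cmul (int c) u) = pt_eval y u ^ c"
proof -
  have "frag_cmul (int c) u \<in> S \<and> pt_eval y (frag_cmul (int c) u) = pt_eval y u ^ c"
    by (induction c) (auto simp: S_0 u pt_eval_0[OF y] frag_cmul_distrib S_add pt_eval_add[OF y])
  then show "frag_cmul (int c) u \<in> S" "pt_eval y (frag_cmul (int c) u) = pt_eval y u ^ c" by auto
qed

lemma pt_eval_wt_general:
  assumes y: "y \<in> X" and f: "\<And>k. k \<in> ks m \<Longrightarrow> f k \<in> S"
  shows "pt_eval y (wt f m) = (\<Prod>k\<in>ks m. pt_eval y (f k) ^ lk m k)"
proof -
  have "(\<Sum>k\<in>K. frag_cmul (int (lk m k)) (f k)) \<in> S \<and>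
     pt_eval y (\<Sum>k\<in>K. frag_cmul (int (lk m k)) (f k)) = (\<Prod>k\<in>K. pt_eval y (f k) ^ lk m k)" if "K \<subseteq> ks m" for K
    using that by (induction K rule: infinite_finite_induct)
      (auto simp: S_0 pt_eval_0[OF y] S_add pt_eval_add[OF y] pt_eval_cmul[OF y] f)
  from this[of "ks m"] show ?thesis unfolding wt_def by auto
qed

text \<open>The type argument carries the characteristic, which decides which entries of the
  generators vanish.\<close>

definition chart_gens :: "'k::field itself \<Rightarrow> (nat \<Rightarrow>\<^sub>0 int) set" where
  "chart_gens _ = g ` {..<n} \<union> {g j - uvec i | j i. j \<in> {d..<n} \<and> i < d \<and> of_int (lk (g j) i) \<noteq> (0::'k)}"

text \<open>The additive injection \<open>A\<close> maps the chart semigroup into \<open>S\<close>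
  by \<open>c1\<close> and \<open>c2\<close>. By \<open>c3\<close> every generator of
  \<open>S\<close> is the image of a difference of chart exponents whose \<open>q\<close>-fold lies
  in the chart semigroup. Dually \<open>X\<close> maps onto the chart by \<open>h'\<close>, and
  \<open>q\<close>-th powers of the coordinates descend.\<close>

lemma normalized_nash_chart:
  fixes A :: "(nat \<Rightarrow>\<^sub>0 int) \<Rightarrow> (nat \<Rightarrow>\<^sub>0 int)"
  assumes d: "0 < d" and A_add: "\<And>u v. A (u + v) = A u + A v" and A_inj: "\<And>u. A u = 0 \<Longrightarrow> u = 0"
    and c1: "\<And>s. s < n \<Longrightarrow> A (g s) \<in> S"
    and c2: "\<And>j i. j \<in> {d..<n} \<Longrightarrow> i < d \<Longrightarrow> of_int (lk (g j) i) \<noteq> (0::'k) \<Longrightarrow> A (g j - uvec i) \<in> S"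
    and q: "0 < q" and frob: "\<And>x y::'k::alg_closed_field. (x + y) ^ q = x ^ q + y ^ q"
    and c3: "\<And>k. k < n \<Longrightarrow> \<exists>u v. u \<in> generated_monoid (chart_gens TYPE('k)) \<and> v \<in> generated_monoid (chart_gens TYPE('k)) \<and>
        frag_cmul (int q) (u - v) \<in> generated_monoid (chart_gens TYPE('k)) \<and> A u = A v + g k"
  shows "\<exists>U. openin (ztop (normalized_nash_blowup d n X)) U \<and>
     isomorphic (subspace_on (normalized_nash_blowup d n X) U) (affine_var n (X :: (nat \<Rightarrow> 'k) set))"
proof -
  note PQ = frac_closed_plu_fracs and Q = frac_closed_poly_fracs
  let ?J = "{d..<n}"
  have I: "{..<n} - ?J = {..<d}" using d_le_n by auto
  have A_0: "A 0 = 0" using A_add[of 0 0] by simp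
  have A_diff: "A (u - v) = A u - A v" for u v using A_add[of "u - v" v] by (simp add: eq_diff_eq)
  have A_eq: "u = v" if "A u = A v" for u v using A_inj[of "u - v"] that by (simp add: A_diff)
  have A_cmul: "A (frag_cmul (int c) u) = frag_cmul (int c) (A u)" for c u
    by (induction c) (simp_all add: A_0 frag_cmul_distrib A_add)
  have A_sum: "A (\<Sum>i\<in>K. f i) = (\<Sum>i\<in>K. A (f i))" for f and K :: "nat set"
    by (induction K rule: infinite_finite_induct) (simp_all add: A_0 A_add)
  have A_wt: "A (wt f m) = wt (\<lambda>k. A (f k)) m" for f and m :: "nat \<Rightarrow>\<^sub>0 nat"
    unfolding wt_def A_sum A_cmul ..
  define xx where "xx y s = (if s < n then pt_eval y (A (g s)) else 0)" for y :: "nat \<Rightarrow> 'k" and s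
  \<comment> \<open>Where the integer entry vanishes in the field, \<open>A (g j - uvec i)\<close>
    may lie outside \<open>S\<close> and \<open>pt_eval\<close> is arbitrary there; the zero factor
    discards it.\<close>
  define N where "N y j i = of_int (lk (g j) i) * pt_eval y (A (g j - uvec i))" for y :: "nat \<Rightarrow> 'k" and j i
  define h' where "h' y = (xx y, gspace n ?J (N y))" for y
  \<comment> \<open>The torus endomorphism dual to \<open>A\<close>: the character \<open>u\<close>
    at \<open>tt t\<close> is the character \<open>A u\<close> at \<open>t\<close>.\<close>
  define tt where "tt t i = chi t (A (uvec i))" for t :: "nat \<Rightarrow> 'k" and i
  have tt_nz: "tt t i \<noteq> 0" if "\<And>i. t i \<noteq> 0" for t i unfolding tt_def by (rule chi_nonzero[OF that])
  have chi_tt: "chi (tt t) u = chi t (A u)" if t: "\<And>i. t i \<noteq> 0" for t u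
  proof -
    have w: "chi (tt t) (wt uvec m) = chi t (A (wt uvec m))" for m
      unfolding A_wt chi_wt[OF t] chi_wt[OF tt_nz[OF t]] by (simp add: tt_def)
    \<comment> \<open>The fact \<open>w\<close> covers nonnegative combinations of unit vectors; a
      general exponent is a difference of two of these.\<close>
    have "chi (tt t) u * chi (tt t) (wt uvec (npart (- u))) = chi (tt t) (wt uvec (npart u))"
      unfolding npart_diff[of u, symmetric] by (rule chi_add[OF tt_nz[OF t], symmetric])
    also have "\<dots> = chi t (A (u + wt uvec (npart (- u))))" unfolding w npart_diff ..
    also have "\<dots> = chi t (A u) * chi (tt t) (wt uvec (npart (- u)))" unfolding A_add chi_add[OF t] w ..
    finally show ?thesis using chi_nonzero[OF tt_nz[OF t]] by simp
  qed
  have xx_X: "xx y \<in> X" if y: "y \<in> X" for y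
  proof -
    have eq: "pmon (xx y) m = pt_eval y (A (wt g m))" if m: "ks m \<subseteq> {..<n}" for m
    proof -
      have "pt_eval y (A (wt g m)) = (\<Prod>k\<in>ks m. pt_eval y (A (g k)) ^ lk m k)"
        unfolding A_wt by (rule pt_eval_wt_general[OF y]) (use m c1 in auto)
      also have "\<dots> = pmon (xx y) m" unfolding pmon_def xx_def using m by (intro prod.cong) auto
      finally show ?thesis by simp
    qed
    have "xx y \<in> kpoints n" by (simp add: xx_def kpoints_def)
    then show ?thesis unfolding toric_points_def by (simp add: eq)
  qed
  have h'_torus: "h' (torus_point n g t) = (torus_point n g (tt t), gspace n ?J (tcoef (tt t)))" if t: "\<And>i. t i \<noteq> 0" for t
  proof -
    have "xx (torus_point n g t) = torus_point n g (tt t)"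
      unfolding xx_def torus_point_def[of n g "tt t"] using pt_eval_torus[OF t c1] by (auto simp: chi_tt[OF t])
    moreover have "gspace n ?J (N (torus_point n g t)) = gspace n ?J (tcoef (tt t))"
    proof (rule gspace_cong)
      fix j i assume j: "j \<in> ?J" and "i \<in> {..<n} - ?J"
      then have i: "i < d" using I by blast
      have "chi t (A (g j - uvec i)) * tt t i = chi t (A (g j))"
        unfolding A_diff tt_def using chi_add[OF t, where u = "A (g j) - A (uvec i)" and v = "A (uvec i)"] by simp
      then have "chi t (A (g j - uvec i)) = chi (tt t) (g j) / tt t i"
        using tt_nz[OF t] by (simp add: chi_tt[OF t] eq_divide_eq)
      then show "N (torus_point n g t) j i = tcoef (tt t) j i"
        unfolding N_def tcoef_def using pt_eval_torus[OF t c2[OF j i]] by (cases "of_int (lk (g j) i) = (0::'k)") auto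
    qed
    ultimately show ?thesis by (simp add: h'_def)
  qed
  have "\<forall>y. \<exists>u. u \<noteq> 0 \<and> (\<forall>e. \<forall>F\<in>pluecker_forms d n e.
     pluecker_eval d F (h' y) = u ^ e * peval F (case_sum (xx y) (minor d (base_vec d n (N y)))))"
    unfolding h'_def by (rule allI, rule pluecker_eval_frame[OF graph_frame[OF d_le_n]])
  from choice[OF this] obtain uu where uu: "\<And>y. uu y \<noteq> 0" "\<And>y e F. F \<in> pluecker_forms d n e \<Longrightarrow>
     pluecker_eval d F (h' y) = uu y ^ e * peval F (case_sum (xx y) (minor d (base_vec d n (N y))))" by blast
  define B where "B F y = peval F (case_sum (xx y) (minor d (base_vec d n (N y))))" for F y
  have B: "pluecker_eval d F (h' y) = uu y ^ e * B F y" if "F \<in> pluecker_forms d n e" for F e y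
    unfolding B_def by (rule uu(2)[OF that])
  have loc_N: "local_frac X (poly_fracs n) y (\<lambda>y. N y j i)" if "j \<in> ?J" "i < d" for y j i
  proof (cases "of_int (lk (g j) i) = (0::'k)")
    case False
    show ?thesis unfolding N_def
      by (rule local_frac_mult[OF Q local_frac_const[OF Q] local_frac_pt_eval[OF c2[OF that False]]])
  qed (simp add: N_def local_frac_const[OF Q])
  have loc_B: "local_frac X (poly_fracs n) y (B F)" if F: "F \<in> pluecker_forms d n e" for F e y
    unfolding B_def
  proof (rule local_frac_peval[OF Q])
    fix i m assume im: "m \<in> ks F" "i \<in> ks m"
    have "i \<in> Inl ` {..<n} \<union> Inr ` {I. I \<subseteq> {..<n} \<and> card I = d}"
      using F im unfolding pluecker_forms_def polys_in_iff by blast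
    then show "local_frac X (poly_fracs n) y (\<lambda>y. case_sum (xx y) (minor d (base_vec d n (N y))) i)"
    proof
      assume "i \<in> Inl ` {..<n}"
      then show ?thesis using local_frac_pt_eval[OF c1] by (auto simp: xx_def)
    next
      assume "i \<in> Inr ` {I. I \<subseteq> {..<n} \<and> card I = d}"
      then obtain I where I: "i = Inr I" by blast
      have "local_frac X (poly_fracs n) y (\<lambda>y. base_vec d n (N y) i l)" if "i < d" for i l
      proof -
        have "(\<lambda>y. base_vec d n (N y) i l) = (if l = i then (\<lambda>_. 1) else if l \<in> ?J then (\<lambda>y. N y l i) else (\<lambda>_. 0))"
          by (auto simp: gvec_def)
        then show ?thesis using loc_N[OF _ that, of l y] local_frac_const[OF Q] by (simp only: split: if_split) blast
      qed
      then show ?thesis unfolding I by (simp add: local_frac_minor[OF Q])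
    qed
  qed
  have h'_Grass: "h' y \<in> X \<times> Grass d n" if "y \<in> X" for y
    unfolding h'_def using xx_X[OF that] graph_in_Grass[OF d_le_n] by simp
  \<comment> \<open>On torus points \<open>h'\<close> lands in the Gauss graph, so by density of the
    torus it maps all of \<open>X\<close> into the closure.\<close>
  have h'_ZC: "h' y \<in> ZC" if y: "y \<in> X" for y
    unfolding ZC_def in_closure_of topspace_frac_space[OF PQ]
  proof (intro conjI h'_Grass y allI impI)
    fix T assume T: "h' y \<in> T \<and> openin (ztop (frac_space (X \<times> Grass d n) (plu_fracs d n))) T"
    obtain a b where ab: "(a, b) \<in> plu_fracs d n" "b (h' y) \<noteq> 0" "{p \<in> X \<times> Grass d n. b p \<noteq> 0} \<subseteq> T"
      using openin_frac_space_basic[OF PQ conjunct2[OF T] conjunct1[OF T]] by blast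
    obtain e F0 G where G: "b = pluecker_eval d G" "G \<in> pluecker_forms d n e" using ab(1) by (elim plu_fracsE)
    have "B G y \<noteq> 0" using ab(2) unfolding G(1) B[OF G(2)] by simp
    from local_frac_polyD[OF loc_B[OF G(2)]] obtain P R where PR: "P \<in> polys_in {..<n}" "R \<in> polys_in {..<n}"
      "peval R y \<noteq> 0" "\<forall>z\<in>X. peval R z \<noteq> 0 \<longrightarrow> B G z = peval P z / peval R z" by blast
    have "peval P y \<noteq> 0" using PR(3,4) y \<open>B G y \<noteq> 0\<close> by auto
    then have nz: "peval (P * R) y \<noteq> 0" using PR(3) by (simp add: peval_mult)
    have PRin: "P * R \<in> polys_in {..<n}" by (rule subring_on_mult[OF subring_on_polys_in PR(1,2)])
    have "psub g (P * R) \<noteq> 0" using nz peval_eq_0[OF y PRin] by blast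
    from torus_dense[OF PRin this] obtain t where t: "\<And>i. t i \<noteq> 0" "peval (P * R) (torus_point n g t) \<noteq> 0" by blast
    let ?x = "torus_point n g t"
    have x: "?x \<in> X" by (rule torus_point_in[OF t(1)])
    have "B G ?x \<noteq> 0" using PR(4) x t(2) by (simp add: peval_mult)
    then have "b (h' ?x) \<noteq> 0" unfolding G(1) B[OF G(2)] using uu(1) by simp
    with h'_Grass[OF x] have "h' ?x \<in> {p \<in> X \<times> Grass d n. b p \<noteq> 0}" by (intro CollectI conjI)
    then have "h' ?x \<in> T" by (rule subsetD[OF ab(3)])
    moreover have "h' ?x \<in> gauss_graph d n X"
    proof -
      have "h' ?x = (torus_point n g (tt t), tan (torus_point n g (tt t)))"
        unfolding h'_torus[OF t(1)] tan_torus[OF tt_nz[OF t(1)]] ..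
      moreover have "torus_point n g (tt t) \<in> X - singular_locus d n X" by (rule torus_smooth[OF tt_nz[OF t(1)]])
      ultimately show ?thesis unfolding gauss_graph_def by blast
    qed
    ultimately show "\<exists>z. z \<in> gauss_graph d n X \<and> z \<in> T" by blast
  qed
  have h'_chart: "h' y \<in> chart" if "y \<in> X" for y
    unfolding chart_def using h'_ZC[OF that] pluecker_graph(1)[OF d_le_n] by (simp add: h'_def)
  have m': "morphism Y (frac_space chart (plu_fracs d n)) h'"
  proof (rule morphism_frac_spaceI[OF Q PQ h'_chart])
    fix a b :: "(nat \<Rightarrow> 'k) \<times> (nat \<Rightarrow> 'k) set \<Rightarrow> 'k" assume "(a, b) \<in> plu_fracs d n"
    then obtain e F G where FG: "a = pluecker_eval d F" "b = pluecker_eval d G" "F \<in> pluecker_forms d n e" "G \<in> pluecker_forms d n e"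
      by (elim plu_fracsE)
    show "\<exists>A B u. \<forall>y\<in>X. u y \<noteq> 0 \<and> a (h' y) = u y * A y \<and> b (h' y) = u y * B y \<and>
        local_frac X (poly_fracs n) y A \<and> local_frac X (poly_fracs n) y B"
      using loc_B[OF FG(3)] loc_B[OF FG(4)] uu(1)
      by (intro exI[of _ "B F"] exI[of _ "B G"] exI[of _ "\<lambda>y. uu y ^ e"]) (simp add: FG B[OF FG(3)] B[OF FG(4)])
  qed
  have pl: "pluecker d (snd z) {..<d} \<noteq> 0" "z \<in> X \<times> Grass d n" if "z \<in> chart" for z
    using that ZC_sub unfolding chart_def by auto
  have loc_c: "local_frac chart (plu_fracs d n) z (\<lambda>z. graph_coord d (snd z) j i)" if "z \<in> chart" "j \<in> ?J" "i < d" for z j i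
    by (rule local_frac_graph_coord[OF d_le_n pl(1) that(1,3,2)])
  let ?\<Gamma> = "\<lambda>t. (torus_point n g t, gspace n ?J (tcoef t))"
  let ?T = "generated_monoid (chart_gens TYPE('k))"
  \<comment> \<open>Each exponent of the chart semigroup gives a function on the chart: a coordinate
    for a generator of \<open>S\<close>, a rescaled graph coordinate for a difference, a product for
    a sum.\<close>
  have f_ex: "\<exists>f. (\<forall>z\<in>chart. local_frac chart (plu_fracs d n) z f) \<and> (\<forall>t. (\<forall>i. t i \<noteq> 0) \<longrightarrow> f (?\<Gamma> t) = chi t u) \<and>
      A u \<in> S \<and> (\<forall>y\<in>X. f (h' y) = pt_eval y (A u))" if "u \<in> ?T" for u
    using that
  proof induction
    case zero
    show ?case by (intro exI[of _ "\<lambda>_. 1"] conjI ballI local_frac_const[OF PQ]) (simp_all add: A_0 S_0 pt_eval_0)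
  next
    case (add v u)
    then obtain f where f: "\<forall>z\<in>chart. local_frac chart (plu_fracs d n) z f" "\<forall>t. (\<forall>i. t i \<noteq> 0) \<longrightarrow> f (?\<Gamma> t) = chi t u"
      "A u \<in> S" "\<forall>y\<in>X. f (h' y) = pt_eval y (A u)" by (elim exE conjE) (rule that, assumption+)
    have "\<exists>e. (\<forall>z\<in>chart. local_frac chart (plu_fracs d n) z e) \<and> (\<forall>t. (\<forall>i. t i \<noteq> 0) \<longrightarrow> e (?\<Gamma> t) = chi t v) \<and>
      A v \<in> S \<and> (\<forall>y\<in>X. e (h' y) = pt_eval y (A v))"
    proof (cases "v \<in> g ` {..<n}")
      case True
      then obtain s where s: "s < n" "v = g s" by (elim imageE) (rule that, simp_all)
      show ?thesis unfolding s(2)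
        by (intro exI[of _ "\<lambda>z. fst z s"] conjI ballI local_frac_plu_var[OF s(1)] c1[OF s(1)])
           (use s(1) in \<open>auto simp: torus_point_def h'_def xx_def\<close>)
    next
      case False
      have "v \<in> {g j - uvec i | j i. j \<in> {d..<n} \<and> i < d \<and> of_int (lk (g j) i) \<noteq> (0::'k)}"
        using add(1)[unfolded chart_gens_def] by (elim UnE) (rule notE[OF False], assumption)
      then obtain j i where ji: "j \<in> ?J" "i < d" "of_int (lk (g j) i) \<noteq> (0::'k)" "v = g j - uvec i"
        by (elim CollectE exE conjE) (rule that, assumption+)
      define c where "c = (of_int (lk (g j) i) :: 'k)"
      have c: "c \<noteq> 0" using ji(3) c_def by simp
      let ?f = "\<lambda>z. (1 / c) * graph_coord d (snd z) j i"
      have "local_frac chart (plu_fracs d n) z ?f" if "z \<in> chart" for z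
        by (rule local_frac_mult[OF PQ local_frac_const[OF PQ] loc_c[OF that ji(1,2)]])
      moreover have "?f (?\<Gamma> t) = chi t (g j - uvec i)" if t: "\<forall>i. t i \<noteq> 0" for t
      proof -
        have "chi t (g j - uvec i) * t i = chi t (g j)"
          using chi_add[where t = t and u = "g j - uvec i" and v = "uvec i"] t by simp
        then show ?thesis
          unfolding snd_conv pluecker_graph(2)[OF d_le_n ji(2,1)] tcoef_def c_def[symmetric] using c t by (simp add: divide_eq_eq)
      qed
      moreover have "?f (h' y) = pt_eval y (A v)" for y
        unfolding h'_def snd_conv pluecker_graph(2)[OF d_le_n ji(2,1)] N_def ji(4) c_def[symmetric] using c by simp
      ultimately show ?thesis unfolding ji(4) using c2[OF ji(1-3)] by (intro exI[of _ ?f]) simp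
    qed
    then obtain e where e: "\<forall>z\<in>chart. local_frac chart (plu_fracs d n) z e" "\<forall>t. (\<forall>i. t i \<noteq> 0) \<longrightarrow> e (?\<Gamma> t) = chi t v"
      "A v \<in> S" "\<forall>y\<in>X. e (h' y) = pt_eval y (A v)" by (elim exE conjE) (rule that, assumption+)
    show ?case
      by (intro exI[of _ "\<lambda>z. e z * f z"] conjI ballI local_frac_mult[OF PQ])
         (use e f in \<open>simp_all add: A_add S_add chi_add pt_eval_add\<close>)
  qed
  from bchoice[OF ballI[OF f_ex]] obtain f where f: "\<forall>u\<in>?T. (\<forall>z\<in>chart. local_frac chart (plu_fracs d n) z (f u)) \<and>
      (\<forall>t. (\<forall>i. t i \<noteq> 0) \<longrightarrow> f u (?\<Gamma> t) = chi t u) \<and> A u \<in> S \<and> (\<forall>y\<in>X. f u (h' y) = pt_eval y (A u))" by (rule exE)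
  have f_loc: "local_frac chart (plu_fracs d n) z (f u)" if "u \<in> ?T" "z \<in> chart" for u z
    using bspec[OF f that(1)] that(2) by simp
  have f_torus: "f u (?\<Gamma> t) = chi t u" if "u \<in> ?T" "\<And>i. t i \<noteq> 0" for u t
    using bspec[OF f that(1)] that(2) by simp
  have f_h': "f u (h' y) = pt_eval y (A u)" if "u \<in> ?T" "y \<in> X" for u y
    using bspec[OF f that(1)] that(2) by simp
  have A_S: "A u \<in> S" if "u \<in> ?T" for u using bspec[OF f that] by simp
  have "\<forall>k. \<exists>u v. k < n \<longrightarrow> u \<in> ?T \<and> v \<in> ?T \<and> frag_cmul (int q) (u - v) \<in> ?T \<and> A u = A v + g k"
    using c3 by simp
  from choice[OF this] obtain un where "\<forall>k. \<exists>v. k < n \<longrightarrow> un k \<in> ?T \<and> v \<in> ?T \<and> frag_cmul (int q) (un k - v) \<in> ?T \<and>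
    A (un k) = A v + g k" by (rule exE)
  from choice[OF this] obtain vn where uv: "\<forall>k. k < n \<longrightarrow> un k \<in> ?T \<and> vn k \<in> ?T \<and> frag_cmul (int q) (un k - vn k) \<in> ?T \<and>
    A (un k) = A (vn k) + g k" by (rule exE)
  \<comment> \<open>This exponent lies in the chart semigroup and \<open>A\<close> maps it to
    \<open>q\<close> times \<open>g k\<close>. Its function \<open>fq k\<close> therefore pulls back
    to the \<open>q\<close>-th power of coordinate \<open>k\<close>.\<close>
  define \<gamma> where "\<gamma> k = frag_cmul (int q) (un k - vn k)" for k
  have un: "un k \<in> ?T" and vn: "vn k \<in> ?T" and \<gamma>T: "\<gamma> k \<in> ?T" and Auv: "A (un k) = A (vn k) + g k" if "k < n" for k
    using uv[rule_format, OF that] by (simp_all add: \<gamma>_def)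
  have A\<gamma>: "A (\<gamma> k) = frag_cmul (int q) (g k)" if "k < n" for k
    unfolding \<gamma>_def A_cmul A_diff Auv[OF that] by simp
  define fq where "fq k = f (\<gamma> k)" for k
  have fq_h': "fq k (h' y) = y k ^ q" if "k < n" "y \<in> X" for k y
    unfolding fq_def f_h'[OF \<gamma>T[OF that(1)] that(2)] A\<gamma>[OF that(1)] pt_eval_cmul(2)[OF that(2) g_S[OF that(1)]]
      pt_eval_g[OF that(2,1)] ..
  have fq_mon: "local_frac chart (plu_fracs d n) z (\<lambda>z. pmon (\<lambda>k. fq k z) m)" if "ks m \<subseteq> {..<n}" "z \<in> chart" for m z
    unfolding pmon_def fq_def
    by (intro local_frac_prod[OF PQ] local_frac_power[OF PQ] f_loc \<gamma>T that(2)) (use that(1) in blast)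
  have fq_torus: "pmon (\<lambda>k. fq k (?\<Gamma> t)) m = chi t (wt \<gamma> m)" if t: "\<And>i. t i \<noteq> 0" and m: "ks m \<subseteq> {..<n}" for t m
    unfolding chi_wt[OF t] pmon_def fq_def using m f_torus[OF \<gamma>T t] by (intro prod.cong) auto
  have A_wt\<gamma>: "A (wt \<gamma> m) = frag_cmul (int q) (wt g m)" if "ks m \<subseteq> {..<n}" for m
  proof -
    have "A (wt \<gamma> m) = wt (\<lambda>k. A (\<gamma> k)) m" by (rule A_wt)
    also have "\<dots> = (\<Sum>k\<in>ks m. frag_cmul (int q) (frag_cmul (int (lk m k)) (g k)))"
      unfolding wt_def
    proof (rule sum.cong[OF refl])
      fix k assume "k \<in> ks m"
      then have "k < n" using that by blast
      then show "frag_cmul (int (lk m k)) (A (\<gamma> k)) = frag_cmul (int q) (frag_cmul (int (lk m k)) (g k))"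
        by (simp add: A\<gamma> mult.commute)
    qed
    also have "\<dots> = frag_cmul (int q) (wt g m)" unfolding wt_def by (rule zmod.scale_sum_right[symmetric])
    finally show ?thesis .
  qed
  have sub_loc: "local_frac chart (plu_fracs d n) z (\<lambda>z. p z + (-1) * q z)"
    if "local_frac chart (plu_fracs d n) z p" "local_frac chart (plu_fracs d n) z q" for z p q
    by (rule local_frac_add[OF PQ that(1) local_frac_mult[OF PQ local_frac_const[OF PQ] that(2)]])
  have agree: "p z = q z" if z: "z \<in> chart" and p: "\<And>z. z \<in> chart \<Longrightarrow> local_frac chart (plu_fracs d n) z p"
    and q: "\<And>z. z \<in> chart \<Longrightarrow> local_frac chart (plu_fracs d n) z q"
    and eq: "\<And>t. (\<And>i. t i \<noteq> 0) \<Longrightarrow> p (?\<Gamma> t) = q (?\<Gamma> t)" for p q :: "(nat \<Rightarrow> 'k) \<times> (nat \<Rightarrow> 'k) set \<Rightarrow> 'k" and z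
  proof -
    have "p z + (-1) * q z = 0"
    proof (rule chart_vanish[OF d _ _ z, where f = "\<lambda>z. p z + (-1) * q z"])
      fix z :: "(nat \<Rightarrow> 'k) \<times> (nat \<Rightarrow> 'k) set" assume "z \<in> chart"
      then show "local_frac chart (plu_fracs d n) z (\<lambda>z. p z + (-1) * q z)" by (intro sub_loc p q)
    next
      fix t :: "nat \<Rightarrow> 'k" assume "\<And>i. t i \<noteq> 0"
      then show "p (?\<Gamma> t) + (-1) * q (?\<Gamma> t) = 0" by (simp add: eq)
    qed
    then show ?thesis by simp
  qed
  \<comment> \<open>The preimage of \<open>z\<close> is made of \<open>q\<close>-th roots of the
    values \<open>fq k z\<close>. The binomial equations hold for the \<open>q\<close>-th powers by
    comparison on the torus, hence for the roots by their uniqueness.\<close>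
  have root_ex: "\<exists>x\<in>X. h' x = z \<and> (\<forall>k<n. x k ^ q = fq k z)" if z: "z \<in> chart" for z
  proof -
    have "\<forall>k. \<exists>a. a ^ q = fq k z" using nth_root_exists[OF q] by blast
    from choice[OF this] obtain a where a: "\<And>k. a k ^ q = fq k z" by blast
    define x where "x = (\<lambda>k. if k < n then a k else 0)"
    have pq: "pmon x m ^ q = pmon (\<lambda>k. fq k z) m" if "ks m \<subseteq> {..<n}" for m
      unfolding pmon_def prod_power_distrib
    proof (rule prod.cong[OF refl])
      fix i assume "i \<in> ks m"
      then have "x i ^ q = fq i z" using that a by (auto simp: x_def)
      then show "(x i ^ lk m i) ^ q = fq i z ^ lk m i" by (metis power_mult mult.commute)
    qed
    have x: "x \<in> X" unfolding toric_points_def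
    proof (intro CollectI conjI allI impI)
      show "x \<in> kpoints n" by (simp add: x_def kpoints_def)
      fix m m' assume m: "ks m \<subseteq> {..<n}" "ks m' \<subseteq> {..<n}" "wt g m = wt g m'"
      have w: "wt \<gamma> m = wt \<gamma> m'" by (rule A_eq) (simp add: A_wt\<gamma> m)
      have "pmon (\<lambda>k. fq k z) m = pmon (\<lambda>k. fq k z) m'"
        by (rule agree[OF z fq_mon[OF m(1)] fq_mon[OF m(2)]]) (simp_all add: fq_torus m w)
      then show "pmon x m = pmon x m'" by - (rule root_unique[OF frob], simp only: pq m)
    qed
    \<comment> \<open>A function on the chart that restricts to the character \<open>u\<close> on
      the torus takes at \<open>z\<close> the value of \<open>A u\<close> at \<open>x\<close>,
      because both values have the same \<open>q\<close>-th power.\<close>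
    have root: "pt_eval x (A u) = p z" if u: "A u \<in> S" and p: "\<And>z. z \<in> chart \<Longrightarrow> local_frac chart (plu_fracs d n) z p"
      "\<And>t. (\<And>i. t i \<noteq> 0) \<Longrightarrow> p (?\<Gamma> t) = chi t u" for u p
    proof -
      obtain m where m: "A u = wt g m" "ks m \<subseteq> {..<n}"
        using u[unfolded S_def] by (elim imageE CollectE) (rule that, assumption+)
      have w: "wt \<gamma> m = frag_cmul (int q) u" by (rule A_eq) (simp add: A_wt\<gamma> m A_cmul)
      have "pmon (\<lambda>k. fq k z) m = p z ^ q"
        by (rule agree[OF z fq_mon[OF m(2)] local_frac_power[OF PQ p(1)]]) (simp_all add: fq_torus m(2) w p(2) chi_cmul)
      then show ?thesis unfolding m(1) pt_eval_wt[OF x m(2)] by - (rule root_unique[OF frob], simp only: pq m)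
    qed
    have "xx x s = fst z s" for s
    proof (cases "s < n")
      case True
      have "pt_eval x (A (g s)) = fst z s"
        by (rule root[OF c1[OF True] local_frac_plu_var[OF True]]) (simp add: torus_point_def True)
      then show ?thesis using True by (simp add: xx_def)
    next
      case False
      have "fst z \<in> X" using pl(2)[OF z] by (simp add: mem_Times_iff)
      then have "fst z \<in> kpoints n" by (rule subsetD[OF X_kpoints])
      then show ?thesis using False by (simp add: xx_def kpoints_def)
    qed
    then have 1: "xx x = fst z" by (rule ext)
    have "gspace n ?J (N x) = gspace n ?J (graph_coord d (snd z))"
    proof (rule gspace_cong)
      fix j i assume j: "j \<in> ?J" and "i \<in> {..<n} - ?J"
      then have i: "i < d" unfolding I by simp
      show "N x j i = graph_coord d (snd z) j i"
      proof (cases "of_int (lk (g j) i) = (0::'k)")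
        case True
        have "graph_coord d (snd z) j i = 0"
          by (rule agree[OF z loc_c[OF _ j i] local_frac_const[OF PQ]])
             (simp_all add: pluecker_graph(2)[OF d_le_n i j] tcoef_def True)
        then show ?thesis by (simp add: N_def True)
      next
        case False
        let ?c = "of_int (lk (g j) i) :: 'k"
        have "pt_eval x (A (g j - uvec i)) = (1 / ?c) * graph_coord d (snd z) j i"
        proof (rule root[OF c2[OF j i False] local_frac_mult[OF PQ local_frac_const[OF PQ] loc_c[OF _ j i]]])
          fix t :: "nat \<Rightarrow> 'k" assume t: "\<And>i. t i \<noteq> 0"
          have "chi t (g j - uvec i) * t i = chi t (g j)"
            using chi_add[OF t, where u = "g j - uvec i" and v = "uvec i"] by simp
          then show "1 / ?c * graph_coord d (snd (?\<Gamma> t)) j i = chi t (g j - uvec i)"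
            unfolding snd_conv pluecker_graph(2)[OF d_le_n i j] tcoef_def using t False by (simp add: divide_eq_eq)
        qed
        then show ?thesis unfolding N_def using False by simp
      qed
    qed
    moreover have "snd z = gspace n ?J (graph_coord d (snd z))"
      using pl[OF z] by (intro gspace_graph_coord d d_le_n) (simp_all add: mem_Times_iff)
    ultimately have "h' x = z" unfolding h'_def 1 by simp
    then show ?thesis using x a by (intro bexI[of _ x]) (simp_all add: x_def)
  qed
  have h'_bij: "bij_betw h' X chart"
  proof (rule bij_betwI')
    fix x y :: "nat \<Rightarrow> 'k" assume xy: "x \<in> X" "y \<in> X"
    show "h' x = h' y \<longleftrightarrow> x = y"
    proof
      assume eq: "h' x = h' y"
      show "x = y"
      proof
        fix k
        show "x k = y k"
        proof (cases "k < n")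
          case True
          have "x k ^ q = y k ^ q" using fq_h'[OF True xy(1)] fq_h'[OF True xy(2)] eq by simp
          then show ?thesis by (rule root_unique[OF frob])
        next
          case False
          then show ?thesis using subsetD[OF X_kpoints xy(1)] subsetD[OF X_kpoints xy(2)] by (simp add: kpoints_def)
        qed
      qed
    qed simp
  next
    fix z :: "(nat \<Rightarrow> 'k) \<times> (nat \<Rightarrow> 'k) set" assume "z \<in> chart"
    from root_ex[OF this] obtain x where "x \<in> X" "h' x = z" by (elim bexE conjE) (rule that)
    then show "\<exists>x\<in>X. z = h' x" by (intro bexI[of _ x]) simp_all
  qed (rule h'_chart)
  have iR: "irreducible_variety (NY :: ((nat \<Rightarrow> 'k) \<times> (nat \<Rightarrow> 'k) set, 'k) fspace)" by (rule irreducible_nash[OF d])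
  note IR = irreducible_frac_space.intro[OF PQ iR]
  have ch: "openin (ztop NY) (chart :: ((nat \<Rightarrow> 'k) \<times> (nat \<Rightarrow> 'k) set) set)" by (rule chart_open)
  have dominant: "\<exists>x\<in>X. h' x \<in> V" if V: "openin (ztop NY) V" "V \<noteq> {}" for V
  proof -
    have "(chart :: ((nat \<Rightarrow> 'k) \<times> (nat \<Rightarrow> 'k) set) set) \<noteq> {}" using h'_chart[OF torus_point_in[of "\<lambda>_. 1"]] by auto
    then have "V \<inter> chart \<noteq> {}" by (rule irreducible_frac_space.meets[OF IR V(1) ch V(2)])
    then obtain z where z: "z \<in> V" "z \<in> chart" by blast
    from root_ex[OF z(2)] obtain x where "x \<in> X" "h' x = z" by (elim bexE conjE) (rule that)
    then show ?thesis using z(1) by (intro bexI[of _ x]) simp_all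
  qed
  have XY: "openin (ztop Y) (X :: (nat \<Rightarrow> 'k) set)" by (metis openin_topspace topspace_frac_space[OF Q])
  interpret RC: radicial_cover "ZC :: ((nat \<Rightarrow> 'k) \<times> (nat \<Rightarrow> 'k) set) set" "plu_fracs d n" "X :: (nat \<Rightarrow> 'k) set" "poly_fracs n" chart h' q
  proof (unfold_locales, rule PQ, rule iR, rule Q, rule irreducible_Y, rule ch, erule (1) local_normal_Y, rule m', rule h'_bij,
      erule (1) dominant, rule q, rule frob)
    fix a b :: "(nat \<Rightarrow> 'k) \<Rightarrow> 'k" assume "(a, b) \<in> poly_fracs n"
    then obtain P R where "a = peval P" "b = peval R" "P \<in> polys_in {..<n}" "R \<in> polys_in {..<n}" by (elim poly_fracsE)
    then have P: "a = peval P" "P \<in> polys_in {..<n}" by simp_all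
    show "a \<in> regular Y X" unfolding regular_frac_space[OF Q] P(1) by (intro conjI ballI XY local_frac_peval_affine[OF P(2)])
    \<comment> \<open>The rational inverse of \<open>h'\<close>: coordinate \<open>k\<close> is the
      quotient of the functions of \<open>un k\<close> and \<open>vn k\<close>, because
      \<open>A\<close> maps the difference of these exponents to \<open>g k\<close>.\<close>
    define F where "F z = (\<lambda>k. if k < n then f (un k) z / f (vn k) z else 0)" for z
    define D where "D z = (\<Prod>k<n. f (vn k) z)" for z
    \<comment> \<open>By additivity the \<open>q\<close>-th power of \<open>P\<close> arises by
      raising the coefficients to the \<open>q\<close>-th power and substituting \<open>fq k\<close>
      for the \<open>q\<close>-th power of variable \<open>k\<close>.\<close>
    define G where "G z = (\<Sum>m\<in>ks P. lk P m ^ q * pmon (\<lambda>k. fq k z) m)" for z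
    have D_loc: "local_frac chart (plu_fracs d n) z D" if "z \<in> chart" for z
      unfolding D_def by (intro local_frac_prod[OF PQ] f_loc vn that) simp
    let ?V = "{z \<in> chart. D z \<noteq> 0}"
    have D_h': "D (h' x) = (\<Prod>k<n. pt_eval x (A (vn k)))" if "x \<in> X" for x
      unfolding D_def by (intro prod.cong) (auto simp: f_h'[OF vn that])
    have F_h': "F (h' x) = x" if x: "x \<in> X" and D: "D (h' x) \<noteq> 0" for x
    proof
      fix k
      show "F (h' x) k = x k"
      proof (cases "k < n")
        case True
        have "pt_eval x (A (vn k)) \<noteq> 0" using D True unfolding D_h'[OF x] by auto
        moreover have "pt_eval x (A (un k)) = pt_eval x (A (vn k)) * x k"
          unfolding Auv[OF True] pt_eval_add[OF x A_S[OF vn[OF True]] g_S[OF True]] pt_eval_g[OF x True] ..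
        ultimately show ?thesis unfolding F_def using True f_h'[OF un[OF True] x] f_h'[OF vn[OF True] x] by simp
      next
        case False
        then show ?thesis using subsetD[OF X_kpoints x] by (simp add: F_def kpoints_def)
      qed
    qed
    \<comment> \<open>The unit of the torus witnesses that the common denominator \<open>D\<close>
      does not vanish identically.\<close>
    let ?one = "torus_point n g (\<lambda>_. 1::'k)"
    have one: "?one \<in> X" "D (h' ?one) \<noteq> 0"
    proof -
      show 1: "?one \<in> X" by (rule torus_point_in) simp
      have "pt_eval ?one (A (vn k)) \<noteq> 0" if "k < n" for k
        using pt_eval_torus[OF _ A_S[OF vn[OF that]], of "\<lambda>_. 1::'k"] chi_nonzero[of "\<lambda>_. 1::'k"] by simp
      then show "D (h' ?one) \<noteq> 0" unfolding D_h'[OF 1] by simp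
    qed
    have VO: "openin (ztop (frac_space chart (plu_fracs d n))) ?V" by (rule openin_local_frac_nonzero[OF PQ D_loc])
    have "(\<lambda>z. peval P (F z)) \<in> regular (frac_space chart (plu_fracs d n)) ?V"
      unfolding regular_frac_space[OF PQ]
    proof (intro conjI VO ballI)
      fix z assume z: "z \<in> ?V"
      show "local_frac chart (plu_fracs d n) z (\<lambda>z. peval P (F z))"
      proof (rule local_frac_peval[OF PQ])
        fix i m assume "m \<in> ks P" "i \<in> ks m"
        then have i: "i < n" using P(2) unfolding polys_in_iff by blast
        have "f (vn i) z \<noteq> 0" using z i by (auto simp: D_def)
        then have "local_frac chart (plu_fracs d n) z (\<lambda>z. f (un i) z / f (vn i) z)"
          using z by (intro local_frac_divide[OF PQ] f_loc un vn i) auto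
        then show "local_frac chart (plu_fracs d n) z (\<lambda>z. F z i)" using i by (simp add: F_def)
      qed
    qed
    then have Freg: "(\<lambda>z. peval P (F z)) \<in> regular NY ?V"
      unfolding regular_frac_open_subspace[OF PQ ch] by blast
    have "?V \<noteq> {}" using one(2) h'_chart[OF one(1)] by blast
    with Freg have "(\<lambda>z. peval P (F z)) \<in> rat_funs NY" by (rule irreducible_frac_space.rat_funsI[OF IR])
    moreover have "G \<in> regular NY chart"
    proof -
      have co: "openin (ztop (frac_space (chart :: ((nat \<Rightarrow> 'k) \<times> (nat \<Rightarrow> 'k) set) set) (plu_fracs d n))) chart"
        by (metis openin_topspace topspace_frac_space[OF PQ])
      have "G \<in> regular (frac_space chart (plu_fracs d n)) chart" unfolding regular_frac_space[OF PQ]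
      proof (intro conjI co ballI)
        fix z :: "(nat \<Rightarrow> 'k) \<times> (nat \<Rightarrow> 'k) set" assume z: "z \<in> chart"
        show "local_frac chart (plu_fracs d n) z G" unfolding G_def
          by (intro local_frac_sum[OF PQ] local_frac_mult[OF PQ] local_frac_const[OF PQ] fq_mon z)
             (use P(2) in \<open>simp add: polys_in_iff\<close>)
      qed
      then show ?thesis unfolding regular_frac_open_subspace[OF PQ ch] by blast
    qed
    moreover have "rat_eq Y (\<lambda>x. peval P (F (h' x))) a"
    proof -
      have loc_v: "local_frac X (poly_fracs n) y (\<lambda>x. \<Prod>k<n. pt_eval x (A (vn k)))" for y :: "nat \<Rightarrow> 'k"
        by (rule local_frac_prod[OF Q local_frac_pt_eval[OF A_S[OF vn]]]) simp
      have "openin (ztop Y) {x \<in> X. (\<Prod>k<n. pt_eval x (A (vn k))) \<noteq> (0::'k)}"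
        by (rule openin_local_frac_nonzero[OF Q loc_v])
      also have "{x \<in> X. (\<Prod>k<n. pt_eval x (A (vn k))) \<noteq> 0} = {x \<in> X. D (h' x) \<noteq> 0}" using D_h' by auto
      finally have "openin (ztop Y) {x \<in> X. D (h' x) \<noteq> 0}" .
      then show ?thesis unfolding rat_eq_def P(1) using one F_h' by (intro exI[of _ "{x \<in> X. D (h' x) \<noteq> 0}"]) auto
    qed
    moreover have "G (h' x) = a x ^ q" if x: "x \<in> X" for x
    proof -
      have zero: "(0::'k) ^ q = 0" using q by (simp add: zero_power)
      have frob_sum: "(\<Sum>m\<in>M. e m) ^ q = (\<Sum>m\<in>M. e m ^ q)" for e :: "(nat \<Rightarrow>\<^sub>0 nat) \<Rightarrow> 'k" and M
        by (induction M rule: infinite_finite_induct) (simp_all add: frob zero)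
      have "pmon (\<lambda>k. fq k (h' x)) m = pmon x m ^ q" if "m \<in> ks P" for m
        unfolding pmon_def prod_power_distrib
      proof (rule prod.cong[OF refl])
        fix i assume "i \<in> ks m"
        then have "i < n" using that P(2) unfolding polys_in_iff by blast
        then have "fq i (h' x) = x i ^ q" by (rule fq_h'[OF _ x])
        then show "fq i (h' x) ^ lk m i = (x i ^ lk m i) ^ q" by (metis power_mult mult.commute)
      qed
      then show ?thesis unfolding G_def P(1) peval_mext mext_def frob_sum power_mult_distrib by (auto intro!: sum.cong)
    qed
    ultimately show "\<exists>F G. F \<in> rat_funs NY \<and> G \<in> regular NY chart \<and> rat_eq Y (\<lambda>x. F (h' x)) a \<and> (\<forall>x\<in>X. G (h' x) = a x ^ q)"
      by (intro exI[of _ "\<lambda>z. peval P (F z)"] exI[of _ G]) simp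
  qed
  show ?thesis using RC.normalization_radicial unfolding normalized_nash_blowup_def nash_eq affine_var_eq[OF X_kpoints] .
qed

end

section \<open>Examples from integer matrices\<close>

text \<open>Vectors are lists from here on, so that conditions on concrete matrices reduce to
  integer arithmetic. Entries beyond the shorter list are ignored.\<close>

fun ldot :: "int list \<Rightarrow> int list \<Rightarrow> int" where
  "ldot (x # xs) (y # ys) = x * y + ldot xs ys"
| "ldot _ _ = 0"

lemma ldot_sum: "length xs = length ys \<Longrightarrow> ldot xs ys = (\<Sum>i<length xs. xs ! i * ys ! i)"
  by (induction xs ys rule: list_induct2) (simp_all add: sum.lessThan_Suc_shift del: sum.lessThan_Suc)

lemma lookup_sum_single: "finite I \<Longrightarrow> lk (\<Sum>i\<in>I. sgl i (f i)) j = (if j \<in> I then f j else 0)"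
  by (induction I rule: finite_induct) (auto simp: lookup_add lookup_single when_def)

definition pvec :: "int list \<Rightarrow> (nat \<Rightarrow>\<^sub>0 int)" where
  "pvec xs = (\<Sum>i<length xs. sgl i (xs ! i))"

lemma lookup_pvec: "lk (pvec xs) i = (if i < length xs then xs ! i else 0)"
  unfolding pvec_def by (simp add: lookup_sum_single)

lemma lookup_uvec: "lk (uvec i) j = (if i = j then 1 else 0)"
  by (simp add: uvec_def lookup_single when_def)

lemma pvec_inj: "length xs = length ys \<Longrightarrow> pvec xs = pvec ys \<Longrightarrow> xs = ys"
  by (rule nth_equalityI) (simp, metis lookup_pvec)

lemma pvec_map2:
  assumes "length xs = length ys"
  shows "pvec xs + pvec ys = pvec (map2 (+) xs ys)" "pvec xs - pvec ys = pvec (map2 (-) xs ys)"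
  using assms by (auto intro!: poly_mapping_eqI simp: lookup_pvec lookup_add lookup_minus)

lemma pvec_cmul: "frag_cmul a (pvec xs) = pvec (map ((*) a) xs)"
  by (rule poly_mapping_eqI) (simp add: lookup_pvec)

definition unit_list :: "nat \<Rightarrow> nat \<Rightarrow> int list" where
  "unit_list r i = (replicate r 0)[i := 1]"

lemma length_unit_list [simp]: "length (unit_list r i) = r" by (simp add: unit_list_def)

lemma pvec_unit_list: "i < r \<Longrightarrow> pvec (unit_list r i) = uvec i"
  by (rule poly_mapping_eqI) (simp add: lookup_pvec lookup_uvec unit_list_def nth_list_update)

definition fval :: "int list \<Rightarrow> (nat \<Rightarrow>\<^sub>0 int) \<Rightarrow> int" where
  "fval F u = (\<Sum>i<length F. F ! i * lk u i)"

lemma fval_add: "fval F (u + v) = fval F u + fval F v"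
  by (simp add: fval_def lookup_add distrib_left sum.distrib)

lemma fval_pvec: "length xs = length F \<Longrightarrow> fval F (pvec xs) = ldot F xs"
  by (simp add: fval_def lookup_pvec ldot_sum)

lemma fval_uvec: "fval F (uvec i) = (if i < length F then F ! i else 0)"
proof -
  have "fval F (uvec i) = (\<Sum>j<length F. if i = j then F ! j else 0)"
    unfolding fval_def by (intro sum.cong) (auto simp: lookup_uvec)
  then show ?thesis by simp
qed

lemma additive_wt:
  assumes l: "additive_on_Z l" shows "l (wt g m) = (\<Sum>k\<in>ks m. int (lk m k) * l (g k))"
proof -
  have l0: "l 0 = 0" using l unfolding additive_on_Z_def by (metis add_cancel_right_right)
  have lc: "l (frag_cmul (int a) u) = int a * l u" for a u
    using l unfolding additive_on_Z_def by (induction a) (simp_all add: l0 frag_cmul_distrib distrib_right)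
  have "l (\<Sum>k\<in>K. f k) = (\<Sum>k\<in>K. l (f k))" for K and f :: "'a \<Rightarrow> _"
    using l unfolding additive_on_Z_def by (induction K rule: infinite_finite_induct) (simp_all add: l0)
  then show ?thesis unfolding wt_def by (simp add: lc)
qed

text \<open>
  The semigroup of dimension \<open>r\<close> generated by the unit vectors and \<open>bs\<close>, cut out by \<open>Fs\<close>, with \<open>d - r\<close>
  free generators added. The vectors \<open>cols\<close> are the images of the unit vectors under the isomorphism
  from the saturated semigroup of the chart.
\<close>

locale toric_example =
  fixes r d :: nat and bs Fs cols :: "int list list" and w :: "int list" and c :: int
  assumes r_le_d: "0 < r" "r \<le> d" and bs: "bs \<noteq> []" "\<forall>b\<in>set bs. length b = r"
    and cols: "length cols = r" and Fs: "\<forall>F\<in>set Fs. length F = r" and w: "length w = r"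
    and Fs_nonneg: "\<forall>F\<in>set Fs. \<forall>b\<in>set (map (unit_list r) [0..<r] @ bs). 0 \<le> ldot F b"
    and c: "0 < c" and weights: "\<forall>b\<in>set (map (unit_list r) [0..<r] @ bs). c \<le> ldot w b \<and> ldot w b < 2 * c"
    and dist: "distinct (map (unit_list r) [0..<r] @ bs)"
    and cone_core: "\<And>us. length us = r \<Longrightarrow> \<forall>F\<in>set Fs. 0 \<le> ldot F us \<Longrightarrow>
       \<exists>as. length as = r + length bs \<and> (\<forall>a\<in>set as. 0 \<le> a) \<and>
         us = map (\<lambda>i. as ! i + ldot (drop r as) (map (\<lambda>b. b ! i) bs)) [0..<r]"
    and cols_inj: "\<And>us. length us = r \<Longrightarrow> map (\<lambda>j. ldot us (map (\<lambda>v. v ! j) cols)) [0..<r] = replicate r 0 \<Longrightarrow>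
       us = replicate r 0"
    and cols_nonneg: "\<forall>F\<in>set Fs. \<forall>b\<in>set (map (unit_list r) [0..<r] @ bs).
       0 \<le> ldot F (map (\<lambda>j. ldot b (map (\<lambda>v. v ! j) cols)) [0..<r])"
begin

definition img :: "int list \<Rightarrow> int list" where
  "img xs = map (\<lambda>j. ldot xs (map (\<lambda>v. v ! j) cols)) [0..<r]"

definition n :: nat where "n = d + length bs"

definition g :: "nat \<Rightarrow> (nat \<Rightarrow>\<^sub>0 int)" where
  "g k = (if k < d then uvec k else pvec (bs ! (k - d)))"

text \<open>Coordinates from \<open>r\<close> on are nonnegative, and the opposite sign from
  \<open>d\<close> on forces those to vanish: the ambient group has infinite rank.\<close>

definition \<Lambda> :: "((nat \<Rightarrow>\<^sub>0 int) \<Rightarrow> int) set" where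
  "\<Lambda> = fval ` set Fs \<union> {(\<lambda>u. lk u i) | i. r \<le> i} \<union> {(\<lambda>u. - lk u i) | i. d \<le> i}"

lemma \<Lambda>_iff: "(\<forall>l\<in>\<Lambda>. 0 \<le> l u) \<longleftrightarrow> (\<forall>F\<in>set Fs. 0 \<le> fval F u) \<and> (\<forall>i\<ge>r. 0 \<le> lk u i) \<and> (\<forall>i\<ge>d. lk u i \<le> 0)"
  unfolding \<Lambda>_def by (auto simp: ball_Un)

lemma g_cases:
  assumes "k < n"
  obtains (unit) "k < r" "g k = pvec (unit_list r k)" "unit_list r k \<in> set (map (unit_list r) [0..<r] @ bs)"
  | (free) "r \<le> k" "k < d" "g k = uvec k"
  | (extra) "d \<le> k" "g k = pvec (bs ! (k - d))" "bs ! (k - d) \<in> set (map (unit_list r) [0..<r] @ bs)" "bs ! (k - d) \<in> set bs"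
proof -
  consider "k < r" | "r \<le> k" "k < d" | "d \<le> k" by linarith
  then show thesis
  proof cases
    case 1
    then show thesis using r_le_d by (intro unit) (simp_all add: g_def pvec_unit_list)
  next
    case 2
    then show thesis by (intro free) (simp_all add: g_def)
  next
    case 3
    then have "bs ! (k - d) \<in> set bs" using assms by (intro nth_mem) (simp add: n_def)
    then show thesis using 3 by (intro extra) (simp_all add: g_def)
  qed
qed

lemma length_gen: "b \<in> set (map (unit_list r) [0..<r] @ bs) \<Longrightarrow> length b = r" using bs(2) by auto

sublocale toric d n g \<Lambda>
proof
  show "d \<le> n" by (simp add: n_def)
  show "g i = uvec i" if "i < d" for i using that by (simp add: g_def)
  show "ks (g i) \<subseteq> {..<d}" if "i < n" for i
    using that
  proof (cases rule: g_cases)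
    case extra
    then show ?thesis using bs(2) r_le_d by (auto simp: in_keys_iff lookup_pvec split: if_splits)
  qed (use r_le_d in \<open>auto simp: in_keys_iff lookup_pvec lookup_uvec split: if_splits\<close>)
  show add: "additive_on_Z l" if "l \<in> \<Lambda>" for l
    using that unfolding \<Lambda>_def additive_on_Z_def by (auto simp: fval_add lookup_add)
  have g_nonneg: "0 \<le> l (g k)" if l: "l \<in> \<Lambda>" and k: "k < n" for l k
  proof -
    have "\<forall>l\<in>\<Lambda>. 0 \<le> l (g k)" using k
    proof (cases rule: g_cases)
      case unit
      then show ?thesis unfolding \<Lambda>_iff using Fs Fs_nonneg r_le_d by (auto simp: fval_pvec lookup_pvec)
    next
      case free
      then show ?thesis unfolding \<Lambda>_iff using Fs by (auto simp: fval_uvec lookup_uvec)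
    next
      case extra
      then show ?thesis unfolding \<Lambda>_iff using Fs Fs_nonneg bs(2) r_le_d by (auto simp: fval_pvec lookup_pvec)
    qed
    then show ?thesis using l by blast
  qed
  show "wt g ` {m. ks m \<subseteq> {..<n}} = {u. \<forall>l\<in>\<Lambda>. 0 \<le> l u}"
  proof (intro subset_antisym subsetI)
    fix u assume "u \<in> wt g ` {m. ks m \<subseteq> {..<n}}"
    then obtain m where m: "u = wt g m" "ks m \<subseteq> {..<n}" by blast
    have "0 \<le> l u" if "l \<in> \<Lambda>" for l
      unfolding m(1) additive_wt[OF add[OF that]] using g_nonneg[OF that] m(2) by (intro sum_nonneg mult_nonneg_nonneg) auto
    then show "u \<in> {u. \<forall>l\<in>\<Lambda>. 0 \<le> l u}" by blast
  next
    fix u assume "u \<in> {u. \<forall>l\<in>\<Lambda>. 0 \<le> l u}"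
    then have u: "\<forall>F\<in>set Fs. 0 \<le> fval F u" "\<forall>i\<ge>r. 0 \<le> lk u i" "\<forall>i\<ge>d. lk u i \<le> 0" unfolding mem_Collect_eq \<Lambda>_iff by blast+
    let ?us = "map (lk u) [0..<r]"
    have "ldot F ?us = fval F u" if "F \<in> set Fs" for F using Fs that by (simp add: fval_def ldot_sum)
    then obtain as where as: "length as = r + length bs" "\<forall>a\<in>set as. 0 \<le> a"
      "?us = map (\<lambda>i. as ! i + ldot (drop r as) (map (\<lambda>b. b ! i) bs)) [0..<r]"
      using cone_core[of ?us] u(1) by auto
    \<comment> \<open>The multiplicities of the generators: \<open>as\<close> supplies those of the
      unit vectors below \<open>r\<close> and of \<open>bs\<close>, while a free generator takes the
      entry of \<open>u\<close> itself.\<close>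
    define f where "f k = (if k < r then as ! k else if k < d then lk u k else as ! (r + (k - d)))" for k
    have f_nonneg: "0 \<le> f k" if "k < n" for k
      using that as(1,2) u(2) r_le_d unfolding f_def n_def by (auto intro!: bspec[OF as(2)] nth_mem)
    define m where "m = (\<Sum>k<n. sgl k (nat (f k)))"
    have m: "lk m k = (if k < n then nat (f k) else 0)" for k unfolding m_def by (simp add: lookup_sum_single)
    have km: "ks m \<subseteq> {..<n}" by (auto simp: in_keys_iff m split: if_splits)
    have lk_sum: "lk (\<Sum>k\<in>K. frag_cmul (a k) (h k)) i = (\<Sum>k\<in>K. a k * lk (h k) i)" for K :: "nat set" and a h i
      by (induction K rule: infinite_finite_induct) (simp_all add: lookup_add)
    have sum_split: "(\<Sum>k<d + l. h k) = (\<Sum>k<d. h k) + (\<Sum>j<l. h (d + j))" for l and h :: "nat \<Rightarrow> int"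
      by (induction l) (simp_all add: add.assoc)
    have "wt g m = u"
    proof (rule poly_mapping_eqI)
      fix i
      have "lk (wt g m) i = (\<Sum>k<n. f k * lk (g k) i)"
        unfolding wt_superset[OF finite_lessThan km] lk_sum using f_nonneg by (intro sum.cong) (simp_all add: m)
      also have "\<dots> = (\<Sum>k<d. f k * lk (g k) i) + (\<Sum>j<length bs. f (d + j) * lk (g (d + j)) i)"
        unfolding n_def by (rule sum_split)
      also have "(\<Sum>k<d. f k * lk (g k) i) = (\<Sum>k<d. if i = k then f k else 0)"
        by (intro sum.cong) (auto simp: g_def lookup_uvec)
      also have "\<dots> = (if i < d then f i else 0)" by simp
      also have "(\<Sum>j<length bs. f (d + j) * lk (g (d + j)) i) = (\<Sum>j<length bs. as ! (r + j) * (if i < r then bs ! j ! i else 0))"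
        using bs(2) r_le_d by (intro sum.cong) (auto simp: g_def lookup_pvec f_def)
      also have "\<dots> = (if i < r then ldot (drop r as) (map (\<lambda>b. b ! i) bs) else 0)"
        using as(1) by (simp add: ldot_sum)
      also have "(if i < d then f i else 0) + \<dots> = lk u i"
      proof (cases "i < r")
        case True
        have "?us ! i = as ! i + ldot (drop r as) (map (\<lambda>b. b ! i) bs)" using True by (subst as(3)) simp
        then show ?thesis using True r_le_d by (simp add: f_def)
      next
        case False
        then show ?thesis using u(2,3) r_le_d by (auto simp: f_def intro: antisym)
      qed
      finally show "lk (wt g m) i = lk u i" .
    qed
    then show "u \<in> wt g ` {m. ks m \<subseteq> {..<n}}" using km by blast
  qed
qed

text \<open>The matrix acts on the first \<open>r\<close> coordinates and every other coordinate is
  kept, so injectivity is that of the matrix and free generators are fixed.\<close>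

definition A :: "(nat \<Rightarrow>\<^sub>0 int) \<Rightarrow> (nat \<Rightarrow>\<^sub>0 int)" where
  "A u = pvec (img (map (lk u) [0..<r])) + (u - pvec (map (lk u) [0..<r]))"

lemma length_img [simp]: "length (img xs) = r" by (simp add: img_def)

lemma img_nth: "length xs = r \<Longrightarrow> j < r \<Longrightarrow> img xs ! j = (\<Sum>i<r. xs ! i * cols ! i ! j)"
  using cols by (simp add: img_def ldot_sum)

lemma lookup_A: "lk (A u) j = (if j < r then \<Sum>i<r. lk u i * cols ! i ! j else lk u j)"
  by (simp add: A_def lookup_add lookup_minus lookup_pvec img_nth)

lemma A_add: "A (u + v) = A u + A v"
  by (rule poly_mapping_eqI) (simp add: lookup_A lookup_add distrib_right sum.distrib)

lemma A_inj:
  assumes "A u = 0" shows "u = 0"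
proof -
  have 0: "lk (A u) j = 0" for j using assms by simp
  have "img (map (lk u) [0..<r]) = replicate r 0"
  proof (rule nth_equalityI)
    fix j assume "j < length (img (map (lk u) [0..<r]))"
    then show "img (map (lk u) [0..<r]) ! j = replicate r 0 ! j" using 0[of j] by (simp add: img_nth lookup_A)
  qed simp
  then have us: "map (lk u) [0..<r] = replicate r 0" using cols_inj[of "map (lk u) [0..<r]"] by (simp add: img_def)
  have "lk u i = 0" for i
  proof (cases "i < r")
    case True
    then have "map (lk u) [0..<r] ! i = 0" unfolding us by simp
    then show ?thesis using True by simp
  next
    case False
    then show ?thesis using 0[of i] by (simp add: lookup_A)
  qed
  then show ?thesis by (intro poly_mapping_eqI) simp
qed

lemma A_pvec: "length xs = r \<Longrightarrow> A (pvec xs) = pvec (img xs)"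
  by (rule poly_mapping_eqI) (simp add: lookup_A lookup_pvec img_nth)

lemma A_uvec: "r \<le> i \<Longrightarrow> A (uvec i) = uvec i"
  by (rule poly_mapping_eqI) (simp add: lookup_A lookup_uvec)

lemma pvec_S:
  assumes "length xs = r" "\<forall>F\<in>set Fs. 0 \<le> ldot F xs" shows "pvec xs \<in> S"
  unfolding S_cone mem_Collect_eq \<Lambda>_iff using assms Fs r_le_d by (auto simp: fval_pvec lookup_pvec)

lemma A_g:
  assumes "k < n" shows "A (g k) \<in> S"
  using assms
proof (cases rule: g_cases)
  case unit
  then show ?thesis using pvec_S[of "img (unit_list r k)"] cols_nonneg by (simp add: A_pvec img_def)
next
  case free
  then show ?thesis using g_S[of k] by (simp add: A_uvec n_def)
next
  case extra
  then show ?thesis using pvec_S[of "img (bs ! (k - d))"] cols_nonneg length_gen[OF extra(3)] by (simp add: A_pvec img_def)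
qed

text \<open>A certificate of irreducibility: generators weigh at least \<open>c\<close> and less
  than \<open>2 * c\<close>, so a sum of two nonzero elements of the semigroup is too heavy to be a
  generator. Each free generator has weight \<open>c\<close>.\<close>

definition weight :: "(nat \<Rightarrow>\<^sub>0 int) \<Rightarrow> int" where
  "weight u = fval w u + c * (\<Sum>i\<in>{r..<d}. lk u i)"

lemma weight_g:
  assumes k: "k < n" shows "c \<le> weight (g k)" "weight (g k) < 2 * c"
proof -
  have "c \<le> weight (g k) \<and> weight (g k) < 2 * c" using k
  proof (cases rule: g_cases)
    case unit
    then show ?thesis using weights w by (auto simp: weight_def fval_pvec lookup_pvec)
  next
    case free
    then show ?thesis using c w by (simp add: weight_def fval_uvec lookup_uvec)
  next
    case extra
    then show ?thesis using weights w length_gen[OF extra(3)] by (auto simp: weight_def fval_pvec lookup_pvec)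
  qed
  then show "c \<le> weight (g k)" "weight (g k) < 2 * c" by auto
qed

lemma weight_additive: "additive_on_Z weight"
  by (simp add: additive_on_Z_def weight_def fval_add lookup_add sum.distrib distrib_left)

lemma weight_wt:
  assumes m: "ks m \<subseteq> {..<n}" "m \<noteq> 0" shows "c \<le> weight (wt g m)"
proof -
  obtain k where k: "k \<in> ks m" using m(2) by (auto simp: poly_mapping_eq_iff fun_eq_iff in_keys_iff)
  have pos: "0 \<le> weight (g i)" if "i \<in> ks m" for i using weight_g(1)[of i] c m(1) that by force
  have "c \<le> weight (g k)" using weight_g(1) k m(1) by auto
  also have "\<dots> \<le> int (lk m k) * weight (g k)"
    using mult_right_mono[of 1 "int (lk m k)" "weight (g k)"] pos[OF k] k by (simp add: in_keys_iff)
  also have "\<dots> \<le> (\<Sum>k\<in>ks m. int (lk m k) * weight (g k))"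
    using k pos by (intro member_le_sum) auto
  finally show ?thesis unfolding additive_wt[OF weight_additive] .
qed

lemma g_inj:
  assumes "i < n" "k < n" "g i = g k" shows "i = k"
proof -
  have *: "i = k" if i: "i < n" and k: "k < n" and eq: "g i = g k" and le: "i \<le> k" for i k
  proof (cases "k < d")
    case True
    then have "lk (uvec i) k = lk (uvec k) k" using eq le by (simp add: g_def)
    then show ?thesis by (simp add: lookup_uvec split: if_splits)
  next
    case False
    then have k': "g k = pvec (bs ! (k - d))" "k - d < length bs" using k by (simp_all add: g_def n_def)
    have bk: "bs ! (k - d) \<in> set bs" using k'(2) by (rule nth_mem)
    show ?thesis using i
    proof (cases rule: g_cases)
      case unit
      have "unit_list r i = bs ! (k - d)" using bk bs(2) eq unit(2) k'(1) by (intro pvec_inj) simp_all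
      moreover have "unit_list r i \<in> set (map (unit_list r) [0..<r])" using unit(1) by simp
      ultimately show ?thesis using dist bk by auto
    next
      case free
      have "lk (uvec i) i = lk (pvec (bs ! (k - d))) i" using eq k'(1) free(3) by simp
      then show ?thesis using bk bs(2) free(1) by (simp add: lookup_uvec lookup_pvec)
    next
      case extra
      then have "bs ! (i - d) = bs ! (k - d)" using bk bs(2) eq k'(1) by (intro pvec_inj) simp_all
      then have "i - d = k - d" using dist k'(2) i extra(1) by (simp add: nth_eq_iff_index_eq n_def less_diff_conv2)
      then show ?thesis using extra(1) False by simp
    qed
  qed
  show ?thesis using *[OF assms] *[OF assms(2,1) assms(3)[symmetric]] by linarith
qed

lemma singular: "singular_locus d n (X :: (nat \<Rightarrow> 'k::alg_closed_field) set) \<noteq> {}"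
proof (rule origin_singular)
  show "d < n" using bs(1) by (simp add: n_def)
  show "m = 0" if "ks m \<subseteq> {..<n}" "wt g m = 0" for m
  proof (rule ccontr)
    assume "m \<noteq> 0"
    from weight_wt[OF that(1) this] show False using c by (simp add: that(2) weight_def fval_def)
  qed
  show "m = sgl i 1" if m: "ks m \<subseteq> {..<n}" and i: "i < n" and eq: "wt g m = g i" for m i
  proof -
    have "m \<noteq> 0" using weight_g(1)[OF i] eq c by (auto simp: weight_def fval_def)
    then obtain k where k: "k \<in> ks m" by (auto simp: poly_mapping_eq_iff fun_eq_iff in_keys_iff)
    define m' where "m' = m - sgl k 1"
    have mm: "m = m' + sgl k 1" unfolding m'_def
      using k by (intro poly_mapping_eqI) (auto simp: lookup_add lookup_minus lookup_single when_def in_keys_iff)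
    have k_n: "k < n" using k m by auto
    have "ks m' \<subseteq> {..<n}"
    proof
      fix x assume "x \<in> ks m'"
      then have "x \<in> ks m" unfolding m'_def by (simp add: in_keys_iff lookup_minus)
      then show "x \<in> {..<n}" using m by blast
    qed
    moreover have "weight (g i) = weight (wt g m') + weight (g k)"
      using weight_additive unfolding eq[symmetric] mm wt_add wt_single additive_on_Z_def by simp
    \<comment> \<open>Otherwise \<open>wt g m'\<close> would weigh at least \<open>c\<close>, and so
      does \<open>g k\<close>, while \<open>g i\<close> weighs less than
      \<open>2 * c\<close>.\<close>
    ultimately have "m' = 0" using weight_wt[of m'] weight_g[OF i] weight_g[OF k_n] by linarith
    then have "m = sgl k 1" using mm by simp
    moreover from this have "k = i" using eq g_inj[OF k_n i] by (simp add: wt_single)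
    ultimately show ?thesis by simp
  qed
qed

text \<open>The list form of \<open>chart_gens\<close> without the free generators. The predicate
  \<open>P\<close> stands for being nonzero in the field, so that the list can be computed from
  integers alone.\<close>

definition chart_lists :: "(int \<Rightarrow> bool) \<Rightarrow> int list list" where
  "chart_lists P = map (unit_list r) [0..<r] @ bs @ concat (map (\<lambda>b. map (\<lambda>i. map2 (-) b (unit_list r i)) (filter (\<lambda>i. P (b ! i)) [0..<r])) bs)"

definition has_root :: "nat \<Rightarrow> (int \<Rightarrow> bool) \<Rightarrow> int list \<Rightarrow> bool" where
  "has_root q P t \<longleftrightarrow> (\<exists>xs\<in>set (chart_lists P). img xs = t) \<or>
     (\<exists>x y z x' y' z'. {x, y, z, x', y', z'} \<subseteq> set (chart_lists P) \<and> img (map2 (-) (map2 (+) x y) z) = t \<and>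
        map ((*) (int q)) (map2 (-) (map2 (+) x y) z) = map2 (+) (map2 (+) x' y') z')"

lemma chart_lists_gens:
  assumes P: "\<forall>b\<in>set bs. \<forall>x\<in>set b. P x \<longleftrightarrow> of_int x \<noteq> (0::'k::field)" and xs: "xs \<in> set (chart_lists P)"
  shows "length xs = r" "pvec xs \<in> chart_gens TYPE('k)"
proof -
  have gs: "pvec b \<in> g ` {..<n}" if b: "b \<in> set (map (unit_list r) [0..<r] @ bs)" for b
  proof (cases "b \<in> set bs")
    case True
    then obtain j where "j < length bs" "b = bs ! j" by (auto simp: in_set_conv_nth)
    then show ?thesis by (intro image_eqI[of _ _ "d + j"]) (simp_all add: g_def n_def)
  next
    case False
    then obtain i where "i < r" "b = unit_list r i" using b by auto
    then show ?thesis using r_le_d by (intro image_eqI[of _ _ i]) (simp_all add: g_def n_def pvec_unit_list)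
  qed
  consider "xs \<in> set (map (unit_list r) [0..<r] @ bs)"
    | b i where "b \<in> set bs" "i < r" "P (b ! i)" "xs = map2 (-) b (unit_list r i)"
    using xs unfolding chart_lists_def by auto
  then have "length xs = r \<and> pvec xs \<in> chart_gens TYPE('k)"
  proof cases
    case 1
    then show ?thesis using gs[OF 1] length_gen[OF 1] unfolding chart_gens_def by blast
  next
    case 2
    have lb: "length b = r" using 2(1) bs(2) by blast
    obtain j where j: "j < length bs" "b = bs ! j" using 2(1) by (auto simp: in_set_conv_nth)
    have gj: "g (d + j) = pvec b" using j(2) by (simp add: g_def)
    have "pvec xs = g (d + j) - uvec i"
      unfolding gj 2(4) pvec_map2(2)[of b "unit_list r i", unfolded lb length_unit_list, OF refl, symmetric]
      by (simp add: pvec_unit_list[OF 2(2)])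
    moreover have "of_int (lk (g (d + j)) i) \<noteq> (0::'k)"
      unfolding gj using P 2(1,2,3) lb by (simp add: lookup_pvec)
    ultimately show ?thesis unfolding chart_gens_def using 2(2,4) r_le_d j(1) lb
      by (intro conjI UnI2 CollectI exI[of _ "d + j"] exI[of _ i]) (simp_all add: n_def)
  qed
  then show "length xs = r" "pvec xs \<in> chart_gens TYPE('k)" by auto
qed

text \<open>The assumptions \<open>chart_img\<close> and \<open>roots\<close> are finite checks on
  integer lists. They provide the hypotheses \<open>c2\<close> and \<open>c3\<close> of
  \<open>normalized_nash_chart\<close>, a free generator being its own root.\<close>

lemma normalized_nash_fixed_point:
  assumes q: "0 < q" and frob: "\<And>x y::'k::alg_closed_field. (x + y) ^ q = x ^ q + y ^ q"
    and P: "\<forall>b\<in>set bs. \<forall>x\<in>set b. P x \<longleftrightarrow> of_int x \<noteq> (0::'k)"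
    and chart_img: "\<forall>xs\<in>set (chart_lists P). \<forall>F\<in>set Fs. 0 \<le> ldot F (img xs)"
    and roots: "\<forall>t\<in>set (map (unit_list r) [0..<r] @ bs). has_root q P t"
  shows "\<exists>n (X :: (nat \<Rightarrow> 'k) set).
    affine_toric_variety d n X \<and> normal_variety (affine_var n X) \<and> singular_locus d n X \<noteq> {} \<and>
    (\<exists>U. openin (ztop (normalized_nash_blowup d n X)) U \<and>
         is_affine (subspace_on (normalized_nash_blowup d n X) U) \<and>
         isomorphic (subspace_on (normalized_nash_blowup d n X) U) (affine_var n X))"
proof -
  let ?T = "generated_monoid (chart_gens TYPE('k))"
  note ch = chart_lists_gens[OF P]
  have chT: "pvec xs \<in> ?T" if "xs \<in> set (chart_lists P)" for xs by (rule generated_monoid_gen[OF ch(2)[OF that]])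
  have d: "0 < d" using r_le_d by simp
  have A_0: "A 0 = 0" by (rule poly_mapping_eqI) (simp add: lookup_A)
  have c2: "A (g j - uvec i) \<in> S" if j: "j \<in> {d..<n}" and i: "i < d" and nz: "of_int (lk (g j) i) \<noteq> (0::'k)" for j i
  proof -
    have jn: "j < n" "d \<le> j" using j by auto
    let ?b = "bs ! (j - d)"
    have b: "?b \<in> set bs" "g j = pvec ?b" using jn by (simp_all add: g_def n_def less_diff_conv2)
    then have lb: "length ?b = r" using bs(2) by blast
    have ir: "i < r" using nz unfolding b(2) lookup_pvec lb by (simp split: if_splits)
    have "P (?b ! i)" using nz P b(1) ir lb unfolding b(2) by (simp add: lookup_pvec)
    then have mem: "map2 (-) ?b (unit_list r i) \<in> set (chart_lists P)" using b(1) ir unfolding chart_lists_def by auto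
    have "g j - uvec i = pvec (map2 (-) ?b (unit_list r i))"
      unfolding b(2) pvec_unit_list[OF ir, symmetric] by (rule pvec_map2) (simp add: lb)
    then show ?thesis using pvec_S[OF length_img] chart_img mem ch(1)[OF mem] by (simp add: A_pvec)
  qed
  have roots': "\<exists>u v. u \<in> ?T \<and> v \<in> ?T \<and> frag_cmul (int q) (u - v) \<in> ?T \<and> A u = A v + pvec t"
    if "t \<in> set (map (unit_list r) [0..<r] @ bs)" for t
    using bspec[OF roots that] unfolding has_root_def
  proof (elim disjE bexE exE conjE)
    fix xs assume xs: "xs \<in> set (chart_lists P)" "img xs = t"
    then show ?thesis using chT ch(1) A_pvec[of xs]
      by (intro exI[of _ "pvec xs"] exI[of _ 0]) (simp add: generated_monoid.zero generated_monoid_cmul A_0)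
  next
    fix x y z x' y' z'
    assume m: "{x, y, z, x', y', z'} \<subseteq> set (chart_lists P)"
      and eq: "map ((*) (int q)) (map2 (-) (map2 (+) x y) z) = map2 (+) (map2 (+) x' y') z'"
      and im: "img (map2 (-) (map2 (+) x y) z) = t"
    have l: "length x = r" "length y = r" "length z = r" "length x' = r" "length y' = r" "length z' = r"
      using ch(1) m by simp_all
    have uv: "pvec x + pvec y - pvec z = pvec (map2 (-) (map2 (+) x y) z)"
      using l by (simp add: pvec_map2)
    have "frag_cmul (int q) (pvec x + pvec y - pvec z) = pvec x' + pvec y' + pvec z'"
      unfolding uv pvec_cmul eq using l by (simp add: pvec_map2)
    moreover have "A (pvec x + pvec y) = A (pvec z) + pvec t"
    proof -
      have "A (pvec x + pvec y) = A (pvec x + pvec y - pvec z) + A (pvec z)" unfolding A_add[symmetric] by simp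
      then show ?thesis unfolding uv using A_pvec[of "map2 (-) (map2 (+) x y) z"] l im by simp
    qed
    ultimately show ?thesis using chT m
      by (intro exI[of _ "pvec x + pvec y"] exI[of _ "pvec z"]) (simp add: generated_monoid_add)
  qed
  have c3: "\<exists>u v. u \<in> ?T \<and> v \<in> ?T \<and> frag_cmul (int q) (u - v) \<in> ?T \<and> A u = A v + g k" if k: "k < n" for k
    using k
  proof (cases rule: g_cases)
    case unit
    then show ?thesis using roots'[OF unit(3)] by simp
  next
    case free
    have "uvec k \<in> chart_gens TYPE('k)" unfolding chart_gens_def using free(3) k by force
    then have "uvec k \<in> ?T" by (rule generated_monoid_gen)
    then show ?thesis using free
      by (intro exI[of _ "uvec k"] exI[of _ 0]) (simp add: generated_monoid.zero generated_monoid_cmul A_uvec A_0)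
  next
    case extra
    then show ?thesis using roots'[OF extra(3)] by simp
  qed
  obtain U where U: "openin (ztop (normalized_nash_blowup d n X)) U"
    "isomorphic (subspace_on (normalized_nash_blowup d n X) U) (affine_var n (X :: (nat \<Rightarrow> 'k) set))"
    using normalized_nash_chart[OF d A_add A_inj A_g c2 q frob c3] by blast
  have "is_affine (subspace_on (normalized_nash_blowup d n X) U)"
    unfolding is_affine_def using X_closed U(2) by blast
  then show ?thesis using U affine_toric_variety_X normal_X singular
    by (intro exI[of _ n] exI[of _ "X :: (nat \<Rightarrow> 'k) set"] conjI exI[of _ U])
qed

end

section \<open>The example outside characteristic two\<close>

text \<open>
  The entries are \<open>0, \<plusminus>1, \<plusminus>2\<close>, so outside characteristic two the same coordinates vanish in \<open>k\<close> as in \<open>\<int>\<close>.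
\<close>

abbreviation gens_odd :: "int list list" where
  "gens_odd \<equiv> [[-2, -1, 1, 2, 2], [-1, 0, 0, 1, 2], [-1, 0, 1, 1, 1], [1, 1, 0, -1, 0]]"

abbreviation facets_odd :: "int list list" where
  "facets_odd \<equiv> [[0, 0, 0, 0, 1], [0, 0, 1, 0, 0], [0, 1, 0, 1, 0], [0, 1, 1, 0, 0], [0, 2, 0, 0, 1], [0, 2, 0, 1, 0], [1, 0, 0, 0, 1], [1, 0, 0, 1, 0], [2, 0, 2, 0, 1]]"

abbreviation cols_odd :: "int list list" where
  "cols_odd \<equiv> [[-2, -1, 1, 3, 2], [-2, 0, 1, 2, 2], [-1, 0, 0, 2, 2], [-2, -1, 1, 2, 2], [-1, 0, 1, 2, 1]]"

text \<open>The case distinctions cut the cone into pieces. On each of them at most five of the nine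
  generators occur, with coefficients that are integral linear forms, so every lattice point is
  reached and not only a multiple of it.\<close>

lemma cone_odd:
  fixes x0 x1 x2 x3 x4 :: int
  assumes facets: "0 \<le> x4" "0 \<le> x2" "0 \<le> x1 + x3" "0 \<le> x1 + x2" "0 \<le> 2 * x1 + x4" "0 \<le> 2 * x1 + x3" "0 \<le> x0 + x4" "0 \<le> x0 + x3" "0 \<le> 2 * x0 + 2 * x2 + x4"
  shows "\<exists>as. length as = 9 \<and> (\<forall>a\<in>set as. 0 \<le> a) \<and>
    [x0, x1, x2, x3, x4] = map (\<lambda>i. as ! i + ldot (drop 5 as) (map (\<lambda>b. b ! i) gens_odd)) [0..<5]"
proof (cases "0 \<le> 2 * x2 - x4")
  case h1: True
  show ?thesis
  proof (cases "0 \<le> x1")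
    case h2: True
    show ?thesis
    proof (cases "0 \<le> x0")
      case h3: True
      show ?thesis
      proof (cases "0 \<le> x3")
        case h4: True
        show ?thesis
          by (rule exI[of _ "[x0, x1, x2, x3, x4, 0, 0, 0, 0]"]) (use facets h1 h2 h3 h4 in \<open>simp add: upt_rec\<close>)
      next
        case h4: False
        show ?thesis
          by (rule exI[of _ "[x0 + x3, x1 + x3, x2, 0, x4, 0, 0, 0, - x3]"]) (use facets h1 h2 h3 h4 in \<open>simp add: upt_rec\<close>)
      qed
    next
      case h3: False
      show ?thesis
      proof (cases "0 \<le> x0 + x2")
        case h4: True
        show ?thesis
          by (rule exI[of _ "[0, x1, x0 + x2, x0 + x3, x0 + x4, 0, 0, - x0, 0]"]) (use facets h1 h2 h3 h4 in \<open>simp add: upt_rec\<close>)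
      next
        case h4: False
        show ?thesis
          by (rule exI[of _ "[0, - x0 + x1 - x2, 0, x0 + x3, x0 + x4, - x0 - x2, 0, x0 + 2 * x2, 0]"]) (use facets h1 h2 h3 h4 in \<open>simp add: upt_rec\<close>)
      qed
    qed
  next
    case h2: False
    show ?thesis
    proof (cases "0 \<le> x0 - x1 + x2")
      case h3: True
      show ?thesis
      proof (cases "0 \<le> x0 - 2 * x1")
        case h4: True
        show ?thesis
          by (rule exI[of _ "[x0 - 2 * x1, 0, x1 + x2, 2 * x1 + x3, 2 * x1 + x4, - x1, 0, 0, 0]"]) (use facets h1 h2 h3 h4 in \<open>simp add: upt_rec\<close>)
      next
        case h4: False
        show ?thesis
          by (rule exI[of _ "[0, 0, x0 - x1 + x2, x0 + x3, x0 + x4, - x1, 0, - x0 + 2 * x1, 0]"]) (use facets h1 h2 h3 h4 in \<open>simp add: upt_rec\<close>)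
      qed
    next
      case h3: False
      show ?thesis
        by (rule exI[of _ "[0, - x0 + x1 - x2, 0, x0 + x3, x0 + x4, - x0 - x2, 0, x0 + 2 * x2, 0]"]) (use facets h1 h2 h3 in \<open>simp add: upt_rec\<close>)
    qed
  qed
next
  case h1: False
  show ?thesis
  proof (cases "0 \<le> x1")
    case h2: True
    show ?thesis
    proof (cases "0 \<le> x0 - x1 + x2")
      case h3: True
      show ?thesis
      proof (cases "0 \<le> x1 - x2 + x3")
        case h4: True
        show ?thesis
          by (rule exI[of _ "[x0 - x1 + x2, 0, 0, x1 - x2 + x3, - 2 * x2 + x4, x2, 0, 0, x1 + x2]"]) (use facets h1 h2 h3 h4 in \<open>simp add: upt_rec\<close>)
      next
        case h4: False
        show ?thesis
          by (rule exI[of _ "[x0 + x3, 0, - x1 + x2 - x3, 0, - 2 * x1 - 2 * x3 + x4, x1 + x3, 0, 0, 2 * x1 + x3]"]) (use facets h1 h2 h3 h4 in \<open>simp add: upt_rec\<close>)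
      qed
    next
      case h3: False
      show ?thesis
      proof (cases "0 \<le> x0 + 2 * x2")
        case h4: True
        show ?thesis
          by (rule exI[of _ "[0, - x0 + x1 - x2, 0, x0 + x3, - 2 * x2 + x4, x2, 0, 0, x0 + 2 * x2]"]) (use facets h1 h2 h3 h4 in \<open>simp add: upt_rec\<close>)
      next
        case h4: False
        show ?thesis
          by (rule exI[of _ "[0, x1 + x2, 0, x0 + x3, 2 * x0 + 2 * x2 + x4, x2, - x0 - 2 * x2, 0, 0]"]) (use facets h1 h2 h3 h4 in \<open>simp add: upt_rec\<close>)
      qed
    qed
  next
    case h2: False
    show ?thesis
    proof (cases "0 \<le> x0 - x1 + x2")
      case h3: True
      show ?thesis
      proof (cases "0 \<le> x1 - x2 + x3")
        case h4: True
        show ?thesis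
          by (rule exI[of _ "[x0 - x1 + x2, 0, 0, x1 - x2 + x3, x1 - x2 + x4, - x1, 0, x1 + x2, 0]"]) (use facets h1 h2 h3 h4 in \<open>simp add: upt_rec\<close>)
      next
        case h4: False
        show ?thesis
          by (rule exI[of _ "[x0 + x3, 0, x1 + x2, 0, - 2 * x1 - 2 * x3 + x4, - x1, 2 * x1 + x3, 0, 0]"]) (use facets h1 h2 h3 h4 in \<open>simp add: upt_rec\<close>)
      qed
    next
      case h3: False
      show ?thesis
      proof (cases "0 \<le> x0 + 2 * x2")
        case h4: True
        show ?thesis
          by (rule exI[of _ "[0, - x0 + x1 - x2, 0, x0 + x3, x0 + x4, - x0 - x2, 0, x0 + 2 * x2, 0]"]) (use facets h1 h2 h3 h4 in \<open>simp add: upt_rec\<close>)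
      next
        case h4: False
        show ?thesis
          by (rule exI[of _ "[0, x1 + x2, 0, x0 + x3, 2 * x0 + 2 * x2 + x4, x2, - x0 - 2 * x2, 0, 0]"]) (use facets h1 h2 h3 h4 in \<open>simp add: upt_rec\<close>)
      qed
    qed
  qed
qed

lemma fixed_point_odd:
  assumes d: "5 \<le> d" and 2: "(2::'k::alg_closed_field) \<noteq> 0"
  shows "\<exists>n (X :: (nat \<Rightarrow> 'k) set).
    affine_toric_variety d n X \<and> normal_variety (affine_var n X) \<and> singular_locus d n X \<noteq> {} \<and>
    (\<exists>U. openin (ztop (normalized_nash_blowup d n X)) U \<and>
         is_affine (subspace_on (normalized_nash_blowup d n X) U) \<and>
         isomorphic (subspace_on (normalized_nash_blowup d n X) U) (affine_var n X))"
proof -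
  have units: "map (unit_list 5) [0..<5] = [[1, 0, 0, 0, 0], [0, 1, 0, 0, 0], [0, 0, 1, 0, 0], [0, 0, 0, 1, 0], [0, 0, 0, 0, 1]]"
    by (simp add: unit_list_def upt_rec eval_nat_numeral)
  \<comment> \<open>The weight vector takes only the values 2 and 3 on the nine generators.\<close>
  interpret E: toric_example 5 d gens_odd facets_odd cols_odd "[3, 2, 2, 2, 2]" 2
  proof
    fix us :: "int list" assume us: "length us = 5"
    then obtain x0 x1 x2 x3 x4 where x: "us = [x0, x1, x2, x3, x4]" by (auto simp: numeral_eq_Suc length_Suc_conv)
    show "\<exists>as. length as = 5 + length gens_odd \<and> (\<forall>a\<in>set as. 0 \<le> a) \<and>
         us = map (\<lambda>i. as ! i + ldot (drop 5 as) (map (\<lambda>b. b ! i) gens_odd)) [0..<5]"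
      if "\<forall>F\<in>set facets_odd. 0 \<le> ldot F us"
    proof -
      have "\<exists>as. length as = 9 \<and> (\<forall>a\<in>set as. 0 \<le> a) \<and>
         us = map (\<lambda>i. as ! i + ldot (drop 5 as) (map (\<lambda>b. b ! i) gens_odd)) [0..<5]"
        unfolding x by (rule cone_odd) (use that in \<open>simp_all add: x\<close>)
      then show ?thesis by simp
    qed
    show "us = replicate 5 0"
      if "map (\<lambda>j. ldot us (map (\<lambda>v. v ! j) cols_odd)) [0..<5] = replicate 5 0"
      using that unfolding x by (simp add: upt_rec eval_nat_numeral)
  qed (insert d, unfold units, simp_all add: upt_rec)
  have lists: "E.chart_lists (\<lambda>x. x \<noteq> 0) = [[1, 0, 0, 0, 0], [0, 1, 0, 0, 0], [0, 0, 1, 0, 0], [0, 0, 0, 1, 0], [0, 0, 0, 0, 1], [-2, -1, 1, 2, 2], [-1, 0, 0, 1, 2], [-1, 0, 1, 1, 1], [1, 1, 0, -1, 0], [-3, -1, 1, 2, 2], [-2, -2, 1, 2, 2], [-2, -1, 0, 2, 2], [-2, -1, 1, 1, 2], [-2, -1, 1, 2, 1], [-2, 0, 0, 1, 2], [-1, 0, 0, 0, 2], [-1, 0, 0, 1, 1], [-2, 0, 1, 1, 1], [-1, 0, 0, 1, 1], [-1, 0, 1, 0, 1], [-1, 0, 1, 1, 0], [0, 1, 0, -1, 0], [1, 0, 0, -1, 0], [1, 1, 0, -2, 0]]"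
    unfolding E.chart_lists_def units by (simp add: unit_list_def upt_rec eval_nat_numeral)
  have img: "E.img xs = map (\<lambda>j. ldot xs (map (\<lambda>v. v ! j) cols_odd)) [0, Suc 0, 2, 3, 4]" for xs
    unfolding E.img_def by (simp add: upt_rec eval_nat_numeral)
  show ?thesis
  \<comment> \<open>For exponent 1 additivity of the power holds in every field.\<close>
  proof (rule E.normalized_nash_fixed_point[of 1 "\<lambda>x. x \<noteq> 0"])
    show "\<forall>b\<in>set gens_odd. \<forall>x\<in>set b. x \<noteq> 0 \<longleftrightarrow> of_int x \<noteq> (0::'k)" using 2 by simp
    show "\<forall>xs\<in>set (E.chart_lists (\<lambda>x. x \<noteq> 0)). \<forall>F\<in>set facets_odd. 0 \<le> ldot F (E.img xs)"
      unfolding lists img by simp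
    show "\<forall>t\<in>set (map (unit_list 5) [0..<5] @ gens_odd). E.has_root 1 (\<lambda>x. x \<noteq> 0) t"
      unfolding units E.has_root_def lists img by simp
  qed simp_all
qed

section \<open>The example in characteristic two\<close>

abbreviation gens_two :: "int list list" where
  "gens_two \<equiv> [[-2, -1, 1, 2], [-1, 0, 0, 2], [-1, 0, 1, 1]]"

text \<open>These are the forms of \<open>facets_odd\<close> that do not involve the fourth
  coordinate. Likewise \<open>gens_two\<close> consists of the first three vectors of
  \<open>gens_odd\<close> without their fourth coordinate; the remaining vector would become a sum
  of two unit vectors.\<close>

abbreviation facets_two :: "int list list" where
  "facets_two \<equiv> [[0, 0, 0, 1], [0, 0, 1, 0], [0, 1, 1, 0], [0, 2, 0, 1], [1, 0, 0, 1], [2, 0, 2, 1]]"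

abbreviation cols_two :: "int list list" where
  "cols_two \<equiv> [[-2, -1, 1, 2], [-1, 0, 0, 2], [-2, 0, 1, 2], [-2, -1, 1, 3]]"

text \<open>As in \<open>cone_odd\<close>, each case uses at most four of the seven generators, with
  integral coefficients.\<close>

lemma cone_two:
  fixes x0 x1 x2 x3 :: int
  assumes facets: "0 \<le> x3" "0 \<le> x2" "0 \<le> x1 + x2" "0 \<le> 2 * x1 + x3" "0 \<le> x0 + x3" "0 \<le> 2 * x0 + 2 * x2 + x3"
  shows "\<exists>as. length as = 7 \<and> (\<forall>a\<in>set as. 0 \<le> a) \<and>
    [x0, x1, x2, x3] = map (\<lambda>i. as ! i + ldot (drop 4 as) (map (\<lambda>b. b ! i) gens_two)) [0..<4]"
proof (cases "0 \<le> x1")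
  case h1: True
  show ?thesis
  proof (cases "0 \<le> x0 + x2")
    case h2: True
    show ?thesis
    proof (cases "0 \<le> x2 - x3")
      case h3: True
      show ?thesis
        by (rule exI[of _ "[x0 + x3, x1, x2 - x3, 0, 0, 0, x3]"]) (use facets h1 h2 h3 in \<open>simp add: upt_rec\<close>)
    next
      case h3: False
      show ?thesis
        by (rule exI[of _ "[x0 + x2, x1, 0, - x2 + x3, 0, 0, x2]"]) (use facets h1 h2 h3 in \<open>simp add: upt_rec\<close>)
    qed
  next
    case h2: False
    show ?thesis
    proof (cases "0 \<le> x0 + 2 * x2")
      case h3: True
      show ?thesis
        by (rule exI[of _ "[0, - x0 + x1 - x2, 0, x0 + x3, - x0 - x2, 0, x0 + 2 * x2]"]) (use facets h1 h2 h3 in \<open>simp add: upt_rec\<close>)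
    next
      case h3: False
      show ?thesis
        by (rule exI[of _ "[0, x1 + x2, 0, 2 * x0 + 2 * x2 + x3, x2, - x0 - 2 * x2, 0]"]) (use facets h1 h2 h3 in \<open>simp add: upt_rec\<close>)
    qed
  qed
next
  case h1: False
  show ?thesis
  proof (cases "0 \<le> x0 - x1 + x2")
    case h2: True
    show ?thesis
    proof (cases "0 \<le> x1 - x2 + x3")
      case h3: True
      show ?thesis
        by (rule exI[of _ "[x0 - x1 + x2, 0, 0, x1 - x2 + x3, - x1, 0, x1 + x2]"]) (use facets h1 h2 h3 in \<open>simp add: upt_rec\<close>)
    next
      case h3: False
      show ?thesis
        by (rule exI[of _ "[x0 + x3, 0, - x1 + x2 - x3, 0, - x1, 0, 2 * x1 + x3]"]) (use facets h1 h2 h3 in \<open>simp add: upt_rec\<close>)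
    qed
  next
    case h2: False
    show ?thesis
    proof (cases "0 \<le> x0 + 2 * x2")
      case h3: True
      show ?thesis
        by (rule exI[of _ "[0, - x0 + x1 - x2, 0, x0 + x3, - x0 - x2, 0, x0 + 2 * x2]"]) (use facets h1 h2 h3 in \<open>simp add: upt_rec\<close>)
    next
      case h3: False
      show ?thesis
        by (rule exI[of _ "[0, x1 + x2, 0, 2 * x0 + 2 * x2 + x3, x2, - x0 - 2 * x2, 0]"]) (use facets h1 h2 h3 in \<open>simp add: upt_rec\<close>)
    qed
  qed
qed

lemma fixed_point_two:
  assumes d: "4 \<le> d" and 2: "(2::'k::alg_closed_field) = 0"
  shows "\<exists>n (X :: (nat \<Rightarrow> 'k) set).
    affine_toric_variety d n X \<and> normal_variety (affine_var n X) \<and> singular_locus d n X \<noteq> {} \<and>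
    (\<exists>U. openin (ztop (normalized_nash_blowup d n X)) U \<and>
         is_affine (subspace_on (normalized_nash_blowup d n X) U) \<and>
         isomorphic (subspace_on (normalized_nash_blowup d n X) U) (affine_var n X))"
proof -
  have units: "map (unit_list 4) [0..<4] = [[1, 0, 0, 0], [0, 1, 0, 0], [0, 0, 1, 0], [0, 0, 0, 1]]"
    by (simp add: unit_list_def upt_rec eval_nat_numeral)
  \<comment> \<open>The weights of the seven generators range from 3 to 5, below twice the bound
    3.\<close>
  interpret E: toric_example 4 d gens_two facets_two cols_two "[3, 3, 4, 4]" 3
  proof
    fix us :: "int list" assume us: "length us = 4"
    then obtain x0 x1 x2 x3 where x: "us = [x0, x1, x2, x3]" by (auto simp: numeral_eq_Suc length_Suc_conv)
    show "\<exists>as. length as = 4 + length gens_two \<and> (\<forall>a\<in>set as. 0 \<le> a) \<and>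
         us = map (\<lambda>i. as ! i + ldot (drop 4 as) (map (\<lambda>b. b ! i) gens_two)) [0..<4]"
      if "\<forall>F\<in>set facets_two. 0 \<le> ldot F us"
    proof -
      have "\<exists>as. length as = 7 \<and> (\<forall>a\<in>set as. 0 \<le> a) \<and>
         us = map (\<lambda>i. as ! i + ldot (drop 4 as) (map (\<lambda>b. b ! i) gens_two)) [0..<4]"
        unfolding x by (rule cone_two) (use that in \<open>simp_all add: x\<close>)
      then show ?thesis by simp
    qed
    show "us = replicate 4 0"
      if "map (\<lambda>j. ldot us (map (\<lambda>v. v ! j) cols_two)) [0..<4] = replicate 4 0"
      using that unfolding x by (simp add: upt_rec eval_nat_numeral)
  qed (insert d, unfold units, simp_all add: upt_rec)
  have lists: "E.chart_lists odd = [[1, 0, 0, 0], [0, 1, 0, 0], [0, 0, 1, 0], [0, 0, 0, 1], [-2, -1, 1, 2], [-1, 0, 0, 2], [-1, 0, 1, 1], [-2, -2, 1, 2], [-2, -1, 0, 2], [-2, 0, 0, 2], [-2, 0, 1, 1], [-1, 0, 0, 1], [-1, 0, 1, 0]]"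
    unfolding E.chart_lists_def units by (simp add: unit_list_def upt_rec eval_nat_numeral)
  have img: "E.img xs = map (\<lambda>j. ldot xs (map (\<lambda>v. v ! j) cols_two)) [0, Suc 0, 2, 3]" for xs
    unfolding E.img_def by (simp add: upt_rec eval_nat_numeral)
  show ?thesis
  proof (rule E.normalized_nash_fixed_point[of 2 "odd"])
    show "\<forall>b\<in>set gens_two. \<forall>x\<in>set b. odd x \<longleftrightarrow> of_int x \<noteq> (0::'k)" using 2 by simp
    show "\<forall>xs\<in>set (E.chart_lists odd). \<forall>F\<in>set facets_two. 0 \<le> ldot F (E.img xs)"
      unfolding lists img by simp
    show "(x + y) ^ 2 = x ^ 2 + y ^ 2" for x y :: 'k using 2 by (simp add: power2_sum)
    have "\<forall>t\<in>set (map (unit_list 4) [0..<4] @ [[-2, -1, 1, 2], [-1, 0, 0, 2]]). \<exists>xs\<in>set (E.chart_lists odd). E.img xs = t"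
      unfolding units lists img by simp
    then have strict: "E.has_root 2 odd t" if "t \<in> set (map (unit_list 4) [0..<4] @ [[-2, -1, 1, 2], [-1, 0, 0, 2]])" for t
      using that unfolding E.has_root_def by blast
    txt \<open>The saturated chart semigroup has one generator outside the chart semigroup.\<close>
    have gap: "E.has_root 2 odd [-1, 0, 1, 1]"
      unfolding E.has_root_def lists img
      \<comment> \<open>The extra generator is \<open>[-1, -1, 1, 1]\<close>, the sum of the first
        two lists minus the third. Twice it is \<open>[-2, -2, 2, 2]\<close>, the sum of the last
        three.\<close>
      by (rule disjI2, rule exI[of _ "[0, 0, 1, 0]"], rule exI[of _ "[-1, 0, 0, 1]"], rule exI[of _ "[0, 1, 0, 0]"],
          rule exI[of _ "[-1, 0, 1, 0]"], rule exI[of _ "[1, 0, 0, 0]"], rule exI[of _ "[-2, -2, 1, 2]"]) simp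
    show "\<forall>t\<in>set (map (unit_list 4) [0..<4] @ gens_two). E.has_root 2 odd t"
    proof
      fix t assume "t \<in> set (map (unit_list 4) [0..<4] @ gens_two)"
      then have "t \<in> set (map (unit_list 4) [0..<4] @ [[-2, -1, 1, 2], [-1, 0, 0, 2]]) \<or> t = [-1, 0, 1, 1]" by auto
      then show "E.has_root 2 odd t" using strict gap by blast
    qed
  qed simp_all
qed

theorem theorem2:
  fixes d :: nat
  assumes "d \<ge> 5"
  shows "\<exists>n (X :: (nat \<Rightarrow> 'k::alg_closed_field) set).
    affine_toric_variety d n X \<and>
    normal_variety (affine_var n X) \<and>
    singular_locus d n X \<noteq> {} \<and>
    (\<exists>U. openin (ztop (normalized_nash_blowup d n X)) U \<and>
         is_affine (subspace_on (normalized_nash_blowup d n X) U) \<and>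
         isomorphic (subspace_on (normalized_nash_blowup d n X) U) (affine_var n X))"
proof (cases "(2::'k) = 0")
  case True
  show ?thesis by (rule fixed_point_two[OF _ True]) (use assms in simp)
next
  case False
  show ?thesis by (rule fixed_point_odd[OF assms False])
qed

end
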